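(* Let $p$ be a prime and $q$ a power of $p$. For every $p$-regular subgroup $\Gamma$ of $\mathrm{PGL}_2(\mathbb{F}_q)$ there exists a rational map $f:\mathbb{P}^1(\bar{\mathbb{F}}_p)\to\mathbb{P}^1(\bar{\mathbb{F}}_p)$ with automorphism group exactly $\Gamma$. In particular, up to conjugation in $\mathrm{PGL}_2(\bar{\mathbb{F}}_p)$, such a map can be constructed for each $\Gamma$ as follows. (1) The map $f(z)=z^2+z$ has $\mathrm{Aut}(f)=1$, and it is of minimal degree for the trivial group. (2) Let $n\ge 2$ be relatively prime to $p$. Then $f(z)=\frac{1}{z^{n-1}}+z$ has $\mathrm{Aut}(f)\cong C_n$, and this map is of minimal degree for $C_n$. (3) Let $p>2$ and let $n\ge2$ be coprime to $p$. The dihedral group $D_{2n}$ is realizable as an automorphism group over $\bar{\mathbb{F}}_p$ through one of the following constructions. (a) If $n\not\equiv-1\pmod p$, then $f(z)=z^{n+1}$ has automorphism group exactly $D_{2n}$. (b) If $n\not\equiv1\pmod p$ and $n>2$, then $f(z)=\frac{1}{z^{n-1}}$ has automorphism group exactly $D_{2n}$, and it is of minimal degree for $D_{2n}$. (c) If $n=2$, then for every $a\in\bar{\mathbb{F}}_p$ with $a\notin\{-3,-1,0,1\}$, the map $$f(z)=z\cdot\frac{z^2+a}{az^2+1}$$ has $\mathrm{Aut}(f)\cong D_4$, and it is of minimal degree for $D_4$. (4) For all $p\ge5$, the tetrahedral group $A_4$ is realizable as the automorphism group of a degree $3$ map over $\bar{\mathbb{F}}_p$, and $3$ is the minimal degree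 for $A_4$. (5) For all $p\ge5$, the octahedral group $S_4$ is realizable as an automorphism group over $\bar{\mathbb{F}}_p$. (6) For all $p\ge7$, the icosahedral group $A_5$ is realizable as an automorphism group over $\bar{\mathbb{F}}_p$.
   Context: Maps are endomorphisms of $\mathbb{P}^1$ over $\bar{\mathbb{F}}_p$ of degree at least $2$. For $\alpha\in\mathrm{PGL}_2(\bar{\mathbb{F}}_p)$ put $f^\alpha=\alpha^{-1}\circ f\circ\alpha$, and $\mathrm{Aut}(f)=\{\alpha\in\mathrm{PGL}_2(\bar{\mathbb{F}}_p):f^\alpha=f\}$. A finite subgroup of $\mathrm{PGL}_2(\bar{\mathbb{F}}_p)$ is $p$-regular if $p$ does not divide its order. A group $\Gamma$ is realizable as an automorphism group over $\bar{\mathbb{F}}_p$ if there is a map $f$ with $\mathrm{Aut}(f)\cong\Gamma$ (each of the $p$-regular isomorphism types here occurs as a single conjugacy class in $\mathrm{PGL}_2(\bar{\mathbb{F}}_p)$, and replacing $f$ by $f^\sigma$ conjugates $\mathrm{Aut}(f)$ by $\sigma$). A map is of minimal degree for $\Gamma$ if it has the smallest degree among all maps of degree $d\ge2$ over $\bar{\mathbb{F}}_p$ with automorphism group $\Gamma$; that degree is the minimal degree for $\Gamma$. $C_n$ is the cyclic group of order $n$ and $D_{2n}$ is the dihedral group of order $2n$ (with $D_4\cong C_2\times C_2$). *)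

theory Defs
  imports
    "HOL-Algebra.Algebraic_Closure_Type"
    "HOL-Algebra.Elementary_Groups"
    "HOL-Algebra.Sym_Groups"
    "HOL-Number_Theory.Cong"
begin

instance alg_closure :: (field) field_gcd ..

text \<open>
  The points of the projective line over a field \<open>'a\<close> are represented by \<open>'a option\<close>:
  \<open>Some t\<close> is the affine point \<open>[t : 1]\<close>, and \<open>None\<close> is \<open>\<infinity> = [1 : 0]\<close>.
\<close>

definition proj_point :: "'a::field \<Rightarrow> 'a \<Rightarrow> 'a option" where
  "proj_point u v = (if v = 0 then None else Some (u / v))"

section \<open>The group \<open>PGL\<^sub>2\<close>\<close>

lemma proj_point_eq_iff:
  assumes "u \<noteq> 0 \<or> v \<noteq> 0" "u' \<noteq> 0 \<or> v' \<noteq> 0"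
  shows "proj_point u v = proj_point u' v' \<longleftrightarrow> u * v' = u' * v"
  using assms by (auto simp: proj_point_def frac_eq_eq)

definition moebius :: "'a::field \<Rightarrow> 'a \<Rightarrow> 'a \<Rightarrow> 'a \<Rightarrow> 'a option \<Rightarrow> 'a option" where
  "moebius a b c d x =
     (case x of
        Some t \<Rightarrow> proj_point (a * t + b) (c * t + d)
      | None \<Rightarrow> proj_point a c)"

text \<open>
  For a subfield \<open>K\<close> of \<open>'a\<close>, \<open>PGL2 K\<close> is the group of projective transformations
  of the line over \<open>'a\<close> given by matrices with entries in \<open>K\<close>. By \<open>moebius_comp\<close> and
  \<open>moebius_eq_iff\<close> below this is the quotient of \<open>GL\<^sub>2\<close> by the scalars.
  For a finite field \<open>'k\<close> with \<open>q = p\<^sup>e\<close> elements, \<open>'k alg_closure\<close> is also an algebraic closure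
  of the prime field, and \<open>PGL2 (range to_ac)\<close> is \<open>PGL\<^sub>2(\<F>\<^sub>q)\<close> inside \<open>PGL2 UNIV\<close>.
\<close>

definition PGL2 :: "'a::field set \<Rightarrow> ('a option \<Rightarrow> 'a option) monoid" where
  "PGL2 K =
     \<lparr>carrier = {moebius a b c d | a b c d.
        a \<in> K \<and> b \<in> K \<and> c \<in> K \<and> d \<in> K \<and> a * d - b * c \<noteq> 0},
      monoid.mult = (\<circ>), one = id\<rparr>"

lemma moebius_proj_point:
  fixes a b c d u v :: "'a::field"
  assumes "a * d - b * c \<noteq> 0" "u \<noteq> 0 \<or> v \<noteq> 0"
  shows "moebius a b c d (proj_point u v) = proj_point (a * u + b * v) (c * u + d * v)"
proof (cases "v = 0")
  case True
  then show ?thesis using assms by (auto simp: moebius_def proj_point_def)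
next
  case False
  have 1: "c * (u / v) + d = (c * u + d * v) / v" "a * (u / v) + b = (a * u + b * v) / v"
    using False by (simp_all add: field_simps)
  show ?thesis using False
    by (simp add: moebius_def proj_point_def 1 del: times_divide_eq_right)
qed

lemma moebius_comp:
  fixes a b c d a' b' c' d' :: "'a::field"
  assumes "a * d - b * c \<noteq> 0" "a' * d' - b' * c' \<noteq> 0"
  shows "moebius a b c d \<circ> moebius a' b' c' d' =
         moebius (a * a' + b * c') (a * b' + b * d') (c * a' + d * c') (c * b' + d * d')"
proof
  fix x :: "'a option"
  have nz: "a' * t + b' \<noteq> 0 \<or> c' * t + d' \<noteq> 0" for t
  proof (rule ccontr)
    assume "\<not> ?thesis"
    then have "b' = - (a' * t)" "d' = - (c' * t)"
      by (simp_all add: add_eq_0_iff)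
    then show False using assms(2) by (simp add: algebra_simps)
  qed
  have nz2: "a' \<noteq> 0 \<or> c' \<noteq> 0" using assms(2) by auto
  show "(moebius a b c d \<circ> moebius a' b' c' d') x =
        moebius (a * a' + b * c') (a * b' + b * d') (c * a' + d * c') (c * b' + d * d') x"
  proof (cases x)
    case None
    then show ?thesis
      using moebius_proj_point[OF assms(1) nz2] by (simp add: moebius_def)
  next
    case (Some t)
    then show ?thesis
      using moebius_proj_point[OF assms(1) nz[of t]]
      by (simp add: moebius_def algebra_simps)
  qed
qed

lemma moebius_eq_iff:
  fixes a b c d a' b' c' d' :: "'a::field"
  assumes "a * d - b * c \<noteq> 0" "a' * d' - b' * c' \<noteq> 0"
  shows "moebius a b c d = moebius a' b' c' d' \<longleftrightarrow>
         (\<exists>k. k \<noteq> 0 \<and> a' = k * a \<and> b' = k * b \<and> c' = k * c \<and> d' = k * d)"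
proof
  have scale: "\<exists>k. x' = k * x \<and> y' = k * y" if "x \<noteq> 0 \<or> y \<noteq> 0" "x * y' = x' * y" for x y x' y' :: 'a
  proof (cases "x = 0")
    case True
    then show ?thesis using that by (intro exI[of _ "y' / y"]) auto
  next
    case False
    then show ?thesis using that by (intro exI[of _ "x' / x"]) (auto simp: field_simps)
  qed
  have nz: "a * s + b * t \<noteq> 0 \<or> c * s + d * t \<noteq> 0"
    if "a * d - b * c \<noteq> 0" "s \<noteq> 0 \<or> t \<noteq> 0" for a b c d s t :: 'a
  proof (rule ccontr)
    assume "\<not> ?thesis"
    then have *: "a * s + b * t = 0" "c * s + d * t = 0" by auto
    have "(a * d - b * c) * s = d * (a * s + b * t) - b * (c * s + d * t)"
      "(a * d - b * c) * t = a * (c * s + d * t) - c * (a * s + b * t)"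
      by (simp_all add: algebra_simps)
    then show False using * that by auto
  qed
  assume eq: "moebius a b c d = moebius a' b' c' d'"
  have cross: "(a * s + b * t) * (c' * s + d' * t) = (a' * s + b' * t) * (c * s + d * t)"
    if "s \<noteq> 0 \<or> t \<noteq> 0" for s t
  proof -
    have "proj_point (a * s + b * t) (c * s + d * t) = proj_point (a' * s + b' * t) (c' * s + d' * t)"
      using fun_cong[OF eq, of "proj_point s t"]
      by (simp add: moebius_proj_point[OF assms(1) that] moebius_proj_point[OF assms(2) that])
    then show ?thesis
      by (simp add: proj_point_eq_iff[OF nz[OF assms(1) that] nz[OF assms(2) that]])
  qed
  have 1: "a * c' = a' * c" "b * d' = b' * d" using cross[of 1 0] cross[of 0 1] by auto
  have 2: "(a + b) * (c' + d') = (a' + b') * (c + d)" using cross[of 1 1] by simp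
  have ac: "a \<noteq> 0 \<or> c \<noteq> 0" and bd: "b \<noteq> 0 \<or> d \<noteq> 0" using assms(1) by auto
  obtain k where k: "a' = k * a" "c' = k * c"
    using scale[of a c c' a'] 1(1) ac by blast
  obtain l where l: "b' = l * b" "d' = l * d"
    using scale[of b d d' b'] 1(2) bd by blast
  have "(l - k) * (a * d - b * c) = 0"
    using 2 unfolding k l by (simp add: algebra_simps)
  then have "l = k" using assms by auto
  moreover have "k \<noteq> 0" using assms(2) k by auto
  ultimately show "\<exists>k. k \<noteq> 0 \<and> a' = k * a \<and> b' = k * b \<and> c' = k * c \<and> d' = k * d"
    using k l by blast
next
  assume "\<exists>k. k \<noteq> 0 \<and> a' = k * a \<and> b' = k * b \<and> c' = k * c \<and> d' = k * d"
  then obtain k where k: "k \<noteq> 0" "a' = k * a" "b' = k * b" "c' = k * c" "d' = k * d" by blast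
  have *: "proj_point (k * u) (k * v) = proj_point u v" for u v
    using k(1) by (simp add: proj_point_def)
  have "k * a * t + k * b = k * (a * t + b)" "k * c * t + k * d = k * (c * t + d)" for t
    by (simp_all add: algebra_simps)
  then show "moebius a b c d = moebius a' b' c' d'"
    by (auto simp: fun_eq_iff moebius_def k * split: option.split)
qed

lemma moebius_one: "moebius 1 0 0 1 = id"
  by (auto simp: fun_eq_iff moebius_def proj_point_def split: option.split)

lemma moebius_in_PGL2:
  "a \<in> K \<Longrightarrow> b \<in> K \<Longrightarrow> c \<in> K \<Longrightarrow> d \<in> K \<Longrightarrow> a * d - b * c \<noteq> 0 \<Longrightarrow>
   moebius a b c d \<in> carrier (PGL2 K)"
  unfolding PGL2_def by auto

lemma PGL2_mult: "f \<otimes>\<^bsub>PGL2 K\<^esub> g = f \<circ> g"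
  and PGL2_one: "\<one>\<^bsub>PGL2 K\<^esub> = id"
  by (simp_all add: PGL2_def)

lemma group_PGL2:
  assumes "1 \<in> K" "\<And>x y. x \<in> K \<Longrightarrow> y \<in> K \<Longrightarrow> x + y \<in> K" "\<And>x. x \<in> K \<Longrightarrow> - x \<in> K"
    "\<And>x y. x \<in> K \<Longrightarrow> y \<in> K \<Longrightarrow> x * y \<in> K"
  shows "group (PGL2 K)"
proof (rule groupI)
  have 0: "0 \<in> K" using assms(2)[OF assms(1) assms(3)[OF assms(1)]] by simp
  fix f g assume "f \<in> carrier (PGL2 K)" "g \<in> carrier (PGL2 K)"
  then obtain a b c d a' b' c' d'
    where f: "f = moebius a b c d" "a \<in> K" "b \<in> K" "c \<in> K" "d \<in> K" "a * d - b * c \<noteq> 0"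
      and g: "g = moebius a' b' c' d'" "a' \<in> K" "b' \<in> K" "c' \<in> K" "d' \<in> K" "a' * d' - b' * c' \<noteq> 0"
    unfolding PGL2_def by auto
  have "(a * a' + b * c') * (c * b' + d * d') - (a * b' + b * d') * (c * a' + d * c')
      = (a * d - b * c) * (a' * d' - b' * c')"
    by (simp add: algebra_simps)
  then have "(a * a' + b * c') * (c * b' + d * d') - (a * b' + b * d') * (c * a' + d * c') \<noteq> 0"
    using f g by simp
  then show "f \<otimes>\<^bsub>PGL2 K\<^esub> g \<in> carrier (PGL2 K)"
    using assms f g by (simp add: PGL2_mult moebius_comp moebius_in_PGL2)
next
  have 0: "0 \<in> K" using assms(2)[OF assms(1) assms(3)[OF assms(1)]] by simp
  show "\<one>\<^bsub>PGL2 K\<^esub> \<in> carrier (PGL2 K)"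
    using moebius_in_PGL2[of 1 K 0 0 1] 0 assms(1) by (simp add: PGL2_one moebius_one)
next
  fix f assume "f \<in> carrier (PGL2 K)"
  then obtain a b c d
    where f: "f = moebius a b c d" "a \<in> K" "b \<in> K" "c \<in> K" "d \<in> K" "a * d - b * c \<noteq> 0"
    unfolding PGL2_def by auto
  have det: "d * a - (- b) * (- c) \<noteq> 0" using f(6) by (simp add: algebra_simps)
  have "moebius d (- b) (- c) a \<in> carrier (PGL2 K)"
    using moebius_in_PGL2[OF _ _ _ _ det, of K] f(2-5) assms(3) by blast
  moreover have "moebius d (- b) (- c) a \<circ> f = id"
  proof -
    have one: "(1::'a) * 1 - 0 * 0 \<noteq> 0" by simp
    have "(a * d - b * c) * (a * d - b * c) - 0 * 0 \<noteq> 0" using f(6) by simp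
    from moebius_eq_iff[OF one this]
    have "moebius 1 0 0 1 = moebius (a * d - b * c) 0 0 (a * d - b * c)"
      using f(6) by auto
    moreover have "d * a + - b * c = a * d - b * c" "d * b + - b * d = 0"
      "- c * a + a * c = 0" "- c * b + a * d = a * d - b * c"
      by (simp_all add: algebra_simps)
    ultimately show ?thesis
      unfolding f(1) moebius_comp[OF det f(6)] by (simp only: moebius_one)
  qed
  ultimately show "\<exists>g\<in>carrier (PGL2 K). g \<otimes>\<^bsub>PGL2 K\<^esub> f = \<one>\<^bsub>PGL2 K\<^esub>"
    by (auto simp: PGL2_mult PGL2_one)
qed (simp_all add: PGL2_mult PGL2_one o_assoc)

section \<open>Endomorphisms of the projective line\<close>

text \<open>
  A nonconstant endomorphism of the projective line is an element of the function field
  \<open>'a(z)\<close>, here \<open>'a poly fract\<close>; only the constant map \<open>\<infinity>\<close> is not of this form.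
  \<open>quot_of_fract\<close> yields numerator and denominator in lowest terms, so that numerator and
  denominator have no common zero; at \<open>\<infinity>\<close> both are homogenised to degree \<open>rat_degree f\<close>.
\<close>

definition rat_degree :: "'a::field_gcd poly fract \<Rightarrow> nat" where
  "rat_degree f = (case quot_of_fract f of (F, G) \<Rightarrow> max (Polynomial.degree F) (Polynomial.degree G))"

definition rat_map :: "'a::field_gcd poly fract \<Rightarrow> 'a option \<Rightarrow> 'a option" where
  "rat_map f x =
     (case quot_of_fract f of (F, G) \<Rightarrow>
       (case x of
          Some t \<Rightarrow> proj_point (poly F t) (poly G t)
        | None \<Rightarrow> proj_point (Polynomial.coeff F (rat_degree f)) (Polynomial.coeff G (rat_degree f))))"

text \<open>
  Over an infinite field an element of the function field is determined by its map on points
  (\<open>rat_map_inject\<close>), so that \<open>f\<^sup>\<alpha> = f\<close> can be expressed as an equality of maps on points.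
\<close>

definition conj_map :: "('a option \<Rightarrow> 'a option) \<Rightarrow> ('a option \<Rightarrow> 'a option) \<Rightarrow> 'a option \<Rightarrow> 'a option" where
  "conj_map \<alpha> f = inv_into UNIV \<alpha> \<circ> f \<circ> \<alpha>"

definition Aut :: "'a::field_gcd poly fract \<Rightarrow> ('a option \<Rightarrow> 'a option) set" where
  "Aut f = {\<alpha> \<in> carrier (PGL2 UNIV). conj_map \<alpha> (rat_map f) = rat_map f}"

definition Aut_group :: "'a::field_gcd poly fract \<Rightarrow> ('a option \<Rightarrow> 'a option) monoid" where
  "Aut_group f = (PGL2 UNIV)\<lparr>carrier := Aut f\<rparr>"

lemma rat_map_inject:
  fixes f g :: "'a::field_gcd poly fract"
  assumes "infinite (UNIV :: 'a set)" "rat_map f = rat_map g"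
  shows "f = g"
proof -
  obtain F G where f: "quot_of_fract f = (F, G)" by fastforce
  obtain F' G' where g: "quot_of_fract g = (F', G')" by fastforce
  have nz: "poly F t \<noteq> 0 \<or> poly G t \<noteq> 0" if "coprime F G" for F G :: "'a poly" and t
  proof (rule ccontr)
    assume "\<not> ?thesis"
    then have "[:- t, 1:] dvd F" "[:- t, 1:] dvd G" by (simp_all add: poly_eq_0_iff_dvd)
    then have "is_unit [:- t, 1:]" using that coprime_common_divisor by blast
    then show False by (simp add: is_unit_pCons_iff)
  qed
  have eq: "poly (F * G') t = poly (F' * G) t" for t
  proof -
    have "proj_point (poly F t) (poly G t) = proj_point (poly F' t) (poly G' t)"
      using fun_cong[OF assms(2), of "Some t"] by (simp add: rat_map_def f g)
    moreover have "coprime F G" "coprime F' G'"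
      using coprime_quot_of_fract[of f] coprime_quot_of_fract[of g] f g by simp_all
    ultimately show ?thesis by (simp add: proj_point_eq_iff[OF nz nz])
  qed
  have "F * G' = F' * G"
  proof (rule ccontr)
    assume "F * G' \<noteq> F' * G"
    then have "finite {t. poly (F * G' - F' * G) t = 0}" by (intro poly_roots_finite) simp
    moreover have "{t. poly (F * G' - F' * G) t = 0} = UNIV"
      using eq by (simp only: poly_diff) simp
    ultimately show False using assms(1) by simp
  qed
  moreover have "G \<noteq> 0" "G' \<noteq> 0"
    using snd_quot_of_fract_nonzero[of f] snd_quot_of_fract_nonzero[of g] f g by auto
  ultimately have "Fract F G = Fract F' G'" by (simp add: eq_fract)
  then show ?thesis using Fract_quot_of_fract[of f] Fract_quot_of_fract[of g] f g by simp
qed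

section \<open>Realizing groups as automorphism groups\<close>

definition realizes :: "'a::field_gcd poly fract \<Rightarrow> 'g monoid \<Rightarrow> bool" where
  "realizes f \<Gamma> \<longleftrightarrow> rat_degree f \<ge> 2 \<and> Aut_group f \<cong> \<Gamma>"

definition minimal_degree_for :: "'a::field_gcd poly fract \<Rightarrow> 'g monoid \<Rightarrow> bool" where
  "minimal_degree_for f \<Gamma> \<longleftrightarrow>
     realizes f \<Gamma> \<and> (\<forall>g :: 'a poly fract. realizes g \<Gamma> \<longrightarrow> rat_degree f \<le> rat_degree g)"

definition p_regular :: "nat \<Rightarrow> 'b set \<Rightarrow> bool" where
  "p_regular p \<Gamma> \<longleftrightarrow> finite \<Gamma> \<and> \<not> p dvd card \<Gamma>"

text \<open>
  \<open>dihedral_group n\<close> has order \<open>2n\<close>; the pair \<open>(k, s)\<close> stands for \<open>\<rho>\<^sup>k \<tau>\<^sup>s\<close>, where \<open>\<rho>\<close> is the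
  rotation of order \<open>n\<close> and \<open>\<tau>\<close> a reflection, so \<open>\<tau> \<rho>\<^sup>l = \<rho>\<^bsup>-l\<^esup> \<tau>\<close>.
\<close>

definition dihedral_group :: "nat \<Rightarrow> (int \<times> bool) monoid" where
  "dihedral_group n =
     \<lparr>carrier = {0..<int n} \<times> UNIV,
      monoid.mult = (\<lambda>(k, s) (l, t). ((if s then k - l else k + l) mod int n, s \<noteq> t)),
      one = (0, False)\<rparr>"

section \<open>The explicit maps\<close>

text \<open>The coordinate function and the constant functions on the projective line.\<close>

definition zvar :: "'a::field_gcd poly fract" where
  "zvar = to_fract [:0, 1:]"

definition const_fun :: "'a::field_gcd \<Rightarrow> 'a poly fract" where
  "const_fun a = to_fract [:a:]"

text \<open>
  The three families of maps with dihedral automorphism group of order \<open>2n\<close>; which of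
  them applies depends on \<open>n\<close> modulo the characteristic \<open>p\<close>.
\<close>

definition dihedral_construction :: "nat \<Rightarrow> nat \<Rightarrow> 'a::field_gcd poly fract \<Rightarrow> bool" where
  "dihedral_construction p n f \<longleftrightarrow>
     (\<not> [int n = - 1] (mod int p) \<and> f = zvar ^ (n + 1)) \<or>
     (\<not> [int n = 1] (mod int p) \<and> n > 2 \<and> f = 1 / zvar ^ (n - 1)) \<or>
     (n = 2 \<and> (\<exists>a. a \<notin> {- 3, - 1, 0, 1} \<and>
        f = zvar * ((zvar\<^sup>2 + const_fun a) / (const_fun a * zvar\<^sup>2 + 1))))"

end

theory Submission
  imports Defs "HOL-Algebra.Sylow" "HOL-Number_Theory.Residues"
begin

text \<open>
  For a finite set \<open>S\<close> of points let \<open>f\<^sub>S\<close> map \<open>z\<close> to the barycentre of \<open>S\<close> in an affine coordinate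
  with \<open>z\<close> at infinity. If neither \<open>|S|\<close> nor \<open>|S| - 1\<close> vanishes in the field, then \<open>f\<^sub>S\<close> has degree
  \<open>|S| - 1\<close> and fixed point set \<open>S\<close>, and since the construction is projectively natural, its
  automorphism group is the setwise stabilizer of \<open>S\<close>.

  Counting the fixed points of a finite group \<open>\<Gamma>\<close> of order prime to \<open>p\<close> as in characteristic 0 shows
  that \<open>\<Gamma>\<close> has a fixed point (and is cyclic), an orbit of size 2 (and is dihedral), or has order
  12, 24 or 60 with the stabilizer orders of a polyhedral group. In the last case \<open>\<Gamma>\<close> is the full
  stabilizer of a suitable short orbit. This realizes \<open>\<Gamma>\<close> itself, independently of the conjugacy
  class of \<open>\<Gamma>\<close>, and the action on orbits or on partitions of them identifies \<open>\<Gamma>\<close> with \<open>A\<^sub>4\<close>, \<open>S\<^sub>4\<close>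
  or \<open>A\<^sub>5\<close>.

  For the minimal degrees, a map that commutes with \<open>z \<mapsto> \<zeta> z\<close>, where \<open>\<zeta>\<close> is a primitive \<open>n\<close>-th root of
  unity, has numerator and denominator with exponents in fixed residue classes modulo \<open>n\<close>. If its
  degree is at least 2 and less than \<open>n\<close>, this leaves only \<open>c / z\<^bsup>n-1\<^esup>\<close> up to conjugation, whose
  automorphism group contains a dihedral group of order \<open>2n\<close>.
\<close>

section \<open>Moebius transformations\<close>

text \<open>Coincidences in small characteristic shape the proof. If \<open>of_nat (card S)\<close>
  is 0 the barycentre makes no sense; if it is 1, an element of order p may preserve
  \<open>S\<close>, since it is a translation with a single fixed point. Once both values are
  excluded, the stabilizer of \<open>S\<close> again has order prime to p, so the orbit count
  applies to it as well, and orbit sizes leave no room for a group larger than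
  \<open>\<Gamma>\<close>.

  The condition can fail for the shortest orbit: the 6 vertices of an octahedron give 6 = 1 in
  characteristic 5, the 12 vertices of an icosahedron give 12 = 1 in characteristic 11. There, in
  the coordinates used below, the vertices are all points of the projective line over the prime
  field, and their stabilizer contains the whole PGL_2 of that field. This is why the realization
  can switch to the 8 or 20 face centres, and why the existence of the two groups is shown with
  pairs of opposite vertices and not with the set of vertices.\<close>

abbreviation PGL :: "('a::field option \<Rightarrow> 'a option) set" where
  "PGL \<equiv> carrier (PGL2 UNIV)"

definition scale :: "'a::field \<Rightarrow> 'a option \<Rightarrow> 'a option" where
  "scale a = map_option (times a)"

definition flip :: "'a::field \<Rightarrow> 'a option \<Rightarrow> 'a option" where
  "flip c x = (case x of None \<Rightarrow> Some 0 | Some t \<Rightarrow> if t = 0 then None else Some (c / t))"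

lemma scale_simps [simp]: "scale a None = None" "scale a (Some t) = Some (a * t)"
  by (simp_all add: scale_def)

lemma flip_simps [simp]:
  "flip c None = Some 0" "flip c (Some 0) = None" "t \<noteq> 0 \<Longrightarrow> flip c (Some t) = Some (c / t)"
  by (simp_all add: flip_def)

lemma flip_Some: "flip c (Some t) = (if t = 0 then None else Some (c / t))"
  by (simp add: flip_def)

lemma PGL_moebius: "a * d - b * c \<noteq> 0 \<Longrightarrow> moebius a b c d \<in> PGL"
  by (rule moebius_in_PGL2) auto

lemma PGL_E:
  assumes "\<alpha> \<in> PGL"
  obtains a b c d where "\<alpha> = moebius a b c d" "a * d - b * c \<noteq> 0"
  using assms unfolding PGL2_def by auto

lemma group_PGL: "group (PGL2 (UNIV :: 'a::field set))"
  by (rule group_PGL2) auto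

lemma PGL_comp: "\<alpha> \<in> PGL \<Longrightarrow> \<beta> \<in> PGL \<Longrightarrow> \<alpha> \<circ> \<beta> \<in> PGL"
  using monoid.m_closed[OF group.is_monoid[OF group_PGL]] by (simp add: PGL2_mult)

lemma PGL_id: "id \<in> PGL"
  using group.is_monoid[OF group_PGL] monoid.one_closed by (fastforce simp: PGL2_one)

lemma PGL_left_inverse:
  assumes "\<alpha> \<in> PGL"
  shows "\<exists>\<beta>\<in>PGL. \<beta> \<circ> \<alpha> = id \<and> \<alpha> \<circ> \<beta> = id"
  using group.r_inv[OF group_PGL assms] group.l_inv[OF group_PGL assms]
    group.inv_closed[OF group_PGL assms]
  by (auto simp: PGL2_mult PGL2_one)

lemma PGL_bij: "\<alpha> \<in> PGL \<Longrightarrow> bij \<alpha>"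
  using PGL_left_inverse o_bij by blast

lemma PGL_inv:
  assumes "\<alpha> \<in> PGL"
  shows "inv_into UNIV \<alpha> \<in> PGL"
proof -
  obtain \<beta> where "\<beta> \<in> PGL" "\<beta> \<circ> \<alpha> = id" "\<alpha> \<circ> \<beta> = id" using PGL_left_inverse[OF assms] by blast
  then show ?thesis using inv_unique_comp by metis
qed

lemma scale_eq_moebius: "scale a = moebius a 0 0 1"
  by (auto simp: fun_eq_iff scale_def moebius_def proj_point_def split: option.splits)

lemma flip_eq_moebius: "flip c = moebius 0 c 1 0"
  by (auto simp: fun_eq_iff flip_def moebius_def proj_point_def split: option.splits)

lemma PGL_scale: "a \<noteq> 0 \<Longrightarrow> scale a \<in> PGL"
  by (simp add: scale_eq_moebius PGL_moebius)

lemma PGL_flip: "c \<noteq> 0 \<Longrightarrow> flip c \<in> PGL"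
  by (simp add: flip_eq_moebius PGL_moebius)

lemma scale_1: "scale (1::'a::field) = id"
  unfolding scale_def by (rule ext) (simp add: map_option_case split: option.split)

lemma scale_comp: "scale a \<circ> scale b = scale (a * b)"
  unfolding scale_def by (rule ext) (simp add: map_option_case mult.assoc split: option.split)

lemma scale_flip: "a \<noteq> 0 \<Longrightarrow> scale a \<circ> flip c = flip (a * c)"
  by (auto simp: fun_eq_iff scale_def flip_def split: option.splits)

lemma flip_scale: "a \<noteq> 0 \<Longrightarrow> flip c \<circ> scale a = flip (c / a)"
  by (auto simp: fun_eq_iff scale_def flip_def split: option.splits)

lemma flip_flip: "c \<noteq> 0 \<Longrightarrow> d \<noteq> 0 \<Longrightarrow> flip c \<circ> flip d = scale (c / d)"
  by (auto simp: fun_eq_iff scale_def flip_def split: option.splits)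

lemma scale_pow: "(scale a ^^ k) = scale (a ^ k)"
  by (induction k) (simp_all add: scale_1 scale_comp)

lemma scale_inject [simp]: "scale a = scale b \<longleftrightarrow> a = b"
  by (metis mult.right_neutral option.sel scale_simps(2))

lemma flip_inject [simp]: "flip a = flip b \<longleftrightarrow> a = b"
  by (metis div_by_1 flip_simps(3) option.sel zero_neq_one)

lemma scale_neq_flip [simp]: "scale a \<noteq> flip b"
  by (metis flip_simps(1) option.distinct(1) scale_simps(1))

section \<open>Normal forms by fixed points, and sharp 3-transitivity\<close>

lemma PGL_fix_None:
  assumes "\<alpha> \<in> PGL" "\<alpha> None = None"
  obtains a b where "a \<noteq> 0" "\<And>t. \<alpha> (Some t) = Some (a * t + b)"
proof -
  obtain a b c d where \<alpha>: "\<alpha> = moebius a b c d" and det: "a * d - b * c \<noteq> 0"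
    using assms(1) by (rule PGL_E)
  have c: "c = 0" using assms(2) by (auto simp: \<alpha> moebius_def proj_point_def split: if_splits)
  then have "a \<noteq> 0" "d \<noteq> 0" using det by auto
  then have "\<alpha> (Some t) = Some ((a / d) * t + b / d)" for t
    by (simp add: \<alpha> c moebius_def proj_point_def field_simps)
  moreover have "a / d \<noteq> 0" using \<open>a \<noteq> 0\<close> \<open>d \<noteq> 0\<close> by simp
  ultimately show ?thesis using that by blast
qed

lemma PGL_fix_None_0:
  assumes "\<alpha> \<in> PGL" "\<alpha> None = None" "\<alpha> (Some 0) = Some 0"
  obtains a where "a \<noteq> 0" "\<alpha> = scale a"
proof -
  obtain a b where ab: "a \<noteq> 0" "\<And>t. \<alpha> (Some t) = Some (a * t + b)"
    using PGL_fix_None[OF assms(1,2)] by metis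
  have "b = 0" using assms(3) ab(2)[of 0] by simp
  then have "\<alpha> x = scale a x" for x using ab(2) assms(2) by (cases x) simp_all
  then have "\<alpha> = scale a" by blast
  then show ?thesis using that ab by blast
qed

lemma PGL_swap_None_0:
  assumes "\<alpha> \<in> PGL" "\<alpha> None = Some 0" "\<alpha> (Some 0) = None"
  obtains c where "c \<noteq> 0" "\<alpha> = flip c"
proof -
  have "\<alpha> \<circ> flip 1 \<in> PGL" using assms PGL_comp PGL_flip by (metis zero_neq_one)
  then obtain a where a: "a \<noteq> 0" "\<alpha> \<circ> flip 1 = scale a"
    by (rule PGL_fix_None_0) (use assms in auto)
  have "flip 1 \<circ> flip 1 = (id :: 'a option \<Rightarrow> _)" by (simp add: flip_flip scale_1)
  then have "\<alpha> = (\<alpha> \<circ> flip 1) \<circ> flip 1" by (simp add: comp_assoc)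
  also have "\<dots> = flip a" using a scale_flip[of a 1] by simp
  finally show ?thesis using that a by blast
qed

text \<open>If the first point is infinity, an affine map carries 0 and 1 to the other two. The
  general case reduces to this by a \<open>\<tau>\<close> that carries infinity to
  \<open>P\<close>.\<close>

lemma PGL_3_transitive:
  fixes P Q R :: "'a::field option"
  assumes "P \<noteq> Q" "P \<noteq> R" "Q \<noteq> R"
  obtains \<sigma> where "\<sigma> \<in> PGL" "\<sigma> None = P" "\<sigma> (Some 0) = Q" "\<sigma> (Some 1) = R"
proof -
  have main: "\<exists>\<sigma>\<in>PGL. \<sigma> None = None \<and> \<sigma> (Some 0) = Q \<and> \<sigma> (Some 1) = R"
    if QR: "None \<noteq> Q" "None \<noteq> R" "Q \<noteq> R" for Q R :: "'a option"
  proof -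
    obtain q r where q: "Q = Some q" "R = Some r" using QR by (cases Q; cases R) auto
    have "moebius (r - q) q 0 1 \<in> PGL" using QR q by (intro PGL_moebius) auto
    moreover have "moebius (r - q) q 0 1 None = None" "moebius (r - q) q 0 1 (Some 0) = Q"
      "moebius (r - q) q 0 1 (Some 1) = R" using q by (simp_all add: moebius_def proj_point_def)
    ultimately show ?thesis by blast
  qed
  have "\<exists>\<sigma>\<in>PGL. \<sigma> None = P \<and> \<sigma> (Some 0) = Q \<and> \<sigma> (Some 1) = R"
  proof (cases P)
    case None
    then show ?thesis using main assms by metis
  next
    case (Some p)
    define \<tau> where "\<tau> = moebius p 1 1 0"
    have \<tau>: "\<tau> \<in> PGL" "\<tau> None = P" using Some
      by (auto simp: \<tau>_def moebius_def proj_point_def intro!: PGL_moebius)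
    then have b: "bij \<tau>" using PGL_bij by blast
    have tt: "\<tau> (inv_into UNIV \<tau> Y) = Y" for Y :: "'a option" using b by (simp add: bij_is_surj surj_f_inv_f)
    have "None \<noteq> inv_into UNIV \<tau> Q" "None \<noteq> inv_into UNIV \<tau> R" "inv_into UNIV \<tau> Q \<noteq> inv_into UNIV \<tau> R"
      using assms \<tau>(2) tt by metis+
    then obtain \<sigma> where "\<sigma> \<in> PGL" "\<sigma> None = None" "\<sigma> (Some 0) = inv_into UNIV \<tau> Q" "\<sigma> (Some 1) = inv_into UNIV \<tau> R"
      using main by blast
    then show ?thesis using tt \<tau> by (intro bexI[of _ "\<tau> \<circ> \<sigma>"]) (auto intro: PGL_comp)
  qed
  then show ?thesis using that by blast
qed

lemma PGL_2_transitive: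
  fixes P Q :: "'a::field option"
  assumes "P \<noteq> Q"
  obtains \<sigma> where "\<sigma> \<in> PGL" "\<sigma> None = P" "\<sigma> (Some 0) = Q"
proof -
  have "\<exists>R. P \<noteq> R \<and> Q \<noteq> R"
  proof -
    have "(None :: 'a option) \<noteq> Some 0" "(None :: 'a option) \<noteq> Some 1" "Some (0::'a) \<noteq> Some 1" by auto
    then show ?thesis by metis
  qed
  then show ?thesis using PGL_3_transitive assms that by metis
qed

section \<open>Conjugation of maps on points\<close>

lemma conj_map_eq_iff: "bij \<sigma> \<Longrightarrow> conj_map \<sigma> f P = Q \<longleftrightarrow> f (\<sigma> P) = \<sigma> Q"
  unfolding conj_map_def by (auto simp: bij_is_inj bij_is_surj surj_f_inv_f)

lemma conj_map_comp: "bij \<sigma> \<Longrightarrow> conj_map \<sigma> (f \<circ> g) = conj_map \<sigma> f \<circ> conj_map \<sigma> g"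
  unfolding conj_map_def by (auto simp: fun_eq_iff bij_is_surj surj_f_inv_f)

lemma conj_map_comp_conj: "bij \<sigma> \<Longrightarrow> bij \<tau> \<Longrightarrow> conj_map (\<sigma> \<circ> \<tau>) f = conj_map \<tau> (conj_map \<sigma> f)"
  unfolding conj_map_def by (simp add: o_inv_distrib comp_assoc)

lemma conj_map_id: "bij \<sigma> \<Longrightarrow> conj_map \<sigma> id = id"
  unfolding conj_map_def by (simp add: bij_is_inj)

lemma conj_map_id_left [simp]: "conj_map id f = f"
  unfolding conj_map_def by simp

lemma conj_map_inv_left: "bij \<sigma> \<Longrightarrow> conj_map (inv_into UNIV \<sigma>) (conj_map \<sigma> f) = f"
  by (simp add: conj_map_comp_conj[symmetric] bij_imp_bij_inv bij_is_surj surj_iff[THEN iffD1])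

lemma conj_map_inv_right: "bij \<sigma> \<Longrightarrow> conj_map \<sigma> (conj_map (inv_into UNIV \<sigma>) f) = f"
  using conj_map_inv_left[of "inv_into UNIV \<sigma>" f] by (simp add: bij_imp_bij_inv inv_inv_eq)

lemma conj_map_inject: "bij \<sigma> \<Longrightarrow> conj_map \<sigma> f = conj_map \<sigma> g \<longleftrightarrow> f = g"
  using conj_map_inv_left by metis

lemma conj_map_PGL: "\<sigma> \<in> PGL \<Longrightarrow> \<alpha> \<in> PGL \<Longrightarrow> conj_map \<sigma> \<alpha> \<in> PGL"
  unfolding conj_map_def by (intro PGL_comp PGL_inv)

lemma conj_map_funpow: "bij \<sigma> \<Longrightarrow> conj_map \<sigma> (f ^^ k) = conj_map \<sigma> f ^^ k"
  by (induction k) (simp_all add: conj_map_comp conj_map_id)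

text \<open>In a coordinate where the three points are infinity, 0 and 1, the map is a scaling that
  fixes 1.\<close>

lemma PGL_fix_3:
  assumes "\<alpha> \<in> PGL" "\<alpha> P = P" "\<alpha> Q = Q" "\<alpha> R = R" "P \<noteq> Q" "P \<noteq> R" "Q \<noteq> R"
  shows "\<alpha> = id"
proof -
  obtain \<sigma> where \<sigma>: "\<sigma> \<in> PGL" "\<sigma> None = P" "\<sigma> (Some 0) = Q" "\<sigma> (Some 1) = R"
    using PGL_3_transitive assms(5-7) by metis
  have b: "bij \<sigma>" using \<sigma> PGL_bij by blast
  have fx: "conj_map \<sigma> \<alpha> None = None" "conj_map \<sigma> \<alpha> (Some 0) = Some 0" "conj_map \<sigma> \<alpha> (Some 1) = Some 1"
    using \<sigma> assms by (simp_all add: conj_map_eq_iff[OF b])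
  obtain a where "conj_map \<sigma> \<alpha> = scale a"
    using PGL_fix_None_0[OF conj_map_PGL[OF \<sigma>(1) assms(1)] fx(1,2)] by metis
  then have "conj_map \<sigma> \<alpha> = id" using fx(3) by (simp add: scale_1)
  then show ?thesis using conj_map_inject[OF b, of \<alpha> id] conj_map_id[OF b] by simp
qed

lemma PGL_eq_3:
  assumes "\<alpha> \<in> PGL" "\<beta> \<in> PGL" "\<alpha> P = \<beta> P" "\<alpha> Q = \<beta> Q" "\<alpha> R = \<beta> R" "P \<noteq> Q" "P \<noteq> R" "Q \<noteq> R"
  shows "\<alpha> = \<beta>"
proof -
  have b: "bij \<beta>" using assms PGL_bij by blast
  have "inv_into UNIV \<beta> \<circ> \<alpha> = id"
    by (rule PGL_fix_3[of _ P Q R]) (use assms b in \<open>auto intro: PGL_comp PGL_inv simp: bij_is_inj\<close>)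
  then have "\<beta> \<circ> (inv_into UNIV \<beta> \<circ> \<alpha>) = \<beta>" by simp
  then show ?thesis using b
    by (simp add: comp_assoc[symmetric] surj_iff[THEN iffD1] bij_is_surj)
qed

text \<open>A fixed point is an eigenvector of the matrix: infinity if \<open>c = 0\<close>,
  otherwise a root of \<open>c t^2 + (d - a) t - b\<close>.\<close>

lemma PGL_fixed_point:
  fixes \<alpha> :: "'a::alg_closed_field option \<Rightarrow> 'a option"
  assumes "\<alpha> \<in> PGL"
  shows "\<exists>P. \<alpha> P = P"
proof -
  obtain a b c d where \<alpha>: "\<alpha> = moebius a b c d" and det: "a * d - b * c \<noteq> 0"
    using assms by (rule PGL_E)
  show ?thesis
  proof (cases "c = 0")
    case True
    then show ?thesis by (intro exI[of _ None]) (simp add: \<alpha> moebius_def proj_point_def)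
  next
    case False
    then obtain t where "poly [:- b, d - a, c:] t = 0"
      using alg_closed_imp_poly_has_root[of "[:- b, d - a, c:]"] by auto
    then have t: "t * (c * t + d) = a * t + b" by (simp add: algebra_simps)
    \<comment> \<open>The quadratic arose by clearing this denominator. If it vanished, the
      numerator would vanish too, and the determinant would be 0.\<close>
    have "c * t + d \<noteq> 0"
    proof
      assume *: "c * t + d = 0"
      then have "a * t + b = 0" "d = - (c * t)" using t by (simp_all add: eq_neg_iff_add_eq_0 add.commute)
      then have "b = - (a * t)" by (simp add: add_eq_0_iff)
      then show False using det \<open>d = - (c * t)\<close> by (simp add: algebra_simps)
    qed
    then show ?thesis using t
      by (intro exI[of _ "Some t"]) (simp add: \<alpha> moebius_def proj_point_def field_simps)
  qed
qed

text \<open>With one fixed point at infinity the map is affine, \<open>t \<mapsto> a t + c\<close>.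
  For \<open>a = 1\<close> its n-th power is the translation by \<open>n c\<close>, which is trivial
  only for \<open>c = 0\<close> because \<open>n\<close> is nonzero in the field. So
  \<open>a \<noteq> 1\<close>, and \<open>c / (1 - a)\<close> is a second fixed point.\<close>

lemma PGL_diagonalizable:
  fixes \<alpha> :: "'a::alg_closed_field option \<Rightarrow> 'a option"
  assumes "\<alpha> \<in> PGL" "\<alpha> ^^ n = id" "\<alpha> \<noteq> id" "of_nat n \<noteq> (0::'a)"
  obtains \<sigma> a where "\<sigma> \<in> PGL" "a \<noteq> 0" "a \<noteq> 1" "conj_map \<sigma> \<alpha> = scale a"
proof -
  obtain P where P: "\<alpha> P = P" using PGL_fixed_point[OF assms(1)] by blast
  obtain Q where "Q \<noteq> P" using option.distinct(1) by (cases P) auto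
  then obtain \<tau> where \<tau>: "\<tau> \<in> PGL" "\<tau> None = P" using PGL_2_transitive by metis
  then have b: "bij \<tau>" using PGL_bij by blast
  define \<beta> where "\<beta> = conj_map \<tau> \<alpha>"
  have \<beta>: "\<beta> \<in> PGL" "\<beta> None = None"
    using \<tau> assms P by (auto simp: \<beta>_def conj_map_PGL conj_map_eq_iff[OF b])
  have "\<beta> ^^ n = id" unfolding \<beta>_def using conj_map_funpow[OF b, of n \<alpha>] assms(2) conj_map_id[OF b] by simp
  have \<beta>id: "\<beta> \<noteq> id" using assms(3) conj_map_inject[OF b, of \<alpha> id] conj_map_id[OF b] by (simp add: \<beta>_def)
  obtain a c where ac: "a \<noteq> 0" "\<And>t. \<beta> (Some t) = Some (a * t + c)"
    using PGL_fix_None[OF \<beta>] by metis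
  have a1: "a \<noteq> 1"
  proof
    assume a: "a = 1"
    have "(\<beta> ^^ k) (Some 0) = Some (of_nat k * c)" for k
      by (induction k) (simp_all add: ac a algebra_simps)
    from this[of n] have "c = 0" using \<open>\<beta> ^^ n = id\<close> assms(4) by simp
    then have "\<beta> x = x" for x using ac(2) \<beta>(2) a by (cases x) auto
    then show False using \<beta>id by (auto simp: fun_eq_iff)
  qed
  define q where "q = c / (1 - a)"
  have q: "\<beta> (Some q) = Some q" using a1 by (simp add: ac q_def field_simps)
  obtain \<rho> where \<rho>: "\<rho> \<in> PGL" "\<rho> None = None" "\<rho> (Some 0) = Some q"
    using PGL_2_transitive[of None "Some q"] by auto
  then have b2: "bij \<rho>" using PGL_bij by blast
  obtain a' where a': "a' \<noteq> 0" "conj_map \<rho> \<beta> = scale a'"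
    by (rule PGL_fix_None_0[OF conj_map_PGL[OF \<rho>(1) \<beta>(1)]])
      (auto simp: conj_map_eq_iff[OF b2] \<rho> \<beta> q)
  have "a' \<noteq> 1" using a' \<beta>id conj_map_inject[OF b2, of \<beta> id] conj_map_id[OF b2] by (auto simp: scale_1)
  then show ?thesis using that[of "\<tau> \<circ> \<rho>" a'] a' \<tau> \<rho> b b2
    by (simp add: PGL_comp conj_map_comp_conj \<beta>_def)
qed

section \<open>Rational maps as maps on points\<close>

lemma infinite_alg_closed: "infinite (UNIV :: 'a::alg_closed_field set)"
proof
  assume fin: "finite (UNIV :: 'a set)"
  \<comment> \<open>Euclid's argument: the product of all linear factors plus 1 takes the value 1
    everywhere.\<close>
  define p where "p = (\<Prod>x\<in>(UNIV :: 'a set). [:- x, 1:]) + 1"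
  have "Polynomial.degree (\<Prod>x\<in>(UNIV :: 'a set). [:- x, 1:]) = card (UNIV :: 'a set)"
    by (subst degree_prod_sum_eq) auto
  moreover have "card (UNIV :: 'a set) > 0" using fin by (simp add: card_gt_0_iff)
  ultimately have "Polynomial.degree p > 0"
    unfolding p_def by (subst degree_add_eq_left) auto
  then obtain x where "poly p x = 0" using alg_closed_imp_poly_has_root by blast
  moreover have "poly p x = 1" using fin by (auto simp: p_def poly_prod)
  ultimately show False by simp
qed

lemma infinite_Diff_finite_UNIV: "finite A \<Longrightarrow> infinite (- A :: 'a::alg_closed_field set)"
  using infinite_alg_closed finite_compl by blast

text \<open>Two binary forms of degree \<open>d\<close> without common zero, written in the affine
  variable; the coefficients of index \<open>d\<close> are their values at infinity. Unlike the
  normalised output of \<open>quot_of_fract\<close>, such pairs are stable under substitution and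
  under linear combination by an invertible matrix, and the degree is carried along as a
  parameter.\<close>

definition rat_pair :: "nat \<Rightarrow> 'a::field poly \<Rightarrow> 'a poly \<Rightarrow> bool" where
  "rat_pair d F G \<longleftrightarrow> Polynomial.degree F \<le> d \<and> Polynomial.degree G \<le> d \<and>
     (Polynomial.coeff F d \<noteq> 0 \<or> Polynomial.coeff G d \<noteq> 0) \<and> (\<forall>t. poly F t \<noteq> 0 \<or> poly G t \<noteq> 0)"

definition pair_map :: "nat \<Rightarrow> 'a::field poly \<Rightarrow> 'a poly \<Rightarrow> 'a option \<Rightarrow> 'a option" where
  "pair_map d F G x = (case x of Some t \<Rightarrow> proj_point (poly F t) (poly G t)
     | None \<Rightarrow> proj_point (Polynomial.coeff F d) (Polynomial.coeff G d))"

lemma rat_pair_degree: "rat_pair d F G \<Longrightarrow> max (Polynomial.degree F) (Polynomial.degree G) = d"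
  unfolding rat_pair_def using le_degree by (metis le_antisym max.absorb1 max.absorb2)

text \<open>The cofactor by which the pair differs from lowest terms divides both entries. So it has
  no root and is constant over an algebraically closed field.\<close>

lemma rat_pair_quot:
  fixes F G :: "'a::{alg_closed_field,field_gcd} poly"
  assumes "rat_pair d F G" "G \<noteq> 0"
  obtains c where "c \<noteq> 0" "F = Polynomial.smult c (fst (quot_of_fract (Fract F G)))"
    "G = Polynomial.smult c (snd (quot_of_fract (Fract F G)))"
proof -
  define F' where "F' = fst (quot_of_fract (Fract F G))"
  define G' where "G' = snd (quot_of_fract (Fract F G))"
  have nz: "G' \<noteq> 0" by (simp add: G'_def)
  have "Fract F' G' = Fract F G" by (simp add: F'_def G'_def)
  then have eq: "F' * G = F * G'" using assms(2) nz by (simp add: eq_fract)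
  have "coprime F' G'" unfolding F'_def G'_def by (rule coprime_quot_of_fract)
  moreover have "G' dvd F' * G" using eq by simp
  ultimately have "G' dvd G" by (simp add: coprime_commute coprime_dvd_mult_right_iff)
  then obtain k where k: "G = G' * k" by blast
  then have kF: "F = F' * k" using eq nz by (simp add: mult.left_commute)
  have "poly k t \<noteq> 0" for t using assms(1) unfolding rat_pair_def k kF by auto
  then have "Polynomial.degree k = 0" using alg_closed_imp_poly_has_root by blast
  then obtain c where c: "k = [:c:]" by (rule degree_eq_zeroE)
  have c0: "c \<noteq> 0" using k assms(2) c by auto
  have cF: "F = Polynomial.smult c F'" and cG: "G = Polynomial.smult c G'"
    using k kF c by (simp_all add: mult.commute[of _ "[:c:]"])
  show ?thesis by (rule that[OF c0 cF[unfolded F'_def] cG[unfolded G'_def]])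
qed

lemma
  fixes F G :: "'a::{alg_closed_field,field_gcd} poly"
  assumes "rat_pair d F G" "G \<noteq> 0"
  shows rat_degree_Fract: "rat_degree (Fract F G) = d"
    and rat_map_Fract: "rat_map (Fract F G) = pair_map d F G"
proof -
  obtain F' G' where q: "quot_of_fract (Fract F G) = (F', G')" by fastforce
  obtain c where c: "c \<noteq> 0" "F = Polynomial.smult c F'" "G = Polynomial.smult c G'"
    using rat_pair_quot[OF assms] unfolding q fst_conv snd_conv by metis
  have e: "Polynomial.coeff F n = c * Polynomial.coeff F' n" "poly F t = c * poly F' t"
    "Polynomial.coeff G n = c * Polynomial.coeff G' n" "poly G t = c * poly G' t" for n t
    using arg_cong[OF c(2), of "\<lambda>p. Polynomial.coeff p n"] arg_cong[OF c(2), of "\<lambda>p. poly p t"]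
      arg_cong[OF c(3), of "\<lambda>p. Polynomial.coeff p n"] arg_cong[OF c(3), of "\<lambda>p. poly p t"] by simp_all
  show *: "rat_degree (Fract F G) = d"
    unfolding rat_degree_def q using rat_pair_degree[OF assms(1)] c by simp
  have pp: "proj_point (c * u) (c * v) = proj_point u v" for u v
    using c(1) by (simp add: proj_point_def)
  show "rat_map (Fract F G) = pair_map d F G"
    unfolding rat_map_def * q pair_map_def
    by (simp only: e case_prod_conv pp)
qed

lemma rat_pairE:
  fixes \<phi> :: "'a::{alg_closed_field,field_gcd} poly fract"
  obtains F G where "rat_pair (rat_degree \<phi>) F G" "G \<noteq> 0" "\<phi> = Fract F G"
    "rat_map \<phi> = pair_map (rat_degree \<phi>) F G"
proof -
  obtain F G where q: "quot_of_fract \<phi> = (F, G)" by fastforce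
  have nz: "G \<noteq> 0" using snd_quot_of_fract_nonzero[of \<phi>] q by simp
  have \<phi>: "\<phi> = Fract F G" using Fract_quot_of_fract[of \<phi>] q by simp
  have "coprime F G" using coprime_quot_of_fract[of \<phi>] q by simp
  then have "poly F t \<noteq> 0 \<or> poly G t \<noteq> 0" for t by (rule coprime_poly_0)
  moreover have "rat_degree \<phi> = max (Polynomial.degree F) (Polynomial.degree G)"
    by (simp add: rat_degree_def q)
  ultimately have "rat_pair (rat_degree \<phi>) F G"
    using nz unfolding rat_pair_def
    by (metis leading_coeff_0_iff max.cobounded1 max.cobounded2 max_def degree_0 zero_le le_antisym)
  then show ?thesis using that nz \<phi> rat_map_Fract by blast
qed

section \<open>Homogeneous evaluation and composition with Moebius transformations\<close>

definition hom_eval :: "nat \<Rightarrow> 'a::field poly \<Rightarrow> 'a \<Rightarrow> 'a \<Rightarrow> 'a" where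
  "hom_eval d F u v = (\<Sum>i\<le>d. Polynomial.coeff F i * u ^ i * v ^ (d - i))"

lemma hom_eval_nonzero:
  assumes "Polynomial.degree F \<le> d" "v \<noteq> 0"
  shows "hom_eval d F u v = v ^ d * poly F (u / v)"
proof -
  have "poly F (u / v) = (\<Sum>i\<le>d. Polynomial.coeff F i * (u / v) ^ i)"
    unfolding poly_altdef using assms(1)
    by (intro sum.mono_neutral_left) (auto simp: coeff_eq_0 not_le)
  moreover have "v ^ d * (Polynomial.coeff F i * (u / v) ^ i) = Polynomial.coeff F i * u ^ i * v ^ (d - i)"
    if "i \<le> d" for i
  proof -
    have "v ^ d = v ^ i * v ^ (d - i)" using that by (simp flip: power_add)
    then show ?thesis using assms(2) by (simp add: power_divide)
  qed
  ultimately show ?thesis unfolding hom_eval_def sum_distrib_left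
    by (metis (no_types, lifting) atMost_iff sum.cong sum_distrib_left)
qed

lemma hom_eval_0: "hom_eval d F u 0 = Polynomial.coeff F d * u ^ d"
proof -
  have "hom_eval d F u 0 = (\<Sum>i\<in>{d}. Polynomial.coeff F i * u ^ i * 0 ^ (d - i))"
    unfolding hom_eval_def by (rule sum.mono_neutral_right) auto
  then show ?thesis by simp
qed

lemma hom_eval_common_zero:
  assumes "rat_pair d F G" "u \<noteq> 0 \<or> v \<noteq> 0"
  shows "hom_eval d F u v \<noteq> 0 \<or> hom_eval d G u v \<noteq> 0"
  using assms by (cases "v = 0") (auto simp: rat_pair_def hom_eval_nonzero hom_eval_0)

lemma pair_map_proj_point:
  assumes "rat_pair d F G" "u \<noteq> 0 \<or> v \<noteq> 0"
  shows "pair_map d F G (proj_point u v) = proj_point (hom_eval d F u v) (hom_eval d G u v)"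
proof -
  have pp: "proj_point (c * x) (c * y) = proj_point x y" if "c \<noteq> 0" for c x y :: 'a
    using that by (simp add: proj_point_def)
  show ?thesis
  proof (cases "v = 0")
    case True
    then show ?thesis using assms pp[of "u ^ d"]
      by (simp add: hom_eval_0 pair_map_def mult.commute) (simp add: proj_point_def)
  next
    case False
    then have "pair_map d F G (proj_point u v) = proj_point (poly F (u / v)) (poly G (u / v))"
      by (simp add: proj_point_def pair_map_def)
    then show ?thesis using False assms by (simp add: hom_eval_nonzero rat_pair_def pp)
  qed
qed

lemma coeff_mult_degree_le:
  assumes "Polynomial.degree p \<le> m" "Polynomial.degree q \<le> n"
  shows "Polynomial.coeff (p * q) (m + n) = Polynomial.coeff p m * Polynomial.coeff q (n::nat)"
proof -
  have "(\<Sum>k\<le>m + n. Polynomial.coeff p k * Polynomial.coeff q (m + n - k)) =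
      (\<Sum>k\<in>{m}. Polynomial.coeff p k * Polynomial.coeff q (m + n - k))"
  proof (rule sum.mono_neutral_right)
    show "\<forall>k\<in>{..m + n} - {m}. Polynomial.coeff p k * Polynomial.coeff q (m + n - k) = 0"
    proof
      fix k assume "k \<in> {..m + n} - {m}"
      then consider "k > m" | "m + n - k > n" by force
      then show "Polynomial.coeff p k * Polynomial.coeff q (m + n - k) = 0"
        using assms by cases (auto simp: coeff_eq_0)
    qed
  qed auto
  then show ?thesis by (simp add: coeff_mult)
qed

text \<open>The composition of \<open>F\<close> with \<open>(a t + b) / (c t + e)\<close>,
  multiplied by \<open>(c t + e) ^ d\<close> to clear denominators.\<close>

definition hom_subst :: "nat \<Rightarrow> 'a::field poly \<Rightarrow> 'a \<Rightarrow> 'a \<Rightarrow> 'a \<Rightarrow> 'a \<Rightarrow> 'a poly" where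
  "hom_subst d F a b c e =
     (\<Sum>i\<le>d. Polynomial.smult (Polynomial.coeff F i) ([:b, a:] ^ i * [:e, c:] ^ (d - i)))"

lemma poly_hom_subst: "poly (hom_subst d F a b c e) t = hom_eval d F (a * t + b) (c * t + e)"
  by (simp add: hom_subst_def hom_eval_def poly_sum algebra_simps)

lemma linear_power_coeff:
  "Polynomial.degree ([:b, a:] ^ n) \<le> n" "Polynomial.coeff ([:b, a:] ^ n) n = (a::'a::field) ^ n"
proof -
  show *: "Polynomial.degree ([:b, a:] ^ n) \<le> n" for n
    using degree_power_le[of "[:b, a:]" n] by (simp split: if_splits)
  show "Polynomial.coeff ([:b, a:] ^ n) n = a ^ n"
  proof (induction n)
    case (Suc n)
    have "Polynomial.coeff ([:b, a:] ^ n) (Suc n) = 0" using * le_imp_less_Suc coeff_eq_0 by blast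
    then show ?case using Suc by simp
  qed simp
qed

lemma hom_subst_coeff:
  "Polynomial.degree (hom_subst d F a b c e) \<le> d"
  "Polynomial.coeff (hom_subst d F a b c e) d = hom_eval d F a c"
proof -
  have deg: "Polynomial.degree ([:b, a:] ^ i * [:e, c:] ^ (d - i)) \<le> d" if "i \<le> d" for i
    using that degree_mult_le[of "[:b, a:] ^ i" "[:e, c:] ^ (d - i)"]
      linear_power_coeff(1)[of b a i] linear_power_coeff(1)[of e c "d - i"] by linarith
  then show "Polynomial.degree (hom_subst d F a b c e) \<le> d"
    unfolding hom_subst_def by (intro degree_sum_le) (auto intro: order.trans[OF degree_smult_le])
  have "Polynomial.coeff ([:b, a:] ^ i * [:e, c:] ^ (d - i)) d = a ^ i * c ^ (d - i)" if "i \<le> d" for i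
  proof -
    have "Polynomial.coeff ([:b, a:] ^ i * [:e, c:] ^ (d - i)) (i + (d - i)) =
        Polynomial.coeff ([:b, a:] ^ i) i * Polynomial.coeff ([:e, c:] ^ (d - i)) (d - i)"
      by (rule coeff_mult_degree_le) (rule linear_power_coeff)+
    then show ?thesis using that by (simp add: linear_power_coeff)
  qed
  then show "Polynomial.coeff (hom_subst d F a b c e) d = hom_eval d F a c"
    by (simp add: hom_subst_def hom_eval_def Polynomial.coeff_sum algebra_simps)
qed

text \<open>The degree cannot drop: an invertible matrix maps nonzero vectors to nonzero vectors, so
  a common zero after the substitution would come from one before it.\<close>

lemma pair_map_moebius_right:
  assumes "rat_pair d F G" "\<sigma> \<in> PGL"
  obtains F' G' where "rat_pair d F' G'" "pair_map d F' G' = pair_map d F G \<circ> \<sigma>"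
proof -
  obtain a b c e where \<sigma>: "\<sigma> = moebius a b c e" and det: "a * e - b * c \<noteq> 0"
    using assms(2) by (rule PGL_E)
  have nz: "a * t + b \<noteq> 0 \<or> c * t + e \<noteq> 0" for t
  proof (rule ccontr)
    assume "\<not> ?thesis"
    then have "b = - (a * t)" "e = - (c * t)" by (simp_all add: add_eq_0_iff)
    then show False using det by (simp add: algebra_simps)
  qed
  have nz2: "a \<noteq> 0 \<or> c \<noteq> 0" using det by auto
  let ?F = "hom_subst d F a b c e" and ?G = "hom_subst d G a b c e"
  have "rat_pair d ?F ?G"
    using hom_eval_common_zero[OF assms(1) nz] hom_eval_common_zero[OF assms(1) nz2]
    by (simp add: rat_pair_def hom_subst_coeff poly_hom_subst)
  moreover have "pair_map d ?F ?G x = (pair_map d F G \<circ> \<sigma>) x" for x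
    by (cases x) (simp_all add: \<sigma> moebius_def pair_map_proj_point[OF assms(1) nz]
      pair_map_proj_point[OF assms(1) nz2] pair_map_def[of d ?F ?G] hom_subst_coeff poly_hom_subst)
  ultimately show ?thesis using that by blast
qed

lemma pair_map_moebius_left:
  assumes "rat_pair d F G" "\<sigma> \<in> PGL"
  obtains F' G' where "rat_pair d F' G'" "pair_map d F' G' = \<sigma> \<circ> pair_map d F G"
proof -
  obtain a b c e where \<sigma>: "\<sigma> = moebius a b c e" and det: "a * e - b * c \<noteq> 0"
    using assms(2) by (rule PGL_E)
  have nz: "a * s + b * t \<noteq> 0 \<or> c * s + e * t \<noteq> 0" if "s \<noteq> 0 \<or> t \<noteq> 0" for s t
  proof (rule ccontr)
    assume "\<not> ?thesis"
    then have *: "a * s + b * t = 0" "c * s + e * t = 0" by auto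
    have "(a * e - b * c) * s = e * (a * s + b * t) - b * (c * s + e * t)"
      "(a * e - b * c) * t = a * (c * s + e * t) - c * (a * s + b * t)"
      by (simp_all add: algebra_simps)
    then show False using * that det by auto
  qed
  let ?F = "Polynomial.smult a F + Polynomial.smult b G" and ?G = "Polynomial.smult c F + Polynomial.smult e G"
  have deg: "Polynomial.degree (Polynomial.smult x F + Polynomial.smult y G) \<le> d" for x y
    using assms(1) by (intro degree_add_le) (auto simp: rat_pair_def intro: order.trans[OF degree_smult_le])
  have "rat_pair d ?F ?G"
    using assms(1) nz unfolding rat_pair_def by (auto simp: deg)
  moreover have "pair_map d ?F ?G x = (\<sigma> \<circ> pair_map d F G) x" for x
    using assms(1) moebius_proj_point[OF det] unfolding rat_pair_def
    by (cases x) (simp_all add: pair_map_def \<sigma>)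
  ultimately show ?thesis using that by blast
qed

lemma pair_map_cross:
  assumes "rat_pair d F G" "rat_pair d' F' G'" "pair_map d F G (Some t) = pair_map d' F' G' (Some t)"
  shows "poly F t * poly G' t = poly F' t * poly G t"
  using assms by (auto simp: pair_map_def rat_pair_def proj_point_eq_iff)

lemma pair_map_cross_poly:
  assumes "rat_pair d F G" "rat_pair d' F' G'" "infinite A"
    "\<And>t. t \<in> A \<Longrightarrow> pair_map d F G (Some t) = pair_map d' F' G' (Some t)"
  shows "F * G' = F' * G"
proof (rule ccontr)
  assume "F * G' \<noteq> F' * G"
  then have "finite {t. poly (F * G' - F' * G) t = 0}" by (intro poly_roots_finite) simp
  moreover have "A \<subseteq> {t. poly (F * G' - F' * G) t = 0}"
    using pair_map_cross[OF assms(1,2) assms(4)] by auto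
  ultimately show False using assms(3) finite_subset by blast
qed

text \<open>Cross multiplication turns agreement at infinitely many points into a polynomial
  identity. Its coefficient at \<open>d + d'\<close> is the comparison at infinity.\<close>

lemma pair_map_eqI:
  assumes "rat_pair d F G" "rat_pair d' F' G'" "infinite A"
    "\<And>t. t \<in> A \<Longrightarrow> pair_map d F G (Some t) = pair_map d' F' G' (Some t)"
  shows "pair_map d F G = pair_map d' F' G'"
proof
  have eq: "F * G' = F' * G" by (rule pair_map_cross_poly[OF assms])
  fix x show "pair_map d F G x = pair_map d' F' G' x"
  proof (cases x)
    case (Some t)
    then show ?thesis using assms(1,2) arg_cong[OF eq, of "\<lambda>p. poly p t"]
      by (simp add: pair_map_def rat_pair_def proj_point_eq_iff)
  next
    case None
    have "Polynomial.coeff (F * G') (d + d') = Polynomial.coeff F d * Polynomial.coeff G' d'"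
      "Polynomial.coeff (F' * G) (d' + d) = Polynomial.coeff F' d' * Polynomial.coeff G d"
      using assms(1,2) by (auto intro!: coeff_mult_degree_le simp: rat_pair_def)
    then show ?thesis using None assms(1,2) eq
      by (simp add: pair_map_def rat_pair_def proj_point_eq_iff add.commute)
  qed
qed

lemma rat_pair_G_nonzero:
  fixes F G :: "'a::alg_closed_field poly"
  assumes "rat_pair d F G" "d > 0"
  shows "G \<noteq> 0"
proof
  assume "G = 0"
  then have "Polynomial.degree F > 0" "\<forall>t. poly F t \<noteq> 0"
    using assms by (auto simp: rat_pair_def intro: less_le_trans dest: le_degree)
  then show False using alg_closed_imp_poly_has_root by blast
qed

text \<open>Positive degree keeps the conjugate away from the constant map infinity, the one
  endomorphism that is not an element of the function field.\<close>

lemma conj_rat_map: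
  fixes \<phi> :: "'a::{alg_closed_field,field_gcd} poly fract"
  assumes "\<sigma> \<in> PGL" "rat_degree \<phi> > 0"
  obtains \<psi> :: "'a poly fract" where "rat_map \<psi> = conj_map \<sigma> (rat_map \<phi>)" "rat_degree \<psi> = rat_degree \<phi>"
proof -
  obtain F G where FG: "rat_pair (rat_degree \<phi>) F G" "rat_map \<phi> = pair_map (rat_degree \<phi>) F G"
    using rat_pairE by metis
  obtain F1 G1 where 1: "rat_pair (rat_degree \<phi>) F1 G1"
    "pair_map (rat_degree \<phi>) F1 G1 = pair_map (rat_degree \<phi>) F G \<circ> \<sigma>"
    using pair_map_moebius_right[OF FG(1) assms(1)] by metis
  obtain F2 G2 where 2: "rat_pair (rat_degree \<phi>) F2 G2"
    "pair_map (rat_degree \<phi>) F2 G2 = inv_into UNIV \<sigma> \<circ> pair_map (rat_degree \<phi>) F1 G1"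
    using pair_map_moebius_left[OF 1(1) PGL_inv[OF assms(1)]] by metis
  have "G2 \<noteq> 0" using rat_pair_G_nonzero[OF 2(1) assms(2)] .
  then show ?thesis using that[of "Fract F2 G2"] rat_map_Fract[OF 2(1)] rat_degree_Fract[OF 2(1)] 1 2 FG
    by (simp add: conj_map_def comp_assoc)
qed

section \<open>Automorphisms as transformations that commute with the map\<close>

lemma Aut_iff: "\<alpha> \<in> Aut \<phi> \<longleftrightarrow> \<alpha> \<in> PGL \<and> (\<forall>x. rat_map \<phi> (\<alpha> x) = \<alpha> (rat_map \<phi> x))"
proof (cases "\<alpha> \<in> PGL")
  case True
  then have "conj_map \<alpha> (rat_map \<phi>) = rat_map \<phi> \<longleftrightarrow> (\<forall>x. rat_map \<phi> (\<alpha> x) = \<alpha> (rat_map \<phi> x))"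
    using conj_map_eq_iff[OF PGL_bij[OF True]] by (auto simp: fun_eq_iff)
  then show ?thesis using True by (simp add: Aut_def)
qed (simp add: Aut_def)

lemma Aut_PGL: "\<alpha> \<in> Aut \<phi> \<Longrightarrow> \<alpha> \<in> PGL"
  by (simp add: Aut_def)

lemma Aut_commute: "\<alpha> \<in> Aut \<phi> \<Longrightarrow> rat_map \<phi> (\<alpha> x) = \<alpha> (rat_map \<phi> x)"
  by (simp add: Aut_iff)

lemma Aut_comp: "\<alpha> \<in> Aut \<phi> \<Longrightarrow> \<beta> \<in> Aut \<phi> \<Longrightarrow> \<alpha> \<circ> \<beta> \<in> Aut \<phi>"
  by (auto simp: Aut_iff PGL_comp)

lemma Aut_id: "id \<in> Aut \<phi>"
  by (simp add: Aut_iff PGL_id)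

lemma Aut_inv: "\<alpha> \<in> Aut \<phi> \<Longrightarrow> inv_into UNIV \<alpha> \<in> Aut \<phi>"
  unfolding Aut_iff using PGL_bij PGL_inv by (metis bij_inv_eq_iff)

text \<open>Both sides of the relation are given by pairs of the same degree, so it can be tested
  away from finitely many inconvenient points such as poles.\<close>

lemma Aut_infinite:
  fixes \<phi> :: "'a::{alg_closed_field,field_gcd} poly fract"
  assumes "\<alpha> \<in> PGL" "infinite A" "\<And>t. t \<in> A \<Longrightarrow> rat_map \<phi> (\<alpha> (Some t)) = \<alpha> (rat_map \<phi> (Some t))"
  shows "\<alpha> \<in> Aut \<phi>"
proof -
  obtain F G where FG: "rat_pair (rat_degree \<phi>) F G" "rat_map \<phi> = pair_map (rat_degree \<phi>) F G"
    using rat_pairE by metis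
  obtain F1 G1 where 1: "rat_pair (rat_degree \<phi>) F1 G1"
    "pair_map (rat_degree \<phi>) F1 G1 = pair_map (rat_degree \<phi>) F G \<circ> \<alpha>"
    using pair_map_moebius_right[OF FG(1) assms(1)] by metis
  obtain F2 G2 where 2: "rat_pair (rat_degree \<phi>) F2 G2"
    "pair_map (rat_degree \<phi>) F2 G2 = \<alpha> \<circ> pair_map (rat_degree \<phi>) F G"
    using pair_map_moebius_left[OF FG(1) assms(1)] by metis
  have "pair_map (rat_degree \<phi>) F1 G1 = pair_map (rat_degree \<phi>) F2 G2"
    by (rule pair_map_eqI[OF 1(1) 2(1) assms(2)]) (use assms(3) 1 2 FG in auto)
  then have "rat_map \<phi> \<circ> \<alpha> = \<alpha> \<circ> rat_map \<phi>" using 1 2 FG by simp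
  then show ?thesis using assms(1) by (auto simp: Aut_iff fun_eq_iff)
qed

lemma Aut_conj:
  assumes "\<sigma> \<in> PGL" "rat_map \<psi> = conj_map \<sigma> (rat_map \<phi>)"
  shows "Aut \<psi> = conj_map \<sigma> ` Aut \<phi>"
proof -
  have b: "bij \<sigma>" using assms PGL_bij by blast
  have 1: "conj_map \<sigma> \<alpha> \<in> Aut \<psi> \<longleftrightarrow> \<alpha> \<in> Aut \<phi>" if "\<alpha> \<in> PGL" for \<alpha>
  proof -
    have "conj_map \<sigma> \<alpha> \<in> Aut \<psi> \<longleftrightarrow> conj_map \<sigma> (rat_map \<phi>) \<circ> conj_map \<sigma> \<alpha> = conj_map \<sigma> \<alpha> \<circ> conj_map \<sigma> (rat_map \<phi>)"
      using that assms by (auto simp: Aut_iff fun_eq_iff conj_map_PGL)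
    also have "\<dots> \<longleftrightarrow> rat_map \<phi> \<circ> \<alpha> = \<alpha> \<circ> rat_map \<phi>"
      by (simp add: conj_map_inject[OF b] flip: conj_map_comp[OF b])
    also have "\<dots> \<longleftrightarrow> \<alpha> \<in> Aut \<phi>" using that by (auto simp: Aut_iff fun_eq_iff)
    finally show ?thesis .
  qed
  show ?thesis
  proof (intro equalityI subsetI)
    fix \<beta> assume \<beta>: "\<beta> \<in> Aut \<psi>"
    let ?\<alpha> = "conj_map (inv_into UNIV \<sigma>) \<beta>"
    have "?\<alpha> \<in> PGL" using Aut_PGL[OF \<beta>] assms by (intro conj_map_PGL PGL_inv)
    moreover have "conj_map \<sigma> ?\<alpha> = \<beta>" by (rule conj_map_inv_right[OF b])
    ultimately show "\<beta> \<in> conj_map \<sigma> ` Aut \<phi>" using 1[of ?\<alpha>] \<beta> by (metis imageI)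
  qed (use 1 Aut_PGL in auto)
qed

section \<open>Barycentre maps\<close>

definition affine_part :: "'a option set \<Rightarrow> 'a set" where
  "affine_part S = {t. Some t \<in> S}"

definition root_poly :: "'a::field option set \<Rightarrow> 'a poly" where
  "root_poly S = (\<Prod>s\<in>affine_part S. [:- s, 1:])"

text \<open>
  The value at \<open>z\<close> is the barycentre of \<open>S\<close> in an affine coordinate for which \<open>z\<close> is the point
  at infinity (\<open>bary_map_value\<close>); hence the fixed points are the points of \<open>S\<close>, and the map commutes
  with every projective transformation that preserves \<open>S\<close>.
\<close>

definition bary_map :: "'a::field_gcd option set \<Rightarrow> 'a poly fract" where
  "bary_map S = Fract ([:0, 1:] * pderiv (root_poly S) - Polynomial.smult (of_nat (card S)) (root_poly S))
     (pderiv (root_poly S))"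

lemma finite_affine_part: "finite S \<Longrightarrow> finite (affine_part S)"
  unfolding affine_part_def using finite_vimageI[of S Some] by (simp add: vimage_def)

lemma card_affine_part:
  assumes "finite S"
  shows "card S = card (affine_part S) + (if None \<in> S then 1 else 0)"
proof -
  have *: "S - {None} = Some ` affine_part S"
  proof (intro equalityI subsetI)
    fix x assume "x \<in> S - {None}"
    then show "x \<in> Some ` affine_part S" by (cases x) (auto simp: affine_part_def)
  qed (auto simp: affine_part_def)
  then have "card (S - {None}) = card (affine_part S)" by (simp add: card_image)
  then show ?thesis using assms by (auto simp: card_Diff_singleton_if split: if_splits) (metis Suc_pred card_gt_0_iff empty_iff)
qed

lemma poly_root_poly: "finite S \<Longrightarrow> poly (root_poly S) t = (\<Prod>s\<in>affine_part S. t - s)"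
  by (simp add: root_poly_def poly_prod)

lemma root_poly_eq_0_iff: "finite S \<Longrightarrow> poly (root_poly S) t = 0 \<longleftrightarrow> Some t \<in> S"
  using finite_affine_part[of S] by (auto simp: poly_root_poly affine_part_def)

lemma pderiv_root_poly:
  assumes "finite S"
  shows "poly (pderiv (root_poly S)) t = (\<Sum>a\<in>affine_part S. \<Prod>s\<in>affine_part S - {a}. t - s)"
  using finite_affine_part[OF assms]
  by (simp add: root_poly_def pderiv_prod poly_sum poly_prod pderiv_pCons)

text \<open>All roots are simple: at a root only the summand that omits its own factor
  survives.\<close>

lemma pderiv_root_poly_nonzero:
  assumes "finite S" "Some t \<in> S"
  shows "poly (pderiv (root_poly S)) t \<noteq> 0"
proof -
  note fin = finite_affine_part[OF assms(1)]
  have t: "t \<in> affine_part S" using assms(2) by (simp add: affine_part_def)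
  have "(\<Sum>a\<in>affine_part S. \<Prod>s\<in>affine_part S - {a}. t - s) = (\<Sum>a\<in>{t}. \<Prod>s\<in>affine_part S - {a}. t - s)"
    using fin t by (intro sum.mono_neutral_right) auto
  then show ?thesis using fin by (simp add: pderiv_root_poly[OF assms(1)])
qed

lemma degree_root_poly: "Polynomial.degree (root_poly S) = card (affine_part S)"
  unfolding root_poly_def by (subst degree_prod_sum_eq) auto

lemma lead_coeff_root_poly: "Polynomial.coeff (root_poly S) (card (affine_part S)) = 1"
proof -
  have "lead_coeff (root_poly S) = 1" unfolding root_poly_def by (simp add: lead_coeff_prod)
  then show ?thesis by (simp add: degree_root_poly)
qed

text \<open>Let P be the root polynomial and n the number of points. Without infinity in
  \<open>S\<close> the leading terms of z P' and n P cancel, and P' keeps the leading coefficient n.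
  With infinity in \<open>S\<close>, P has degree n - 1, the coefficient of z P' - n P there is (n -
  1) - n = -1, and P' has smaller degree. There is no common zero: P' does not vanish at roots of P,
  and elsewhere a zero of P' leaves the value -n P.\<close>

lemma bary_rat_pair:
  assumes "finite S" "card S \<ge> 2" "of_nat (card S) \<noteq> (0::'a::field)"
  shows "rat_pair (card S - 1)
    ([:0, 1:] * pderiv (root_poly S) - Polynomial.smult (of_nat (card S)) (root_poly S))
    (pderiv (root_poly (S :: 'a option set)))" (is "rat_pair _ ?F ?G")
    and "Polynomial.coeff (pderiv (root_poly S)) (card S - 1) = 0 \<longleftrightarrow> None \<in> S"
proof -
  let ?P = "root_poly S" and ?n = "card S"
  obtain m where m: "?n = Suc (Suc m)" using assms(2) by (metis Suc_le_D numeral_2_eq_2 Suc_le_mono)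
  have ct: "Polynomial.coeff ?F k = (if k = 0 then 0 else of_nat k * Polynomial.coeff ?P k) - of_nat ?n * Polynomial.coeff ?P k" for k
    by (cases k) (simp_all only: coeff_diff coeff_smult, simp_all add: coeff_pderiv)
  have degP: "Polynomial.degree ?P \<le> ?n" using card_affine_part[OF assms(1)] by (simp add: degree_root_poly)
  have G0: "Polynomial.coeff ?P k = 0" if "k > ?n" for k using that degP coeff_eq_0 by (metis le_less_trans)
  have "Polynomial.coeff ?F k = 0" if "k > ?n - 1" for k
    unfolding ct using that G0[of k] m by (cases "k = ?n") auto
  then have dF: "Polynomial.degree ?F \<le> ?n - 1" by (intro degree_le) auto
  have dG: "Polynomial.degree ?G \<le> ?n - 1"
    by (intro degree_le) (use m in \<open>auto simp: coeff_pderiv G0\<close>)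
  have lead: "Polynomial.coeff ?G (?n - 1) = 0 \<longleftrightarrow> None \<in> S" "Polynomial.coeff ?F (?n - 1) \<noteq> 0" if "None \<in> S" for x
  proof -
    have c: "card (affine_part S) = ?n - 1" using card_affine_part[OF assms(1)] that by simp
    then have "Polynomial.coeff ?P ?n = 0" using m by (intro coeff_eq_0) (simp add: degree_root_poly)
    then show "Polynomial.coeff ?G (?n - 1) = 0 \<longleftrightarrow> None \<in> S" using m that by (simp add: coeff_pderiv)
    show "Polynomial.coeff ?F (?n - 1) \<noteq> 0"
      unfolding ct using lead_coeff_root_poly[of S] c m by simp
  qed
  have lead2: "Polynomial.coeff ?G (?n - 1) \<noteq> 0" if "None \<notin> S"
  proof -
    have c: "card (affine_part S) = ?n" using card_affine_part[OF assms(1)] that by simp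
    then show ?thesis using lead_coeff_root_poly[of S] assms(3) m by (simp add: coeff_pderiv)
  qed
  show "Polynomial.coeff ?G (?n - 1) = 0 \<longleftrightarrow> None \<in> S" using lead lead2 by blast
  have "poly ?F t \<noteq> 0 \<or> poly ?G t \<noteq> 0" for t
    using assms root_poly_eq_0_iff[OF assms(1), of t] pderiv_root_poly_nonzero[OF assms(1), of t] by auto
  then show "rat_pair (?n - 1) ?F ?G"
    using dF dG lead lead2 unfolding rat_pair_def by blast
qed

text \<open>The affine coordinate \<open>1 / (s - t)\<close> on the line with \<open>t\<close> moved
  to infinity; the old point at infinity gets coordinate 0. It is applied only to points other than
  \<open>t\<close>.\<close>

definition recip_diff :: "'a::field \<Rightarrow> 'a option \<Rightarrow> 'a" where
  "recip_diff t x = (case x of None \<Rightarrow> 0 | Some s \<Rightarrow> 1 / (s - t))"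

text \<open>As functions of \<open>x\<close> both sides are affine coordinates with the same pole,
  so they differ by an affine change of coordinate, which is made explicit here. Barycentres are
  compatible with such changes.\<close>

lemma recip_diff_moebius:
  assumes "a * e - b * c \<noteq> (0::'a::field)" "c * t + e \<noteq> 0" "x \<noteq> Some t"
  shows "recip_diff ((a * t + b) / (c * t + e)) (moebius a b c e x) =
    (c * t + e) / (a * e - b * c) * ((c * t + e) * recip_diff t x + c)"
proof -
  let ?w = "c * t + e" and ?D = "a * e - b * c"
  show ?thesis
  proof (cases x)
    case None
    show ?thesis
    proof (cases "c = 0")
      case False
      have "a / c - (a * t + b) / ?w = ?D / (c * ?w)" using False assms by (simp add: field_simps)
      then show ?thesis using None False assms
        by (simp add: recip_diff_def moebius_def proj_point_def)
    qed (use None in \<open>simp add: recip_diff_def moebius_def proj_point_def\<close>)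
  next
    case (Some s)
    then have st: "s \<noteq> t" using assms by auto
    show ?thesis
    proof (cases "c * s + e = 0")
      case True
      have "(?w * (1 / (s - t)) + c) * (s - t) = c * s + e" using st by (simp add: field_simps)
      then have "?w * (1 / (s - t)) + c = 0" using st True by simp
      then show ?thesis using Some True
        by (simp add: recip_diff_def moebius_def proj_point_def)
    next
      case False
      have "(a * s + b) / (c * s + e) - (a * t + b) / ?w = ?D * (s - t) / ((c * s + e) * ?w)"
        using False assms by (simp add: field_simps)
      moreover have "?w * (1 / (s - t)) + c = (c * s + e) / (s - t)" using st by (simp add: field_simps)
      ultimately show ?thesis using Some False assms
        by (simp add: recip_diff_def moebius_def proj_point_def)
    qed
  qed
qed

context
  fixes S :: "'a::{alg_closed_field,field_gcd} option set"
  assumes S: "finite S" "card S \<ge> 2" "of_nat (card S) \<noteq> (0::'a)"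
begin

lemma rat_map_bary: "rat_map (bary_map S) = pair_map (card S - 1)
    ([:0, 1:] * pderiv (root_poly S) - Polynomial.smult (of_nat (card S)) (root_poly S))
    (pderiv (root_poly S))"
  and rat_degree_bary: "rat_degree (bary_map S) = card S - 1"
proof -
  have "pderiv (root_poly S) \<noteq> 0" using rat_pair_G_nonzero[OF bary_rat_pair(1)[OF S]] S by simp
  then show "rat_map (bary_map S) = pair_map (card S - 1)
    ([:0, 1:] * pderiv (root_poly S) - Polynomial.smult (of_nat (card S)) (root_poly S))
    (pderiv (root_poly S))" "rat_degree (bary_map S) = card S - 1"
    unfolding bary_map_def using rat_map_Fract rat_degree_Fract bary_rat_pair(1)[OF S] by blast+
qed

lemma bary_fixed_iff: "rat_map (bary_map S) x = x \<longleftrightarrow> x \<in> S"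
proof (cases x)
  case None
  then show ?thesis using bary_rat_pair(2)[OF S]
    by (auto simp: rat_map_bary pair_map_def proj_point_def)
next
  case (Some t)
  then show ?thesis using S root_poly_eq_0_iff[OF S(1), of t] pderiv_root_poly_nonzero[OF S(1), of t]
    by (auto simp: rat_map_bary pair_map_def proj_point_def field_simps)
qed

text \<open>Up to sign the sum is the logarithmic derivative of \<open>root_poly S\<close>. In the
  coordinate \<open>1 / (s - t)\<close> the barycentre is the sum divided by \<open>card S\<close>;
  solving for \<open>s\<close> gives \<open>t\<close> plus \<open>card S\<close> divided by the
  sum.\<close>

lemma bary_map_value:
  assumes "Some t \<notin> S"
  shows "rat_map (bary_map S) (Some t) =
    proj_point (t * (\<Sum>x\<in>S. recip_diff t x) + of_nat (card S)) (\<Sum>x\<in>S. recip_diff t x)"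
proof -
  let ?P = "poly (root_poly S) t" and ?\<sigma> = "\<Sum>x\<in>S. recip_diff t x"
  note fin = finite_affine_part[OF S(1)]
  have P: "?P \<noteq> 0" using assms S(1) by (simp add: root_poly_eq_0_iff)
  have "?\<sigma> = (\<Sum>x\<in>Some ` affine_part S. recip_diff t x)"
  proof (rule sum.mono_neutral_right)
    show "\<forall>i\<in>S - Some ` affine_part S. recip_diff t i = 0"
    proof
      fix i assume "i \<in> S - Some ` affine_part S"
      then show "recip_diff t i = 0" by (cases i) (auto simp: recip_diff_def affine_part_def)
    qed
  qed (auto simp: affine_part_def S(1))
  also have "\<dots> = (\<Sum>s\<in>affine_part S. 1 / (s - t))"
    by (subst sum.reindex) (auto simp: recip_diff_def)
  finally have \<sigma>: "?\<sigma> = (\<Sum>s\<in>affine_part S. 1 / (s - t))" .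
  have "poly (pderiv (root_poly S)) t = (\<Sum>a\<in>affine_part S. (- ?P) * (1 / (a - t)))"
    unfolding pderiv_root_poly[OF S(1)]
  proof (rule sum.cong)
    fix a assume a: "a \<in> affine_part S"
    have "t \<noteq> a" using a assms by (auto simp: affine_part_def)
    moreover have "?P = (t - a) * (\<Prod>s\<in>affine_part S - {a}. t - s)"
      unfolding poly_root_poly[OF S(1)] using fin a by (rule prod.remove)
    ultimately show "(\<Prod>s\<in>affine_part S - {a}. t - s) = (- ?P) * (1 / (a - t))"
      by (simp add: field_simps)
  qed simp
  also have "\<dots> = (- ?P) * ?\<sigma>" unfolding \<sigma> by (simp only: sum_distrib_left)
  finally have G: "poly (pderiv (root_poly S)) t = (- ?P) * ?\<sigma>" .
  have F: "poly ([:0, 1:] * pderiv (root_poly S) - Polynomial.smult (of_nat (card S)) (root_poly S)) t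
      = (- ?P) * (t * ?\<sigma> + of_nat (card S))"
    using G by (simp add: algebra_simps)
  have "rat_map (bary_map S) (Some t) =
      proj_point ((- ?P) * (t * ?\<sigma> + of_nat (card S))) ((- ?P) * ?\<sigma>)"
    unfolding rat_map_bary pair_map_def option.simps F G ..
  also have "\<dots> = proj_point (t * ?\<sigma> + of_nat (card S)) ?\<sigma>"
    using P unfolding proj_point_def by auto
  finally show ?thesis .
qed

lemma bary_equivariant:
  assumes "\<alpha> \<in> PGL" "\<alpha> ` S = S"
  shows "\<alpha> \<in> Aut (bary_map S)"
proof -
  obtain a b c e where \<alpha>: "\<alpha> = moebius a b c e" and det: "a * e - b * c \<noteq> 0"
    using assms(1) by (rule PGL_E)
  \<comment> \<open>At points of \<open>S\<close> the value formula does not apply, and at the pole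
    of \<open>\<alpha>\<close> the image is not affine; only finitely many points are lost.\<close>
  let ?A = "affine_part S \<union> {t. c * t + e = 0}"
  have inj: "inj_on \<alpha> S" using PGL_bij[OF assms(1)] bij_is_inj inj_on_subset by blast
  have "{t. c * t + e = 0} \<subseteq> {- e / c}" using det by (cases "c = 0") (auto simp: field_simps add_eq_0_iff)
  then have "finite ?A" using finite_affine_part[OF S(1)] finite_subset by blast
  then have "infinite (- ?A)" by (rule infinite_Diff_finite_UNIV)
  then show ?thesis
  proof (rule Aut_infinite[OF assms(1)])
    fix t assume "t \<in> - ?A"
    then have t: "Some t \<notin> S" and w: "c * t + e \<noteq> 0" by (auto simp: affine_part_def)
    let ?D = "a * e - b * c" and ?w = "c * t + e" and ?\<sigma> = "\<Sum>x\<in>S. recip_diff t x" and ?n = "of_nat (card S) :: 'a"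
    let ?t = "(a * t + b) / ?w"
    have \<alpha>t: "\<alpha> (Some t) = Some ?t" using w by (simp add: \<alpha> moebius_def proj_point_def)
    have "Some ?t \<notin> S"
    proof
      assume "Some ?t \<in> S"
      then obtain x where "x \<in> S" "\<alpha> x = \<alpha> (Some t)" using assms(2) \<alpha>t by (metis imageE)
      then show False using t PGL_bij[OF assms(1)] by (metis bij_pointE)
    qed
    have "(\<Sum>x\<in>S. recip_diff ?t x) = (\<Sum>x\<in>\<alpha> ` S. recip_diff ?t x)" by (simp add: assms(2))
    also have "\<dots> = (\<Sum>x\<in>S. ?w / ?D * (?w * recip_diff t x + c))"
      unfolding sum.reindex[OF inj]
    proof (rule sum.cong)
      fix x assume "x \<in> S"
      then have "x \<noteq> Some t" using t by blast
      then show "(recip_diff ?t \<circ> \<alpha>) x = ?w / ?D * (?w * recip_diff t x + c)"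
        unfolding comp_apply \<alpha> by (rule recip_diff_moebius[OF det w])
    qed simp
    also have "\<dots> = ?w / ?D * (?w * ?\<sigma> + ?n * c)"
      by (simp only: sum_distrib_left[symmetric] sum.distrib sum_constant)
    finally have \<sigma>': "(\<Sum>x\<in>S. recip_diff ?t x) = ?w / ?D * (?w * ?\<sigma> + ?n * c)" .
    define Y where "Y = (t * ?\<sigma> + ?n)"
    \<comment> \<open>If the sum vanishes, \<open>Y\<close> is the number of points, which is
      nonzero in the field.\<close>
    have Y: "Y \<noteq> 0 \<or> ?\<sigma> \<noteq> 0" using S(3) by (auto simp: Y_def)
    have "rat_map (bary_map S) (Some ?t) = proj_point (?t * (?w / ?D * (?w * ?\<sigma> + ?n * c)) + ?n) (?w / ?D * (?w * ?\<sigma> + ?n * c))"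
      using bary_map_value[OF \<open>Some ?t \<notin> S\<close>] \<sigma>' by simp
    also have "?t * (?w / ?D * (?w * ?\<sigma> + ?n * c)) + ?n = ?w / ?D * (a * Y + b * ?\<sigma>)"
    proof -
      have "?t * (?w / ?D * (?w * ?\<sigma> + ?n * c)) = (a * t + b) / ?D * (?w * ?\<sigma> + ?n * c)" using w by simp
      moreover have "(a * t + b) * (?w * ?\<sigma> + ?n * c) + ?n * ?D = ?w * (a * Y + b * ?\<sigma>)"
        by (simp add: Y_def algebra_simps)
      ultimately show ?thesis using det by (simp add: divide_simps)
    qed
    also have "?w * ?\<sigma> + ?n * c = c * Y + e * ?\<sigma>" by (simp add: Y_def algebra_simps)
    also have "proj_point (?w / ?D * (a * Y + b * ?\<sigma>)) (?w / ?D * (c * Y + e * ?\<sigma>)) =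
        proj_point (a * Y + b * ?\<sigma>) (c * Y + e * ?\<sigma>)"
      using w det unfolding proj_point_def by auto
    also have "\<dots> = \<alpha> (rat_map (bary_map S) (Some t))"
      unfolding bary_map_value[OF t] \<alpha> Y_def[symmetric] using moebius_proj_point[OF det Y] by simp
    finally show "rat_map (bary_map S) (\<alpha> (Some t)) = \<alpha> (rat_map (bary_map S) (Some t))"
      by (simp add: \<alpha>t)
  qed
qed

text \<open>An automorphism permutes the fixed points, and these are exactly the points of
  \<open>S\<close>. The converse is equivariance.\<close>

lemma Aut_bary: "Aut (bary_map S) = {\<alpha> \<in> PGL. \<alpha> ` S = S}"
proof (intro equalityI subsetI)
  fix \<alpha> assume \<alpha>: "\<alpha> \<in> Aut (bary_map S)"
  have sub: "\<beta> ` S \<subseteq> S" if "\<beta> \<in> Aut (bary_map S)" for \<beta>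
  proof
    fix y assume "y \<in> \<beta> ` S"
    then obtain x where x: "x \<in> S" "y = \<beta> x" by blast
    then show "y \<in> S" using Aut_commute[OF that, of x] bary_fixed_iff[of x] bary_fixed_iff[of y] by simp
  qed
  have "inj_on \<alpha> S" using PGL_bij[OF Aut_PGL[OF \<alpha>]] bij_is_inj inj_on_subset by blast
  then have "\<alpha> ` S = S" using sub[OF \<alpha>] S(1) by (simp add: card_image card_subset_eq)
  then show "\<alpha> \<in> {\<alpha> \<in> PGL. \<alpha> ` S = S}" using Aut_PGL[OF \<alpha>] by simp
qed (use bary_equivariant in auto)

end

section \<open>Finite groups of order prime to the characteristic\<close>

lemma power_card_eq_1:
  fixes A :: "'a::field set"
  assumes "finite A" "0 \<notin> A" "\<And>x y. x \<in> A \<Longrightarrow> y \<in> A \<Longrightarrow> x * y \<in> A" "a \<in> A"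
  shows "a ^ card A = 1"
proof -
  have "a \<noteq> 0" using assms by auto
  then have inj: "inj_on (times a) A" by (simp add: inj_on_def)
  moreover have "times a ` A \<subseteq> A" using assms by auto
  ultimately have im: "times a ` A = A" using assms(1) by (simp add: card_image card_subset_eq)
  have "\<Prod>A = \<Prod>(times a ` A)" by (simp add: im)
  also have "\<dots> = (\<Prod>x\<in>A. a * x)" by (subst prod.reindex[OF inj]) simp
  also have "\<dots> = a ^ card A * \<Prod>A" by (simp add: prod.distrib)
  finally show ?thesis using assms(1,2) by simp
qed

lemma card_roots_of_unity_le:
  assumes "n > 0"
  shows "finite {x :: 'a::field. x ^ n = 1}" "card {x :: 'a::field. x ^ n = 1} \<le> n"
proof -
  let ?p = "monom 1 n - 1 :: 'a poly"
  have "Polynomial.coeff ?p 0 = - 1" using assms by simp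
  then have nz: "?p \<noteq> 0" by (metis coeff_0 neg_equal_0_iff_equal one_neq_zero)
  have "Polynomial.degree ?p \<le> n" by (intro degree_diff_le) (auto simp: degree_monom_eq)
  moreover have "{x. poly ?p x = 0} = {x. x ^ n = 1}" by (auto simp: poly_monom)
  ultimately show "finite {x :: 'a. x ^ n = 1}" "card {x :: 'a. x ^ n = 1} \<le> n"
    using poly_roots_finite[OF nz] card_poly_roots_bound[OF nz] by auto
qed

text \<open>Multiplication by an element permutes \<open>A\<close>, so each element is a root of
  unity of order dividing \<open>card A\<close>; there are at most \<open>card A\<close> of
  these.\<close>

lemma roots_of_unity_eqI:
  fixes A :: "'a::field set"
  assumes "finite A" "A \<noteq> {}" "0 \<notin> A" "\<And>x y. x \<in> A \<Longrightarrow> y \<in> A \<Longrightarrow> x * y \<in> A"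
  shows "A = {x. x ^ card A = 1}"
proof -
  have "card A > 0" using assms by (simp add: card_gt_0_iff)
  moreover have "A \<subseteq> {x. x ^ card A = 1}" using power_card_eq_1 assms by auto
  ultimately show ?thesis using card_roots_of_unity_le by (metis card_seteq)
qed

text \<open>Closure is stated with composition and \<open>inv_into\<close>, so that it applies to
  points directly; \<open>subgroup_PGL\<close> translates it to the monoid.\<close>

locale finite_PGL_group =
  fixes \<Gamma> :: "('a::{alg_closed_field,field_gcd} option \<Rightarrow> 'a option) set"
  assumes finite_group: "finite \<Gamma>"
    and in_PGL: "\<gamma> \<in> \<Gamma> \<Longrightarrow> \<gamma> \<in> PGL"
    and id_closed: "id \<in> \<Gamma>"
    and comp_closed: "\<gamma> \<in> \<Gamma> \<Longrightarrow> \<delta> \<in> \<Gamma> \<Longrightarrow> \<gamma> \<circ> \<delta> \<in> \<Gamma>"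
    and inv_closed: "\<gamma> \<in> \<Gamma> \<Longrightarrow> inv_into UNIV \<gamma> \<in> \<Gamma>"
begin

definition stab :: "'a option \<Rightarrow> ('a option \<Rightarrow> 'a option) set" where
  "stab P = {\<gamma> \<in> \<Gamma>. \<gamma> P = P}"

definition orb :: "'a option \<Rightarrow> 'a option set" where
  "orb P = (\<lambda>\<gamma>. \<gamma> P) ` \<Gamma>"

lemma bij_elem: "\<gamma> \<in> \<Gamma> \<Longrightarrow> bij \<gamma>"
  using in_PGL PGL_bij by blast

lemma elem_inv [simp]:
  "\<gamma> \<in> \<Gamma> \<Longrightarrow> inv_into UNIV \<gamma> (\<gamma> x) = x" "\<gamma> \<in> \<Gamma> \<Longrightarrow> \<gamma> (inv_into UNIV \<gamma> x) = x"
  using bij_elem by (simp_all add: bij_is_inj bij_is_surj surj_f_inv_f)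

lemma elem_inv_comp:
  "\<gamma> \<in> \<Gamma> \<Longrightarrow> inv_into UNIV \<gamma> \<circ> \<gamma> = id" "\<gamma> \<in> \<Gamma> \<Longrightarrow> \<gamma> \<circ> inv_into UNIV \<gamma> = id"
  by (auto simp: fun_eq_iff)

lemma inj_comp_left: "\<gamma> \<in> \<Gamma> \<Longrightarrow> inj_on ((\<circ>) \<gamma>) A"
  by (rule inj_onI) (metis comp_assoc elem_inv_comp(1) id_comp)

lemma card_pos: "card \<Gamma> > 0"
  using finite_group id_closed by (auto simp: card_gt_0_iff)

lemma finite_stab: "finite (stab P)"
  using finite_group by (simp add: stab_def)

lemma id_stab: "id \<in> stab P"
  by (simp add: stab_def id_closed)

lemma card_stab_pos: "card (stab P) > 0"
  using finite_stab id_stab by (auto simp: card_gt_0_iff)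

lemma finite_orb: "finite (orb P)"
  using finite_group by (simp add: orb_def)

lemma orb_self: "P \<in> orb P"
  unfolding orb_def using id_closed by (metis id_apply image_eqI)

lemma orb_closed: "Q \<in> orb P \<Longrightarrow> \<gamma> \<in> \<Gamma> \<Longrightarrow> \<gamma> Q \<in> orb P"
  using comp_closed by (auto simp: orb_def image_iff) (metis comp_apply)

lemma orb_sym: "Q \<in> orb P \<Longrightarrow> P \<in> orb Q"
  using inv_closed by (auto simp: orb_def image_iff) (metis elem_inv(1))

lemma orb_eq: "Q \<in> orb P \<Longrightarrow> orb Q = orb P"
proof -
  have "orb Q \<subseteq> orb P" if "Q \<in> orb P" for P Q using that orb_closed by (auto simp: orb_def[of Q])
  then show "Q \<in> orb P \<Longrightarrow> orb Q = orb P" using orb_sym by blast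
qed

lemma orb_invariant: "\<gamma> \<in> \<Gamma> \<Longrightarrow> \<gamma> ` orb P = orb P"
proof -
  assume \<gamma>: "\<gamma> \<in> \<Gamma>"
  have "\<gamma> ` orb P \<subseteq> orb P" using \<gamma> orb_closed by blast
  moreover have "inj_on \<gamma> (orb P)" using bij_elem[OF \<gamma>] bij_is_inj inj_on_subset by blast
  ultimately show ?thesis using finite_orb by (simp add: card_image card_subset_eq)
qed

lemma card_transporter:
  assumes "Q \<in> orb P"
  shows "card {\<gamma> \<in> \<Gamma>. \<gamma> P = Q} = card (stab P)"
proof -
  obtain \<gamma> where \<gamma>: "\<gamma> \<in> \<Gamma>" "Q = \<gamma> P" using assms by (auto simp: orb_def)
  have "{\<delta> \<in> \<Gamma>. \<delta> P = Q} = (\<circ>) \<gamma> ` stab P"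
  proof (intro equalityI subsetI)
    fix \<delta> assume \<delta>: "\<delta> \<in> {\<delta> \<in> \<Gamma>. \<delta> P = Q}"
    then have "inv_into UNIV \<gamma> \<circ> \<delta> \<in> stab P" using \<gamma> by (auto simp: stab_def comp_closed inv_closed)
    moreover have "\<delta> = \<gamma> \<circ> (inv_into UNIV \<gamma> \<circ> \<delta>)" using \<gamma> by (auto simp: fun_eq_iff)
    ultimately show "\<delta> \<in> (\<circ>) \<gamma> ` stab P" by blast
  qed (use \<gamma> comp_closed in \<open>auto simp: stab_def\<close>)
  then show ?thesis using card_image[OF inj_comp_left[OF \<gamma>(1)]] by simp
qed

lemma orbit_stabilizer: "card (orb P) * card (stab P) = card \<Gamma>"
proof -
  have "card \<Gamma> = (\<Sum>Q\<in>orb P. card {\<gamma> \<in> \<Gamma>. \<gamma> P = Q})"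
    using sum.image_gen[OF finite_group, of "\<lambda>_. 1::nat" "\<lambda>\<gamma>. \<gamma> P"] by (simp add: orb_def)
  also have "\<dots> = card (orb P) * card (stab P)" using card_transporter by simp
  finally show ?thesis by simp
qed

lemma card_stab_orb: "Q \<in> orb P \<Longrightarrow> card (stab Q) = card (stab P)"
  using orbit_stabilizer[of P] orbit_stabilizer[of Q] orb_eq[of Q P] card_pos by (metis mult_cancel1 mult_is_0 not_less_zero)

end

text \<open>This is p-regularity in the form in which it is used: one may divide by the group order
  in the field.\<close>

locale regular_group = finite_PGL_group +
  assumes regular: "of_nat (card \<Gamma>) \<noteq> (0::'a)"
begin

lemma regular_stab: "regular_group (stab P)"
proof
  show "of_nat (card (stab P)) \<noteq> (0::'a)"
    using regular orbit_stabilizer[of P] by (metis mult_zero_right of_nat_mult)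
  show "inv_into UNIV \<gamma> \<in> stab P" if "\<gamma> \<in> stab P" for \<gamma>
    using that inv_closed by (auto simp: stab_def) (metis elem_inv(1))
qed (auto simp: stab_def finite_group in_PGL id_closed comp_closed)

text \<open>Fixing infinity and 0 leaves scalings. Their factors form a finite set closed under
  products, hence all roots of unity of that order.\<close>

lemma two_fixed_points_scale:
  assumes \<sigma>: "\<sigma> \<in> PGL"
    and fx: "\<And>\<gamma>. \<gamma> \<in> \<Gamma> \<Longrightarrow> \<gamma> (\<sigma> None) = \<sigma> None" "\<And>\<gamma>. \<gamma> \<in> \<Gamma> \<Longrightarrow> \<gamma> (\<sigma> (Some 0)) = \<sigma> (Some 0)"
  shows "conj_map \<sigma> ` \<Gamma> = scale ` {a. a ^ card \<Gamma> = 1}" "card {a::'a. a ^ card \<Gamma> = 1} = card \<Gamma>"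
proof -
  have b3: "bij \<sigma>" using \<sigma> PGL_bij by blast
  have sc: "\<exists>a. a \<noteq> 0 \<and> conj_map \<sigma> \<gamma> = scale a" if "\<gamma> \<in> \<Gamma>" for \<gamma>
    using PGL_fix_None_0[OF conj_map_PGL[OF \<sigma> in_PGL[OF that]]] fx[OF that] conj_map_eq_iff[OF b3] by metis
  define A where "A = {a. a \<noteq> 0 \<and> scale a \<in> conj_map \<sigma> ` \<Gamma>}"
  have A: "scale ` A = conj_map \<sigma> ` \<Gamma>" using sc by (auto simp: A_def image_iff) metis
  have injs: "inj_on scale A" by (simp add: inj_on_def)
  have "card (conj_map \<sigma> ` \<Gamma>) = card \<Gamma>" by (rule card_image) (simp add: inj_on_def conj_map_inject[OF b3])
  then have cA: "card A = card \<Gamma>" using card_image[OF injs] A by simp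
  have finA: "finite A" using A finite_group injs by (metis finite_imageI finite_imageD)
  have neA: "A \<noteq> {}" using A id_closed by auto
  have "x * y \<in> A" if xy: "x \<in> A" "y \<in> A" for x y
  proof -
    obtain \<gamma> \<delta> where "\<gamma> \<in> \<Gamma>" "\<delta> \<in> \<Gamma>" "scale x = conj_map \<sigma> \<gamma>" "scale y = conj_map \<sigma> \<delta>"
      using xy by (auto simp: A_def)
    then have "scale (x * y) = conj_map \<sigma> (\<gamma> \<circ> \<delta>)" "\<gamma> \<circ> \<delta> \<in> \<Gamma>"
      by (simp_all add: conj_map_comp[OF b3] comp_closed flip: scale_comp)
    then show ?thesis using xy unfolding A_def by auto
  qed
  then have "A = {x. x ^ card A = 1}"
    by (intro roots_of_unity_eqI finA neA) (auto simp: A_def)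
  then show "conj_map \<sigma> ` \<Gamma> = scale ` {a. a ^ card \<Gamma> = 1}" "card {a::'a. a ^ card \<Gamma> = 1} = card \<Gamma>"
    using A cA by metis+
qed

text \<open>With \<open>P\<close> at infinity every element is affine, so the mean of the images of
  0 is a second point fixed by the whole group. Forming this mean is where the order has to be
  invertible.\<close>

lemma fixed_point_scale:
  assumes "\<And>\<gamma>. \<gamma> \<in> \<Gamma> \<Longrightarrow> \<gamma> P = P"
  obtains \<sigma> where "\<sigma> \<in> PGL" "\<sigma> None = P" "conj_map \<sigma> ` \<Gamma> = scale ` {a. a ^ card \<Gamma> = 1}"
    "card {a::'a. a ^ card \<Gamma> = 1} = card \<Gamma>"
proof -
  obtain Q where "Q \<noteq> P" using option.distinct(1) by (cases P) auto
  then obtain \<tau> where \<tau>: "\<tau> \<in> PGL" "\<tau> None = P" using PGL_2_transitive by metis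
  then have b: "bij \<tau>" using PGL_bij by blast
  define u where "u \<gamma> = the (conj_map \<tau> \<gamma> (Some 0))" for \<gamma>
  have aff: "\<exists>a b. a \<noteq> 0 \<and> (\<forall>t. conj_map \<tau> \<gamma> (Some t) = Some (a * t + b))" if "\<gamma> \<in> \<Gamma>" for \<gamma>
  proof -
    have "conj_map \<tau> \<gamma> None = None" using assms[OF that] by (simp add: conj_map_eq_iff[OF b] \<tau>)
    then show ?thesis using PGL_fix_None[OF conj_map_PGL[OF \<tau>(1) in_PGL[OF that]]] by metis
  qed
  have u: "conj_map \<tau> \<gamma> (Some 0) = Some (u \<gamma>)" if "\<gamma> \<in> \<Gamma>" for \<gamma>
    using aff[OF that] by (auto simp: u_def)
  define N where "N = (of_nat (card \<Gamma>) :: 'a)"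
  define q where "q = (\<Sum>\<gamma>\<in>\<Gamma>. u \<gamma>) / N"
  have N: "N \<noteq> 0" using regular by (simp add: N_def)
  have fixq: "conj_map \<tau> \<delta> (Some q) = Some q" if \<delta>: "\<delta> \<in> \<Gamma>" for \<delta>
  proof -
    obtain a b where ab: "\<And>t. conj_map \<tau> \<delta> (Some t) = Some (a * t + b)" using aff[OF \<delta>] by blast
    have "(\<circ>) \<delta> ` \<Gamma> \<subseteq> \<Gamma>" using \<delta> comp_closed by auto
    then have im: "(\<circ>) \<delta> ` \<Gamma> = \<Gamma>" using card_image[OF inj_comp_left[OF \<delta>]] finite_group
      by (intro card_subset_eq) auto
    have "u (\<delta> \<circ> \<gamma>) = a * u \<gamma> + b" if "\<gamma> \<in> \<Gamma>" for \<gamma>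
    proof -
      have "Some (u (\<delta> \<circ> \<gamma>)) = conj_map \<tau> \<delta> (conj_map \<tau> \<gamma> (Some 0))"
        using u[OF comp_closed[OF \<delta> that]] by (simp add: conj_map_comp[OF b])
      then show ?thesis using u[OF that] ab by simp
    qed
    then have "(\<Sum>\<gamma>\<in>\<Gamma>. u (\<delta> \<circ> \<gamma>)) = a * (\<Sum>\<gamma>\<in>\<Gamma>. u \<gamma>) + N * b"
      by (simp add: sum.distrib sum_distrib_left N_def)
    moreover have "(\<Sum>\<gamma>\<in>\<Gamma>. u (\<delta> \<circ> \<gamma>)) = (\<Sum>\<gamma>\<in>\<Gamma>. u \<gamma>)"
      using sum.reindex[OF inj_comp_left[OF \<delta>, of \<Gamma>], of u] im by simp
    ultimately have "(\<Sum>\<gamma>\<in>\<Gamma>. u \<gamma>) = a * (\<Sum>\<gamma>\<in>\<Gamma>. u \<gamma>) + N * b" by simp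
    from arg_cong[OF this, of "\<lambda>x. x / N"] have "q = (a * (\<Sum>\<gamma>\<in>\<Gamma>. u \<gamma>) + N * b) / N"
      by (simp only: q_def)
    also have "\<dots> = a * q + b" using N by (simp add: q_def add_divide_distrib)
    finally have "q = a * q + b" .
    then show ?thesis using ab by simp
  qed
  obtain \<rho> where \<rho>: "\<rho> \<in> PGL" "\<rho> None = None" "\<rho> (Some 0) = Some q"
    using PGL_2_transitive[of None "Some q"] by auto
  then have b2: "bij \<rho>" using PGL_bij by blast
  define \<sigma> where "\<sigma> = \<tau> \<circ> \<rho>"
  have \<sigma>: "\<sigma> \<in> PGL" "\<sigma> None = P" using \<tau> \<rho> by (auto simp: \<sigma>_def PGL_comp)
  have "\<gamma> (\<sigma> None) = \<sigma> None" "\<gamma> (\<sigma> (Some 0)) = \<sigma> (Some 0)" if "\<gamma> \<in> \<Gamma>" for \<gamma>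
    using assms[OF that] \<sigma> fixq[OF that] \<rho> by (simp_all add: \<sigma>_def conj_map_eq_iff[OF b])
  then show ?thesis using two_fixed_points_scale[OF \<sigma>(1)] that \<sigma> by blast
qed

lemma stab_scale:
  obtains \<sigma> where "\<sigma> \<in> PGL" "\<sigma> None = P" "conj_map \<sigma> ` stab P = scale ` {a. a ^ card (stab P) = 1}"
    "card {a::'a. a ^ card (stab P) = 1} = card (stab P)"
proof -
  interpret H: regular_group "stab P" by (rule regular_stab)
  show ?thesis by (rule H.fixed_point_scale[of P]) (use that in \<open>auto simp: stab_def\<close>)
qed

text \<open>The stabilizer consists of scalings in a suitable coordinate, and \<open>P'\<close> is
  the point with coordinate 0. One point serves all elements of the stabilizer at once, which makes
  axes meaningful later.\<close>

lemma antipode: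
  obtains P' where "P' \<noteq> P" "\<And>\<gamma>. \<gamma> \<in> stab P \<Longrightarrow> \<gamma> \<noteq> id \<Longrightarrow> {x. \<gamma> x = x} = {P, P'}"
    "\<And>\<gamma>. \<gamma> \<in> stab P \<Longrightarrow> \<gamma> P' = P'"
proof -
  obtain \<sigma> where \<sigma>: "\<sigma> \<in> PGL" "\<sigma> None = P" "conj_map \<sigma> ` stab P = scale ` {a. a ^ card (stab P) = 1}"
    using stab_scale by metis
  then have b: "bij \<sigma>" using PGL_bij by blast
  define P' where "P' = \<sigma> (Some 0)"
  have 1: "P' \<noteq> P" using \<sigma> b by (metis P'_def bij_pointE option.distinct(1))
  have main: "{x. \<gamma> x = x} = {P, P'}" if \<gamma>: "\<gamma> \<in> stab P" "\<gamma> \<noteq> id" for \<gamma>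
  proof -
    obtain a where a: "conj_map \<sigma> \<gamma> = scale a" using \<sigma>(3) \<gamma>(1) by blast
    have "a \<noteq> 1" using a \<gamma>(2) conj_map_inject[OF b, of \<gamma> id] conj_map_id[OF b] by (auto simp: scale_1)
    then have "scale a y = y \<longleftrightarrow> y = None \<or> y = Some 0" for y
      by (cases y) auto
    then have *: "\<gamma> (\<sigma> y) = \<sigma> y \<longleftrightarrow> y = None \<or> y = Some 0" for y
      using conj_map_eq_iff[OF b, of \<gamma> y y] a by simp
    have "\<gamma> x = x \<longleftrightarrow> x = P \<or> x = P'" for x
    proof -
      obtain y where "x = \<sigma> y" using b by (metis bij_pointE)
      then show ?thesis using * \<sigma>(2) P'_def b by (metis bij_pointE)
    qed
    then show ?thesis by auto
  qed
  moreover have "\<gamma> P' = P'" if "\<gamma> \<in> stab P" for \<gamma>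
    using main[OF that] by (cases "\<gamma> = id") auto
  ultimately show ?thesis using that 1 by blast
qed

lemma card_fixed_points:
  assumes "\<gamma> \<in> \<Gamma>" "\<gamma> \<noteq> id"
  shows "card {x. \<gamma> x = x} = 2"
proof -
  obtain P where P: "\<gamma> P = P" using PGL_fixed_point[OF in_PGL[OF assms(1)]] by blast
  then have "\<gamma> \<in> stab P" using assms by (simp add: stab_def)
  obtain P' where "P' \<noteq> P" "{x. \<gamma> x = x} = {P, P'}"
    using antipode[of P] \<open>\<gamma> \<in> stab P\<close> assms(2) by metis
  then show ?thesis by simp
qed

text \<open>All nontrivial elements of \<open>stab P\<close> have the same two fixed points, and
  \<open>Q\<close> is one of them.\<close>

lemma stab_eq_of_common:
  assumes "\<gamma> \<in> \<Gamma>" "\<gamma> \<noteq> id" "\<gamma> P = P" "\<gamma> Q = Q"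
  shows "stab P = stab Q"
proof -
  have sub: "stab P \<subseteq> stab Q" if PQ: "\<gamma> P = P" "\<gamma> Q = Q" for P Q
  proof
    fix \<delta> assume \<delta>: "\<delta> \<in> stab P"
    have \<gamma>s: "\<gamma> \<in> stab P" using assms(1) PQ by (simp add: stab_def)
    obtain P' where P': "{x. \<gamma> x = x} = {P, P'}" "\<And>\<gamma>. \<gamma> \<in> stab P \<Longrightarrow> \<gamma> P' = P'"
      using antipode[of P] \<gamma>s assms(2) by metis
    have "Q = P \<or> Q = P'" using P'(1) PQ(2) by blast
    then have "\<delta> Q = Q" using \<delta> P'(2)[OF \<delta>] by (auto simp: stab_def)
    then show "\<delta> \<in> stab Q" using \<delta> by (simp add: stab_def)
  qed
  show ?thesis using sub assms by blast
qed

end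

section \<open>Orbit types\<close>

text \<open>After division by N the last assumption reads 1/m1 + 1/m2 + 1/m3 = 1 + 2/N. A sum above
  1 excludes first m1 >= 3, then m1 = 2 with m2 >= 4, and then m1 = 2, m2 = 3 with m3 >= 6.\<close>

lemma orbit_size_arith:
  fixes N :: nat
  assumes "m1 \<le> m2" "m2 \<le> m3" "2 \<le> m1" "k1 * m1 = N" "k2 * m2 = N" "k3 * m3 = N"
    "k1 + k2 + k3 = N + 2"
  shows "m1 = 2 \<and> m2 = 2 \<and> k3 = 2 \<or> m1 = 2 \<and> m2 = 3 \<and> (m3 = 3 \<and> N = 12 \<or> m3 = 4 \<and> N = 24 \<or> m3 = 5 \<and> N = 60)"
proof -
  have le: "c * k \<le> N" if "k * m = N" "c \<le> m" for c k m
    using that by (metis mult.commute mult_le_mono1)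
  have "m1 = 2"
  proof (rule ccontr)
    assume "m1 \<noteq> 2"
    then have "3 * k1 \<le> N" "3 * k2 \<le> N" "3 * k3 \<le> N"
      using le[OF assms(4), of 3] le[OF assms(5), of 3] le[OF assms(6), of 3] assms(1-3) by simp_all
    then show False using assms(7) by linarith
  qed
  then have k1: "2 * k1 = N" using assms by simp
  have "m2 < 4"
  proof (rule ccontr)
    assume "\<not> m2 < 4"
    then have "4 * k2 \<le> N" "4 * k3 \<le> N"
      using le[OF assms(5), of 4] le[OF assms(6), of 4] assms(2) by simp_all
    then show False using assms(7) k1 by linarith
  qed
  then consider "m2 = 2" | "m2 = 3" using assms \<open>m1 = 2\<close> by linarith
  then show ?thesis
  proof cases
    case 1
    then show ?thesis using assms k1 \<open>m1 = 2\<close> by simp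
  next
    case 2
    then have k2: "3 * k2 = N" using assms by simp
    have "m3 < 6"
    proof (rule ccontr)
      assume "\<not> m3 < 6"
      then have "6 * k3 \<le> N" using le[OF assms(6), of 6] by simp
      then show False using assms(7) k1 k2 by linarith
    qed
    then consider "m3 = 3" | "m3 = 4" | "m3 = 5" using assms 2 by linarith
    then show ?thesis using assms(6,7) k1 k2 \<open>m1 = 2\<close> 2 by cases auto
  qed
qed

context regular_group
begin

definition special :: "'a option set" where
  "special = {P. card (stab P) \<ge> 2}"

lemma special_iff: "P \<in> special \<longleftrightarrow> (\<exists>\<gamma>\<in>\<Gamma>. \<gamma> \<noteq> id \<and> \<gamma> P = P)"
proof
  assume P: "P \<in> special"
  then have "stab P \<noteq> {id}" by (auto simp: special_def)
  then show "\<exists>\<gamma>\<in>\<Gamma>. \<gamma> \<noteq> id \<and> \<gamma> P = P" using id_stab[of P] by (auto simp: stab_def)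
next
  assume "\<exists>\<gamma>\<in>\<Gamma>. \<gamma> \<noteq> id \<and> \<gamma> P = P"
  then obtain \<gamma> where \<gamma>: "\<gamma> \<noteq> id" "\<gamma> \<in> stab P" by (auto simp: stab_def)
  then have "card {id, \<gamma>} \<le> card (stab P)" using id_stab finite_stab by (intro card_mono) auto
  then show "P \<in> special" using \<gamma> by (simp add: special_def)
qed

lemma finite_special: "finite special"
proof -
  have "special = (\<Union>\<gamma>\<in>\<Gamma> - {id}. {x. \<gamma> x = x})" by (auto simp: special_iff)
  moreover have "finite {x. \<gamma> x = x}" if "\<gamma> \<in> \<Gamma> - {id}" for \<gamma>
    using card_fixed_points[of \<gamma>] that by (metis DiffE card.infinite insertCI zero_neq_numeral)
  ultimately show ?thesis using finite_group by simp
qed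

text \<open>Pairs of a nonidentity element and one of its fixed points are counted in two ways; each
  such element has exactly two fixed points.\<close>

lemma sum_special: "(\<Sum>P\<in>special. card (stab P) - 1) = 2 * (card \<Gamma> - 1)"
proof -
  have 1: "card (stab P) - 1 = (\<Sum>\<gamma>\<in>{\<gamma> \<in> \<Gamma> - {id}. \<gamma> P = P}. 1)" for P
  proof -
    have "{\<gamma> \<in> \<Gamma> - {id}. \<gamma> P = P} = stab P - {id}" by (auto simp: stab_def)
    then show ?thesis using id_stab by (simp add: card_Diff_singleton)
  qed
  have "(\<Sum>P\<in>special. card (stab P) - 1) = (\<Sum>\<gamma>\<in>\<Gamma> - {id}. \<Sum>P\<in>{P \<in> special. \<gamma> P = P}. 1)"
    unfolding 1 by (rule sum.swap_restrict) (use finite_special finite_group in auto)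
  also have "\<dots> = (\<Sum>\<gamma>\<in>\<Gamma> - {id}. 2)"
  proof (rule sum.cong)
    fix \<gamma> assume \<gamma>: "\<gamma> \<in> \<Gamma> - {id}"
    then have "{P \<in> special. \<gamma> P = P} = {P. \<gamma> P = P}" by (auto simp: special_iff)
    then show "(\<Sum>P\<in>{P \<in> special. \<gamma> P = P}. 1) = (2::nat)" using card_fixed_points \<gamma> by simp
  qed simp
  finally show ?thesis using id_closed by (simp add: card_Diff_singleton mult.commute)
qed

text \<open>An orbit \<open>K\<close> with stabilizers of order m contributes
  \<open>card K * (m - 1)\<close>, which is \<open>card \<Gamma> - card K\<close> by the
  orbit-stabilizer formula.\<close>

lemma sum_orbits: "(\<Sum>K\<in>orb ` special. card \<Gamma> - card K) = 2 * (card \<Gamma> - 1)"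
proof -
  have "(\<Sum>P\<in>special. card (stab P) - 1) = (\<Sum>K\<in>orb ` special. \<Sum>P\<in>{P \<in> special. orb P = K}. card (stab P) - 1)"
    by (rule sum.image_gen[OF finite_special])
  also have "\<dots> = (\<Sum>K\<in>orb ` special. card \<Gamma> - card K)"
  proof (rule sum.cong)
    fix K assume "K \<in> orb ` special"
    then obtain Q where Q: "Q \<in> special" "K = orb Q" by blast
    have st: "card (stab P) = card (stab Q)" if "P \<in> orb Q" for P using card_stab_orb[OF that] .
    have "{P \<in> special. orb P = K} = orb Q"
    proof (intro equalityI subsetI)
      fix P assume "P \<in> {P \<in> special. orb P = K}"
      then show "P \<in> orb Q" using orb_self[of P] Q(2) by simp
    next
      fix P assume "P \<in> orb Q"
      then show "P \<in> {P \<in> special. orb P = K}" using st[of P] orb_eq[of P Q] Q by (simp add: special_def)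
    qed
    then have "(\<Sum>P\<in>{P \<in> special. orb P = K}. card (stab P) - 1) = card (orb Q) * (card (stab Q) - 1)"
      using st by simp
    also have "\<dots> = card \<Gamma> - card K"
      using orbit_stabilizer[of Q] by (simp add: Q(2) diff_mult_distrib2)
    finally show "(\<Sum>P\<in>{P \<in> special. orb P = K}. card (stab P) - 1) = card \<Gamma> - card K" .
  qed simp
  finally show ?thesis using sum_special by simp
qed

text \<open>The signature of the action, as for spherical triangle groups; the classification
  produces \<open>P\<close>, \<open>Q\<close>, \<open>R\<close> as representatives of the orbits
  with nontrivial stabilizer.\<close>

definition orbit_type :: "nat \<Rightarrow> nat \<Rightarrow> nat \<Rightarrow> bool" where
  "orbit_type a b c \<longleftrightarrow> (\<exists>P Q R. card (stab P) = a \<and> card (stab Q) = b \<and> card (stab R) = c \<and>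
     special \<subseteq> orb P \<union> orb Q \<union> orb R)"

theorem classification:
  "(\<exists>P. \<forall>\<gamma>\<in>\<Gamma>. \<gamma> P = P) \<or> (\<exists>P. card (orb P) = 2 \<and> card (stab P) \<ge> 2) \<or>
   card \<Gamma> = 12 \<and> orbit_type 2 3 3 \<or> card \<Gamma> = 24 \<and> orbit_type 2 3 4 \<or> card \<Gamma> = 60 \<and> orbit_type 2 3 5"
proof (cases "card \<Gamma> = 1")
  case True
  then have "\<Gamma> = {id}" using id_closed card_1_singletonE by (metis singletonD)
  then show ?thesis by simp
next
  case False
  define N where "N = card \<Gamma>"
  then have N: "N \<ge> 2" using False card_pos by simp
  define \<O> where "\<O> = orb ` special"
  have finO: "finite \<O>" using finite_special by (simp add: \<O>_def)
  have sm: "(\<Sum>K\<in>\<O>. N - card K) = 2 * (N - 1)" unfolding \<O>_def N_def by (rule sum_orbits)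
  have O: "card K \<ge> 1" "2 * card K \<le> N" if "K \<in> \<O>" for K
  proof -
    obtain P where P: "P \<in> special" "K = orb P" using \<open>K \<in> \<O>\<close> by (auto simp: \<O>_def)
    then show "card K \<ge> 1" using finite_orb orb_self by (metis card_0_eq empty_iff less_one not_le)
    have "card K * card (stab P) = N" using orbit_stabilizer P by (simp add: N_def)
    moreover have "card K * 2 \<le> card K * card (stab P)" using P by (intro mult_le_mono2) (simp add: special_def)
    ultimately show "2 * card K \<le> N" by simp
  qed
  \<comment> \<open>An orbit in the sum has at most N/2 points, so each term is at least N/2, and
    four orbits would already give 2 N.\<close>
  have "(\<Sum>K\<in>\<O>. N) \<le> (\<Sum>K\<in>\<O>. 2 * (N - card K))" using O(2) by (intro sum_mono) fastforce
  also have "\<dots> = 4 * (N - 1)" using sm by (simp flip: sum_distrib_left)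
  also have "\<dots> < 4 * N" using N by simp
  finally have le: "card \<O> < 4" by simp
  \<comment> \<open>Each term is at most N - 1, so one orbit is not enough.\<close>
  have "(\<Sum>K\<in>\<O>. N - card K) \<le> (\<Sum>K\<in>\<O>. N - 1)" using O(1) by (intro sum_mono diff_le_mono2) auto
  then have "2 * (N - 1) \<le> card \<O> * (N - 1)" using sm by simp
  then have "2 \<le> card \<O>" using N by (simp add: mult_le_cancel2)
  with le consider "card \<O> = 2" | "card \<O> = 3" by linarith
  then show ?thesis
  proof cases
    case 1
    then obtain A B where AB: "\<O> = {A, B}" "A \<noteq> B" by (meson card_2_iff)
    \<comment> \<open>Two terms reach the total 2 (N - 1) only if both equal N - 1, so the orbits
      are fixed points.\<close>
    have "(N - card A) + (N - card B) = 2 * (N - 1)" using sm AB by simp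
    then have "card A = 1" using O[of A] O[of B] AB N by auto
    moreover have "A \<in> \<O>" using AB by simp
    then obtain P where P: "A = orb P" unfolding \<O>_def by blast
    ultimately have "orb P = {P}" using orb_self by (metis card_1_singletonE singletonD)
    then have "\<forall>\<gamma>\<in>\<Gamma>. \<gamma> P = P" using orb_closed[of P P] by simp
    then show ?thesis by blast
  next
    case 2
    then obtain A B C where ABC: "\<O> = {A, B, C}" "A \<noteq> B" "A \<noteq> C" "B \<noteq> C" by (metis card_3_iff)
    obtain P Q R where PQR: "A = orb P" "B = orb Q" "C = orb R" "P \<in> special" "Q \<in> special" "R \<in> special"
      using ABC(1) unfolding \<O>_def by (metis (no_types, lifting) imageE insertCI)
    have cov: "special \<subseteq> orb P \<union> orb Q \<union> orb R"
    proof
      fix x assume "x \<in> special"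
      then have "orb x \<in> {A, B, C}" using ABC(1) by (auto simp: \<O>_def)
      then show "x \<in> orb P \<union> orb Q \<union> orb R" using orb_self[of x] PQR by auto
    qed
    have "(N - card A) + (N - card B) + (N - card C) = 2 * (N - 1)" using sm ABC by simp
    then have s: "card (orb P) + card (orb Q) + card (orb R) = N + 2"
      using O[of A] O[of B] O[of C] ABC(1) N PQR by auto
    have main: ?thesis if h: "card (stab P) \<le> card (stab Q)" "card (stab Q) \<le> card (stab R)"
      "P \<in> special" "Q \<in> special" "R \<in> special"
      "card (orb P) + card (orb Q) + card (orb R) = N + 2" "special \<subseteq> orb P \<union> orb Q \<union> orb R" for P Q R
    proof -
      have "2 \<le> card (stab P)" "2 \<le> card (stab R)" using h by (auto simp: special_def)
      from orbit_size_arith[OF h(1,2) this(1) orbit_stabilizer orbit_stabilizer orbit_stabilizer] h(6)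
      have "card (orb R) = 2 \<or> card (stab P) = 2 \<and> card (stab Q) = 3 \<and>
         (card (stab R) = 3 \<and> N = 12 \<or> card (stab R) = 4 \<and> N = 24 \<or> card (stab R) = 5 \<and> N = 60)"
        by (auto simp: N_def)
      then show ?thesis using \<open>2 \<le> card (stab R)\<close> h(7) unfolding orbit_type_def N_def by blast
    qed
    consider "card (stab P) \<le> card (stab Q)" "card (stab Q) \<le> card (stab R)"
      | "card (stab P) \<le> card (stab R)" "card (stab R) \<le> card (stab Q)"
      | "card (stab Q) \<le> card (stab P)" "card (stab P) \<le> card (stab R)"
      | "card (stab Q) \<le> card (stab R)" "card (stab R) \<le> card (stab P)"
      | "card (stab R) \<le> card (stab P)" "card (stab P) \<le> card (stab Q)"
      | "card (stab R) \<le> card (stab Q)" "card (stab Q) \<le> card (stab P)" by linarith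
    then show ?thesis
    proof cases
      case 1
      then show ?thesis by (intro main[of P Q R]) (use PQR s cov in auto)
    next
      case 2
      then show ?thesis by (intro main[of P R Q]) (use PQR s cov in auto)
    next
      case 3
      then show ?thesis by (intro main[of Q P R]) (use PQR s cov in auto)
    next
      case 4
      then show ?thesis by (intro main[of Q R P]) (use PQR s cov in auto)
    next
      case 5
      then show ?thesis by (intro main[of R P Q]) (use PQR s cov in auto)
    next
      case 6
      then show ?thesis by (intro main[of R Q P]) (use PQR s cov in auto)
    qed
  qed
qed

text \<open>The two points of the orbit are moved to infinity and 0. The elements fixing them become
  scalings by roots of unity, the others become maps \<open>flip c\<close>.\<close>

lemma dihedral_form:
  assumes "card (orb P) = 2"
  obtains \<sigma> where "\<sigma> \<in> PGL"
    "conj_map \<sigma> ` \<Gamma> = scale ` {a. a ^ card (stab P) = 1} \<union> flip ` {a. a ^ card (stab P) = 1}"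
proof -
  obtain Q where Q: "orb P = {P, Q}" "P \<noteq> Q"
    using assms orb_self[of P] unfolding card_2_iff by (metis insert_commute insertE singletonD)
  have cases: "\<gamma> P = P \<and> \<gamma> Q = Q \<or> \<gamma> P = Q \<and> \<gamma> Q = P" if "\<gamma> \<in> \<Gamma>" for \<gamma>
  proof -
    have "\<gamma> P \<in> {P, Q}" "\<gamma> Q \<in> {P, Q}" using orb_closed[of _ P \<gamma>] that Q by blast+
    moreover have "\<gamma> P \<noteq> \<gamma> Q" using bij_elem[OF that] Q(2) by (metis bij_pointE)
    ultimately show ?thesis by auto
  qed
  obtain \<sigma> where \<sigma>: "\<sigma> \<in> PGL" "\<sigma> None = P" "\<sigma> (Some 0) = Q" using PGL_2_transitive Q(2) by metis
  then have b: "bij \<sigma>" using PGL_bij by blast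
  interpret H: regular_group "stab P" by (rule regular_stab)
  have "\<gamma> P = P \<and> \<gamma> Q = Q" if "\<gamma> \<in> stab P" for \<gamma>
    using that cases[of \<gamma>] Q(2) unfolding stab_def by auto
  note stPQ = this
  have st: "conj_map \<sigma> ` stab P = scale ` {a. a ^ card (stab P) = 1}"
    by (rule H.two_fixed_points_scale(1)[OF \<sigma>(1)]) (use stPQ in \<open>simp_all add: \<sigma>\<close>)
  have "Q \<in> orb P" using Q(1) by blast
  then obtain \<delta> where \<delta>: "\<delta> \<in> \<Gamma>" "\<delta> P = Q" unfolding orb_def by blast
  have fl: "\<exists>c. c \<noteq> 0 \<and> conj_map \<sigma> \<gamma> = flip c" if "\<gamma> \<in> \<Gamma>" "\<gamma> P = Q" for \<gamma>
  proof (rule PGL_swap_None_0[of "conj_map \<sigma> \<gamma>"])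
    show "conj_map \<sigma> \<gamma> \<in> PGL" using \<sigma>(1) in_PGL[OF that(1)] by (rule conj_map_PGL)
    show "conj_map \<sigma> \<gamma> None = Some 0" "conj_map \<sigma> \<gamma> (Some 0) = None"
      using cases[OF that(1)] that(2) Q(2) by (auto simp: conj_map_eq_iff[OF b] \<sigma>)
  qed blast
  obtain c where c: "c \<noteq> 0" "conj_map \<sigma> \<delta> = flip c" using fl[OF \<delta>] by blast
  \<comment> \<open>Rescaling by a square root of \<open>c\<close> turns \<open>flip c\<close> into
    \<open>flip 1\<close> and leaves scalings unchanged. Every swap is then \<open>flip 1\<close>
    followed by a scaling of the stabilizer.\<close>
  obtain l where l: "l ^ 2 = c" using nth_root_exists[of 2 c] by auto
  then have l0: "l \<noteq> 0" using c by auto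
  define \<tau> where "\<tau> = \<sigma> \<circ> scale l"
  have bl: "bij (scale l)" using l0 PGL_scale PGL_bij by blast
  have cs: "conj_map (scale l) (scale a) = scale a" for a
  proof
    fix x show "conj_map (scale l) (scale a) x = scale a x"
      by (cases x) (simp_all add: conj_map_eq_iff[OF bl] mult.left_commute)
  qed
  have cf: "conj_map (scale l) (flip x) = flip (x / c)" for x
  proof
    fix y show "conj_map (scale l) (flip x) y = flip (x / c) y"
      using l0 c(1) by (cases y) (auto simp: conj_map_eq_iff[OF bl] flip_Some l[symmetric] field_simps power2_eq_square)
  qed
  have \<tau>: "\<tau> \<in> PGL" using \<sigma> l0 by (simp add: \<tau>_def PGL_comp PGL_scale)
  then have bt: "bij \<tau>" using PGL_bij by blast
  have conj\<tau>: "conj_map \<tau> \<gamma> = conj_map (scale l) (conj_map \<sigma> \<gamma>)" for \<gamma>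
    unfolding \<tau>_def by (rule conj_map_comp_conj[OF b bl])
  have st': "conj_map \<tau> ` stab P = scale ` {a. a ^ card (stab P) = 1}"
  proof -
    have "conj_map \<tau> ` stab P = conj_map (scale l) ` scale ` {a. a ^ card (stab P) = 1}"
      unfolding st[symmetric] by (simp add: image_image conj\<tau>)
    then show ?thesis by (simp add: image_image cs)
  qed
  have d1: "conj_map \<tau> \<delta> = flip 1" using c by (simp add: conj\<tau> cf)
  have sub: "stab P \<subseteq> \<Gamma>" by (auto simp: stab_def)
  have "conj_map \<tau> ` \<Gamma> = scale ` {a. a ^ card (stab P) = 1} \<union> flip ` {a. a ^ card (stab P) = 1}"
  proof (intro equalityI subsetI)
    fix \<beta> assume "\<beta> \<in> conj_map \<tau> ` \<Gamma>"
    then obtain \<gamma> where \<gamma>: "\<gamma> \<in> \<Gamma>" "\<beta> = conj_map \<tau> \<gamma>" by blast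
    show "\<beta> \<in> scale ` {a. a ^ card (stab P) = 1} \<union> flip ` {a. a ^ card (stab P) = 1}"
    proof (cases "\<gamma> P = P")
      case True
      then show ?thesis using \<gamma> st' by (auto simp: stab_def)
    next
      case False
      then have \<gamma>P: "\<gamma> P = Q" "\<gamma> Q = P" using cases[OF \<gamma>(1)] by auto
      then obtain e where e: "\<beta> = flip e" using fl[OF \<gamma>(1)] \<gamma>(2) conj\<tau> cf by metis
      have "\<gamma> \<circ> \<delta> \<in> stab P" using \<gamma>P \<gamma> \<delta> by (simp add: stab_def comp_closed)
      then have "conj_map \<tau> (\<gamma> \<circ> \<delta>) \<in> scale ` {a. a ^ card (stab P) = 1}" using st' by blast
      moreover have "conj_map \<tau> (\<gamma> \<circ> \<delta>) = flip e \<circ> flip 1" using e \<gamma>(2) d1 by (simp add: conj_map_comp[OF bt])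
      moreover have "e \<noteq> 0"
        using e \<gamma>(2) PGL_bij[OF conj_map_PGL[OF \<tau> in_PGL[OF \<gamma>(1)]]]
        by (metis bij_pointE div_0 flip_simps(1,3) option.distinct(1) zero_neq_one)
      ultimately have "e ^ card (stab P) = 1" by (auto simp: flip_flip)
      then show ?thesis using e by blast
    qed
  next
    fix \<beta> :: "'a option \<Rightarrow> 'a option"
    assume "\<beta> \<in> scale ` {a. a ^ card (stab P) = 1} \<union> flip ` {a. a ^ card (stab P) = 1}"
    then consider (s) "\<beta> \<in> scale ` {a. a ^ card (stab P) = 1}" | (f) a where "\<beta> = flip a" "a ^ card (stab P) = 1" by blast
    then show "\<beta> \<in> conj_map \<tau> ` \<Gamma>"
    proof cases
      case s
      then show ?thesis using st' sub by blast
    next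
      case f
      then have "scale a \<in> conj_map \<tau> ` stab P" using st' by blast
      then obtain \<gamma> where \<gamma>: "\<gamma> \<in> \<Gamma>" "scale a = conj_map \<tau> \<gamma>" using sub by blast
      have "a \<noteq> 0" using f(2) card_stab_pos[of P] by (auto simp: zero_power)
      then have "\<beta> = scale a \<circ> flip 1" using f(1) by (simp add: scale_flip)
      then have "\<beta> = conj_map \<tau> (\<gamma> \<circ> \<delta>)" using \<gamma>(2) d1 by (simp add: conj_map_comp[OF bt])
      then show ?thesis using comp_closed[OF \<gamma>(1) \<delta>(1)] by blast
    qed
  qed
  then show ?thesis using that \<tau> by blast
qed

end

section \<open>Isomorphism types\<close>

lemma three_cycle_cubed:
  assumes "p \<in> three_cycles n"
  shows "p \<circ> p \<circ> p = id"
proof -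
  obtain a b c where abc: "cycle [a, b, c]" "p = cycle_of_list [a, b, c]"
    using assms by (auto simp: length_Suc_conv numeral_3_eq_3)
  then have "a \<noteq> b" "a \<noteq> c" "b \<noteq> c" by auto
  then show ?thesis unfolding abc(2) by (auto simp: fun_eq_iff transpose_def)
qed

text \<open>
  A subgroup of index 2 contains all squares, hence all 3-cycles, and these generate the
  alternating group.
\<close>

lemma index_2_subgroup_alt_group:
  assumes "subgroup H (sym_group n)" "2 * card H = fact n"
  shows "H = carrier (alt_group n)"
proof -
  interpret G: group "sym_group n" by (rule sym_group_is_group)
  interpret H: subgroup H "sym_group n" by (rule assms(1))
  have fin: "finite (carrier (sym_group n))"
    using sym_group_card_carrier[of n] by (metis card.infinite fact_nonzero)
  have finH: "finite H" using finite_subset[OF H.subset fin] .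
  have comp: "x \<circ> y \<in> H" if "x \<in> H" "y \<in> H" for x y
    using H.m_closed[OF that] by (simp add: sym_group_mult)
  have sq: "x \<circ> x \<in> H" if x: "x \<in> carrier (sym_group n)" for x
  proof (cases "x \<in> H")
    case False
    have bx: "bij x" using x by (simp add: sym_group_carrier permutes_bij)
    have ix: "inj_on ((\<circ>) x) H" using bx by (intro inj_onI) (simp add: fun.inj_map_strong bij_is_inj fun_eq_iff inj_eq)
    have dis: "H \<inter> (\<circ>) x ` H = {}"
    proof (rule ccontr)
      assume "H \<inter> (\<circ>) x ` H \<noteq> {}"
      then obtain h where h: "h \<in> H" "x \<circ> h \<in> H" by blast
      have "x \<otimes>\<^bsub>sym_group n\<^esub> h \<in> H" using h(2) by (simp add: sym_group_mult)
      from H.m_closed[OF this H.m_inv_closed[OF h(1)]]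
      have "(x \<otimes>\<^bsub>sym_group n\<^esub> h) \<otimes>\<^bsub>sym_group n\<^esub> inv\<^bsub>sym_group n\<^esub> h \<in> H" .
      moreover have "(x \<otimes>\<^bsub>sym_group n\<^esub> h) \<otimes>\<^bsub>sym_group n\<^esub> inv\<^bsub>sym_group n\<^esub> h = x"
        using x H.mem_carrier[OF h(1)] by (metis G.m_assoc G.inv_closed G.r_inv G.r_one)
      ultimately have "x \<in> H" by simp
      then show False using False by blast
    qed
    have "card (H \<union> (\<circ>) x ` H) = card H + card ((\<circ>) x ` H)"
      by (rule card_Un_disjoint) (use finH dis in auto)
    also have "\<dots> = card (carrier (sym_group n))"
      using card_image[OF ix] assms(2) by (simp add: sym_group_card_carrier)
    finally have "card (H \<union> (\<circ>) x ` H) = card (carrier (sym_group n))" .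
    moreover have "H \<union> (\<circ>) x ` H \<subseteq> carrier (sym_group n)"
      using H.subset x G.m_closed[OF x] by (auto simp: sym_group_mult)
    \<comment> \<open>\<open>H\<close> and the coset of \<open>x\<close> fill the group. The square
      of \<open>x\<close> cannot lie in the coset, since cancelling \<open>x\<close> would put
      \<open>x\<close> into \<open>H\<close>.\<close>
    ultimately have "H \<union> (\<circ>) x ` H = carrier (sym_group n)" using fin card_subset_eq by blast
    moreover have "x \<circ> x \<in> carrier (sym_group n)" using G.m_closed[OF x x] by (simp add: sym_group_mult)
    ultimately consider "x \<circ> x \<in> H" | h where "h \<in> H" "x \<circ> x = x \<circ> h" by blast
    then show ?thesis
    proof cases
      case 2
      then have "x = h" using bx by (simp add: fun_eq_iff inj_eq bij_is_inj)
      then show ?thesis using 2 False by blast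
    qed
  qed (use comp in blast)
  have tc: "p \<in> H" if p: "p \<in> three_cycles n" for p
  proof -
    have pc: "p \<in> carrier (sym_group n)"
      using p three_cycles_incl[of n] by (auto simp: alt_group_carrier sym_group_carrier)
    \<comment> \<open>The cube is trivial, so \<open>p\<close> is its own fourth power and thus a
      product of squares.\<close>
    have "p = (p \<circ> p) \<circ> (p \<circ> p)" using three_cycle_cubed[OF p] by (metis comp_assoc comp_id)
    then show ?thesis using comp[OF sq[OF pc] sq[OF pc]] by simp
  qed
  have "x \<in> H" if "x \<in> generate (alt_group n) (three_cycles n)" for x
    using that
  proof induction
    case one
    then show ?case using H.one_closed unfolding sym_group_one alt_group_one .
  next
    case (incl h)
    then show ?case by (rule tc)
  next
    case (inv h)
    then have h: "h \<in> carrier (alt_group n)" using three_cycles_incl by blast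
    then have "inv\<^bsub>alt_group n\<^esub> h = inv\<^bsub>sym_group n\<^esub> h"
      by (simp only: alt_group_inv_equality[OF h]) (simp add: alt_group_carrier sym_group_carrier)
    then show ?case using H.m_inv_closed[OF tc[OF inv]] by simp
  next
    case (eng h1 h2)
    then show ?case unfolding alt_group_mult using comp by blast
  qed
  then have sub: "carrier (alt_group n) \<subseteq> H" unfolding alt_group_carrier_as_three_cycles by blast
  show ?thesis
  proof (cases "n \<ge> 2")
    case True
    then show ?thesis using alt_group_card_carrier[OF True] assms(2) sub finH
      by (metis card_subset_eq mult_left_cancel zero_neq_numeral)
  next
    case False
    then have "n = 0 \<or> n = 1" by linarith
    then have "(fact n :: nat) = 1" by auto
    then show ?thesis using assms(2) by (metis dvd_triv_left odd_one)
  qed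
qed

abbreviation subgrp :: "('a::field option \<Rightarrow> 'a option) set \<Rightarrow> ('a option \<Rightarrow> 'a option) monoid" where
  "subgrp \<Gamma> \<equiv> (PGL2 UNIV)\<lparr>carrier := \<Gamma>\<rparr>"

lemma subgrp_simps: "x \<otimes>\<^bsub>subgrp \<Gamma>\<^esub> y = x \<circ> y" "\<one>\<^bsub>subgrp \<Gamma>\<^esub> = id"
  by (simp_all add: PGL2_def)

context finite_PGL_group
begin

lemma subgroup_PGL: "subgroup \<Gamma> (PGL2 UNIV)"
proof
  fix x assume x: "x \<in> \<Gamma>"
  have "inv\<^bsub>PGL2 UNIV\<^esub> x = inv_into UNIV x"
    using x by (intro group.inv_equality[OF group_PGL]) (auto simp: in_PGL inv_closed PGL2_mult PGL2_one elem_inv_comp)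
  then show "inv\<^bsub>PGL2 UNIV\<^esub> x \<in> \<Gamma>" using inv_closed[OF x] by simp
qed (auto simp: in_PGL id_closed comp_closed PGL2_mult PGL2_one)

lemma group_subgrp: "group (subgrp \<Gamma>)"
  using group.subgroup_imp_group[OF group_PGL subgroup_PGL] .

text \<open>Numbering the elements of \<open>Y\<close> turns the action into permutations of
  \<open>{1..n}\<close>, the points moved by \<open>sym_group n\<close>, extended by the identity
  elsewhere. Only the behaviour of \<open>act\<close> on \<open>Y\<close> is constrained, so it may
  be application to points, images of sets or conjugation.\<close>

lemma action_hom:
  fixes act :: "('a option \<Rightarrow> 'a option) \<Rightarrow> 'x \<Rightarrow> 'x"
  assumes "finite Y" "card Y = n"
    and cl: "\<And>\<gamma> x. \<gamma> \<in> \<Gamma> \<Longrightarrow> x \<in> Y \<Longrightarrow> act \<gamma> x \<in> Y"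
    and co: "\<And>\<gamma> \<delta> x. \<gamma> \<in> \<Gamma> \<Longrightarrow> \<delta> \<in> \<Gamma> \<Longrightarrow> x \<in> Y \<Longrightarrow> act (\<gamma> \<circ> \<delta>) x = act \<gamma> (act \<delta> x)"
    and i: "\<And>x. x \<in> Y \<Longrightarrow> act id x = x"
    and faithful: "\<And>\<gamma>. \<gamma> \<in> \<Gamma> \<Longrightarrow> (\<And>x. x \<in> Y \<Longrightarrow> act \<gamma> x = x) \<Longrightarrow> \<gamma> = id"
  obtains \<phi> where "\<phi> \<in> hom (subgrp \<Gamma>) (sym_group n)" "inj_on \<phi> \<Gamma>"
proof -
  define I where "I = {1..n}"
  have I: "finite I" "card I = n" by (simp_all add: I_def)
  obtain b where b: "bij_betw b I Y"
    using finite_same_card_bij[OF I(1) assms(1)] I(2) assms(2) by auto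
  define c where "c = the_inv_into I b"
  have bc: "b i \<in> Y" "c (b i) = i" if "i \<in> I" for i
    using b that by (auto simp: c_def bij_betw_def the_inv_into_f_f)
  have cb: "c x \<in> I" "b (c x) = x" if "x \<in> Y" for x
    using b that the_inv_into_into[of b "I" x "I"] f_the_inv_into_f[of b "I" x]
    by (auto simp: c_def bij_betw_def)
  define \<phi> where "\<phi> \<gamma> j = (if j \<in> I then c (act \<gamma> (b j)) else j)" for \<gamma> j
  have hom: "\<phi> (\<gamma> \<circ> \<delta>) = \<phi> \<gamma> \<circ> \<phi> \<delta>" if "\<gamma> \<in> \<Gamma>" "\<delta> \<in> \<Gamma>" for \<gamma> \<delta>
  proof
    fix j
    show "\<phi> (\<gamma> \<circ> \<delta>) j = (\<phi> \<gamma> \<circ> \<phi> \<delta>) j"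
    proof (cases "j \<in> I")
      case True
      then have "act \<delta> (b j) \<in> Y" using bc cl that by blast
      then show ?thesis using True cb co[OF that bc(1)[OF True]] by (simp add: \<phi>_def)
    qed (simp add: \<phi>_def)
  qed
  have \<phi>id: "\<phi> id = id"
    by (rule ext) (simp add: \<phi>_def bc i)
  have perm: "\<phi> \<gamma> permutes I" if \<gamma>: "\<gamma> \<in> \<Gamma>" for \<gamma>
  proof (rule bij_imp_permutes)
    have "\<phi> (inv_into UNIV \<gamma>) \<circ> \<phi> \<gamma> = id"
      using hom[OF inv_closed[OF \<gamma>] \<gamma>] elem_inv_comp(1)[OF \<gamma>] \<phi>id by simp
    then have "inj (\<phi> \<gamma>)" by (metis inj_on_id inj_on_imageI2)
    moreover have "\<phi> \<gamma> ` I \<subseteq> I" using bc cb cl[OF \<gamma>] by (auto simp: \<phi>_def image_subset_iff)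
    ultimately show "bij_betw (\<phi> \<gamma>) I I"
      unfolding bij_betw_def using endo_inj_surj[OF I(1)] inj_on_subset[of "\<phi> \<gamma>" UNIV I] by blast
  qed (simp add: \<phi>_def)
  have "\<phi> \<in> hom (subgrp \<Gamma>) (sym_group n)"
    unfolding hom_def by (simp add: Pi_iff PGL2_mult sym_group_carrier sym_group_mult hom) (use perm I_def in simp)
  moreover have "inj_on \<phi> \<Gamma>"
  proof (rule inj_onI)
    fix \<gamma> \<delta> assume gd: "\<gamma> \<in> \<Gamma>" "\<delta> \<in> \<Gamma>" "\<phi> \<gamma> = \<phi> \<delta>"
    let ?\<epsilon> = "inv_into UNIV \<delta> \<circ> \<gamma>"
    have \<epsilon>: "?\<epsilon> \<in> \<Gamma>" using gd by (simp add: comp_closed inv_closed)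
    have "\<phi> ?\<epsilon> = id"
      using hom[OF inv_closed[OF gd(2)] gd(1)] hom[OF inv_closed[OF gd(2)] gd(2)] gd(3) elem_inv_comp(1)[OF gd(2)] \<phi>id by simp
    have "act ?\<epsilon> x = x" if x: "x \<in> Y" for x
    proof -
      have "\<phi> ?\<epsilon> (c x) = c x" using \<open>\<phi> ?\<epsilon> = id\<close> by simp
      then have "c (act ?\<epsilon> x) = c x" using cb[OF x] by (simp add: \<phi>_def)
      then show ?thesis using cb(2)[OF x] cb(2)[OF cl[OF \<epsilon> x]] by simp
    qed
    then have "?\<epsilon> = id" using faithful[OF \<epsilon>] by blast
    then have "\<delta> \<circ> ?\<epsilon> = \<delta>" by simp
    then show "\<gamma> = \<delta>" using elem_inv_comp(2)[OF gd(2)] by (simp add: comp_assoc[symmetric])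
  qed
  ultimately show ?thesis using that by blast
qed

text \<open>The image has the order of \<open>\<Gamma>\<close>, so it is the whole symmetric group
  or a subgroup of index 2.\<close>

lemma hom_sym_iso:
  assumes "\<phi> \<in> hom (subgrp \<Gamma>) (sym_group n)" "inj_on \<phi> \<Gamma>"
  shows "card \<Gamma> = fact n \<Longrightarrow> subgrp \<Gamma> \<cong> sym_group n"
    and "2 * card \<Gamma> = fact n \<Longrightarrow> subgrp \<Gamma> \<cong> alt_group n"
proof -
  have gh: "group_hom (subgrp \<Gamma>) (sym_group n) \<phi>"
    using assms(1) group_subgrp sym_group_is_group by (simp add: group_hom_def group_hom_axioms_def)
  have sg: "subgroup (\<phi> ` \<Gamma>) (sym_group n)"
    using group_hom.img_is_subgroup[OF gh] by simp
  have ci: "card (\<phi> ` \<Gamma>) = card \<Gamma>" using card_image[OF assms(2)] .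
  have fin: "finite (carrier (sym_group n))"
    using sym_group_card_carrier[of n] by (metis card.infinite fact_nonzero)
  show "subgrp \<Gamma> \<cong> sym_group n" if "card \<Gamma> = fact n"
  proof -
    have "\<phi> ` \<Gamma> = carrier (sym_group n)"
      using subgroup.subset[OF sg] ci that fin by (simp add: card_subset_eq sym_group_card_carrier)
    then show ?thesis using assms unfolding is_iso_def iso_def bij_betw_def by auto
  qed
  show "subgrp \<Gamma> \<cong> alt_group n" if "2 * card \<Gamma> = fact n"
  proof -
    have im: "\<phi> ` \<Gamma> = carrier (alt_group n)"
      using index_2_subgroup_alt_group[OF sg] ci that by simp
    then have "\<phi> \<in> hom (subgrp \<Gamma>) (alt_group n)"
      using assms(1) by (auto simp: hom_def alt_group_mult sym_group_mult)
    then show ?thesis using im assms(2) unfolding is_iso_def iso_def bij_betw_def by auto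
  qed
qed

end

text \<open>An orbit with stabilizers of order 3 has four points, the vertices of a tetrahedron. A
  nonidentity element fixes only two points of the line, so the action is faithful, and 12 is half
  of 4!.\<close>

lemma (in regular_group) tetrahedral_iso:
  assumes "card \<Gamma> = 12" "orbit_type 2 3 3"
  shows "subgrp \<Gamma> \<cong> alt_group 4"
proof -
  obtain Q where "card (stab Q) = 3" using assms(2) unfolding orbit_type_def by blast
  then have c4: "card (orb Q) = 4" using orbit_stabilizer[of Q] assms(1) by simp
  obtain \<phi> where "\<phi> \<in> hom (subgrp \<Gamma>) (sym_group 4)" "inj_on \<phi> \<Gamma>"
  proof (rule action_hom[OF finite_orb c4, of "\<lambda>\<gamma> x. \<gamma> x"])
    fix \<gamma> assume \<gamma>: "\<gamma> \<in> \<Gamma>" and fx: "\<And>x. x \<in> orb Q \<Longrightarrow> \<gamma> x = x"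
    show "\<gamma> = id"
    proof (rule ccontr)
      assume "\<gamma> \<noteq> id"
      then have 2: "card {x. \<gamma> x = x} = 2" using card_fixed_points[OF \<gamma>] by simp
      then have "card (orb Q) \<le> card {x. \<gamma> x = x}"
        by (intro card_mono) (auto simp: fx intro: card_ge_0_finite)
      then show False using 2 c4 by simp
    qed
  qed (auto simp: orb_closed)
  then show ?thesis by (rule hom_sym_iso(2)) (simp add: assms(1) fact_numeral)
qed

section \<open>Rotation axes and the octahedral group\<close>

context regular_group
begin

text \<open>For a special point this is the pair of poles of a rotation axis. Defined by common
  fixed points, it depends only on \<open>stab P\<close>; for a trivial stabilizer it is the whole
  line.\<close>

definition axis :: "'a option \<Rightarrow> 'a option set" where
  "axis P = {x. \<forall>\<gamma>\<in>stab P. \<gamma> x = x}"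

lemma axis_fixed:
  assumes "\<gamma> \<in> stab P" "\<gamma> \<noteq> id"
  shows "axis P = {x. \<gamma> x = x}"
proof -
  obtain P' where "\<And>\<gamma>. \<gamma> \<in> stab P \<Longrightarrow> \<gamma> \<noteq> id \<Longrightarrow> {x. \<gamma> x = x} = {P, P'}"
    "\<And>\<gamma>. \<gamma> \<in> stab P \<Longrightarrow> \<gamma> P' = P'" using antipode[of P] by metis
  then show ?thesis using assms unfolding axis_def by (auto simp: stab_def)
qed

lemma special_elem:
  assumes "P \<in> special"
  obtains \<gamma> where "\<gamma> \<in> stab P" "\<gamma> \<noteq> id"
  using assms unfolding special_iff stab_def by blast

lemma axis_self: "P \<in> axis P"
  by (simp add: axis_def stab_def)

lemma card_axis: "P \<in> special \<Longrightarrow> card (axis P) = 2"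
  by (metis (no_types, lifting) axis_fixed card_fixed_points special_elem stab_def mem_Collect_eq)

lemma axis_stab:
  assumes "P \<in> special" "x \<in> axis P"
  shows "stab x = stab P" "axis x = axis P" "x \<in> special"
proof -
  obtain \<gamma> where \<gamma>: "\<gamma> \<in> stab P" "\<gamma> \<noteq> id" using special_elem[OF assms(1)] .
  then have "\<gamma> x = x" "\<gamma> P = P" "\<gamma> \<in> \<Gamma>" using assms(2) by (auto simp: axis_def stab_def)
  then show *: "stab x = stab P" using stab_eq_of_common \<gamma>(2) by blast
  then show "axis x = axis P" "x \<in> special" using assms(1) by (simp_all add: axis_def special_def)
qed

lemma axis_image:
  assumes "\<gamma> \<in> \<Gamma>"
  shows "axis (\<gamma> P) = \<gamma> ` axis P"
proof -
  have sub: "\<gamma> ` axis P \<subseteq> axis (\<gamma> P)" if \<gamma>: "\<gamma> \<in> \<Gamma>" for \<gamma> P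
  proof
    fix y assume "y \<in> \<gamma> ` axis P"
    then obtain x where x: "x \<in> axis P" "y = \<gamma> x" by blast
    have "\<delta> y = y" if \<delta>: "\<delta> \<in> stab (\<gamma> P)" for \<delta>
    proof -
      have "inv_into UNIV \<gamma> \<circ> \<delta> \<circ> \<gamma> \<in> stab P"
        using \<delta> \<gamma> by (auto simp: stab_def comp_closed inv_closed)
      then have "(inv_into UNIV \<gamma> \<circ> \<delta> \<circ> \<gamma>) x = x" using x(1) unfolding axis_def by blast
      then have "inv_into UNIV \<gamma> (\<delta> (\<gamma> x)) = x" by simp
      then show ?thesis using \<gamma> x(2) by (metis elem_inv(2))
    qed
    then show "y \<in> axis (\<gamma> P)" by (simp add: axis_def)
  qed
  have "inv_into UNIV \<gamma> ` axis (\<gamma> P) \<subseteq> axis P"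
    using sub[OF inv_closed[OF assms], of "\<gamma> P"] assms by simp
  then have "\<gamma> ` inv_into UNIV \<gamma> ` axis (\<gamma> P) \<subseteq> \<gamma> ` axis P" by blast
  then have "axis (\<gamma> P) \<subseteq> \<gamma> ` axis P" using assms by (simp add: image_image)
  then show ?thesis using sub[OF assms] by blast
qed

text \<open>Both ends of an axis have the same stabilizer, so by the second assumption they lie in
  one orbit, and the axes split this orbit into pairs.\<close>

lemma card_axes:
  assumes "P \<in> special" "\<And>x. card (stab x) = card (stab P) \<Longrightarrow> x \<in> orb P"
  shows "2 * card (axis ` orb P) = card (orb P)"
proof -
  have sp: "Q \<in> special" if "Q \<in> orb P" for Q
    using card_stab_orb[OF that] assms(1) by (simp add: special_def)
  have sub: "axis Q \<subseteq> orb P" if "Q \<in> orb P" for Q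
    using axis_stab(1)[OF sp[OF that]] assms(2) card_stab_orb[OF that] by auto
  have "card (orb P) = (\<Sum>A\<in>axis ` orb P. \<Sum>Q\<in>{Q \<in> orb P. axis Q = A}. 1)"
    using sum.image_gen[OF finite_orb, of "\<lambda>_. 1::nat" P axis] by simp
  also have "\<dots> = (\<Sum>A\<in>axis ` orb P. 2)"
  proof (rule sum.cong)
    fix A assume "A \<in> axis ` orb P"
    then obtain R where R: "R \<in> orb P" "A = axis R" by blast
    have "{Q \<in> orb P. axis Q = A} = axis R"
    proof (intro equalityI subsetI)
      fix Q assume "Q \<in> {Q \<in> orb P. axis Q = A}"
      then show "Q \<in> axis R" using axis_self[of Q] R by simp
    next
      fix Q assume "Q \<in> axis R"
      then show "Q \<in> {Q \<in> orb P. axis Q = A}" using sub[OF R(1)] axis_stab(2)[OF sp[OF R(1)]] R by auto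
    qed
    then show "(\<Sum>Q\<in>{Q \<in> orb P. axis Q = A}. 1) = (2::nat)" using card_axis[OF sp[OF R(1)]] by simp
  qed simp
  finally show ?thesis by simp
qed

lemma elem_pow: "\<gamma> \<in> stab P \<Longrightarrow> \<gamma> ^^ card (stab P) = id"
proof -
  assume \<gamma>: "\<gamma> \<in> stab P"
  obtain \<sigma> where \<sigma>: "\<sigma> \<in> PGL" "conj_map \<sigma> ` stab P = scale ` {a. a ^ card (stab P) = 1}"
    using stab_scale by metis
  have b: "bij \<sigma>" using PGL_bij[OF \<sigma>(1)] .
  obtain a where a: "a ^ card (stab P) = 1" "conj_map \<sigma> \<gamma> = scale a" using \<sigma>(2) \<gamma> by blast
  then have "conj_map \<sigma> (\<gamma> ^^ card (stab P)) = conj_map \<sigma> id"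
    by (simp add: conj_map_funpow[OF b] scale_pow scale_1 conj_map_id[OF b])
  then show ?thesis by (simp add: conj_map_inject[OF b])
qed

lemma orbit_type_stab:
  assumes "orbit_type a b c" "P \<in> special"
  shows "card (stab P) \<in> {a, b, c}"
proof -
  obtain A B C where ABC: "card (stab A) = a" "card (stab B) = b" "card (stab C) = c"
    "special \<subseteq> orb A \<union> orb B \<union> orb C" using assms(1) unfolding orbit_type_def by blast
  then have "P \<in> orb A \<or> P \<in> orb B \<or> P \<in> orb C" using assms(2) by blast
  then show ?thesis using card_stab_orb ABC by blast
qed

lemma orbit_type_same_stab:
  assumes "orbit_type a b c" "P \<in> special" "card (stab P) = card (stab Q)" "a \<noteq> b" "b \<noteq> c" "a \<noteq> c"
  shows "Q \<in> orb P"
proof -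
  obtain A B C where ABC: "card (stab A) = a" "card (stab B) = b" "card (stab C) = c"
    "special \<subseteq> orb A \<union> orb B \<union> orb C" using assms(1) unfolding orbit_type_def by blast
  have "Q \<in> special" using assms(2,3) by (simp add: special_def)
  then have PQ: "P \<in> orb A \<or> P \<in> orb B \<or> P \<in> orb C" "Q \<in> orb A \<or> Q \<in> orb B \<or> Q \<in> orb C"
    using ABC(4) assms(2) by blast+
  have "P \<in> orb D \<Longrightarrow> Q \<in> orb D \<Longrightarrow> Q \<in> orb P" for D using orb_eq by blast
  then show ?thesis using PQ card_stab_orb[of P] card_stab_orb[of Q] ABC assms(3-6) by metis
qed

text \<open>The axes are the body diagonals of a cube. A nonidentity element preserving each of them
  fixes no end: otherwise its cube is trivial, while its square fixes both ends and any third vertex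
  and so is trivial as well. Hence it swaps the ends of every axis, and this determines it.\<close>

lemma axes_fixed_imp_id:
  assumes "card \<Gamma> = 24" "orbit_type 2 3 4" "card (stab P) = 3" "\<gamma> \<in> \<Gamma>"
    and fx: "\<And>Q. Q \<in> orb P \<Longrightarrow> \<gamma> ` axis Q = axis Q"
  shows "\<gamma> = id"
proof (rule ccontr)
  assume "\<gamma> \<noteq> id"
  have c8: "card (orb P) = 8" using orbit_stabilizer[of P] assms(1,3) by simp
  have sp: "Q \<in> special" "card (stab Q) = 3" if "Q \<in> orb P" for Q
    using card_stab_orb[OF that] assms(3) by (simp_all add: special_def)
  obtain partner where pa: "\<And>Q. Q \<in> orb P \<Longrightarrow> axis Q = {Q, partner Q} \<and> partner Q \<noteq> Q"
  proof -
    have "\<exists>R. axis Q = {Q, R} \<and> R \<noteq> Q" if "Q \<in> orb P" for Q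
    proof -
      obtain u v where uv: "axis Q = {u, v}" "u \<noteq> v" using card_axis[OF sp(1)[OF \<open>Q \<in> orb P\<close>]] by (meson card_2_iff)
      then show ?thesis using axis_self[of Q] by auto
    qed
    then show ?thesis using that by metis
  qed
  have moved: "\<delta> Q = partner Q \<and> \<delta> (partner Q) = Q"
    if \<delta>: "\<delta> \<in> \<Gamma>" "\<delta> \<noteq> id" "\<And>Q. Q \<in> orb P \<Longrightarrow> \<delta> ` axis Q = axis Q" and Q: "Q \<in> orb P" for \<delta> Q
  proof -
    have swap: "\<delta> R = R \<or> \<delta> R = partner R \<and> \<delta> (partner R) = R" if "R \<in> orb P" for R
    proof -
      have "\<delta> ` {R, partner R} = {R, partner R}" "R \<noteq> partner R" using \<delta>(3)[OF that] pa[OF that] by metis+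
      then show ?thesis by (auto simp: insert_eq_iff doubleton_eq_iff)
    qed
    have "\<delta> Q \<noteq> Q"
    proof
      assume "\<delta> Q = Q"
      then have st: "\<delta> \<in> stab Q" using \<delta> by (simp add: stab_def)
      then have fixset: "{x. \<delta> x = x} = {Q, partner Q}" using axis_fixed[OF st \<delta>(2)] pa[OF Q] by simp
      have "\<not> orb P \<subseteq> {Q, partner Q}"
      proof
        assume "orb P \<subseteq> {Q, partner Q}"
        then have "card (orb P) \<le> card {Q, partner Q}" by (intro card_mono) auto
        also have "\<dots> \<le> 2" by (simp add: card_insert_if)
        finally show False using c8 by simp
      qed
      then obtain R where R: "R \<in> orb P" "R \<notin> {Q, partner Q}" by blast
      then have "\<delta> R \<noteq> R" using fixset by blast
      then have "\<delta> (\<delta> R) = R" using swap[OF R(1)] by auto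
      moreover have "\<delta> (partner Q) = partner Q" using fixset by blast
      moreover have "Q \<noteq> partner Q" "Q \<noteq> R" "partner Q \<noteq> R" using conjunct2[OF pa[OF Q]] R(2) by auto
      ultimately have "\<delta> \<circ> \<delta> = id" using \<open>\<delta> Q = Q\<close>
        by (intro PGL_fix_3[OF in_PGL[OF comp_closed[OF \<delta>(1) \<delta>(1)]], of Q "partner Q" R]) simp_all
      moreover have "\<delta> \<circ> (\<delta> \<circ> \<delta>) = id" using elem_pow[OF st] sp(2)[OF Q] by (simp add: numeral_3_eq_3)
      ultimately show False using \<delta>(2) by simp
    qed
    then show ?thesis using swap[OF Q] by simp
  qed
  obtain a b c where abc: "a \<in> orb P" "b \<in> orb P" "c \<in> orb P" "a \<noteq> b" "a \<noteq> c" "b \<noteq> c"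
  proof -
    obtain K where "K \<subseteq> orb P" "card K = 3" using c8 obtain_subset_with_card_n[of 3 "orb P"] by auto
    then show ?thesis using that unfolding card_3_iff by (metis insert_subset)
  qed
  have uniq: "\<delta> = \<gamma>" if "\<delta> \<in> \<Gamma>" "\<delta> \<noteq> id" and dx: "\<And>Q. Q \<in> orb P \<Longrightarrow> \<delta> ` axis Q = axis Q" for \<delta>
  proof (rule PGL_eq_3[OF in_PGL[OF that(1)] in_PGL[OF assms(4)], of a b c])
    have eq: "\<delta> Q = \<gamma> Q" if "Q \<in> orb P" for Q
      using moved[OF \<open>\<delta> \<in> \<Gamma>\<close> \<open>\<delta> \<noteq> id\<close> _ that] moved[OF assms(4) \<open>\<gamma> \<noteq> id\<close> fx that] dx by metis
    show "\<delta> a = \<gamma> a" "\<delta> b = \<gamma> b" "\<delta> c = \<gamma> c" using eq abc by blast+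
  qed (use abc in auto)
  \<comment> \<open>Conjugates of \<open>\<gamma>\<close> preserve all axes too, so by uniqueness
    they coincide with \<open>\<gamma>\<close>.\<close>
  have central: "\<delta> (\<gamma> x) = \<gamma> (\<delta> x)" if \<delta>: "\<delta> \<in> \<Gamma>" for \<delta> x
  proof -
    let ?e = "\<delta> \<circ> \<gamma> \<circ> inv_into UNIV \<delta>"
    have "?e = \<gamma>"
    proof (rule uniq)
      show "?e \<in> \<Gamma>" using \<delta> assms(4) by (simp add: comp_closed inv_closed)
      show "?e \<noteq> id"
      proof
        assume "?e = id"
        from fun_cong[OF this] have "\<delta> (\<gamma> y) = \<delta> y" for y using elem_inv(1)[OF \<delta>] by (metis comp_apply id_apply)
        then have "\<gamma> y = y" for y using bij_elem[OF \<delta>] by (metis bij_pointE)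
        then show False using \<open>\<gamma> \<noteq> id\<close> by (auto simp: fun_eq_iff)
      qed
      fix Q assume "Q \<in> orb P"
      then have Q': "inv_into UNIV \<delta> Q \<in> orb P" using \<delta> by (simp add: orb_closed inv_closed)
      have "?e ` axis Q = \<delta> ` \<gamma> ` inv_into UNIV \<delta> ` axis Q" by (simp add: image_comp comp_assoc)
      also have "inv_into UNIV \<delta> ` axis Q = axis (inv_into UNIV \<delta> Q)" using axis_image[OF inv_closed[OF \<delta>]] by simp
      also have "\<delta> ` \<gamma> ` \<dots> = \<delta> ` axis (inv_into UNIV \<delta> Q)" using fx[OF Q'] by simp
      also have "\<dots> = axis Q" using axis_image[OF \<delta>, of "inv_into UNIV \<delta> Q"] \<delta> by simp
      finally show "?e ` axis Q = axis Q" .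
    qed
    then have "?e (\<delta> x) = \<gamma> (\<delta> x)" by simp
    then show ?thesis using \<delta> by simp
  qed
  obtain R where R: "\<gamma> R = R" using PGL_fixed_point[OF in_PGL[OF assms(4)]] by blast
  \<comment> \<open>The group permutes the fixed points of a central element. This gives an orbit of
    at most 2 points with stabilizer order at most 4, too small for 24 elements.\<close>
  have "orb R \<subseteq> {x. \<gamma> x = x}"
  proof
    fix x assume "x \<in> orb R"
    then obtain \<delta> where "\<delta> \<in> \<Gamma>" "x = \<delta> R" by (auto simp: orb_def)
    then show "x \<in> {x. \<gamma> x = x}" using central[of \<delta> R] R by simp
  qed
  moreover have c2: "card {x. \<gamma> x = x} = 2" using card_fixed_points[OF assms(4) \<open>\<gamma> \<noteq> id\<close>] .
  then have "finite {x. \<gamma> x = x}" by (intro card_ge_0_finite) simp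
  ultimately have "card (orb R) \<le> 2" using card_mono c2 by metis
  moreover have "R \<in> special" using R assms(4) \<open>\<gamma> \<noteq> id\<close> by (auto simp: special_iff)
  then have "card (stab R) \<le> 4" using orbit_type_stab[OF assms(2)] by fastforce
  ultimately have "card (orb R) * card (stab R) \<le> 2 * 4" by (intro mult_le_mono)
  then show False using orbit_stabilizer[of R] assms(1) by simp
qed

text \<open>The 8 points with stabilizer of order 3 are the vertices of a cube. They form 4
  diagonals, and 24 = 4!.\<close>

lemma octahedral_iso:
  assumes "card \<Gamma> = 24" "orbit_type 2 3 4"
  shows "subgrp \<Gamma> \<cong> sym_group 4"
proof -
  obtain P where P: "card (stab P) = 3" using assms(2) unfolding orbit_type_def by blast
  then have sp: "P \<in> special" by (simp add: special_def)
  have "2 * card (axis ` orb P) = card (orb P)"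
    by (rule card_axes[OF sp]) (rule orbit_type_same_stab[OF assms(2) sp], auto)
  then have c4: "card (axis ` orb P) = 4" using orbit_stabilizer[of P] assms(1) P by simp
  obtain \<phi> where "\<phi> \<in> hom (subgrp \<Gamma>) (sym_group 4)" "inj_on \<phi> \<Gamma>"
  proof (rule action_hom[of "axis ` orb P" 4 image])
    show "\<gamma> ` A \<in> axis ` orb P" if "\<gamma> \<in> \<Gamma>" "A \<in> axis ` orb P" for \<gamma> A
    proof -
      obtain Q where Q: "Q \<in> orb P" "A = axis Q" using \<open>A \<in> axis ` orb P\<close> by blast
      then have "\<gamma> ` A = axis (\<gamma> Q)" using axis_image[OF \<open>\<gamma> \<in> \<Gamma>\<close>] by simp
      then show ?thesis using orb_closed[OF Q(1) \<open>\<gamma> \<in> \<Gamma>\<close>] by blast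
    qed
    show "\<gamma> = id" if "\<gamma> \<in> \<Gamma>" "\<And>A. A \<in> axis ` orb P \<Longrightarrow> \<gamma> ` A = A" for \<gamma>
      using axes_fixed_imp_id[OF assms P that(1)] that(2) by blast
  qed (auto simp: image_comp finite_orb c4)
  then show ?thesis by (rule hom_sym_iso(1)) (simp add: assms(1) fact_numeral)
qed

end

section \<open>Involutions, their centralizers and the icosahedral group\<close>

context finite_PGL_group
begin

text \<open>Conjugation in the order opposite to \<open>conj_map\<close>, so that it is a left
  action, as \<open>action_hom\<close> requires.\<close>

definition cj :: "('a option \<Rightarrow> 'a option) \<Rightarrow> ('a option \<Rightarrow> 'a option) \<Rightarrow> 'a option \<Rightarrow> 'a option" where
  "cj \<gamma> \<delta> = \<gamma> \<circ> \<delta> \<circ> inv_into UNIV \<gamma>"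

definition involutions :: "('a option \<Rightarrow> 'a option) set" where
  "involutions = {\<tau> \<in> \<Gamma>. \<tau> \<noteq> id \<and> \<tau> \<circ> \<tau> = id}"

definition centralizer :: "('a option \<Rightarrow> 'a option) \<Rightarrow> ('a option \<Rightarrow> 'a option) set" where
  "centralizer \<tau> = {\<gamma> \<in> \<Gamma>. \<gamma> \<circ> \<tau> = \<tau> \<circ> \<gamma>}"

lemma finite_involutions: "finite involutions"
  using finite_group by (simp add: involutions_def)

lemma cj_closed: "\<gamma> \<in> \<Gamma> \<Longrightarrow> \<delta> \<in> \<Gamma> \<Longrightarrow> cj \<gamma> \<delta> \<in> \<Gamma>"
  by (simp add: cj_def comp_closed inv_closed)

lemma cj_comp: "\<gamma> \<in> \<Gamma> \<Longrightarrow> cj \<gamma> (\<delta> \<circ> \<epsilon>) = cj \<gamma> \<delta> \<circ> cj \<gamma> \<epsilon>"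
  by (auto simp: cj_def fun_eq_iff)

lemma cj_cj: "\<gamma> \<in> \<Gamma> \<Longrightarrow> \<delta> \<in> \<Gamma> \<Longrightarrow> cj (\<gamma> \<circ> \<delta>) \<epsilon> = cj \<gamma> (cj \<delta> \<epsilon>)"
  using bij_elem by (simp add: cj_def o_inv_distrib comp_assoc)

lemma cj_id: "cj id \<delta> = \<delta>" "\<gamma> \<in> \<Gamma> \<Longrightarrow> cj \<gamma> id = id"
  by (simp_all add: cj_def elem_inv_comp)

lemma cj_eq_iff: "\<gamma> \<in> \<Gamma> \<Longrightarrow> cj \<gamma> \<delta> = \<epsilon> \<longleftrightarrow> \<gamma> \<circ> \<delta> = \<epsilon> \<circ> \<gamma>"
proof -
  assume \<gamma>: "\<gamma> \<in> \<Gamma>"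
  show "cj \<gamma> \<delta> = \<epsilon> \<longleftrightarrow> \<gamma> \<circ> \<delta> = \<epsilon> \<circ> \<gamma>"
  proof
    assume "cj \<gamma> \<delta> = \<epsilon>"
    then have "\<epsilon> \<circ> \<gamma> = cj \<gamma> \<delta> \<circ> \<gamma>" by simp
    also have "\<dots> = \<gamma> \<circ> \<delta>" by (simp add: cj_def comp_assoc elem_inv_comp[OF \<gamma>])
    finally show "\<gamma> \<circ> \<delta> = \<epsilon> \<circ> \<gamma>" by simp
  next
    assume "\<gamma> \<circ> \<delta> = \<epsilon> \<circ> \<gamma>"
    then show "cj \<gamma> \<delta> = \<epsilon>" by (simp add: cj_def comp_assoc elem_inv_comp[OF \<gamma>])
  qed
qed

lemma cj_inj: "\<gamma> \<in> \<Gamma> \<Longrightarrow> inj_on (cj \<gamma>) A"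
  by (rule inj_onI) (metis cj_cj cj_id(1) elem_inv_comp(1) inv_closed)

lemma cj_involution:
  assumes \<gamma>: "\<gamma> \<in> \<Gamma>" and \<tau>: "\<tau> \<in> involutions"
  shows "cj \<gamma> \<tau> \<in> involutions"
proof -
  have t: "\<tau> \<in> \<Gamma>" "\<tau> \<noteq> id" "\<tau> \<circ> \<tau> = id" using \<tau> by (auto simp: involutions_def)
  have "cj \<gamma> \<tau> \<noteq> cj \<gamma> id" using inj_onD[OF cj_inj[OF \<gamma>, of UNIV]] t(2) by blast
  moreover have "cj \<gamma> \<tau> \<circ> cj \<gamma> \<tau> = id" using cj_comp[OF \<gamma>, of \<tau> \<tau>] t(3) cj_id(2)[OF \<gamma>] by simp
  ultimately show ?thesis using cj_closed[OF \<gamma> t(1)] cj_id(2)[OF \<gamma>] by (simp add: involutions_def)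
qed

lemma centralizer_iff: "\<gamma> \<in> centralizer \<tau> \<longleftrightarrow> \<gamma> \<in> \<Gamma> \<and> cj \<gamma> \<tau> = \<tau>"
  unfolding centralizer_def using cj_eq_iff by auto

end

context regular_group
begin

context
  assumes ico: "card \<Gamma> = 60" "orbit_type 2 3 5"
begin

text \<open>The third and the fifth power of an involution are the involution itself, so it cannot
  lie in a stabilizer of order 3 or 5.\<close>

lemma involution_stab:
  assumes "\<tau> \<in> involutions" "\<tau> P = P"
  shows "stab P = {id, \<tau>}" "card (stab P) = 2"
proof -
  have \<tau>: "\<tau> \<in> \<Gamma>" "\<tau> \<noteq> id" "\<And>x. \<tau> (\<tau> x) = x"
    using assms(1) by (auto simp: involutions_def fun_eq_iff)
  then have st: "\<tau> \<in> stab P" using assms(2) by (simp add: stab_def)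
  have sp: "P \<in> special" using \<tau> assms(2) by (auto simp: special_iff)
  have "(\<tau> ^^ 3) x = \<tau> x" "(\<tau> ^^ 5) x = \<tau> x" for x by (simp_all add: eval_nat_numeral \<tau>(3))
  then have "\<tau> ^^ 3 = \<tau>" "\<tau> ^^ 5 = \<tau>" by blast+
  then have "card (stab P) \<noteq> 3" "card (stab P) \<noteq> 5" using elem_pow[OF st] \<tau>(2) by metis+
  then show c2: "card (stab P) = 2" using orbit_type_stab[OF ico(2) sp] by blast
  have "{id, \<tau>} \<subseteq> stab P" using st id_stab by simp
  moreover have "card {id, \<tau>} = 2" using \<tau>(2) by simp
  ultimately show "stab P = {id, \<tau>}" using card_subset_eq[OF finite_stab] c2 by metis
qed

lemma stab_involution:
  assumes "card (stab P) = 2"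
  shows "\<exists>\<tau>\<in>involutions. stab P = {id, \<tau>}"
proof -
  have "P \<in> special" using assms by (simp add: special_def)
  then obtain \<tau> where \<tau>: "\<tau> \<in> stab P" "\<tau> \<noteq> id" using special_elem by metis
  have "\<tau> \<circ> \<tau> = id" using elem_pow[OF \<tau>(1)] assms by (simp add: numeral_2_eq_2)
  then have "\<tau> \<in> involutions" using \<tau> by (simp add: involutions_def stab_def)
  then show ?thesis using involution_stab(1)[of \<tau> P] \<tau> by (auto simp: stab_def)
qed

text \<open>There are 30 points with stabilizer of order 2. Each is fixed by one involution, and
  each involution fixes two of them.\<close>

lemma card_involutions: "card involutions = 15"
proof -
  obtain P where P: "card (stab P) = 2" using ico(2) unfolding orbit_type_def by blast
  have sp: "P \<in> special" using P by (simp add: special_def)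
  have mem: "Q \<in> orb P \<longleftrightarrow> card (stab Q) = 2" for Q
    using card_stab_orb[of Q P] orbit_type_same_stab[OF ico(2) sp, of Q] P by auto
  have "card (orb P) = 30" using orbit_stabilizer[of P] P ico(1) by simp
  have 1: "(\<Sum>\<tau>\<in>{\<tau> \<in> involutions. \<tau> Q = Q}. 1) = (1::nat)" if Q: "Q \<in> orb P" for Q
  proof -
    obtain \<tau> where \<tau>: "\<tau> \<in> involutions" "stab Q = {id, \<tau>}" using stab_involution mem Q by blast
    have "{\<tau> \<in> involutions. \<tau> Q = Q} = stab Q - {id}"
      using \<tau> by (auto simp: stab_def involutions_def)
    also have "\<dots> = {\<tau>}" using \<tau> by (auto simp: involutions_def)
    finally show ?thesis by simp
  qed
  have 2: "(\<Sum>Q\<in>{Q \<in> orb P. \<tau> Q = Q}. 1) = (2::nat)" if \<tau>: "\<tau> \<in> involutions" for \<tau>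
  proof -
    have "{Q \<in> orb P. \<tau> Q = Q} = {Q. \<tau> Q = Q}" using involution_stab(2)[OF \<tau>] mem by blast
    then show ?thesis using card_fixed_points[of \<tau>] \<tau> by (simp add: involutions_def)
  qed
  have "(\<Sum>Q\<in>orb P. \<Sum>\<tau>\<in>{\<tau> \<in> involutions. \<tau> Q = Q}. 1::nat) = (\<Sum>\<tau>\<in>involutions. \<Sum>Q\<in>{Q \<in> orb P. \<tau> Q = Q}. 1)"
    by (rule sum.swap_restrict[OF finite_orb finite_involutions])
  then show ?thesis using 1 2 \<open>card (orb P) = 30\<close> by simp
qed

lemma involution_axis:
  assumes "\<tau> \<in> involutions" "\<tau> P = P"
  shows "axis P = {x. \<tau> x = x}" "P \<in> special" "\<And>Q. Q \<in> axis P \<Longrightarrow> Q \<in> orb P"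
proof -
  have st: "\<tau> \<in> stab P" "\<tau> \<noteq> id" using assms by (auto simp: stab_def involutions_def)
  show "axis P = {x. \<tau> x = x}" by (rule axis_fixed[OF st])
  show sp: "P \<in> special" using involution_stab(2)[OF assms] by (simp add: special_def)
  show "Q \<in> orb P" if "Q \<in> axis P" for Q
    using orbit_type_same_stab[OF ico(2) sp, of Q] axis_stab(1)[OF sp that] by simp
qed

text \<open>An element that sends \<open>P\<close> to a fixed point of \<open>\<tau>\<close>
  conjugates \<open>\<tau>\<close> into the stabilizer of that point, whose only involution is
  \<open>\<tau>\<close>.\<close>

lemma centralizer_axis:
  assumes "\<tau> \<in> involutions" "\<tau> P = P"
  shows "centralizer \<tau> = {\<gamma> \<in> \<Gamma>. \<gamma> P \<in> axis P}"
proof (intro equalityI subsetI)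
  fix \<gamma> assume "\<gamma> \<in> centralizer \<tau>"
  then have \<gamma>: "\<gamma> \<in> \<Gamma>" "\<gamma> \<circ> \<tau> = \<tau> \<circ> \<gamma>" by (auto simp: centralizer_def)
  have "\<tau> (\<gamma> P) = \<gamma> P" using fun_cong[OF \<gamma>(2), of P] assms(2) by simp
  then show "\<gamma> \<in> {\<gamma> \<in> \<Gamma>. \<gamma> P \<in> axis P}" using \<gamma> involution_axis(1)[OF assms] by simp
next
  fix \<gamma> assume "\<gamma> \<in> {\<gamma> \<in> \<Gamma>. \<gamma> P \<in> axis P}"
  then have \<gamma>: "\<gamma> \<in> \<Gamma>" "\<gamma> P \<in> axis P" by auto
  have "cj \<gamma> \<tau> \<in> involutions" using cj_involution[OF \<gamma>(1) assms(1)] .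
  moreover have "cj \<gamma> \<tau> (\<gamma> P) = \<gamma> P" using \<gamma> assms(2) by (simp add: cj_def)
  ultimately have "cj \<gamma> \<tau> \<in> stab (\<gamma> P)" "cj \<gamma> \<tau> \<noteq> id" by (auto simp: stab_def involutions_def)
  moreover have "stab (\<gamma> P) = {id, \<tau>}"
    using axis_stab(1)[OF involution_axis(2)[OF assms] \<gamma>(2)] involution_stab(1)[OF assms] by simp
  ultimately have "cj \<gamma> \<tau> = \<tau>" by blast
  then show "\<gamma> \<in> centralizer \<tau>" using \<gamma> by (simp add: centralizer_iff)
qed

text \<open>The two fixed points of \<open>\<tau>\<close> lie in one orbit, so the elements sending
  \<open>P\<close> to either of them form two cosets of a stabilizer of order 2.\<close>

lemma card_centralizer: "\<tau> \<in> involutions \<Longrightarrow> card (centralizer \<tau>) = 4"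
proof -
  assume \<tau>: "\<tau> \<in> involutions"
  then obtain P where P: "\<tau> P = P" using PGL_fixed_point in_PGL unfolding involutions_def by blast
  note ax = involution_axis[OF \<tau> P]
  obtain u v where uv: "axis P = {u, v}" "u \<noteq> v" using card_axis[OF ax(2)] by (meson card_2_iff)
  have "centralizer \<tau> = {\<gamma> \<in> \<Gamma>. \<gamma> P = u} \<union> {\<gamma> \<in> \<Gamma>. \<gamma> P = v}"
    using centralizer_axis[OF \<tau> P] uv by auto
  moreover have "card ({\<gamma> \<in> \<Gamma>. \<gamma> P = u} \<union> {\<gamma> \<in> \<Gamma>. \<gamma> P = v}) = card {\<gamma> \<in> \<Gamma>. \<gamma> P = u} + card {\<gamma> \<in> \<Gamma>. \<gamma> P = v}"
    using uv(2) finite_group by (intro card_Un_disjoint) auto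
  ultimately show ?thesis
    using card_transporter ax(3) uv(1) involution_stab(2)[OF \<tau> P] by simp
qed

text \<open>An element of the centralizer either fixes \<open>P\<close>, and then is
  \<open>id\<close> or \<open>\<tau>\<close>, or swaps the two fixed points of
  \<open>\<tau>\<close>. In the second case it also has a fixed point of its own, so its square
  fixes three points.\<close>

lemma centralizer_square:
  assumes \<tau>: "\<tau> \<in> involutions" and \<gamma>: "\<gamma> \<in> centralizer \<tau>"
  shows "\<gamma> \<circ> \<gamma> = id"
proof -
  obtain P where P: "\<tau> P = P" using \<tau> PGL_fixed_point in_PGL unfolding involutions_def by blast
  have \<gamma>': "\<gamma> \<in> \<Gamma>" "\<gamma> P \<in> axis P" using \<gamma> centralizer_axis[OF \<tau> P] by auto
  note ax = involution_axis[OF \<tau> P]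
  show ?thesis
  proof (cases "\<gamma> P = P")
    case True
    then have "\<gamma> \<in> {id, \<tau>}" using \<gamma>' involution_stab(1)[OF \<tau> P] by (auto simp: stab_def)
    then show ?thesis using \<tau> by (auto simp: involutions_def)
  next
    case False
    obtain u v where uv: "axis P = {u, v}" "u \<noteq> v" using card_axis[OF ax(2)] by (meson card_2_iff)
    then have axP: "axis P = {P, \<gamma> P}" using axis_self[of P] \<gamma>'(2) False by auto
    have "\<gamma> ` axis P = axis P"
      using axis_image[OF \<gamma>'(1)] axis_stab(2)[OF ax(2) \<gamma>'(2)] by simp
    then have "\<gamma> (\<gamma> P) \<in> {P, \<gamma> P}" using axP by auto
    moreover have "\<gamma> (\<gamma> P) \<noteq> \<gamma> P" using False bij_elem[OF \<gamma>'(1)] by (metis bij_pointE)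
    ultimately have gg: "\<gamma> (\<gamma> P) = P" by blast
    obtain R where R: "\<gamma> R = R" using PGL_fixed_point in_PGL[OF \<gamma>'(1)] by blast
    have "R \<noteq> P" "R \<noteq> \<gamma> P" using R False gg by auto
    then show ?thesis using gg R False
      by (intro PGL_fix_3[OF in_PGL[OF comp_closed[OF \<gamma>'(1) \<gamma>'(1)]], of P "\<gamma> P" R]) auto
  qed
qed

lemma centralizer_comp:
  assumes "\<gamma> \<in> centralizer \<tau>" "\<delta> \<in> centralizer \<tau>"
  shows "\<gamma> \<circ> \<delta> \<in> centralizer \<tau>"
  using assms unfolding centralizer_iff by (simp add: comp_closed cj_cj)

lemma centralizer_abelian:
  assumes "\<tau> \<in> involutions" "\<gamma> \<in> centralizer \<tau>" "\<delta> \<in> centralizer \<tau>"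
  shows "\<gamma> \<circ> \<delta> = \<delta> \<circ> \<gamma>"
proof
  fix x
  have g: "\<gamma> (\<gamma> y) = y" and d: "\<delta> (\<delta> y) = y" and gd: "\<gamma> (\<delta> (\<gamma> (\<delta> y))) = y" for y
    using fun_cong[OF centralizer_square[OF assms(1,2)], of y] fun_cong[OF centralizer_square[OF assms(1,3)], of y]
      fun_cong[OF centralizer_square[OF assms(1) centralizer_comp[OF assms(2,3)]], of y] by simp_all
  have "\<gamma> (\<delta> x) = \<gamma> (\<delta> (\<gamma> (\<delta> (\<delta> (\<gamma> x)))))" by (simp only: d g)
  then show "(\<gamma> \<circ> \<delta>) x = (\<delta> \<circ> \<gamma>) x" by (simp only: gd comp_apply)
qed

text \<open>Centralizers are abelian, so one is contained in the other, and both have order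
  4.\<close>

lemma centralizer_eq:
  assumes "\<tau> \<in> involutions" "\<tau>' \<in> involutions" "\<tau>' \<in> centralizer \<tau>"
  shows "centralizer \<tau>' = centralizer \<tau>"
proof -
  have "centralizer \<tau> \<subseteq> centralizer \<tau>'"
    using centralizer_abelian[OF assms(1) _ assms(3)] by (auto simp: centralizer_def)
  moreover have "finite (centralizer \<tau>')" using finite_group by (simp add: centralizer_def)
  ultimately show ?thesis using card_centralizer assms(1,2) by (metis card_subset_eq)
qed

lemma involution_centralizer: "\<tau> \<in> involutions \<Longrightarrow> \<tau> \<in> centralizer \<tau>"
  by (simp add: centralizer_def involutions_def)

lemma centralizer_involution:
  assumes "\<tau> \<in> involutions" "\<gamma> \<in> centralizer \<tau>" "\<gamma> \<noteq> id"
  shows "\<gamma> \<in> involutions"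
proof -
  have "\<gamma> \<circ> \<gamma> = id" by (rule centralizer_square[OF assms(1,2)])
  moreover have "\<gamma> \<in> \<Gamma>" using assms(2) by (simp add: centralizer_def)
  ultimately show ?thesis using assms(3) by (simp add: involutions_def)
qed

text \<open>The three involutions of a centralizer all have this same centralizer, so the 15
  involutions fall into 5 triples.\<close>

lemma card_centralizers: "card (centralizer ` involutions) = 5"
proof -
  have "card involutions = (\<Sum>V\<in>centralizer ` involutions. \<Sum>\<tau>\<in>{\<tau> \<in> involutions. centralizer \<tau> = V}. 1)"
    using sum.image_gen[OF finite_involutions, of "\<lambda>_. 1::nat" centralizer] by simp
  also have "\<dots> = (\<Sum>V\<in>centralizer ` involutions. 3)"
  proof (rule sum.cong)
    fix V assume "V \<in> centralizer ` involutions"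
    then obtain \<tau> where \<tau>: "\<tau> \<in> involutions" "V = centralizer \<tau>" by blast
    have "{\<tau>' \<in> involutions. centralizer \<tau>' = V} = V - {id}"
    proof (intro equalityI subsetI)
      fix \<tau>' assume "\<tau>' \<in> {\<tau>' \<in> involutions. centralizer \<tau>' = V}"
      then show "\<tau>' \<in> V - {id}" using involution_centralizer by (auto simp: involutions_def)
    next
      fix \<tau>' assume t: "\<tau>' \<in> V - {id}"
      then have "\<tau>' \<in> involutions" using centralizer_involution \<tau> by blast
      then show "\<tau>' \<in> {\<tau>' \<in> involutions. centralizer \<tau>' = V}" using centralizer_eq \<tau> t by blast
    qed
    moreover have "id \<in> V" using \<tau> by (simp add: centralizer_def id_closed)
    moreover have "card V = 4" using card_centralizer \<tau> by simp
    ultimately show "(\<Sum>\<tau>\<in>{\<tau> \<in> involutions. centralizer \<tau> = V}. 1) = (3::nat)"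
      by (simp add: card_Diff_singleton)
  qed simp
  finally show ?thesis using card_involutions by simp
qed

lemma cj_centralizer:
  assumes "\<gamma> \<in> \<Gamma>" "\<tau> \<in> involutions"
  shows "cj \<gamma> ` centralizer \<tau> = centralizer (cj \<gamma> \<tau>)"
proof (rule card_subset_eq)
  show "finite (centralizer (cj \<gamma> \<tau>))" using finite_group by (simp add: centralizer_def)
  show "cj \<gamma> ` centralizer \<tau> \<subseteq> centralizer (cj \<gamma> \<tau>)"
  proof
    fix \<epsilon> assume "\<epsilon> \<in> cj \<gamma> ` centralizer \<tau>"
    then obtain \<delta> where \<delta>: "\<delta> \<in> \<Gamma>" "\<delta> \<circ> \<tau> = \<tau> \<circ> \<delta>" "\<epsilon> = cj \<gamma> \<delta>" by (auto simp: centralizer_def)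
    have "\<epsilon> \<circ> cj \<gamma> \<tau> = cj \<gamma> \<tau> \<circ> \<epsilon>" unfolding \<delta>(3) cj_comp[OF assms(1), symmetric] \<delta>(2) ..
    then show "\<epsilon> \<in> centralizer (cj \<gamma> \<tau>)" using \<delta> assms(1) by (simp add: centralizer_def cj_closed)
  qed
  show "card (cj \<gamma> ` centralizer \<tau>) = card (centralizer (cj \<gamma> \<tau>))"
    using card_image[OF cj_inj[OF assms(1)]] card_centralizer[OF assms(2)]
      card_centralizer[OF cj_involution[OF assms]] by simp
qed

text \<open>Choose a four-group that does not contain \<open>\<gamma>\<close>; then
  \<open>\<gamma>\<close> commutes with none of its nonidentity elements. But the product of
  \<open>\<tau>\<close> and its conjugate by \<open>\<gamma>\<close> is fixed under this
  conjugation, so it is trivial, and \<open>\<gamma>\<close> commutes with \<open>\<tau>\<close>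
  after all.\<close>

lemma no_normalizing_involution:
  assumes \<gamma>: "\<gamma> \<in> involutions" and fx: "\<And>V. V \<in> centralizer ` involutions \<Longrightarrow> cj \<gamma> ` V = V"
  shows False
proof -
  have g: "\<gamma> \<in> \<Gamma>" "\<gamma> \<circ> \<gamma> = id" using \<gamma> by (auto simp: involutions_def)
  have "\<not> centralizer ` involutions \<subseteq> {centralizer \<gamma>}"
  proof
    assume "centralizer ` involutions \<subseteq> {centralizer \<gamma>}"
    then have "card (centralizer ` involutions) \<le> card {centralizer \<gamma>}" by (intro card_mono) auto
    then show False using card_centralizers by simp
  qed
  then obtain \<tau> where \<tau>: "\<tau> \<in> involutions" "centralizer \<tau> \<noteq> centralizer \<gamma>" by blast
  have notin: "\<gamma> \<notin> centralizer \<tau>" using centralizer_eq[OF \<tau>(1) \<gamma>] \<tau>(2) by blast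
  have no: "cj \<gamma> t \<noteq> t" if t: "t \<in> centralizer \<tau>" "t \<noteq> id" for t
  proof
    assume "cj \<gamma> t = t"
    then have "\<gamma> \<in> centralizer t" using g by (simp add: centralizer_iff)
    moreover have "centralizer t = centralizer \<tau>"
      using centralizer_eq[OF \<tau>(1) centralizer_involution[OF \<tau>(1) t] t(1)] .
    ultimately show False using notin by blast
  qed
  define b where "b = cj \<gamma> \<tau>"
  have tc: "\<tau> \<in> centralizer \<tau>" by (rule involution_centralizer[OF \<tau>(1)])
  have bc: "b \<in> centralizer \<tau>" using fx[of "centralizer \<tau>"] \<tau>(1) tc unfolding b_def by blast
  have cb: "cj \<gamma> b = \<tau>" unfolding b_def using cj_cj[OF g(1) g(1), of \<tau>] g(2) by (simp add: cj_id)
  have "cj \<gamma> (\<tau> \<circ> b) = b \<circ> \<tau>" using cb by (simp add: cj_comp[OF g(1)] b_def)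
  also have "\<dots> = \<tau> \<circ> b" using centralizer_abelian[OF \<tau>(1) bc tc] .
  finally have fixt: "cj \<gamma> (\<tau> \<circ> b) = \<tau> \<circ> b" .
  have "\<tau> \<circ> b = id" using no[OF centralizer_comp[OF tc bc]] fixt by blast
  then have "\<tau> \<circ> (\<tau> \<circ> b) = \<tau>" by simp
  then have "b = \<tau>" using centralizer_square[OF \<tau>(1) tc] by (simp add: comp_assoc[symmetric])
  then show False using no[OF tc] \<tau>(1) by (simp add: b_def involutions_def)
qed

text \<open>The commutator \<open>w\<close> of \<open>\<gamma>\<close> and \<open>\<tau>\<close>
  again normalizes every four-group and lies in the one of \<open>\<tau>\<close>. If it is trivial,
  \<open>\<gamma>\<close> lies there too. Either way a normalizing involution appears.\<close>

lemma normalizing_imp_id: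
  assumes \<gamma>: "\<gamma> \<in> \<Gamma>" and fx: "\<And>V. V \<in> centralizer ` involutions \<Longrightarrow> cj \<gamma> ` V = V"
  shows "\<gamma> = id"
proof (rule ccontr)
  assume "\<gamma> \<noteq> id"
  obtain \<tau> where \<tau>: "\<tau> \<in> involutions" using card_involutions by fastforce
  have t: "\<tau> \<in> \<Gamma>" "\<tau> \<circ> \<tau> = id" using \<tau> by (auto simp: involutions_def)
  have tc: "\<tau> \<in> centralizer \<tau>" by (rule involution_centralizer[OF \<tau>])
  have bc: "cj \<gamma> \<tau> \<in> centralizer \<tau>" using fx[of "centralizer \<tau>"] \<tau> tc by blast
  define w where "w = cj \<gamma> \<tau> \<circ> \<tau>"
  have wc: "w \<in> centralizer \<tau>" unfolding w_def by (rule centralizer_comp[OF bc tc])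
  show False
  proof (cases "w = id")
    case True
    then have "w \<circ> \<tau> = \<tau>" by simp
    then have "cj \<gamma> \<tau> = \<tau>" using t(2) by (simp add: w_def comp_assoc)
    then have "\<gamma> \<in> centralizer \<tau>" using \<gamma> by (simp add: centralizer_iff)
    then have "\<gamma> \<in> involutions" using centralizer_involution[OF \<tau>] \<open>\<gamma> \<noteq> id\<close> by blast
    then show False using no_normalizing_involution fx by blast
  next
    case False
    then have "w \<in> involutions" using centralizer_involution[OF \<tau> wc] by blast
    moreover have "cj w ` V = V" if V: "V \<in> centralizer ` involutions" for V
    proof -
      let ?i = "inv_into UNIV \<gamma>"
      have i: "?i \<in> \<Gamma>" using \<gamma> by (rule inv_closed)
      have w: "w = \<gamma> \<circ> (\<tau> \<circ> (?i \<circ> \<tau>))" by (simp add: w_def cj_def comp_assoc)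
      have im: "cj (\<alpha> \<circ> \<beta>) ` A = cj \<alpha> ` cj \<beta> ` A" if "\<alpha> \<in> \<Gamma>" "\<beta> \<in> \<Gamma>" for \<alpha> \<beta> A
        using cj_cj[OF that] by (simp add: image_image)
      have cl: "cj \<alpha> ` W \<in> centralizer ` involutions" if "\<alpha> \<in> \<Gamma>" "W \<in> centralizer ` involutions" for \<alpha> W
        using that(2) cj_centralizer[OF that(1)] cj_involution[OF that(1)] by auto
      have ii: "cj ?i ` W = W" if "W \<in> centralizer ` involutions" for W
      proof -
        have "cj ?i ` W = cj ?i ` cj \<gamma> ` W" using fx[OF that] by simp
        also have "\<dots> = cj (?i \<circ> \<gamma>) ` W" using im[OF i \<gamma>] by simp
        finally show ?thesis using elem_inv_comp(1)[OF \<gamma>] by (simp add: cj_id)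
      qed
      \<comment> \<open>\<open>\<tau>\<close> only permutes the four-groups, but it occurs twice,
        and the factors \<open>\<gamma>\<close> and its inverse act trivially on them.\<close>
      have "cj w ` V = cj \<gamma> ` cj \<tau> ` cj ?i ` cj \<tau> ` V"
        unfolding w using \<gamma> t i by (simp add: im comp_closed)
      also have "cj ?i ` cj \<tau> ` V = cj \<tau> ` V" by (rule ii[OF cl[OF t(1) V]])
      also have "cj \<tau> ` cj \<tau> ` V = V" using im[OF t(1) t(1), of V] t(2) by (simp add: cj_id)
      also have "cj \<gamma> ` V = V" by (rule fx[OF V])
      finally show ?thesis .
    qed
    ultimately show False using no_normalizing_involution by blast
  qed
qed

text \<open>The centralizers of the 15 involutions are 5 Klein four-groups, which \<open>\<Gamma>\<close> permutes by conjugation.\<close>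

lemma icosahedral_iso: "subgrp \<Gamma> \<cong> alt_group 5"
proof -
  obtain \<phi> where "\<phi> \<in> hom (subgrp \<Gamma>) (sym_group 5)" "inj_on \<phi> \<Gamma>"
  proof (rule action_hom[of "centralizer ` involutions" 5 "\<lambda>\<gamma> V. cj \<gamma> ` V"])
    show "cj \<gamma> ` V \<in> centralizer ` involutions" if "\<gamma> \<in> \<Gamma>" "V \<in> centralizer ` involutions" for \<gamma> V
      using that(2) cj_centralizer[OF that(1)] cj_involution[OF that(1)] by auto
    show "cj (\<gamma> \<circ> \<delta>) ` V = cj \<gamma> ` cj \<delta> ` V" if "\<gamma> \<in> \<Gamma>" "\<delta> \<in> \<Gamma>" for \<gamma> \<delta> V
      using cj_cj[OF that] by (simp add: image_image)
    show "\<gamma> = id" if "\<gamma> \<in> \<Gamma>" "\<And>V. V \<in> centralizer ` involutions \<Longrightarrow> cj \<gamma> ` V = V" for \<gamma>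
      using normalizing_imp_id that by blast
  qed (use finite_involutions in \<open>auto simp: cj_id card_centralizers\<close>)
  then show ?thesis by (rule hom_sym_iso(2)) (simp add: ico(1) fact_numeral)
qed

end

end

section \<open>Realization of the exceptional groups\<close>

lemma nat_pow_subgrp: "x [^]\<^bsub>subgrp \<Gamma>\<^esub> (n::nat) = x ^^ n"
proof (induction n)
  case 0
  then show ?case by (simp add: nat_pow_def PGL2_one)
next
  case (Suc n)
  have "x [^]\<^bsub>subgrp \<Gamma>\<^esub> Suc n = x [^]\<^bsub>subgrp \<Gamma>\<^esub> n \<circ> x" by (simp add: nat_pow_def PGL2_mult)
  then show ?case using Suc by (simp only: funpow_Suc_right)
qed

text \<open>Cauchy's theorem, read off from Sylow's theorem with exponent 1; the cofactor
  \<open>m\<close> may still be divisible by \<open>p\<close>.\<close>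

lemma subgroup_PGL_cauchy:
  assumes "subgroup H (PGL2 (UNIV :: 'a::field set))" "finite H" "Factorial_Ring.prime p" "p dvd card H"
  obtains h where "h \<in> H" "h \<noteq> id" "h ^^ p = id"
proof -
  have gH: "group (subgrp H)" by (rule group.subgroup_imp_group[OF group_PGL assms(1)])
  obtain m where m: "card H = p ^ 1 * m" using assms(4) by (auto elim: dvdE)
  obtain K where K: "subgroup K (subgrp H)" "card K = p ^ 1"
    using sylow_thm[OF assms(3) gH, of 1 m] m assms(2) by (auto simp: Coset.order_def)
  have KH: "K \<subseteq> H" using subgroup.subset[OF K(1)] by simp
  have gK: "group (subgrp K)" using group.subgroup_imp_group[OF gH K(1)] by simp
  have p2: "p \<ge> 2" using assms(3) by (rule prime_ge_2_nat)
  have "\<not> K \<subseteq> {id}"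
  proof
    assume "K \<subseteq> {id}"
    then have "card K \<le> card {id :: 'a option \<Rightarrow> 'a option}" by (intro card_mono) auto
    then show False using K(2) p2 by simp
  qed
  then obtain h where h: "h \<in> K" "h \<noteq> id" by blast
  have "h [^]\<^bsub>subgrp K\<^esub> Coset.order (subgrp K) = \<one>\<^bsub>subgrp K\<^esub>"
    by (rule group.pow_order_eq_1[OF gK]) (use h in simp)
  then have "h ^^ p = id" using K(2) by (simp only: nat_pow_subgrp subgrp_simps Coset.order_def) simp
  then show ?thesis using that h KH by blast
qed

text \<open>
  In characteristic \<open>p\<close> an element of order \<open>p\<close> is a translation in a suitable coordinate, and the sum
  over an invariant finite set \<open>T\<close> shows that \<open>|T| = 0\<close> in the field.
\<close>

lemma order_char_invariant_set:
  fixes h :: "'a::alg_closed_field option \<Rightarrow> 'a option"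
  assumes "h \<in> PGL" "h \<noteq> id" "h ^^ CHAR('a) = id" "CHAR('a) > 0" "finite S" "h ` S = S"
  shows "of_nat (card S) = (0::'a) \<or> of_nat (card S) = (1::'a)"
proof -
  obtain P where P: "h P = P" using PGL_fixed_point[OF assms(1)] by blast
  obtain Q where "Q \<noteq> P" using option.distinct(1) by (cases P) auto
  then obtain \<sigma> where \<sigma>: "\<sigma> \<in> PGL" "\<sigma> None = P" using PGL_2_transitive by metis
  then have b: "bij \<sigma>" using PGL_bij by blast
  define \<beta> where "\<beta> = conj_map \<sigma> h"
  have \<beta>: "\<beta> \<in> PGL" "\<beta> None = None"
    using \<sigma> assms(1) P by (auto simp: \<beta>_def conj_map_PGL conj_map_eq_iff[OF b])
  have \<beta>p: "\<beta> ^^ CHAR('a) = id"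
    unfolding \<beta>_def using conj_map_funpow[OF b, of "CHAR('a)" h] assms(3) conj_map_id[OF b] by simp
  have \<beta>id: "\<beta> \<noteq> id" using assms(2) conj_map_inject[OF b, of h id] conj_map_id[OF b] by (simp add: \<beta>_def)
  obtain a c where ac: "a \<noteq> 0" "\<And>t. \<beta> (Some t) = Some (a * t + c)"
    using PGL_fix_None[OF \<beta>] by metis
  have "\<exists>u. \<forall>t. (\<beta> ^^ k) (Some t) = Some (a ^ k * t + u)" for k
  proof (induction k)
    case (Suc k)
    then obtain u where "\<And>t. (\<beta> ^^ k) (Some t) = Some (a ^ k * t + u)" by blast
    then have "(\<beta> ^^ Suc k) (Some t) = Some (a ^ Suc k * t + (a * u + c))" for t
      by (simp add: ac algebra_simps)
    then show ?case by blast
  qed (auto intro: exI[of _ 0])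
  then obtain u where u: "\<And>t. Some t = Some (a ^ CHAR('a) * t + u)" using \<beta>p by (metis id_apply)
  \<comment> \<open>Comparison at 0 and 1 gives \<open>u = 0\<close> and makes \<open>a\<close> a
    root of unity of order dividing the characteristic. The Frobenius map is injective, so
    \<open>a = 1\<close> and the map is a translation.\<close>
  from u[of 0] u[of 1] have "a ^ CHAR('a) = 1" by simp
  then have "(a - 1) ^ CHAR('a) = 0"
    using freshmans_dream[OF prime_CHAR_semidom[OF assms(4)] refl, of "a - 1" 1] by simp
  then have a: "a = 1" by simp
  have c0: "c \<noteq> 0"
  proof
    assume "c = 0"
    then have "\<beta> x = x" for x using ac(2) \<beta>(2) a by (cases x) auto
    then show False using \<beta>id by (auto simp: fun_eq_iff)
  qed
  define S' where "S' = inv_into UNIV \<sigma> ` S"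
  have S': "finite S'" "card S' = card S"
    using assms(5) b by (auto simp: S'_def card_image bij_imp_bij_inv bij_is_inj inj_on_subset[OF bij_is_inj[OF bij_imp_bij_inv[OF b]]])
  have "\<beta> x \<in> S'" if x: "x \<in> S'" for x
  proof -
    obtain y where y: "y \<in> S" "x = inv_into UNIV \<sigma> y" using x by (auto simp: S'_def)
    then have "\<sigma> x = y" using b by (simp add: bij_is_surj surj_f_inv_f)
    then have "\<beta> x = inv_into UNIV \<sigma> (h y)" by (simp add: \<beta>_def conj_map_def)
    then show ?thesis using assms(6) y(1) by (auto simp: S'_def)
  qed
  then have "(\<lambda>t. t + c) ` affine_part S' \<subseteq> affine_part S'"
    using ac(2) a by (force simp: affine_part_def)
  moreover have inj: "inj_on (\<lambda>t. t + c) (affine_part S')" by (simp add: inj_on_def)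
  ultimately have im: "(\<lambda>t. t + c) ` affine_part S' = affine_part S'"
    using endo_inj_surj[OF finite_affine_part[OF S'(1)]] by blast
  have "\<Sum>(affine_part S') = (\<Sum>t\<in>(\<lambda>t. t + c) ` affine_part S'. t)" by (simp add: im)
  also have "\<dots> = \<Sum>(affine_part S') + of_nat (card (affine_part S')) * c"
    by (subst sum.reindex[OF inj]) (simp add: sum.distrib)
  finally have "of_nat (card (affine_part S')) = (0::'a)" using c0 by simp
  \<comment> \<open>Infinity may belong to the set or not, hence the two possible residues.\<close>
  then show ?thesis using card_affine_part[OF S'(1)] S'(2) by (auto split: if_splits)
qed

section \<open>Setwise stabilizers of finite sets\<close>

lemma finite_Stab:
  assumes "finite S" "card S \<ge> 3"
  shows "finite {\<alpha> \<in> PGL. \<alpha> ` S = (S :: 'a::field option set)}"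
proof -
  obtain K where "K \<subseteq> S" "card K = 3" using assms obtain_subset_with_card_n by metis
  then obtain x y z where xyz: "x \<in> S" "y \<in> S" "z \<in> S" "x \<noteq> y" "x \<noteq> z" "y \<noteq> z"
    unfolding card_3_iff by auto
  let ?H = "{\<alpha> \<in> PGL. \<alpha> ` S = S}"
  have "inj_on (\<lambda>\<alpha>. (\<alpha> x, \<alpha> y, \<alpha> z)) ?H"
    using xyz by (intro inj_onI) (auto intro: PGL_eq_3)
  moreover have "(\<lambda>\<alpha>. (\<alpha> x, \<alpha> y, \<alpha> z)) ` ?H \<subseteq> S \<times> S \<times> S" using xyz by blast
  ultimately show ?thesis using assms(1) by (meson finite_SigmaI finite_imageD finite_subset)
qed

lemma finite_PGL_groupI:
  assumes "finite S" "card S \<ge> 3" "\<And>\<alpha>. \<alpha> \<in> H \<Longrightarrow> \<alpha> \<in> PGL" "\<And>\<alpha>. \<alpha> \<in> H \<Longrightarrow> \<alpha> ` S = S" "id \<in> H"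
    "\<And>\<gamma> \<delta>. \<gamma> \<in> H \<Longrightarrow> \<delta> \<in> H \<Longrightarrow> \<gamma> \<circ> \<delta> \<in> H" "\<And>\<gamma>. \<gamma> \<in> H \<Longrightarrow> inv_into UNIV \<gamma> \<in> H"
  shows "finite_PGL_group H"
proof -
  have "H \<subseteq> {\<alpha> \<in> PGL. \<alpha> ` S = S}" using assms(3,4) by blast
  then have "finite H" using finite_Stab[OF assms(1,2)] finite_subset by blast
  then show ?thesis by (rule finite_PGL_group.intro[OF _ assms(3,5-7)])
qed

lemma finite_PGL_group_Stab:
  fixes S :: "'a::{alg_closed_field,field_gcd} option set"
  assumes "finite S" "card S \<ge> 3"
  shows "finite_PGL_group {\<alpha> \<in> PGL. \<alpha> ` S = S}"
proof (rule finite_PGL_groupI[OF assms])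
  fix \<gamma> \<delta> assume gd: "\<gamma> \<in> {\<alpha> \<in> PGL. \<alpha> ` S = S}" "\<delta> \<in> {\<alpha> \<in> PGL. \<alpha> ` S = S}"
  have "(\<gamma> \<circ> \<delta>) ` S = \<gamma> ` \<delta> ` S" by (rule image_comp[symmetric])
  also have "\<dots> = S" using gd by simp
  finally have "(\<gamma> \<circ> \<delta>) ` S = S" .
  moreover have "\<gamma> \<circ> \<delta> \<in> PGL" using gd by (intro PGL_comp) simp_all
  ultimately show "\<gamma> \<circ> \<delta> \<in> {\<alpha> \<in> PGL. \<alpha> ` S = S}" by blast
next
  fix \<gamma> assume g: "\<gamma> \<in> {\<alpha> \<in> PGL. \<alpha> ` S = S}"
  then have "bij \<gamma>" "\<gamma> ` S = S" using PGL_bij by auto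
  then have "inv_into UNIV \<gamma> ` S = S" by (metis bij_is_inj image_inv_f_f)
  moreover have "inv_into UNIV \<gamma> \<in> PGL" using g by (intro PGL_inv) simp
  ultimately show "inv_into UNIV \<gamma> \<in> {\<alpha> \<in> PGL. \<alpha> ` S = S}" by blast
qed (simp_all add: PGL_id)

text \<open>Otherwise Cauchy's theorem yields an element of order p that preserves \<open>S\<close>,
  and this forces one of the two excluded residues of \<open>card S\<close>.\<close>

lemma regular_group_Stab:
  fixes S :: "'a::{alg_closed_field,field_gcd} option set"
  assumes "finite S" "card S \<ge> 3" "of_nat (card S) \<noteq> (0::'a)" "of_nat (card S) \<noteq> (1::'a)"
  shows "regular_group {\<alpha> \<in> PGL. \<alpha> ` S = S}"
proof -
  define H where "H = {\<alpha> \<in> PGL. \<alpha> ` S = S}"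
  have H: "\<alpha> \<in> H \<longleftrightarrow> \<alpha> \<in> PGL \<and> \<alpha> ` S = S" for \<alpha> by (simp add: H_def)
  interpret H: finite_PGL_group H unfolding H_def by (rule finite_PGL_group_Stab[OF assms(1,2)])
  have "of_nat (card H) \<noteq> (0::'a)"
  proof
    assume "of_nat (card H) = (0::'a)"
    then have dv: "CHAR('a) dvd card H" by (simp add: of_nat_eq_0_iff_char_dvd)
    then have pos: "CHAR('a) > 0" using dvd_pos_nat H.card_pos by blast
    obtain h where h: "h \<in> H" "h \<noteq> id" "h ^^ CHAR('a) = id"
      using subgroup_PGL_cauchy[OF H.subgroup_PGL H.finite_group prime_CHAR_semidom[OF pos] dv] by blast
    then show False using order_char_invariant_set[of h S] pos assms by (simp add: H)
  qed
  then have "regular_group H"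
    using H.finite_PGL_group_axioms by (simp add: regular_group_def regular_group_axioms_def)
  then show ?thesis by (simp only: H_def)
qed

context regular_group
begin

definition exceptional :: bool where
  "exceptional \<longleftrightarrow> card \<Gamma> = 12 \<and> orbit_type 2 3 3 \<or> card \<Gamma> = 24 \<and> orbit_type 2 3 4 \<or> card \<Gamma> = 60 \<and> orbit_type 2 3 5"

lemma exceptional_stab:
  assumes exceptional
  shows "card \<Gamma> = 12 \<Longrightarrow> card (stab P) \<le> 3" "card \<Gamma> = 24 \<Longrightarrow> card (stab P) \<le> 4" "card \<Gamma> = 60 \<Longrightarrow> card (stab P) \<le> 5"
proof -
  have *: "card (stab P) \<in> {a, b, c}" if "orbit_type a b c" "card (stab P) \<ge> 2" for a b c
    using orbit_type_stab[OF that(1)] that(2) by (simp add: special_def)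
  show "card \<Gamma> = 12 \<Longrightarrow> card (stab P) \<le> 3" using assms *[of 2 3 3] by (fastforce simp: exceptional_def)
  show "card \<Gamma> = 24 \<Longrightarrow> card (stab P) \<le> 4" using assms *[of 2 3 4] by (fastforce simp: exceptional_def)
  show "card \<Gamma> = 60 \<Longrightarrow> card (stab P) \<le> 5" using assms *[of 2 3 5] by (fastforce simp: exceptional_def)
qed

lemma exceptional_card: "exceptional \<Longrightarrow> card \<Gamma> = 12 \<or> card \<Gamma> = 24 \<or> card \<Gamma> = 60"
  by (auto simp: exceptional_def)

lemma exceptional_orb:
  assumes exceptional
  shows "card (orb P) > 2"
proof (rule ccontr)
  assume "\<not> card (orb P) > 2"
  then have "card (orb P) * card (stab P) \<le> 2 * card (stab P)" by simp
  then have "card \<Gamma> \<le> 2 * card (stab P)" by (simp add: orbit_stabilizer)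
  then show False using exceptional_card[OF assms] exceptional_stab[OF assms, of P] by auto
qed

text \<open>The first two alternatives of the classification each provide an orbit of at most two
  points.\<close>

lemma exceptionalI:
  assumes "\<And>P. card (orb P) > 2"
  shows exceptional
proof -
  have "\<not> (\<forall>\<gamma>\<in>\<Gamma>. \<gamma> P = P)" for P
  proof
    assume "\<forall>\<gamma>\<in>\<Gamma>. \<gamma> P = P"
    then have "orb P \<subseteq> {P}" by (auto simp: orb_def)
    then have "card (orb P) \<le> card {P}" by (intro card_mono) auto
    then show False using assms[of P] by simp
  qed
  then show ?thesis using classification assms unfolding exceptional_def by (metis less_irrefl)
qed

text \<open>The stabilizer H of \<open>S\<close> contains \<open>\<Gamma>\<close>, so it has no
  orbit of size at most 2 and is itself exceptional. Since \<open>S\<close> is still one orbit, the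
  order of H is \<open>card S\<close> times a stabilizer order, and that is at most 4 for order 24
  and 5 for order 60. Growth from 12 to 24 or 60 would need 6 or 15, and growth from 24 to 60 fails
  because 8 * 5 < 60.\<close>

lemma Stab_exceptional:
  assumes ex: exceptional and S: "S = orb Q"
    and c: "of_nat (card S) \<noteq> (0::'a)" "of_nat (card S) \<noteq> (1::'a)"
    and s: "card \<Gamma> = 12 \<Longrightarrow> card S = 4" "card \<Gamma> = 24 \<Longrightarrow> card S \<le> 8"
  shows "{\<alpha> \<in> PGL. \<alpha> ` S = S} = \<Gamma>"
proof -
  define H where "H = {\<alpha> \<in> PGL. \<alpha> ` S = S}"
  have fin: "finite S" "card S \<ge> 3" using finite_orb exceptional_orb[OF ex, of Q] by (auto simp: S)
  interpret H: regular_group H unfolding H_def by (rule regular_group_Stab[OF fin c])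
  have sub: "\<Gamma> \<subseteq> H" unfolding H_def S using in_PGL orb_invariant by blast
  have "card (H.orb P) > 2" for P
  proof -
    have "orb P \<subseteq> H.orb P" using sub by (auto simp: orb_def H.orb_def)
    then have "card (orb P) \<le> card (H.orb P)" by (intro card_mono H.finite_orb)
    then show ?thesis using exceptional_orb[OF ex, of P] by simp
  qed
  then have exH: "H.exceptional" by (rule H.exceptionalI)
  have "\<gamma> Q \<in> S" if "\<gamma> \<in> H" for \<gamma>
    using that orb_self[of Q] S by (auto simp: H_def)
  then have "H.orb Q \<subseteq> S" unfolding H.orb_def by blast
  moreover have "S \<subseteq> H.orb Q"
  proof
    fix x assume "x \<in> S"
    then have "x \<in> orb Q" using S by simp
    then obtain \<gamma> where "\<gamma> \<in> \<Gamma>" "x = \<gamma> Q" unfolding orb_def by blast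
    then show "x \<in> H.orb Q" unfolding H.orb_def using sub by blast
  qed
  ultimately have "H.orb Q = S" by blast
  then have os: "card S * card (H.stab Q) = card H" using H.orbit_stabilizer[of Q] by simp
  have le: "card \<Gamma> \<le> card H" by (rule card_mono[OF H.finite_group sub])
  have "card H \<le> card \<Gamma>"
  proof (rule ccontr)
    assume "\<not> card H \<le> card \<Gamma>"
    then consider "card \<Gamma> = 12" "card H = 24" | "card \<Gamma> = 12" "card H = 60" | "card \<Gamma> = 24" "card H = 60"
      using exceptional_card[OF ex] H.exceptional_card[OF exH] by linarith
    then show False
    proof cases
      case 1
      then show ?thesis using os s(1) H.exceptional_stab(2)[OF exH, of Q] by simp
    next
      case 2
      then show ?thesis using os s(1) H.exceptional_stab(3)[OF exH, of Q] by simp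
    next
      case 3
      have "card S * card (H.stab Q) \<le> 8 * 5"
        by (rule mult_le_mono[OF s(2)[OF 3(1)] H.exceptional_stab(3)[OF exH 3(2)]])
      then show ?thesis using os 3 by simp
    qed
  qed
  then have "\<Gamma> = H" by (rule card_seteq[OF H.finite_group sub])
  then show ?thesis by (simp only: H_def)
qed

text \<open>For order 12 the 4 vertices work, as 4 - 1 = 3 divides the order. For order 24 the 6
  vertices fail only if 6 = 1; then 8 = 1 would give 2 = 0. For order 60 the 12 vertices fail only
  if 12 = 1; then 20 = 1 would give 8 = 0.\<close>

lemma exceptional_good_orbit:
  assumes ex: exceptional
  obtains Q where "of_nat (card (orb Q)) \<noteq> (0::'a)" "of_nat (card (orb Q)) \<noteq> (1::'a)"
    "card \<Gamma> = 12 \<Longrightarrow> card (orb Q) = 4" "card \<Gamma> = 24 \<Longrightarrow> card (orb Q) \<le> 8"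
proof -
  have nz: "of_nat n \<noteq> (0::'a)" if "n dvd card \<Gamma>" for n
    using that regular by (metis dvdE mult_zero_left of_nat_mult)
  have orbc: "card (orb Q) = k" if "card (stab Q) = m" "k * m = card \<Gamma>" "m > 0" for Q k m
    using orbit_stabilizer[of Q] that by (metis mult_cancel2 not_gr_zero)
  consider "card \<Gamma> = 12" "orbit_type 2 3 3" | "card \<Gamma> = 24" "orbit_type 2 3 4" | "card \<Gamma> = 60" "orbit_type 2 3 5"
    using ex unfolding exceptional_def by blast
  then show ?thesis
  proof cases
    case 1
    then obtain Q where Q: "card (stab Q) = 3" unfolding orbit_type_def by blast
    have "card (orb Q) = 4" using orbc[OF Q, of 4] 1 by simp
    moreover have "(4::'a) - 1 = 3" by simp
    then have "(4::'a) \<noteq> 0" "(4::'a) \<noteq> 1" using nz[of 4] nz[of 3] 1 by force+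
    ultimately show ?thesis using that[of Q] 1 by simp
  next
    case 2
    then obtain Q R where Q: "card (stab Q) = 4" "card (stab R) = 3" unfolding orbit_type_def by blast
    have o: "card (orb Q) = 6" "card (orb R) = 8" using orbc[OF Q(1), of 6] orbc[OF Q(2), of 8] 2 by simp_all
    have n: "(6::'a) \<noteq> 0" "(8::'a) \<noteq> 0" "(2::'a) \<noteq> 0" using nz[of 6] nz[of 8] nz[of 2] 2 by auto
    show ?thesis
    proof (cases "(6::'a) = 1")
      case True
      have "(8::'a) \<noteq> 1"
      proof
        assume "(8::'a) = 1"
        have "(2::'a) = 8 - 6" by simp
        also have "\<dots> = 1 - 1" by (simp only: True \<open>(8::'a) = 1\<close>)
        finally show False using n(3) by simp
      qed
      then show ?thesis using that[of R] 2 o n by simp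
    next
      case False
      then show ?thesis using that[of Q] 2 o n by simp
    qed
  next
    case 3
    then obtain Q R where Q: "card (stab Q) = 5" "card (stab R) = 3" unfolding orbit_type_def by blast
    have o: "card (orb Q) = 12" "card (orb R) = 20" using orbc[OF Q(1), of 12] orbc[OF Q(2), of 20] 3 by simp_all
    have n: "(12::'a) \<noteq> 0" "(20::'a) \<noteq> 0" "(8::'a) \<noteq> 0"
    proof -
      have "(2::'a) * 2 * 2 \<noteq> 0" using nz[of 2] 3 by (simp only: mult_eq_0_iff) simp
      then show "(8::'a) \<noteq> 0" by simp
    qed (use nz[of 12] nz[of 20] 3 in auto)
    show ?thesis
    proof (cases "(12::'a) = 1")
      case True
      have "(20::'a) \<noteq> 1"
      proof
        assume "(20::'a) = 1"
        have "(8::'a) = 20 - 12" by simp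
        also have "\<dots> = 1 - 1" by (simp only: True \<open>(20::'a) = 1\<close>)
        finally show False using n(3) by simp
      qed
      then show ?thesis using that[of R] 3 o n by simp
    next
      case False
      then show ?thesis using that[of Q] 3 o n by simp
    qed
  qed
qed

theorem exceptional_realization:
  assumes ex: exceptional
  obtains f :: "'a poly fract" where "Aut f = \<Gamma>" "rat_degree f \<ge> 2" "card \<Gamma> = 12 \<Longrightarrow> rat_degree f = 3"
proof -
  obtain Q where Q: "of_nat (card (orb Q)) \<noteq> (0::'a)" "of_nat (card (orb Q)) \<noteq> (1::'a)"
    "card \<Gamma> = 12 \<Longrightarrow> card (orb Q) = 4" "card \<Gamma> = 24 \<Longrightarrow> card (orb Q) \<le> 8"
    using exceptional_good_orbit[OF ex] by metis
  have c3: "card (orb Q) > 2" by (rule exceptional_orb[OF ex])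
  then have c2: "card (orb Q) \<ge> 2" by simp
  have "Aut (bary_map (orb Q)) = \<Gamma>"
    using Aut_bary[OF finite_orb c2 Q(1)] Stab_exceptional[OF ex refl Q] by simp
  then show ?thesis using that[of "bary_map (orb Q)"] rat_degree_bary[OF finite_orb c2 Q(1)] c3 Q(3) by simp
qed

lemma exceptional_iso:
  assumes exceptional
  shows "card \<Gamma> = 12 \<Longrightarrow> subgrp \<Gamma> \<cong> alt_group 4" "card \<Gamma> = 24 \<Longrightarrow> subgrp \<Gamma> \<cong> sym_group 4"
    "card \<Gamma> = 60 \<Longrightarrow> subgrp \<Gamma> \<cong> alt_group 5"
  using assms tetrahedral_iso octahedral_iso icosahedral_iso by (auto simp: exceptional_def)

end

section \<open>Existence of the exceptional groups\<close>

text \<open>Induction by splitting off a prime \<open>q\<close>, with \<open>n = q * m\<close>. If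
  \<open>q\<close> divides \<open>m\<close>, a \<open>q\<close>-th root of a primitive
  \<open>m\<close>-th root is primitive of order \<open>n\<close>. Otherwise the orders are coprime
  and a nontrivial \<open>q\<close>-th root of unity is multiplied on.\<close>

lemma primitive_root_exists:
  assumes "of_nat n \<noteq> (0::'a::alg_closed_field)"
  shows "\<exists>\<zeta>::'a. \<forall>k. \<zeta> ^ k = 1 \<longleftrightarrow> n dvd k"
  using assms
proof (induction n rule: less_induct)
  case (less n)
  then have n0: "n > 0" by (cases n) auto
  show ?case
  proof (cases "n = 1")
    case True
    then show ?thesis by (intro exI[of _ 1]) simp
  next
    case False
    then obtain q where q: "Factorial_Ring.prime q" "q dvd n" using prime_factor_nat by blast
    then obtain m where m: "n = q * m" by (auto elim: dvdE)
    have q2: "q \<ge> 2" using q(1) by (rule prime_ge_2_nat)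
    have qm: "of_nat q \<noteq> (0::'a)" "of_nat m \<noteq> (0::'a)" using less.prems m by auto
    have "m < n" using m n0 q2 by simp
    then obtain \<zeta> :: 'a where \<zeta>: "\<And>k. \<zeta> ^ k = 1 \<longleftrightarrow> m dvd k" using less.IH qm(2) by blast
    show ?thesis
    proof (cases "q dvd m")
      case True
      obtain \<xi> where \<xi>: "\<xi> ^ q = \<zeta>" using nth_root_exists[of q \<zeta>] q2 by auto
      have "\<xi> ^ k = 1 \<longleftrightarrow> n dvd k" for k
      proof
        assume k: "\<xi> ^ k = 1"
        have "\<zeta> ^ k = (\<xi> ^ k) ^ q" by (simp add: \<xi>[symmetric] power_mult[symmetric] mult.commute)
        then have "m dvd k" using k \<zeta> by simp
        then obtain l where l: "k = q * l" using True by (meson dvd_trans dvdE)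
        then have "\<zeta> ^ l = 1" using k by (simp add: power_mult \<xi>)
        then show "n dvd k" using \<zeta> m l by simp
      next
        assume "n dvd k"
        then obtain l where "k = n * l" by (elim dvdE)
        then have "k = q * (m * l)" using m by (simp add: mult.assoc)
        then have "\<xi> ^ k = \<zeta> ^ (m * l)" by (simp add: power_mult \<xi>)
        then show "\<xi> ^ k = 1" using \<zeta> by simp
      qed
      then show ?thesis by blast
    next
      case False
      \<comment> \<open>A root of 1 + X + ... + X^(q-1). At X = 1 this polynomial has the value
        \<open>q\<close>, which is nonzero in the field, so the root is not 1.\<close>
      obtain \<eta> :: 'a where \<eta>: "(\<Sum>i\<le>q - 1. 1 * \<eta> ^ i) = 0"
        using alg_closed[of "q - 1" "\<lambda>_. 1"] q2 by auto
      have \<eta>1: "\<eta> \<noteq> 1"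
      proof
        assume "\<eta> = 1"
        then have "of_nat (q - 1) + 1 = (0::'a)" using \<eta> by (simp add: add.commute)
        then show False using qm(1) q2 by (metis One_nat_def Suc_diff_1 of_nat_Suc add.commute zero_less_iff_neq_zero not_numeral_le_zero)
      qed
      have "\<eta> ^ q = 1"
      proof -
        have "{..q - 1} = {..<q}" using q2 by auto
        then have "(\<Sum>i<q. \<eta> ^ i) = 0" using \<eta> by simp
        then show ?thesis using one_diff_power_eq[of \<eta> q] by simp
      qed
      have \<eta>: "\<eta> ^ k = 1 \<longleftrightarrow> q dvd k" for k
      proof
        assume k: "\<eta> ^ k = 1"
        show "q dvd k"
        proof (rule ccontr)
          assume "\<not> q dvd k"
          then have "coprime q k" using q(1) by (simp add: prime_imp_coprime)
          then have "coprime k q" by (simp add: coprime_commute)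
          moreover have "k \<noteq> 0" using \<open>\<not> q dvd k\<close> by (metis dvd_0_right)
          ultimately obtain u v where "k * u = q * v + 1" using coprime_bezout_strong[of k q] q2 by auto
          then have "\<eta> ^ (k * u) = \<eta> ^ (q * v) * \<eta>" by (simp add: power_add)
          then show False using k \<open>\<eta> ^ q = 1\<close> \<eta>1 by (simp add: power_mult)
        qed
      qed (use \<open>\<eta> ^ q = 1\<close> in \<open>auto elim!: dvdE simp: power_mult\<close>)
      have cop: "coprime q m" using q(1) False by (simp add: prime_imp_coprime)
      have "(\<zeta> * \<eta>) ^ k = 1 \<longleftrightarrow> n dvd k" for k
      proof
        assume k: "(\<zeta> * \<eta>) ^ k = 1"
        have "\<eta> ^ (k * q) = 1" using \<eta> by simp
        then have "\<zeta> ^ (k * q) = ((\<zeta> * \<eta>) ^ k) ^ q" by (simp add: power_mult_distrib flip: power_mult)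
        then have "m dvd k * q" using k \<zeta> by simp
        then have mk: "m dvd k" using cop by (simp add: coprime_commute coprime_dvd_mult_left_iff)
        then have "\<zeta> ^ k = 1" using \<zeta> by blast
        then have "\<eta> ^ k = 1" using k by (simp add: power_mult_distrib)
        then show "n dvd k" using \<eta> mk cop m by (simp add: divides_mult)
      next
        assume "n dvd k"
        then have "q dvd k" "m dvd k" using m by (auto dest: dvd_mult_left dvd_mult_right)
        then have "\<zeta> ^ k = 1" "\<eta> ^ k = 1" using \<zeta> \<eta> by blast+
        then show "(\<zeta> * \<eta>) ^ k = 1" by (simp add: power_mult_distrib)
      qed
      then show ?thesis by blast
    qed
  qed
qed

lemma primitive_root_powers:
  fixes \<zeta> :: "'a::field"
  assumes "\<And>k. \<zeta> ^ k = 1 \<longleftrightarrow> n dvd k" "n > 0"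
  shows "inj_on (\<lambda>k. \<zeta> ^ k) {..<n}" "{a. a ^ n = 1} = (\<lambda>k. \<zeta> ^ k) ` {..<n}" "card {a::'a. a ^ n = 1} = n"
proof -
  have z0: "\<zeta> \<noteq> 0" using assms(1)[of n] assms(2) by (auto simp: zero_power)
  have *: "i = j" if "\<zeta> ^ i = \<zeta> ^ j" "i \<le> j" "j < n" for i j
  proof -
    have "\<zeta> ^ j = \<zeta> ^ i * \<zeta> ^ (j - i)" using that(2) by (simp flip: power_add)
    then have "\<zeta> ^ (j - i) = 1" using that(1) z0 by simp
    then have "n dvd j - i" using assms(1) by simp
    then show ?thesis using that(2,3) by (metis diff_is_0_eq diff_less_Suc dvd_imp_le le_antisym less_le_trans not_less neq0_conv zero_less_diff less_imp_diff_less)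
  qed
  show inj: "inj_on (\<lambda>k. \<zeta> ^ k) {..<n}"
  proof (rule inj_onI)
    fix i j assume "i \<in> {..<n}" "j \<in> {..<n}" "\<zeta> ^ i = \<zeta> ^ j"
    then show "i = j" using *[of i j] *[of j i] by (cases "i \<le> j") auto
  qed
  have "(\<zeta> ^ k) ^ n = 1" for k using assms(1)[of "k * n"] by (simp add: power_mult)
  then have sub: "(\<lambda>k. \<zeta> ^ k) ` {..<n} \<subseteq> {a. a ^ n = 1}" by auto
  have c: "card ((\<lambda>k. \<zeta> ^ k) ` {..<n}) = n" using card_image[OF inj] by simp
  show eq: "{a. a ^ n = 1} = (\<lambda>k. \<zeta> ^ k) ` {..<n}"
    using card_seteq[OF card_roots_of_unity_le(1)[OF assms(2)] sub] card_roots_of_unity_le(2)[OF assms(2), where ?'a = 'a] c by simp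
  show "card {a::'a. a ^ n = 1} = n" using c by (simp add: eq)
qed

lemma card_roots_of_unity:
  assumes "of_nat n \<noteq> (0::'a::alg_closed_field)"
  shows "card {a::'a. a ^ n = 1} = n"
proof -
  have "n > 0" using assms by (cases n) auto
  then show ?thesis using primitive_root_exists[OF assms] primitive_root_powers(3) by blast
qed

text \<open>Outside infinity and 0 the scaling alone produces three points in each orbit, because
  \<open>a ^ 2 \<noteq> 1\<close>. From infinity and from 0 the element \<open>\<beta>\<close> leads
  to such a point.\<close>

lemma (in regular_group) exceptional_criterion:
  assumes "scale a \<in> \<Gamma>" "a \<noteq> 0" "a ^ 2 \<noteq> 1" "\<beta> \<in> \<Gamma>" "\<beta> None = Some b" "b \<noteq> 0" "\<beta> (Some 0) = Some c" "c \<noteq> 0"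
  shows exceptional
proof (rule exceptionalI)
  fix P
  have a1: "a \<noteq> 1" using assms(3) by auto
  have three: "card (orb P) > 2" if "{x, y, z} \<subseteq> orb P" "x \<noteq> y" "x \<noteq> z" "y \<noteq> z" for x y z
    using card_mono[OF finite_orb that(1)] that(2-4) by simp
  have sc: "scale a x \<in> orb P" if "x \<in> orb P" for x using orb_closed[OF that assms(1)] .
  have bc: "\<beta> x \<in> orb P" if "x \<in> orb P" for x using orb_closed[OF that assms(4)] .
  show "card (orb P) > 2"
  proof (cases P)
    case None
    have "Some b \<in> orb P" using bc[OF orb_self] None assms(5) by simp
    then show ?thesis using three[of None "Some b" "Some (a * b)"] sc[of "Some b"] orb_self[of P] None a1 assms(6) by simp
  next
    case (Some t)
    show ?thesis
    proof (cases "t = 0")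
      case True
      have "Some c \<in> orb P" using bc[OF orb_self] Some True assms(7) by simp
      then show ?thesis
        using three[of "Some 0" "Some c" "Some (a * c)"] sc[of "Some c"] orb_self[of P] Some True a1 assms(2,8) by simp
    next
      case False
      have "Some (a * t) \<in> orb P" "Some (a * (a * t)) \<in> orb P"
        using sc[OF orb_self] sc[OF sc[OF orb_self]] Some by simp_all
      moreover have "a * (a * t) \<noteq> t" using assms(3) False by (simp add: power2_eq_square flip: mult.assoc)
      ultimately show ?thesis
        using three[of "Some t" "Some (a * t)" "Some (a * (a * t))"] orb_self[of P] Some False a1 assms(2) by simp
    qed
  qed
qed

lemma image_subset_card_eq:
  assumes "finite S" "\<alpha> ` S \<subseteq> S" "inj \<alpha>"
  shows "\<alpha> ` S = S"
  using assms by (meson card_image card_subset_eq inj_on_subset subset_UNIV)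

text \<open>The vertices are infinity and the three cube roots of unity. The scaling by
  \<open>w\<close> and an involution exchanging the vertices in two pairs already make the
  stabilizer exceptional.\<close>

lemma tetrahedral_exists:
  assumes "(2::'a::{alg_closed_field,field_gcd}) \<noteq> 0" "(3::'a) \<noteq> 0"
  shows "\<exists>\<Gamma> :: ('a option \<Rightarrow> 'a option) set. regular_group \<Gamma> \<and> regular_group.exceptional \<Gamma> \<and> card \<Gamma> = 12"
proof -
  obtain w :: 'a where "(\<Sum>k\<le>2. 1 * w ^ k) = 0" using alg_closed[of 2 "\<lambda>_. 1"] by auto
  then have w: "w\<^sup>2 = - w - 1" by (simp add: eval_nat_numeral algebra_simps eq_neg_iff_add_eq_0)
  then have ww: "w * w = - w - 1" by (simp add: power2_eq_square)
  have w1: "w \<noteq> 1"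
  proof
    assume "w = 1"
    then have "(3::'a) = 0" using w by (simp add: eq_neg_iff_add_eq_0)
    then show False using assms by simp
  qed
  have wm2: "w \<noteq> - 2"
  proof
    assume "w = - 2"
    then have 4: "(4::'a) = 1" using ww by simp
    have "(3::'a) = 4 - 1" by simp
    also have "\<dots> = 0" by (simp only: 4 diff_self)
    finally have "(3::'a) = 0" .
    then show False using assms by simp
  qed
  have w0: "w \<noteq> 0" using ww by auto
  have w21: "w\<^sup>2 \<noteq> 1"
  proof
    assume "w\<^sup>2 = 1"
    then have h: "- w - 1 = 1" using w by simp
    have "w = - (- w - 1) - 1" by simp
    also have "\<dots> = - 2" by (simp only: h) simp
    finally show False using wm2 by simp
  qed
  have w2w: "w\<^sup>2 \<noteq> w" using w1 w0 by (simp add: power2_eq_square)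
  define S where "S = {None, Some 1, Some w, Some (w\<^sup>2)}"
  have S: "finite S" "card S = 4" using w1 w21 w2w by (auto simp: S_def)
  have "(4::'a) = 3 + 1" by simp
  then have c: "of_nat (card S) \<noteq> (0::'a)" "of_nat (card S) \<noteq> (1::'a)"
  proof -
    have "(2::'a) * 2 \<noteq> 0" using assms by (simp only: mult_eq_0_iff) simp
    then show "of_nat (card S) \<noteq> (0::'a)" by (simp add: S)
    show "of_nat (card S) \<noteq> (1::'a)" unfolding S using assms(2) \<open>(4::'a) = 3 + 1\<close>
      by (metis add_cancel_left_left of_nat_numeral)
  qed
  define \<Gamma> where "\<Gamma> = {\<alpha> \<in> PGL. \<alpha> ` S = S}"
  interpret regular_group \<Gamma> unfolding \<Gamma>_def by (rule regular_group_Stab) (use S c in auto)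
  have \<Gamma>I: "\<alpha> \<in> \<Gamma>" if "\<alpha> \<in> PGL" "\<alpha> ` S \<subseteq> S" for \<alpha>
    using that image_subset_card_eq[OF S(1) that(2)] PGL_bij bij_is_inj by (auto simp: \<Gamma>_def)
  \<comment> \<open>An involution exchanging infinity and 1 has the form
    \<open>(z + b) / (z - 1)\<close>; it exchanges \<open>w\<close> and its square exactly for
    \<open>b = 2\<close>.\<close>
  define \<beta> where "\<beta> = moebius 1 2 1 (- 1 :: 'a)"
  have "- 1 - 2 \<noteq> (0::'a)" using assms(2) by (simp add: algebra_simps)
  then have \<beta>P: "\<beta> \<in> PGL" unfolding \<beta>_def by (intro PGL_moebius) simp
  have "w - 1 \<noteq> 0" "w\<^sup>2 - 1 \<noteq> 0" using w1 w21 by simp_all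
  moreover have "(w + 2) = w\<^sup>2 * (w - 1)" "w\<^sup>2 + 2 = w * (w\<^sup>2 - 1)"
    unfolding w by (simp_all add: algebra_simps ww)
  ultimately have \<beta>: "\<beta> None = Some 1" "\<beta> (Some 0) = Some (- 2)" "\<beta> (Some 1) = None"
    "\<beta> (Some w) = Some (w\<^sup>2)" "\<beta> (Some (w\<^sup>2)) = Some w"
    by (simp_all add: \<beta>_def moebius_def proj_point_def)
  have b: "\<beta> \<in> \<Gamma>" by (rule \<Gamma>I[OF \<beta>P]) (simp add: S_def \<beta>)
  have "w * w\<^sup>2 = 1" unfolding w by (simp add: algebra_simps ww)
  then have s: "scale w \<in> \<Gamma>" by (intro \<Gamma>I[OF PGL_scale[OF w0]]) (simp add: S_def power2_eq_square)
  have ex: exceptional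
    by (rule exceptional_criterion[OF s w0 w21 b \<beta>(1) _ \<beta>(2)]) (use assms in auto)
  have "orb None = S"
  proof
    show "orb None \<subseteq> S"
    proof
      fix x assume "x \<in> orb None"
      then obtain \<alpha> where "\<alpha> \<in> \<Gamma>" and x: "x = \<alpha> None" unfolding orb_def by blast
      then have "\<alpha> ` S = S" by (simp add: \<Gamma>_def)
      moreover have "None \<in> S" by (simp add: S_def)
      ultimately show "x \<in> S" using x by blast
    qed
    have "Some 1 \<in> orb None" using orb_closed[OF orb_self b] \<beta>(1) by metis
    moreover from this have "Some w \<in> orb None" using orb_closed[OF _ s] by (metis mult.right_neutral scale_simps(2))
    moreover from this have "Some (w\<^sup>2) \<in> orb None" using orb_closed[OF _ s] by (metis power2_eq_square scale_simps(2))
    ultimately show "S \<subseteq> orb None" using orb_self by (simp add: S_def)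
  qed
  then have "4 * card (stab None) = card \<Gamma>" using orbit_stabilizer[of None] S by simp
  \<comment> \<open>Order 24 or 60 would need a point stabilizer of order 6 or 15.\<close>
  then have "card \<Gamma> = 12" using exceptional_card[OF ex] exceptional_stab[OF ex, of None] by auto
  then show ?thesis using ex regular_group_axioms by blast
qed

text \<open>
  The octahedral and the icosahedral group are the groups that permute the 3 pairs of opposite
  vertices of an octahedron, respectively the 6 pairs of opposite vertices of an icosahedron.
\<close>

lemma finite_PGL_group_pairs:
  fixes \<P> :: "'a::{alg_closed_field,field_gcd} option set set"
  assumes "finite \<P>" "finite (\<Union>\<P>)" "card (\<Union>\<P>) \<ge> 3"
  shows "finite_PGL_group {\<alpha> \<in> PGL. (`) \<alpha> ` \<P> = \<P>}"
proof (rule finite_PGL_groupI[OF assms(2,3)])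
  fix \<alpha> :: "'a option \<Rightarrow> 'a option" assume "\<alpha> \<in> {\<alpha> \<in> PGL. (`) \<alpha> ` \<P> = \<P>}"
  then have eq: "(`) \<alpha> ` \<P> = \<P>" by simp
  have "\<alpha> ` \<Union>\<P> = \<Union>((`) \<alpha> ` \<P>)" by blast
  then show "\<alpha> ` \<Union>\<P> = \<Union>\<P>" by (simp add: eq)
next
  fix \<gamma> \<delta> :: "'a option \<Rightarrow> 'a option"
  assume gd: "\<gamma> \<in> {\<alpha> \<in> PGL. (`) \<alpha> ` \<P> = \<P>}" "\<delta> \<in> {\<alpha> \<in> PGL. (`) \<alpha> ` \<P> = \<P>}"
  have "(`) (\<gamma> \<circ> \<delta>) ` \<P> = (`) \<gamma> ` (`) \<delta> ` \<P>" by (simp add: image_image image_comp)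
  also have "\<dots> = \<P>" using gd by simp
  finally have "(`) (\<gamma> \<circ> \<delta>) ` \<P> = \<P>" .
  moreover have "\<gamma> \<circ> \<delta> \<in> PGL" using gd by (intro PGL_comp) simp_all
  ultimately show "\<gamma> \<circ> \<delta> \<in> {\<alpha> \<in> PGL. (`) \<alpha> ` \<P> = \<P>}" by blast
next
  fix \<gamma> :: "'a option \<Rightarrow> 'a option" assume g: "\<gamma> \<in> {\<alpha> \<in> PGL. (`) \<alpha> ` \<P> = \<P>}"
  then have "inj \<gamma>" "(`) \<gamma> ` \<P> = \<P>" using PGL_bij bij_is_inj by auto
  then have "(`) (inv_into UNIV \<gamma>) ` \<P> = (`) (inv_into UNIV \<gamma>) ` (`) \<gamma> ` \<P>" by simp
  also have "\<dots> = \<P>" by (simp only: image_image) (simp add: inv_f_f[OF \<open>inj \<gamma>\<close>])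
  finally have "(`) (inv_into UNIV \<gamma>) ` \<P> = \<P>" .
  moreover have "inv_into UNIV \<gamma> \<in> PGL" using g by (intro PGL_inv) simp
  ultimately show "inv_into UNIV \<gamma> \<in> {\<alpha> \<in> PGL. (`) \<alpha> ` \<P> = \<P>}" by blast
qed (use PGL_id in \<open>auto simp: image_iff\<close>)

lemma pairs_group_memI:
  assumes "\<alpha> \<in> PGL" "finite \<P>" "\<And>A. A \<in> \<P> \<Longrightarrow> \<alpha> ` A \<in> \<P>"
  shows "\<alpha> \<in> {\<alpha> \<in> PGL. (`) \<alpha> ` \<P> = \<P>}"
proof -
  have "inj ((`) \<alpha>)" using PGL_bij[OF assms(1)] by (intro injI) (simp add: inj_image_eq_iff bij_is_inj)
  then have "(`) \<alpha> ` \<P> = \<P>" using assms(2,3) by (intro image_subset_card_eq) auto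
  then show ?thesis using assms(1) by simp
qed

text \<open>The vertices are infinity, 0 and the fourth roots of unity, opposite points being
  negatives of each other apart from infinity and 0. The order is computed as 6 vertices times 4
  scalings, and only then does regularity follow.\<close>

lemma octahedral_exists:
  assumes "(2::'a::{alg_closed_field,field_gcd}) \<noteq> 0" "(3::'a) \<noteq> 0"
  shows "\<exists>\<Gamma> :: ('a option \<Rightarrow> 'a option) set. regular_group \<Gamma> \<and> regular_group.exceptional \<Gamma> \<and> card \<Gamma> = 24"
proof -
  obtain i :: 'a where i: "i\<^sup>2 = - 1" using nth_root_exists[of 2 "- 1 :: 'a"] by auto
  then have ii: "i * i = - 1" by (simp add: power2_eq_square)
  have m1: "(1::'a) \<noteq> - 1" using assms(1) by (metis add.inverse_inverse add_eq_0_iff one_add_one)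
  have i0: "i \<noteq> 0" "i \<noteq> 1" "i \<noteq> - 1" using ii m1 by auto
  have ni: "i \<noteq> - i" using i0(1) assms(1) by (metis add_eq_0_iff mult_2 mult_eq_0_iff)
  define \<P> where "\<P> = {{None, Some 0}, {Some 1, Some (- 1)}, {Some i, Some (- i)}}"
  have S: "\<Union>\<P> = {None, Some 0, Some 1, Some (- 1), Some i, Some (- i)}" by (auto simp: \<P>_def)
  have d: "(1::'a) \<noteq> - 1" "1 \<noteq> i" "1 \<noteq> - i" "- 1 \<noteq> i" "- 1 \<noteq> - i" "i \<noteq> - i"
    using m1 i0 ni by (metis minus_minus)+
  have cS: "card (\<Union>\<P>) = 6" unfolding S using d i0 by simp
  have fin: "finite \<P>" "finite (\<Union>\<P>)" by (simp_all add: \<P>_def)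
  define \<Gamma> where "\<Gamma> = {\<alpha> \<in> PGL. (`) \<alpha> ` \<P> = \<P>}"
  interpret G: finite_PGL_group \<Gamma> unfolding \<Gamma>_def by (rule finite_PGL_group_pairs) (use fin cS in auto)
  \<comment> \<open>The quarter turn about the axis through \<open>i\<close> and \<open>- i\<close>;
    it runs through 0, 1, infinity and -1.\<close>
  define \<beta> where "\<beta> = moebius 1 1 (- 1) (1 :: 'a)"
  have \<beta>P: "\<beta> \<in> PGL" unfolding \<beta>_def using assms(1) by (intro PGL_moebius) simp
  have n: "1 - i \<noteq> 0" "1 + i \<noteq> 0" using i0 by (auto simp: add_eq_0_iff)
  have "1 + i = i * (1 - i)" "1 - i = - i * (1 + i)" by (simp_all add: algebra_simps ii)
  then have e: "(1 + i) / (1 - i) = i" "(1 - i) / (1 + i) = - i"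
    using n by (metis nonzero_mult_div_cancel_right)+
  have \<beta>: "\<beta> None = Some (- 1)" "\<beta> (Some 0) = Some 1" "\<beta> (Some 1) = None" "\<beta> (Some (- 1)) = Some 0"
    "\<beta> (Some i) = Some i" "\<beta> (Some (- i)) = Some (- i)"
    using assms(1) n e by (simp_all add: \<beta>_def moebius_def proj_point_def add.commute[of i])
  have b: "\<beta> \<in> \<Gamma>" unfolding \<Gamma>_def
    by (rule pairs_group_memI[OF \<beta>P fin(1)]) (auto simp: \<P>_def \<beta> insert_commute)
  have s: "scale i \<in> \<Gamma>" unfolding \<Gamma>_def
    by (rule pairs_group_memI[OF PGL_scale[OF i0(1)] fin(1)]) (auto simp: \<P>_def ii insert_commute)
  have s2: "scale (- 1) \<in> \<Gamma>" and s3: "scale (- i) \<in> \<Gamma>"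
    using G.comp_closed[OF s s] G.comp_closed[OF s G.comp_closed[OF s s]] by (simp_all add: scale_comp ii)
  have orbS: "G.orb None = \<Union>\<P>"
  proof
    show "G.orb None \<subseteq> \<Union>\<P>"
    proof
      fix x assume "x \<in> G.orb None"
      then obtain \<alpha> where "\<alpha> \<in> \<Gamma>" and x: "x = \<alpha> None" unfolding G.orb_def by blast
      then have \<alpha>: "(`) \<alpha> ` \<P> = \<P>" by (simp add: \<Gamma>_def)
      have "\<alpha> ` {None, Some 0} \<in> (`) \<alpha> ` \<P>" by (rule imageI) (simp add: \<P>_def)
      then show "x \<in> \<Union>\<P>" using \<alpha> x by auto
    qed
    have m: "Some (- 1) \<in> G.orb None" using G.orb_closed[OF G.orb_self b] \<beta>(1) by metis
    have "Some 0 \<in> G.orb None" using G.orb_closed[OF m b] \<beta>(4) by simp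
    moreover have "Some 1 \<in> G.orb None" "Some i \<in> G.orb None" "Some (- i) \<in> G.orb None"
      using G.orb_closed[OF m s2] G.orb_closed[OF m s] G.orb_closed[OF m s3] by simp_all
    ultimately show "\<Union>\<P> \<subseteq> G.orb None" using m G.orb_self[of None] by (simp add: S)
  qed
  have stab: "G.stab None = scale ` {1, - 1, i, - i}"
  proof
    show "G.stab None \<subseteq> scale ` {1, - 1, i, - i}"
    proof
      fix \<alpha> assume "\<alpha> \<in> G.stab None"
      then have "\<alpha> \<in> \<Gamma>" and None: "\<alpha> None = None" by (simp_all add: G.stab_def)
      then have \<alpha>: "\<alpha> \<in> PGL" "(`) \<alpha> ` \<P> = \<P>" "\<alpha> None = None" by (simp_all add: \<Gamma>_def)
      have "\<alpha> ` {None, Some 0} \<in> (`) \<alpha> ` \<P>" by (rule imageI) (simp add: \<P>_def)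
      then have "{None, \<alpha> (Some 0)} \<in> \<P>" using \<alpha> by simp
      then have "\<alpha> (Some 0) \<in> {None, Some 0}" by (auto simp: \<P>_def doubleton_eq_iff)
      moreover have "\<alpha> (Some 0) \<noteq> \<alpha> None" using PGL_bij[OF \<alpha>(1)] by (metis bij_pointE option.distinct(1))
      ultimately have "\<alpha> (Some 0) = Some 0" using \<alpha>(3) by auto
      then obtain a where a: "a \<noteq> 0" "\<alpha> = scale a" using PGL_fix_None_0[OF \<alpha>(1,3)] by metis
      have "\<alpha> ` {Some 1, Some (- 1)} \<in> (`) \<alpha> ` \<P>" by (rule imageI) (simp add: \<P>_def)
      then have "{Some a, Some (- a)} \<in> \<P>" using \<alpha> a by simp
      then have "a \<in> {1, - 1, i, - i}" by (auto simp: \<P>_def doubleton_eq_iff)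
      then show "\<alpha> \<in> scale ` {1, - 1, i, - i}" using a by blast
    qed
    show "scale ` {1, - 1, i, - i} \<subseteq> G.stab None" using s s2 s3 G.id_closed by (simp add: G.stab_def scale_1)
  qed
  have "card (scale ` {1, - 1, i, - i}) = card {1, - 1, i, - i}" by (rule card_image) (simp add: inj_on_def)
  also have "\<dots> = 4" using d by simp
  finally have c24: "card \<Gamma> = 24" using G.orbit_stabilizer[of None] cS by (simp add: orbS stab)
  have "(2::'a) * 2 * 2 * 3 \<noteq> 0" using assms by (simp only: mult_eq_0_iff) simp
  then have "of_nat (card \<Gamma>) \<noteq> (0::'a)" by (simp add: c24)
  then interpret regular_group \<Gamma> by unfold_locales
  have "i\<^sup>2 \<noteq> 1" using i m1 by simp
  then have exceptional
    by (rule exceptional_criterion[OF s i0(1) _ b \<beta>(1) _ \<beta>(2)]) auto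
  then show ?thesis using c24 regular_group_axioms by blast
qed

lemma moebius_Some_eq:
  assumes "c * t + d \<noteq> 0" "a * t + b = v * (c * t + d)"
  shows "moebius a b c d (Some t) = Some v"
  using assms by (simp add: moebius_def proj_point_def)

text \<open>Up to scaling these are the classical vertices: infinity, 0, and the products of fifth
  roots of unity with \<open>x + x^4\<close> and with \<open>x^2 + x^3\<close>. The vertex opposite
  to a root of unity \<open>u\<close> is \<open>r * u\<close>. The order is 12 vertices times 5
  scalings.\<close>

lemma icosahedral_exists:
  assumes "(2::'a::{alg_closed_field,field_gcd}) \<noteq> 0" "(3::'a) \<noteq> 0" "(5::'a) \<noteq> 0"
  shows "\<exists>\<Gamma> :: ('a option \<Rightarrow> 'a option) set. regular_group \<Gamma> \<and> regular_group.exceptional \<Gamma> \<and> card \<Gamma> = 60"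
proof -
  have "of_nat 5 \<noteq> (0::'a)" using assms(3) by simp
  then obtain x :: 'a where prim: "\<And>k. x ^ k = 1 \<longleftrightarrow> 5 dvd k" using primitive_root_exists[of 5] by blast
  define U where "U = {a::'a. a ^ 5 = 1}"
  have U: "U = (\<lambda>k. x ^ k) ` {..<5}" "card U = 5"
    unfolding U_def using primitive_root_powers[of x 5] prim by simp_all
  then have finU: "finite U" using card.infinite by fastforce
  have "{..<5} = {0,1,2,3,4::nat}" by auto
  then have Ux: "U = {1, x, x\<^sup>2, x ^ 3, x ^ 4}" using U(1) by simp
  have x5: "x ^ 5 = 1" using prim[of 5] by simp
  have xn: "x \<noteq> 1" "x\<^sup>2 \<noteq> 1" "x ^ 3 \<noteq> 1" "x ^ 4 \<noteq> 1"
    using prim[of 1] prim[of 2] prim[of 3] prim[of 4] by simp_all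
  have x0: "x \<noteq> 0" using x5 by auto
  have "(x - 1) * (1 + x + x\<^sup>2 + x ^ 3 + x ^ 4) = x ^ 5 - 1" by Groebner_Basis.algebra
  then have c5: "1 + x + x\<^sup>2 + x ^ 3 + x ^ 4 = 0" using x5 xn(1) by simp
  \<comment> \<open>The quotient of \<open>x + x^4\<close> by \<open>x^2 + x^3\<close>, simplified
    with the cyclotomic relation.\<close>
  define r where "r = x + x ^ 4 - 1"
  have r2: "r\<^sup>2 + 3 * r + 1 = 0" using c5 unfolding r_def by Groebner_Basis.algebra
  have r0: "r \<noteq> 0" using r2 by auto
  have r1: "r \<noteq> 1"
  proof
    assume "r = 1"
    then have "(5::'a) = 0" using r2 by simp
    then show False using assms(3) by simp
  qed
  have rm1: "r \<noteq> - 1"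
  proof
    assume "r = - 1"
    then show False using r2 by simp
  qed
  have r5: "r ^ 5 \<noteq> 1"
  proof
    assume h: "r ^ 5 = 1"
    \<comment> \<open>Reduction with the quadratic relation gives
      \<open>r ^ 5 = 55 * r + 21\<close>. Eliminating \<open>r\<close> between
      \<open>11 * r + 4\<close> and the quadratic then leaves 5 = 0. So both rings of vertices are
      disjoint.\<close>
    have "5 * (11 * r + 4) = 0" using r2 h by Groebner_Basis.algebra
    then have "(5::'a) = 0 \<or> 11 * r + 4 = 0" by (simp only: mult_eq_0_iff)
    then have "11 * r + 4 = 0" using assms(3) by blast
    moreover have "121 * (r\<^sup>2 + 3 * r + 1) - (11 * r + 29) * (11 * r + 4) = 5"
      by (simp add: algebra_simps power2_eq_square)
    ultimately have "(5::'a) = 0" using r2 by (simp only: mult_zero_right diff_self)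
    then show False using assms(3) by simp
  qed
  have rU: "r \<notin> U" using r5 by (simp add: U_def)
  have Um: "u * v \<in> U" if "u \<in> U" "v \<in> U" for u v using that by (simp add: U_def power_mult_distrib)
  have Ud: "u / v \<in> U" if "u \<in> U" "v \<in> U" for u v using that by (simp add: U_def power_divide)
  have U0: "u \<noteq> 0" if "u \<in> U" for u using that by (auto simp: U_def)
  have U1: "1 \<in> U" by (simp add: U_def)
  define pair where "pair u = {Some u, Some (r * u)}" for u
  define \<P> where "\<P> = insert {None, Some 0} (pair ` U)"
  have S: "\<Union>\<P> = {None, Some 0} \<union> (Some ` U \<union> (\<lambda>u. Some (r * u)) ` U)" by (auto simp: \<P>_def pair_def)
  have fin: "finite \<P>" "finite (\<Union>\<P>)" using finU by (simp_all add: \<P>_def pair_def)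
  have "card (Some ` U \<union> (\<lambda>u. Some (r * u)) ` U) = card (Some ` U) + card ((\<lambda>u. Some (r * u)) ` U)"
  proof (rule card_Un_disjoint)
    show "Some ` U \<inter> (\<lambda>u. Some (r * u)) ` U = {}"
    proof (rule ccontr)
      assume "Some ` U \<inter> (\<lambda>u. Some (r * u)) ` U \<noteq> {}"
      then obtain u v where uv: "u \<in> U" "v \<in> U" "u = r * v" by auto
      then have "r = u / v" using U0 by simp
      then show False using Ud uv rU by metis
    qed
  qed (use finU in auto)
  also have "\<dots> = 10" using U(2) r0 by (simp add: card_image inj_on_def)
  finally have c10: "card (Some ` U \<union> (\<lambda>u. Some (r * u)) ` U) = 10" .
  have "card (\<Union>\<P>) = card {None, Some (0::'a)} + card (Some ` U \<union> (\<lambda>u. Some (r * u)) ` U)"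
    unfolding S by (rule card_Un_disjoint) (use finU U0 r0 in auto)
  then have cS: "card (\<Union>\<P>) = 12" using c10 by simp
  define \<Gamma> where "\<Gamma> = {\<alpha> \<in> PGL. (`) \<alpha> ` \<P> = \<P>}"
  interpret G: finite_PGL_group \<Gamma> unfolding \<Gamma>_def by (rule finite_PGL_group_pairs) (use fin cS in auto)
  \<comment> \<open>The involution that exchanges infinity with 1 and their opposite vertices 0 and
    \<open>r\<close>.\<close>
  define \<beta> where "\<beta> = moebius 1 (- r) 1 (- 1 :: 'a)"
  have \<beta>P: "\<beta> \<in> PGL" unfolding \<beta>_def using r1 by (intro PGL_moebius) simp
  have \<beta>0: "\<beta> None = Some 1" "\<beta> (Some 0) = Some r" "\<beta> (Some 1) = None" "\<beta> (Some r) = Some 0"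
    using r1 by (simp_all add: \<beta>_def moebius_def proj_point_def)
  have val: "\<beta> (Some u) = Some v" if "u \<noteq> 1" "u - r = v * (u - 1)" for u v
    unfolding \<beta>_def by (rule moebius_Some_eq) (use that in simp_all)
  have "x - r = x ^ 4 * (x - 1)" "x ^ 4 - r = x * (x ^ 4 - 1)"
    "x\<^sup>2 - r = r * x\<^sup>2 * (x\<^sup>2 - 1)" "x ^ 3 - r = r * x ^ 3 * (x ^ 3 - 1)"
    using c5 unfolding r_def by Groebner_Basis.algebra+
  then have v1: "\<beta> (Some x) = Some (x ^ 4)" "\<beta> (Some (x ^ 4)) = Some x"
    "\<beta> (Some (x\<^sup>2)) = Some (r * x\<^sup>2)" "\<beta> (Some (x ^ 3)) = Some (r * x ^ 3)"
    using xn by (blast intro: val)+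
  have ne: "r * u \<noteq> 1" if "u \<in> U" for u
  proof
    assume "r * u = 1"
    then have "r = 1 / u" using U0[OF that] by (simp add: field_simps)
    then show False using Ud[OF U1 that] rU by simp
  qed
  have inU: "x \<in> U" "x\<^sup>2 \<in> U" "x ^ 3 \<in> U" "x ^ 4 \<in> U" using Ux by auto
  have "r * x - r = r * x ^ 4 * (r * x - 1)" "r * x ^ 4 - r = r * x * (r * x ^ 4 - 1)"
    "r * x\<^sup>2 - r = x\<^sup>2 * (r * x\<^sup>2 - 1)" "r * x ^ 3 - r = x ^ 3 * (r * x ^ 3 - 1)"
    using c5 unfolding r_def by Groebner_Basis.algebra+
  then have v2: "\<beta> (Some (r * x)) = Some (r * x ^ 4)" "\<beta> (Some (r * x ^ 4)) = Some (r * x)"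
    "\<beta> (Some (r * x\<^sup>2)) = Some (x\<^sup>2)" "\<beta> (Some (r * x ^ 3)) = Some (x ^ 3)"
    using ne inU by (blast intro: val)+
  have b: "\<beta> \<in> \<Gamma>" unfolding \<Gamma>_def
  proof (rule pairs_group_memI[OF \<beta>P fin(1)])
    have pu: "pair u \<in> \<P>" if "u \<in> U" for u using that by (simp add: \<P>_def)
    fix A assume "A \<in> \<P>"
    then consider "A = {None, Some 0}" | "A = pair 1" | "A = pair x" | "A = pair (x\<^sup>2)" | "A = pair (x ^ 3)" | "A = pair (x ^ 4)"
      unfolding \<P>_def Ux by blast
    then show "\<beta> ` A \<in> \<P>"
    proof cases
      case 1
      then have "\<beta> ` A = pair 1" by (simp add: \<beta>0 pair_def)
      then show ?thesis using pu[OF U1] by simp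
    next
      case 2
      then have "\<beta> ` A = {None, Some 0}" by (simp add: \<beta>0 pair_def)
      then show ?thesis by (simp add: \<P>_def)
    next
      case 3
      then have "\<beta> ` A = pair (x ^ 4)" by (simp add: v1 v2 pair_def)
      then show ?thesis using pu inU by simp
    next
      case 4
      then have "\<beta> ` A = pair (x\<^sup>2)" by (simp add: v1 v2 pair_def insert_commute)
      then show ?thesis using pu inU by simp
    next
      case 5
      then have "\<beta> ` A = pair (x ^ 3)" by (simp add: v1 v2 pair_def insert_commute)
      then show ?thesis using pu inU by simp
    next
      case 6
      then have "\<beta> ` A = pair x" by (simp add: v1 v2 pair_def)
      then show ?thesis using pu inU by simp
    qed
  qed
  have s: "scale u \<in> \<Gamma>" if u: "u \<in> U" for u unfolding \<Gamma>_def
  proof (rule pairs_group_memI[OF PGL_scale[OF U0[OF u]] fin(1)])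
    fix A assume "A \<in> \<P>"
    then consider "A = {None, Some 0}" | v where "v \<in> U" "A = pair v" unfolding \<P>_def by blast
    then show "scale u ` A \<in> \<P>"
    proof cases
      case 2
      then have "scale u ` A = pair (u * v)" by (simp add: pair_def mult.left_commute)
      then show ?thesis using Um[OF u 2(1)] by (simp add: \<P>_def)
    qed (simp add: \<P>_def)
  qed
  have orbS: "G.orb None = \<Union>\<P>"
  proof
    show "G.orb None \<subseteq> \<Union>\<P>"
    proof
      fix y assume "y \<in> G.orb None"
      then obtain \<alpha> where "\<alpha> \<in> \<Gamma>" and y: "y = \<alpha> None" unfolding G.orb_def by blast
      then have \<alpha>: "(`) \<alpha> ` \<P> = \<P>" by (simp add: \<Gamma>_def)
      have "\<alpha> ` {None, Some 0} \<in> (`) \<alpha> ` \<P>" by (rule imageI) (simp add: \<P>_def)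
      then have "\<alpha> ` {None, Some 0} \<in> \<P>" by (simp only: \<alpha>)
      then show "y \<in> \<Union>\<P>" using y by (intro UnionI) auto
    qed
    have sm: "Some (u * t) \<in> G.orb None" if "Some t \<in> G.orb None" "u \<in> U" for u t
      using G.orb_closed[OF that(1) s[OF that(2)]] by simp
    have "Some 1 \<in> G.orb None" using G.orb_closed[OF G.orb_self b] \<beta>0(1) by metis
    then have a: "Some u \<in> G.orb None" if "u \<in> U" for u using sm[of 1 u] that by simp
    have "Some (r * x\<^sup>2) \<in> G.orb None" using G.orb_closed[OF a b, of "x\<^sup>2"] v1(3) inU by simp
    then have "Some (u / x\<^sup>2 * (r * x\<^sup>2)) \<in> G.orb None" if "u \<in> U" for u
      using sm Ud[OF that inU(2)] by blast
    moreover have "u / x\<^sup>2 * (r * x\<^sup>2) = r * u" for u using x0 by simp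
    ultimately have c: "Some (r * u) \<in> G.orb None" if "u \<in> U" for u using that by metis
    have "Some 0 \<in> G.orb None" using G.orb_closed[OF c[OF U1] b] \<beta>0(4) by simp
    then show "\<Union>\<P> \<subseteq> G.orb None" using a c G.orb_self[of None] unfolding S by blast
  qed
  have stab: "G.stab None = scale ` U"
  proof
    show "G.stab None \<subseteq> scale ` U"
    proof
      fix \<alpha> assume "\<alpha> \<in> G.stab None"
      then have "\<alpha> \<in> \<Gamma>" and None: "\<alpha> None = None" by (simp_all add: G.stab_def)
      then have \<alpha>: "\<alpha> \<in> PGL" "(`) \<alpha> ` \<P> = \<P>" "\<alpha> None = None" by (simp_all add: \<Gamma>_def)
      have "\<alpha> ` {None, Some 0} \<in> (`) \<alpha> ` \<P>" by (rule imageI) (simp add: \<P>_def)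
      then have "{None, \<alpha> (Some 0)} \<in> \<P>" using \<alpha> by simp
      then have "\<alpha> (Some 0) \<in> {None, Some 0}" by (auto simp: \<P>_def pair_def doubleton_eq_iff)
      moreover have "\<alpha> (Some 0) \<noteq> \<alpha> None" using PGL_bij[OF \<alpha>(1)] by (metis bij_pointE option.distinct(1))
      ultimately have "\<alpha> (Some 0) = Some 0" using \<alpha>(3) by auto
      then obtain a where a: "a \<noteq> 0" "\<alpha> = scale a" using PGL_fix_None_0[OF \<alpha>(1,3)] by metis
      have "\<alpha> ` pair 1 \<in> (`) \<alpha> ` \<P>" by (rule imageI) (use U1 in \<open>simp add: \<P>_def\<close>)
      then have "{Some a, Some (a * r)} \<in> \<P>" using \<alpha> a by (simp add: pair_def)
      then obtain u where u: "u \<in> U" "{Some a, Some (a * r)} = pair u" by (auto simp: \<P>_def doubleton_eq_iff)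
      then consider "a = u" | "a = r * u" "a * r = u" by (auto simp: pair_def doubleton_eq_iff)
      then show "\<alpha> \<in> scale ` U"
      proof cases
        case 2
        \<comment> \<open>Matching the pair in reversed order would give \<open>r^2 = 1\<close>,
          which is impossible.\<close>
        then have "(r * r) * u = 1 * u" by simp
        then have "r * r = 1" using mult_right_cancel[OF U0[OF u(1)]] by blast
        then have "(r - 1) * (r + 1) = 0" by (simp add: algebra_simps)
        then show ?thesis using r1 rm1 by (simp add: eq_neg_iff_add_eq_0)
      qed (use a u in blast)
    qed
    show "scale ` U \<subseteq> G.stab None" using s by (auto simp: G.stab_def)
  qed
  have "card (scale ` U) = card U" by (rule card_image) (simp add: inj_on_def)
  then have c60: "card \<Gamma> = 60" using G.orbit_stabilizer[of None] cS U(2) by (simp add: orbS stab)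
  have "(2::'a) * 2 * 3 * 5 \<noteq> 0" using assms by (simp only: mult_eq_0_iff) simp
  then have "of_nat (card \<Gamma>) \<noteq> (0::'a)" by (simp add: c60)
  then interpret regular_group \<Gamma> by unfold_locales
  have exceptional
    by (rule exceptional_criterion[OF s[OF inU(1)] x0 xn(2) b \<beta>0(1) _ \<beta>0(2) r0]) simp
  then show ?thesis using c60 regular_group_axioms by blast
qed

section \<open>Cyclic and dihedral groups\<close>

definition unity_roots :: "nat \<Rightarrow> 'a::field set" where
  "unity_roots n = {a. a ^ n = 1}"

definition cyclic_PGL :: "nat \<Rightarrow> ('a::field option \<Rightarrow> 'a option) set" where
  "cyclic_PGL n = scale ` unity_roots n"

definition dihedral_PGL :: "nat \<Rightarrow> ('a::field option \<Rightarrow> 'a option) set" where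
  "dihedral_PGL n = scale ` unity_roots n \<union> flip ` unity_roots n"

text \<open>The natural parametrization \<open>h\<close> runs from the abstract group to the
  transformations, while the isomorphism is wanted in the other direction; so \<open>h\<close> is
  inverted.\<close>

lemma bij_hom_iso:
  assumes "bij_betw h (carrier D) (carrier G)"
    "\<And>x y. x \<in> carrier D \<Longrightarrow> y \<in> carrier D \<Longrightarrow> x \<otimes>\<^bsub>D\<^esub> y \<in> carrier D"
    "\<And>x y. x \<in> carrier D \<Longrightarrow> y \<in> carrier D \<Longrightarrow> h (x \<otimes>\<^bsub>D\<^esub> y) = h x \<otimes>\<^bsub>G\<^esub> h y"
  shows "G \<cong> D"
proof -
  let ?g = "the_inv_into (carrier D) h"
  have inj: "inj_on h (carrier D)" and im: "h ` carrier D = carrier G" using assms(1) by (auto simp: bij_betw_def)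
  have g: "?g y \<in> carrier D" "h (?g y) = y" if "y \<in> carrier G" for y
    using the_inv_into_into[OF inj, of y "carrier D"] f_the_inv_into_f[OF inj, of y] that im by auto
  have "?g (x \<otimes>\<^bsub>G\<^esub> y) = ?g x \<otimes>\<^bsub>D\<^esub> ?g y" if "x \<in> carrier G" "y \<in> carrier G" for x y
  proof -
    have "h (?g x \<otimes>\<^bsub>D\<^esub> ?g y) = x \<otimes>\<^bsub>G\<^esub> y" using assms(3) g that by simp
    then show ?thesis using the_inv_into_f_f[OF inj assms(2)[OF g(1)[OF that(1)] g(1)[OF that(2)]]] by simp
  qed
  then have "?g \<in> hom G D" using g by (auto simp: hom_def)
  then show ?thesis using bij_betw_the_inv_into[OF assms(1)] unfolding is_iso_def iso_def by blast
qed

context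
  fixes n :: nat and \<zeta> :: "'a::field"
  assumes n: "n > 0" and prim: "\<And>k. \<zeta> ^ k = 1 \<longleftrightarrow> n dvd k"
begin

lemma root_nonzero: "\<zeta> \<noteq> 0"
  using prim[of n] n by (auto simp: zero_power)

lemma root_powi_mod: "\<zeta> powi (k mod int n) = \<zeta> powi k"
proof -
  have "\<zeta> powi k = \<zeta> powi (int n * (k div int n)) * \<zeta> powi (k mod int n)"
    using power_int_add[OF disjI1[OF root_nonzero], of "int n * (k div int n)" "k mod int n"] by simp
  moreover have "\<zeta> powi (int n * (k div int n)) = 1" using prim[of n] by (simp add: power_int_mult)
  ultimately show ?thesis by simp
qed

lemma bij_root_powi: "bij_betw (\<lambda>k. \<zeta> powi k) {0..<int n} (unity_roots n)"
proof -
  have "bij_betw nat {0..<int n} {..<n}"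
    by (rule bij_betw_byWitness[where f' = int]) auto
  moreover have "bij_betw (\<lambda>k. \<zeta> ^ k) {..<n} (unity_roots n)"
    unfolding bij_betw_def unity_roots_def using primitive_root_powers(1,2)[of \<zeta>] prim n by blast
  ultimately have "bij_betw ((\<lambda>k. \<zeta> ^ k) \<circ> nat) {0..<int n} (unity_roots n)"
    by (rule bij_betw_trans)
  then show ?thesis by (rule bij_betw_cong[THEN iffD1, rotated]) (simp add: power_int_def)
qed

lemma cyclic_PGL_iso_aux: "subgrp (cyclic_PGL n :: ('a option \<Rightarrow> 'a option) set) \<cong> integer_mod_group n"
proof (rule bij_hom_iso[where h = "\<lambda>k. scale (\<zeta> powi k)"])
  have "bij_betw scale (unity_roots n) (cyclic_PGL n :: ('a option \<Rightarrow> _) set)"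
    by (simp add: bij_betw_def cyclic_PGL_def inj_on_def)
  then have "bij_betw (scale \<circ> (\<lambda>k. \<zeta> powi k)) {0..<int n} (cyclic_PGL n)"
    using bij_root_powi bij_betw_trans by blast
  then show "bij_betw (\<lambda>k. scale (\<zeta> powi k)) (carrier (integer_mod_group n)) (carrier (subgrp (cyclic_PGL n)))"
    using n by (simp add: carrier_integer_mod_group comp_def)
next
  fix x y assume "x \<in> carrier (integer_mod_group n)" "y \<in> carrier (integer_mod_group n)"
  then show "x \<otimes>\<^bsub>integer_mod_group n\<^esub> y \<in> carrier (integer_mod_group n)"
    using n by (simp add: carrier_integer_mod_group)
  show "scale (\<zeta> powi (x \<otimes>\<^bsub>integer_mod_group n\<^esub> y)) = scale (\<zeta> powi x) \<otimes>\<^bsub>subgrp (cyclic_PGL n)\<^esub> scale (\<zeta> powi y)"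
    using root_nonzero by (simp add: PGL2_mult scale_comp root_powi_mod power_int_add)
qed

text \<open>\<open>flip 1\<close> is the reflection: \<open>scale a \<circ> flip 1 = flip a\<close>,
  and \<open>flip 1 \<circ> scale a = flip (1 / a)\<close> accounts for the sign of the
  exponent.\<close>

lemma dihedral_PGL_iso_aux: "subgrp (dihedral_PGL n :: ('a option \<Rightarrow> 'a option) set) \<cong> dihedral_group n"
proof (rule bij_hom_iso[where h = "\<lambda>(k, s). (if s then flip else scale) (\<zeta> powi k)"])
  let ?h = "\<lambda>(k, s). (if s then flip else scale) (\<zeta> powi k)"
  have car: "carrier (dihedral_group n) = {0..<int n} \<times> UNIV" by (simp add: dihedral_group_def)
  have e: "inj_on (\<lambda>k. \<zeta> powi k) {0..<int n}" "(\<lambda>k. \<zeta> powi k) ` {0..<int n} = unity_roots n"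
    using bij_root_powi by (auto simp: bij_betw_def)
  have "inj_on ?h ({0..<int n} \<times> UNIV)"
    using inj_onD[OF e(1)] scale_neq_flip[symmetric] by (auto simp: inj_on_def split: if_splits)
  moreover have "?h ` ({0..<int n} \<times> UNIV) = scale ` (\<lambda>k. \<zeta> powi k) ` {0..<int n} \<union> flip ` (\<lambda>k. \<zeta> powi k) ` {0..<int n}"
  proof -
    have "{0..<int n} \<times> (UNIV :: bool set) = (\<lambda>k. (k, False)) ` {0..<int n} \<union> (\<lambda>k. (k, True)) ` {0..<int n}"
      by (auto simp: UNIV_bool)
    then show ?thesis by (simp add: image_Un image_image)
  qed
  ultimately show "bij_betw ?h (carrier (dihedral_group n)) (carrier (subgrp (dihedral_PGL n)))"
    by (simp add: bij_betw_def car e dihedral_PGL_def)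
  fix x y assume xy: "x \<in> carrier (dihedral_group n)" "y \<in> carrier (dihedral_group n)"
  obtain k s l t where kl: "x = (k, s)" "y = (l, t)" by fastforce
  show "x \<otimes>\<^bsub>dihedral_group n\<^esub> y \<in> carrier (dihedral_group n)"
    using n by (simp add: kl dihedral_group_def)
  have p: "\<zeta> powi k \<noteq> 0" "\<zeta> powi l \<noteq> 0" using root_nonzero by simp_all
  show "?h (x \<otimes>\<^bsub>dihedral_group n\<^esub> y) = ?h x \<otimes>\<^bsub>subgrp (dihedral_PGL n)\<^esub> ?h y"
    using root_nonzero p by (simp add: kl dihedral_group_def PGL2_mult scale_comp scale_flip flip_scale flip_flip
      root_powi_mod power_int_add power_int_diff)
qed

end

lemma cyclic_PGL_iso:
  assumes "of_nat n \<noteq> (0::'a::alg_closed_field)"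
  shows "subgrp (cyclic_PGL n :: ('a option \<Rightarrow> 'a option) set) \<cong> integer_mod_group n"
proof -
  have "n > 0" using assms by (cases n) auto
  then show ?thesis using primitive_root_exists[OF assms] cyclic_PGL_iso_aux by blast
qed

lemma dihedral_PGL_iso:
  assumes "of_nat n \<noteq> (0::'a::alg_closed_field)"
  shows "subgrp (dihedral_PGL n :: ('a option \<Rightarrow> 'a option) set) \<cong> dihedral_group n"
proof -
  have "n > 0" using assms by (cases n) auto
  then show ?thesis using primitive_root_exists[OF assms] dihedral_PGL_iso_aux by blast
qed

section \<open>The explicit maps\<close>

lemma zvar_power: "(zvar :: 'a::field_gcd poly fract) ^ k = to_fract (monom 1 k)"
proof (induction k)
  case (Suc k)
  have "[:0, 1:] * monom (1::'a) k = monom 1 (Suc k)" by (simp add: monom_Suc)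
  then show ?case using Suc by (simp add: zvar_def flip: to_fract_mult)
qed (simp add: monom_0 flip: one_pCons)

lemma nonzero_root_exists:
  assumes "of_nat d \<noteq> (0::'a::alg_closed_field)" "d \<ge> 2"
  shows "\<exists>\<zeta>::'a. \<zeta> \<noteq> 1 \<and> \<zeta> ^ d = 1"
  using primitive_root_exists[OF assms(1)] assms(2)
  by (metis dvd_refl nat_dvd_1_iff_1 numeral_le_one_iff power_one_right semiring_norm(69))

lemma two_roots:
  assumes "of_nat d \<noteq> (0::'a::alg_closed_field)" "d \<ge> 2" "t \<noteq> (0::'a)"
  obtains y y' where "y \<noteq> y'" "y ^ d = t" "y' ^ d = t" "y \<noteq> 0" "y' \<noteq> 0"
proof -
  obtain y where y: "y ^ d = t" using nth_root_exists[of d t] assms(2) by auto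
  obtain \<zeta> :: 'a where \<zeta>: "\<zeta> \<noteq> 1" "\<zeta> ^ d = 1" using nonzero_root_exists[OF assms(1,2)] by blast
  have "y \<noteq> 0" "\<zeta> \<noteq> 0" using y \<zeta> assms by (auto simp: zero_power)
  then show ?thesis using that[of y "\<zeta> * y"] y \<zeta> by (simp add: power_mult_distrib)
qed

context
  fixes dummy :: "'a::{alg_closed_field,field_gcd}"
begin

lemma quadratic_map:
  shows "rat_degree (zvar\<^sup>2 + zvar :: 'a poly fract) = 2"
    and "rat_map (zvar\<^sup>2 + zvar) None = (None :: 'a option)"
    and "rat_map (zvar\<^sup>2 + zvar) (Some t) = Some (t\<^sup>2 + t :: 'a)"
proof -
  have eq: "zvar\<^sup>2 + zvar = Fract [:0, 1, 1:] (1 :: 'a poly)"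
    unfolding zvar_power unfolding zvar_def by (simp add: monom_altdef power2_eq_square flip: to_fract_add) (simp add: to_fract_def)
  have rp: "rat_pair 2 [:0, 1, 1 :: 'a:] 1" by (auto simp: rat_pair_def numeral_2_eq_2)
  have m: "rat_degree (zvar\<^sup>2 + zvar :: 'a poly fract) = 2" "rat_map (zvar\<^sup>2 + zvar :: 'a poly fract) = pair_map 2 [:0, 1, 1:] 1"
    unfolding eq using rat_degree_Fract[OF rp] rat_map_Fract[OF rp] by simp_all
  show "rat_degree (zvar\<^sup>2 + zvar :: 'a poly fract) = 2" "rat_map (zvar\<^sup>2 + zvar) None = (None :: 'a option)"
    "rat_map (zvar\<^sup>2 + zvar) (Some t) = Some (t\<^sup>2 + t :: 'a)"
    unfolding m by (simp_all add: pair_map_def proj_point_def numeral_2_eq_2 algebra_simps)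
qed

text \<open>Infinity is its own only preimage, while the other fixed point 0 has the further
  preimage -1. So an automorphism fixes both and is a scaling, and the values at 1 give the factor
  1.\<close>

lemma Aut_quadratic: "Aut (zvar\<^sup>2 + zvar :: 'a poly fract) = {id}"
proof -
  define f :: "'a poly fract" where "f = zvar\<^sup>2 + zvar"
  note fv = quadratic_map(2,3)[folded f_def]
  let ?f = "rat_map f"
  have "\<alpha> = id" if \<alpha>: "\<alpha> \<in> Aut f" for \<alpha>
  proof -
  note com = Aut_commute[OF \<alpha>] and b = PGL_bij[OF Aut_PGL[OF \<alpha>]]
  have fixed: "?f x = x \<longleftrightarrow> x = None \<or> x = Some 0" for x
    by (cases x) (simp_all add: fv)
  have pole: "?f x = None \<longleftrightarrow> x = None" for x by (cases x) (simp_all add: fv)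
  have im: "\<alpha> None \<in> {None, Some 0}" "\<alpha> (Some 0) \<in> {None, Some 0}"
    using com[of None] com[of "Some 0"] fixed by (metis insertI1 insertI2 singletonI)+
  have N: "\<alpha> None = None"
  proof (rule ccontr)
    assume "\<alpha> None \<noteq> None"
    then have 0: "\<alpha> None = Some 0" using im by auto
    obtain y where y: "\<alpha> y = Some (- 1)" using b by (metis bij_pointE)
    have "?f (Some (- 1)) = \<alpha> (?f y)" using com[of y] y by simp
    then have "\<alpha> (?f y) = \<alpha> None" using 0 by (simp add: fv)
    then have "?f y = None" using b by (metis bij_pointE)
    then show False using pole y 0 by simp
  qed
  moreover have "\<alpha> (Some 0) \<noteq> \<alpha> None" using b by (metis bij_pointE option.distinct(1))
  ultimately have "\<alpha> (Some 0) = Some 0" using im by auto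
  then obtain c where c: "c \<noteq> 0" "\<alpha> = scale c" using PGL_fix_None_0[OF Aut_PGL[OF \<alpha>] N] by metis
  have "c * c + c = c * 2" using com[of "Some 1"] by (simp add: c fv power2_eq_square)
  then have "c * c = c * 1" by (simp add: algebra_simps)
  then have "c = 1" using c(1) by (simp only: mult_cancel_left) simp
  then show ?thesis using c by (simp add: scale_1)
  qed
  then have "Aut f = {id}" using Aut_id by blast
  then show ?thesis by (simp only: f_def)
qed

lemma cyclic_map:
  assumes "n \<ge> 2"
  shows "rat_degree (1 / zvar ^ (n - 1) + zvar :: 'a poly fract) = n"
    and "rat_map (1 / zvar ^ (n - 1) + zvar) None = (None :: 'a option)"
    and "rat_map (1 / zvar ^ (n - 1) + zvar) (Some t) = (if t = 0 then None else Some ((t ^ n + 1) / t ^ (n - 1)) :: 'a option)"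
proof -
  obtain m where m: "n = Suc m" using assms by (cases n) auto
  have "1 / to_fract (monom (1::'a) m) + zvar = to_fract (monom 1 n + 1) / to_fract (monom 1 m)"
  proof -
    have "(zvar :: 'a poly fract) * to_fract (monom 1 m) = to_fract (monom 1 n)"
      by (simp add: m flip: zvar_power)
    moreover have "to_fract (monom (1::'a) m) \<noteq> 0" by simp
    ultimately show ?thesis by (simp add: field_simps)
  qed
  then have eq: "1 / zvar ^ (n - 1) + zvar = Fract (monom 1 n + 1) (monom 1 m :: 'a poly)"
    by (simp add: m zvar_power Fract_conv_to_fract)
  have "Polynomial.degree (monom (1::'a) n + 1) \<le> n" by (intro degree_add_le) (auto simp: degree_monom_eq)
  moreover have "Polynomial.coeff (1 :: 'a poly) n = 0" using m by (simp add: coeff_eq_0)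
  ultimately have rp: "rat_pair n (monom 1 n + 1) (monom 1 m :: 'a poly)"
    using m by (auto simp: rat_pair_def degree_monom_eq poly_monom)
  have nz: "monom (1::'a) m \<noteq> 0" by simp
  show "rat_degree (1 / zvar ^ (n - 1) + zvar :: 'a poly fract) = n"
    unfolding eq by (rule rat_degree_Fract[OF rp nz])
  show "rat_map (1 / zvar ^ (n - 1) + zvar) None = (None :: 'a option)"
    unfolding eq rat_map_Fract[OF rp nz] using m by (simp add: pair_map_def proj_point_def)
  show "rat_map (1 / zvar ^ (n - 1) + zvar) (Some t) = (if t = 0 then None else Some ((t ^ n + 1) / t ^ (n - 1)) :: 'a option)"
    unfolding eq rat_map_Fract[OF rp nz] using m assms by (simp add: pair_map_def proj_point_def poly_monom zero_power)
qed

text \<open>Infinity is the only fixed point, and 0 is its only other preimage, so automorphisms are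
  scalings. Commutation at 1 reads \<open>a ^ n + 1 = 2 * a ^ n\<close>.\<close>

lemma Aut_cyclic:
  assumes n: "n \<ge> 2"
  shows "Aut (1 / zvar ^ (n - 1) + zvar :: 'a poly fract) = cyclic_PGL n"
proof -
  define f :: "'a poly fract" where "f = 1 / zvar ^ (n - 1) + zvar"
  note fv = cyclic_map(2,3)[OF n, folded f_def]
  let ?f = "rat_map f"
  obtain m where m: "n = Suc m" using n by (cases n) auto
  have fixed: "?f x = x \<longleftrightarrow> x = None" for x
  proof (cases x)
    case (Some t)
    have "(t ^ n + 1) / t ^ m \<noteq> t" if "t \<noteq> 0"
    proof
      assume "(t ^ n + 1) / t ^ m = t"
      then have "t ^ n + 1 = t * t ^ m" using that by (simp add: divide_eq_eq)
      then show False by (simp add: m)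
    qed
    then show ?thesis using Some m by (simp add: fv)
  qed (simp add: fv)
  have pole: "?f x = None \<longleftrightarrow> x = None \<or> x = Some 0" for x by (cases x) (simp_all add: fv)
  have "Aut f = cyclic_PGL n"
  proof (intro equalityI subsetI)
    fix \<alpha> assume \<alpha>: "\<alpha> \<in> Aut f"
    note com = Aut_commute[OF \<alpha>] and b = PGL_bij[OF Aut_PGL[OF \<alpha>]]
    have "?f (\<alpha> None) = \<alpha> None" using com[of None] fv(1) by metis
    then have N: "\<alpha> None = None" using fixed by blast
    have "?f (\<alpha> (Some 0)) = None" using com[of "Some 0"] N by (simp add: fv)
    moreover have "\<alpha> (Some 0) \<noteq> \<alpha> None" using b by (metis bij_pointE option.distinct(1))
    ultimately have "\<alpha> (Some 0) = Some 0" using pole N by metis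
    then obtain a where a: "a \<noteq> 0" "\<alpha> = scale a" using PGL_fix_None_0[OF Aut_PGL[OF \<alpha>] N] by metis
    have "(a ^ n + 1) / a ^ (n - 1) = a * 2" using com[of "Some 1"] a by (simp add: fv)
    then have "a ^ n + 1 = a * 2 * a ^ (n - 1)" using nonzero_divide_eq_eq[of "a ^ (n - 1)"] a(1) by simp
    also have "a * 2 * b = a * b + a * b" for b by Groebner_Basis.algebra
    also have "a * a ^ (n - 1) = a ^ n" by (simp add: m)
    finally have "a ^ n = 1" by simp
    then show "\<alpha> \<in> cyclic_PGL n" using a by (simp add: cyclic_PGL_def unity_roots_def)
  next
    fix \<alpha> :: "'a option \<Rightarrow> 'a option" assume "\<alpha> \<in> cyclic_PGL n"
    then obtain a where a: "\<alpha> = scale a" "a ^ n = 1" by (auto simp: cyclic_PGL_def unity_roots_def)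
    then have a0: "a \<noteq> 0" using n by (auto simp: zero_power)
    have aa: "a * a ^ m = 1" using a m by simp
    have "?f (scale a x) = scale a (?f x)" for x
    proof (cases x)
      case (Some t)
      have "((a * t) ^ n + 1) / (a * t) ^ m = a * ((t ^ n + 1) / t ^ m)" if "t \<noteq> 0"
      proof -
        have "((a * t) ^ n + 1) / (a * t) ^ m = (a * a ^ m) * (t ^ n + 1) / (a ^ m * t ^ m)"
          using aa a(2) by (simp add: power_mult_distrib)
        also have "\<dots> = a * ((t ^ n + 1) / t ^ m)" using a0 that by (simp add: field_simps)
        finally show ?thesis .
      qed
      then show ?thesis using Some a0 m by (simp add: fv)
    qed (simp add: fv)
    then show "\<alpha> \<in> Aut f"
      using a0 by (simp add: Aut_iff a PGL_scale)
  qed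
  then show ?thesis by (simp only: f_def)
qed

text \<open>This isolates what \<open>z ^ (n + 1)\<close> and \<open>1 / z ^ (n - 1)\<close> share:
  infinity and 0 have one preimage each, every other point has at least two. So automorphisms
  preserve the pair and are scalings or flips. They move the fixed point 1 to a fixed point, and
  that image is their parameter.\<close>

lemma Aut_power_type:
  fixes f :: "'a poly fract"
  assumes inj: "\<And>y y'. rat_map f y = rat_map f y' \<Longrightarrow> rat_map f y \<in> {None, Some 0} \<Longrightarrow> y = y'"
    and two: "\<And>t. t \<noteq> 0 \<Longrightarrow> \<exists>y y'. y \<noteq> y' \<and> rat_map f y = Some t \<and> rat_map f y' = Some t"
    and onto: "\<And>x. x \<in> {None, Some 0} \<Longrightarrow> \<exists>y. rat_map f y = x"
    and one: "rat_map f (Some 1) = Some 1"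
    and per: "\<And>a. a \<noteq> 0 \<Longrightarrow> rat_map f (Some a) = Some a \<longleftrightarrow> a ^ n = 1"
    and sc: "\<And>a x. a ^ n = 1 \<Longrightarrow> rat_map f (scale a x) = scale a (rat_map f x)"
    and fl: "\<And>a x. a ^ n = 1 \<Longrightarrow> rat_map f (flip a x) = flip a (rat_map f x)"
    and n: "n > 0"
  shows "Aut f = dihedral_PGL n"
proof (intro equalityI subsetI)
  fix \<alpha> assume \<alpha>: "\<alpha> \<in> Aut f"
  note com = Aut_commute[OF \<alpha>] and b = PGL_bij[OF Aut_PGL[OF \<alpha>]]
  have pres: "\<alpha> x \<in> {None, Some 0}" if x: "x \<in> {None, Some 0}" for x
  proof (rule ccontr)
    assume "\<alpha> x \<notin> {None, Some 0}"
    then obtain t where t: "\<alpha> x = Some t" "t \<noteq> 0" by (cases "\<alpha> x") auto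
    obtain y y' where y: "y \<noteq> y'" "rat_map f y = \<alpha> x" "rat_map f y' = \<alpha> x" using two t by metis
    obtain u u' where u: "y = \<alpha> u" "y' = \<alpha> u'" using b by (metis bij_pointE)
    then have "\<alpha> (rat_map f u) = \<alpha> x" "\<alpha> (rat_map f u') = \<alpha> x" using y com by simp_all
    then have "rat_map f u = x" "rat_map f u' = x" using b by (metis bij_pointE)+
    then have "u = u'" using inj x by metis
    then show False using u y by simp
  qed
  have ne: "\<alpha> (Some 0) \<noteq> \<alpha> None" using b by (metis bij_pointE option.distinct(1))
  have fix1: "rat_map f (\<alpha> (Some 1)) = \<alpha> (Some 1)" using com[of "Some 1"] one by simp
  consider "\<alpha> None = None" "\<alpha> (Some 0) = Some 0" | "\<alpha> None = Some 0" "\<alpha> (Some 0) = None"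
    using pres[of None] pres[of "Some 0"] ne by auto
  then show "\<alpha> \<in> dihedral_PGL n"
  proof cases
    case 1
    then obtain a where a: "a \<noteq> 0" "\<alpha> = scale a" using PGL_fix_None_0[OF Aut_PGL[OF \<alpha>]] by metis
    then have "a ^ n = 1" using fix1 per by simp
    then show ?thesis using a by (simp add: dihedral_PGL_def unity_roots_def)
  next
    case 2
    then obtain a where a: "a \<noteq> 0" "\<alpha> = flip a" using PGL_swap_None_0[OF Aut_PGL[OF \<alpha>]] by metis
    then have "a ^ n = 1" using fix1 per by simp
    then show ?thesis using a by (simp add: dihedral_PGL_def unity_roots_def)
  qed
next
  fix \<alpha> :: "'a option \<Rightarrow> 'a option" assume "\<alpha> \<in> dihedral_PGL n"
  then obtain a where a: "a ^ n = 1" "\<alpha> = scale a \<or> \<alpha> = flip a" by (auto simp: dihedral_PGL_def unity_roots_def)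
  then have "a \<noteq> 0" using n by (auto simp: zero_power)
  then show "\<alpha> \<in> Aut f" using a sc fl by (auto simp: Aut_iff PGL_scale PGL_flip)
qed

lemma power_map:
  assumes "d > 0"
  shows "rat_degree (zvar ^ d :: 'a poly fract) = d"
    and "rat_map (zvar ^ d) None = (None :: 'a option)"
    and "rat_map (zvar ^ d) (Some t) = Some (t ^ d :: 'a)"
proof -
  have eq: "zvar ^ d = Fract (monom 1 d) (1 :: 'a poly)" by (simp add: zvar_power to_fract_def)
  have rp: "rat_pair d (monom 1 d) (1 :: 'a poly)" by (auto simp: rat_pair_def degree_monom_eq)
  note m = rat_degree_Fract[OF rp] rat_map_Fract[OF rp]
  show "rat_degree (zvar ^ d :: 'a poly fract) = d" "rat_map (zvar ^ d) None = (None :: 'a option)"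
    "rat_map (zvar ^ d) (Some t) = Some (t ^ d :: 'a)"
    using m assms by (simp_all add: eq pair_map_def proj_point_def poly_monom coeff_eq_0)
qed

lemma inverse_power_map:
  assumes "d > 0"
  shows "rat_degree (1 / zvar ^ d :: 'a poly fract) = d"
    and "rat_map (1 / zvar ^ d) None = (Some 0 :: 'a option)"
    and "rat_map (1 / zvar ^ d) (Some t) = (if t = 0 then None else Some (1 / t ^ d) :: 'a option)"
proof -
  have eq: "1 / zvar ^ d = Fract 1 (monom 1 d :: 'a poly)" by (simp add: zvar_power Fract_conv_to_fract)
  have rp: "rat_pair d 1 (monom 1 d :: 'a poly)" by (auto simp: rat_pair_def degree_monom_eq)
  have nz: "monom (1::'a) d \<noteq> 0" by simp
  note m = rat_degree_Fract[OF rp nz] rat_map_Fract[OF rp nz]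
  show "rat_degree (1 / zvar ^ d :: 'a poly fract) = d" "rat_map (1 / zvar ^ d) None = (Some 0 :: 'a option)"
    "rat_map (1 / zvar ^ d) (Some t) = (if t = 0 then None else Some (1 / t ^ d) :: 'a option)"
    using m assms by (simp_all add: eq pair_map_def proj_point_def poly_monom coeff_eq_0 zero_power)
qed

text \<open>The condition on \<open>n + 1\<close> provides two preimages for each point other than
  infinity and 0. If \<open>n + 1\<close> is the characteristic p, the map is Frobenius and commutes
  with all of PGL_2 over F_p.\<close>

lemma Aut_power:
  assumes n: "n \<ge> 2" and char: "of_nat (n + 1) \<noteq> (0::'a)"
  shows "Aut (zvar ^ (n + 1) :: 'a poly fract) = dihedral_PGL n"
proof -
  define f :: "'a poly fract" where "f = zvar ^ (n + 1)"
  have n1: "n + 1 > 0" by simp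
  note fv = power_map(2,3)[OF n1, folded f_def]
  let ?f = "rat_map f"
  have "Aut f = dihedral_PGL n"
  proof (rule Aut_power_type)
  show "y = y'" if "?f y = ?f y'" "?f y \<in> {None, Some 0}" for y y'
    using that by (cases y; cases y') (auto simp: fv)
  show "\<exists>y y'. y \<noteq> y' \<and> ?f y = Some t \<and> ?f y' = Some t" if t: "t \<noteq> 0" for t
  proof -
    obtain y y' where "y \<noteq> y'" "y ^ (n + 1) = t" "y' ^ (n + 1) = t"
      by (rule two_roots[OF char _ t]) (use n in auto)
    then show ?thesis by (intro exI[of _ "Some y"] exI[of _ "Some y'"]) (simp add: fv)
  qed
  show "\<exists>y. ?f y = x" if "x \<in> {None, Some 0}" for x using that by (auto simp: fv intro: exI[of _ x])
  show "?f (Some 1) = Some 1" by (simp add: fv)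
  show "?f (Some a) = Some a \<longleftrightarrow> a ^ n = 1" if "a \<noteq> 0" for a using that by (simp add: fv)
  show "?f (scale a x) = scale a (?f x)" if "a ^ n = 1" for a x
    using that by (cases x) (simp_all add: fv power_mult_distrib)
  show "?f (flip a x) = flip a (?f x)" if "a ^ n = 1" for a x
    using that by (cases x) (simp_all add: fv flip_Some power_divide)
qed (use n in simp)
  then show ?thesis by (simp only: f_def)
qed

lemma inverse_power_equivariant:
  assumes n: "n \<ge> 2" and a: "a ^ n = (1::'a)"
  shows "rat_map (1 / zvar ^ (n - 1)) (scale a x) = scale a (rat_map (1 / zvar ^ (n - 1)) x)"
    and "rat_map (1 / zvar ^ (n - 1)) (flip a x) = flip a (rat_map (1 / zvar ^ (n - 1)) x)"
proof -
  define f :: "'a poly fract" where "f = 1 / zvar ^ (n - 1)"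
  have n1: "n - 1 > 0" using n by simp
  note fv = inverse_power_map(2,3)[OF n1, folded f_def]
  obtain m where m: "n = Suc m" using n by (cases n) auto
  have m0: "m > 0" using m n by simp
  have "a ^ m \<noteq> 0" "a * a ^ m = 1" using a m by auto
  then have e: "1 / a ^ m = a" by (simp add: field_simps)
  have "a \<noteq> 0" using a n by (auto simp: zero_power)
  then have "rat_map f (scale a x) = scale a (rat_map f x)"
    using e m by (cases x) (simp_all add: fv power_mult_distrib, simp_all add: field_simps)
  moreover have "rat_map f (flip a x) = flip a (rat_map f x)"
    using \<open>a \<noteq> 0\<close> e m by (cases x) (simp_all add: fv flip_Some power_divide, simp_all add: field_simps)
  ultimately show "rat_map (1 / zvar ^ (n - 1)) (scale a x) = scale a (rat_map (1 / zvar ^ (n - 1)) x)"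
    "rat_map (1 / zvar ^ (n - 1)) (flip a x) = flip a (rat_map (1 / zvar ^ (n - 1)) x)"
    by (simp_all only: f_def)
qed

text \<open>This inclusion holds in every characteristic. It rules out degree \<open>n - 1\<close>
  for cyclic groups even where the automorphism group of the map is larger than dihedral.\<close>

lemma dihedral_PGL_subset_Aut:
  assumes n: "n \<ge> 2"
  shows "dihedral_PGL n \<subseteq> Aut (1 / zvar ^ (n - 1) :: 'a poly fract)"
proof
  fix \<alpha> :: "'a option \<Rightarrow> 'a option" assume "\<alpha> \<in> dihedral_PGL n"
  then obtain a where a: "a ^ n = 1" "\<alpha> = scale a \<or> \<alpha> = flip a" by (auto simp: dihedral_PGL_def unity_roots_def)
  then have "a \<noteq> 0" using n by (auto simp: zero_power)
  then show "\<alpha> \<in> Aut (1 / zvar ^ (n - 1))"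
    using a(2) inverse_power_equivariant[OF n a(1)] PGL_scale PGL_flip unfolding Aut_iff by blast
qed

lemma Aut_inverse_power:
  assumes n: "n > 2" and char: "of_nat (n - 1) \<noteq> (0::'a)"
  shows "Aut (1 / zvar ^ (n - 1) :: 'a poly fract) = dihedral_PGL n"
proof -
  define f :: "'a poly fract" where "f = 1 / zvar ^ (n - 1)"
  have n1: "n - 1 > 0" using n by simp
  note fv = inverse_power_map(2,3)[OF n1, folded f_def]
  let ?f = "rat_map f"
  obtain m where m: "n = Suc m" using n by (cases n) auto
  have m0: "m > 0" using m n by simp
  have "Aut f = dihedral_PGL n"
  proof (rule Aut_power_type)
  show "y = y'" if "?f y = ?f y'" "?f y \<in> {None, Some 0}" for y y'
    using that by (cases y; cases y') (auto simp: fv split: if_splits)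
  show "\<exists>y y'. y \<noteq> y' \<and> ?f y = Some t \<and> ?f y' = Some t" if t: "t \<noteq> 0" for t
  proof -
    have "1 / t \<noteq> 0" using t by simp
    obtain y y' where "y \<noteq> y'" "y ^ (n - 1) = 1 / t" "y' ^ (n - 1) = 1 / t" "y \<noteq> 0" "y' \<noteq> 0"
      by (rule two_roots[OF char _ \<open>1 / t \<noteq> 0\<close>]) (use n in auto)
    then show ?thesis by (intro exI[of _ "Some y"] exI[of _ "Some y'"]) (simp add: fv)
  qed
  show "\<exists>y. ?f y = x" if "x \<in> {None, Some 0}" for x
  proof (cases x)
    case None
    then show ?thesis by (intro exI[of _ "Some 0"]) (simp add: fv)
  next
    case (Some t)
    then show ?thesis using that by (intro exI[of _ None]) (simp add: fv)
  qed
  show "?f (Some 1) = Some 1" by (simp add: fv)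
  show "?f (Some a) = Some a \<longleftrightarrow> a ^ n = 1" if "a \<noteq> 0" for a
    using that m by (auto simp: fv field_simps)
  show "?f (scale a x) = scale a (?f x)" "?f (flip a x) = flip a (?f x)" if a: "a ^ n = 1" for a x
    unfolding f_def using n by (intro inverse_power_equivariant[OF _ a]; simp)+
qed (use n in simp)
  then show ?thesis by (simp only: f_def)
qed

end

section \<open>The cubic maps for the Klein four-group\<close>

lemma scale_proj_point: "scale c (proj_point u v) = proj_point (c * u) v"
  by (simp add: proj_point_def)

lemma flip_proj_point: "u \<noteq> 0 \<or> v \<noteq> 0 \<Longrightarrow> flip c (proj_point u v) = proj_point (c * v) u"
  by (auto simp: proj_point_def flip_Some)

lemma proj_point_cancel: "k \<noteq> 0 \<Longrightarrow> proj_point (k * u) (k * v) = proj_point u v"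
  by (simp add: proj_point_def)

lemma unity_roots_2: "unity_roots 2 = {1, - 1 :: 'a::field}"
  by (auto simp: unity_roots_def power2_eq_1_iff)

context
  fixes a :: "'a::{alg_closed_field,field_gcd}" and f :: "'a poly fract"
  assumes a: "a \<notin> {- 3, - 1, 0, 1}" and two: "(2::'a) \<noteq> 0"
    and f: "f = zvar * ((zvar\<^sup>2 + const_fun a) / (const_fun a * zvar\<^sup>2 + 1))"
begin

text \<open>At a common zero \<open>t^2 = - a\<close> and then \<open>a^2 = 1\<close>; this is where
  the values 1 and -1 are excluded.\<close>

lemma klein_four_pair: "rat_pair 3 [:0, a, 0, 1:] [:1, 0, a:]"
proof -
  have "poly [:0, a, 0, 1:] t \<noteq> 0 \<or> poly [:1, 0, a:] t \<noteq> 0" for t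
  proof (rule ccontr)
    assume "\<not> ?thesis"
    then have t: "t * (t\<^sup>2 + a) = 0" "1 + a * t\<^sup>2 = 0" by (simp_all add: algebra_simps power2_eq_square)
    then have "t \<noteq> 0" by auto
    then have "t\<^sup>2 = - a" using t(1) by (simp add: eq_neg_iff_add_eq_0)
    then have "1 - a\<^sup>2 = 0" using t(2) by (simp add: power2_eq_square)
    then have "(1 - a) * (1 + a) = 0" by (simp add: algebra_simps power2_eq_square)
    then show False using a by (simp add: add_eq_0_iff)
  qed
  then show ?thesis by (simp add: rat_pair_def numeral_3_eq_3)
qed

lemma klein_four_map:
  shows "rat_degree f = 3" and "rat_map f None = None"
    and "rat_map f (Some t) = proj_point (t * (t\<^sup>2 + a)) (a * t\<^sup>2 + 1)"
proof -
  have "zvar\<^sup>2 + const_fun a = to_fract [:a, 0, 1:]"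
    unfolding zvar_power const_fun_def by (simp add: monom_altdef power2_eq_square flip: to_fract_add)
  moreover have "const_fun a * zvar\<^sup>2 + 1 = to_fract [:1, 0, a:]"
    unfolding zvar_power const_fun_def
    by (simp add: monom_altdef power2_eq_square one_pCons flip: to_fract_add to_fract_mult to_fract_1)
  ultimately have "f = Fract [:0, a, 0, 1:] [:1, 0, a:]"
    unfolding f zvar_def by (simp add: Fract_conv_to_fract flip: to_fract_mult)
  then have m: "rat_degree f = 3" "rat_map f = pair_map 3 [:0, a, 0, 1:] [:1, 0, a:]"
    using rat_degree_Fract[OF klein_four_pair] rat_map_Fract[OF klein_four_pair] by simp_all
  show "rat_degree f = 3" "rat_map f None = None"
    "rat_map f (Some t) = proj_point (t * (t\<^sup>2 + a)) (a * t\<^sup>2 + 1)"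
    unfolding m by (simp_all add: pair_map_def numeral_3_eq_3 proj_point_def algebra_simps power2_eq_square)
qed

lemma klein_four_nonzero: "t * (t\<^sup>2 + a) \<noteq> 0 \<or> a * t\<^sup>2 + 1 \<noteq> 0"
proof -
  have "poly [:0, a, 0, 1:] t \<noteq> 0 \<or> poly [:1, 0, a:] t \<noteq> 0" using klein_four_pair by (simp add: rat_pair_def)
  then show ?thesis by (simp add: algebra_simps power2_eq_square)
qed

lemma klein_four_subset: "dihedral_PGL 2 \<subseteq> Aut f"
proof
  fix \<alpha> :: "'a option \<Rightarrow> 'a option" assume "\<alpha> \<in> dihedral_PGL 2"
  then obtain e where e: "e\<^sup>2 = 1" "\<alpha> = scale e \<or> \<alpha> = flip e" by (auto simp: dihedral_PGL_def unity_roots_def)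
  then have e0: "e \<noteq> 0" by auto
  have "rat_map f (scale e x) = scale e (rat_map f x)" for x
    by (cases x) (simp_all add: klein_four_map scale_proj_point power_mult_distrib e(1) mult.assoc)
  moreover have "rat_map f (flip e x) = flip e (rat_map f x)" for x
  proof (cases x)
    case None
    then show ?thesis by (simp add: klein_four_map proj_point_def)
  next
    case (Some t)
    show ?thesis
    proof (cases "t = 0")
      case True
      then show ?thesis using Some by (simp add: klein_four_map proj_point_def)
    next
      case False
      then have q: "e / t * t = e" by simp
      have i: "t ^ 3 * (q * (q\<^sup>2 + a)) = e * (a * t\<^sup>2 + 1)" "t ^ 3 * (a * q\<^sup>2 + 1) = t * (t\<^sup>2 + a)"
        if qt: "q * t = e" for q
      proof -
        have "t ^ 3 * (q * (q\<^sup>2 + a)) = (q * t) * ((q * t)\<^sup>2 + a * t\<^sup>2)"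
          "t ^ 3 * (a * q\<^sup>2 + 1) = t * (a * (q * t)\<^sup>2 + t\<^sup>2)"
          by (simp_all add: algebra_simps eval_nat_numeral)
        then show "t ^ 3 * (q * (q\<^sup>2 + a)) = e * (a * t\<^sup>2 + 1)" "t ^ 3 * (a * q\<^sup>2 + 1) = t * (t\<^sup>2 + a)"
          unfolding qt e(1) by (simp_all add: add.commute)
      qed
      have "rat_map f (flip e x) = proj_point (e / t * ((e / t)\<^sup>2 + a)) (a * (e / t)\<^sup>2 + 1)"
        using Some False by (simp add: klein_four_map)
      also have "\<dots> = proj_point (t ^ 3 * (e / t * ((e / t)\<^sup>2 + a))) (t ^ 3 * (a * (e / t)\<^sup>2 + 1))"
        by (rule proj_point_cancel[symmetric]) (use False in simp)
      also have "t ^ 3 * (e / t * ((e / t)\<^sup>2 + a)) = e * (a * t\<^sup>2 + 1)"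
        by (rule i(1)[OF q])
      also have "t ^ 3 * (a * (e / t)\<^sup>2 + 1) = t * (t\<^sup>2 + a)"
        by (rule i(2)[OF q])
      finally show ?thesis using Some klein_four_nonzero by (simp add: klein_four_map flip_proj_point)
    qed
  qed
  ultimately show "\<alpha> \<in> Aut f" using e e0 PGL_scale PGL_flip unfolding Aut_iff by blast
qed

text \<open>
  The multiplier of \<open>f\<close> is \<open>a\<close> at the fixed point \<open>0\<close> and \<open>(3 - a) / (1 + a)\<close> at \<open>1\<close>; they differ since
  \<open>(a - 1) (a + 3) \<noteq> 0\<close>. The linear coefficient at \<open>0\<close> of \<open>f \<circ> \<alpha> = \<alpha> \<circ> f\<close> compares the two.
\<close>

lemma klein_four_no_map_0_1:
  assumes \<alpha>: "\<alpha> \<in> Aut f"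
  shows "\<alpha> (Some 0) \<noteq> Some 1"
proof
  assume h: "\<alpha> (Some 0) = Some 1"
  obtain u v w x where \<alpha>m: "\<alpha> = moebius u v w x" and det: "u * x - v * w \<noteq> 0"
    using Aut_PGL[OF \<alpha>] by (rule PGL_E)
  have x: "x = v" "v \<noteq> 0" using h by (auto simp: \<alpha>m moebius_def proj_point_def split: if_splits)
  define Y where "Y = [:v, u:]"
  define W where "W = [:v, w:]"
  define P where "P = [:0, a, 0, 1:]"
  define Q where "Q = [:1, 0, a:]"
  \<comment> \<open>\<open>L\<close> and \<open>R\<close> are the two sides of the cross-multiplied
    relation \<open>f \<circ> \<alpha> = \<alpha> \<circ> f\<close>, with homogeneous coordinates of
    the left map scaled by the cube of the denominator of \<open>\<alpha>\<close>. They agree off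
    the pole of \<open>\<alpha>\<close>, hence identically.\<close>
  define L where "L = (Y ^ 3 + Polynomial.smult a (Y * W\<^sup>2)) * (Polynomial.smult w P + Polynomial.smult v Q)"
  define R where "R = (Polynomial.smult a (Y\<^sup>2 * W) + W ^ 3) * (Polynomial.smult u P + Polynomial.smult v Q)"
  have val: "poly Y s = u * s + v" "poly W s = w * s + v" "poly P s = s * (s\<^sup>2 + a)" "poly Q s = a * s\<^sup>2 + 1" for s
    by (simp_all add: Y_def W_def P_def Q_def algebra_simps power2_eq_square)
  have eq: "poly L s = poly R s" if s: "w * s + v \<noteq> 0" for s
  proof -
    define y where "y = u * s + v"
    define z where "z = w * s + v"
    have z: "z \<noteq> 0" using s by (simp add: z_def)
    then have q: "y / z * z = y" by simp
    have i: "z ^ 3 * (q * (q\<^sup>2 + a)) = y ^ 3 + a * (y * z\<^sup>2)" "z ^ 3 * (a * q\<^sup>2 + 1) = a * (y\<^sup>2 * z) + z ^ 3"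
      if "q * z = y" for q
      unfolding that[symmetric] by (simp_all add: algebra_simps eval_nat_numeral)
    have "\<alpha> (Some s) = Some (y / z)" using s by (simp add: \<alpha>m x moebius_def proj_point_def y_def z_def)
    then have "rat_map f (\<alpha> (Some s)) = proj_point (y / z * ((y / z)\<^sup>2 + a)) (a * (y / z)\<^sup>2 + 1)"
      by (simp add: klein_four_map)
    also have "\<dots> = proj_point (z ^ 3 * (y / z * ((y / z)\<^sup>2 + a))) (z ^ 3 * (a * (y / z)\<^sup>2 + 1))"
      by (rule proj_point_cancel[symmetric]) (use z in simp)
    finally have l: "rat_map f (\<alpha> (Some s)) = proj_point (z ^ 3 * (y / z * ((y / z)\<^sup>2 + a))) (z ^ 3 * (a * (y / z)\<^sup>2 + 1))" .
    have r: "\<alpha> (rat_map f (Some s)) = proj_point (u * poly P s + v * poly Q s) (w * poly P s + v * poly Q s)"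
      unfolding \<alpha>m klein_four_map using moebius_proj_point[OF det klein_four_nonzero] by (simp add: val x)
    have nz1: "z ^ 3 * (y / z * ((y / z)\<^sup>2 + a)) \<noteq> 0 \<or> z ^ 3 * (a * (y / z)\<^sup>2 + 1) \<noteq> 0"
      using klein_four_nonzero[of "y / z"] z by simp
    have nz2: "u * poly P s + v * poly Q s \<noteq> 0 \<or> w * poly P s + v * poly Q s \<noteq> 0"
    proof (rule ccontr)
      assume "\<not> ?thesis"
      then have 0: "u * poly P s + v * poly Q s = 0" "w * poly P s + v * poly Q s = 0" by auto
      have "(u * v - v * w) * poly P s = v * (u * poly P s + v * poly Q s) - v * (w * poly P s + v * poly Q s)"
        "(u * v - v * w) * poly Q s = u * (w * poly P s + v * poly Q s) - w * (u * poly P s + v * poly Q s)"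
        by (simp_all add: algebra_simps)
      then have "poly P s = 0" "poly Q s = 0" using 0 det x by simp_all
      then show False using klein_four_nonzero[of s] val by simp
    qed
    have "z ^ 3 * (y / z * ((y / z)\<^sup>2 + a)) * (w * poly P s + v * poly Q s) =
        (u * poly P s + v * poly Q s) * (z ^ 3 * (a * (y / z)\<^sup>2 + 1))"
      using Aut_commute[OF \<alpha>, of "Some s"] proj_point_eq_iff[OF nz1 nz2] l r by simp
    then have "(y ^ 3 + a * (y * z\<^sup>2)) * (w * poly P s + v * poly Q s) =
        (u * poly P s + v * poly Q s) * (a * (y\<^sup>2 * z) + z ^ 3)"
      unfolding i[OF q] .
    moreover have "poly L s = (y ^ 3 + a * (y * z\<^sup>2)) * (w * poly P s + v * poly Q s)"
      by (simp add: L_def val(1,2) y_def z_def)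
    moreover have "poly R s = (a * (y\<^sup>2 * z) + z ^ 3) * (u * poly P s + v * poly Q s)"
      by (simp add: R_def val(1,2) y_def z_def)
    ultimately show ?thesis by (simp only: mult.commute)
  qed
  have "{s. w * s + v = 0} \<subseteq> {- v / w}" using x by (cases "w = 0") (auto simp: field_simps add_eq_0_iff)
  then have "finite {s. w * s + v = 0}" using finite_subset by blast
  then have "infinite (- {s. w * s + v = 0})" by (rule infinite_Diff_finite_UNIV)
  moreover have "- {s. w * s + v = 0} \<subseteq> {s. poly (L - R) s = 0}" using eq by auto
  ultimately have "infinite {s. poly (L - R) s = 0}" using finite_subset by blast
  then have "L - R = 0" using poly_roots_finite by blast
  then have "Polynomial.coeff (L - R) 1 = 0" by simp
  moreover have "Polynomial.coeff (L - R) 1 = v ^ 3 * ((u - w) * ((1 - a) * (a + 3)))"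
    unfolding L_def R_def Y_def W_def P_def Q_def by (simp add: eval_nat_numeral algebra_simps)
  moreover have "u - w \<noteq> 0" using det x by (auto simp: algebra_simps)
  moreover have "1 - a \<noteq> 0" "a + 3 \<noteq> 0" using a by (auto simp: eq_neg_iff_add_eq_0)
  ultimately show False using x(2) by simp
qed

text \<open>The fixed points are infinity, 0, 1 and -1. Since 0 cannot move to 1, symmetry keeps the
  pair of infinity and 0 invariant, which leaves scalings and flips; the image of 1 restricts their
  parameter to 1 or -1.\<close>

lemma Aut_klein_four: "Aut f = dihedral_PGL 2"
proof (rule equalityI[OF _ klein_four_subset], rule subsetI)
  fix \<alpha> assume \<alpha>: "\<alpha> \<in> Aut f"
  note b = PGL_bij[OF Aut_PGL[OF \<alpha>]]
  have D: "scale (- 1) \<in> Aut f" "flip 1 \<in> Aut f"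
    using klein_four_subset by (auto simp: dihedral_PGL_def unity_roots_2)
  have fixed: "x \<in> {None, Some 0, Some 1, Some (- 1)}" if x: "rat_map f x = x" for x
  proof (cases x)
    case (Some t)
    then have "a * t\<^sup>2 + 1 \<noteq> 0" "t * (t\<^sup>2 + a) = t * (a * t\<^sup>2 + 1)"
      using x by (auto simp: klein_four_map proj_point_def divide_eq_eq split: if_splits)
    then have "t * ((1 - a) * ((t - 1) * (t + 1))) = 0" by (simp add: algebra_simps power2_eq_square)
    then show ?thesis using a Some by (auto simp: eq_neg_iff_add_eq_0)
  qed simp
  have a1: "a + 1 \<noteq> 0" using a by (auto simp: eq_neg_iff_add_eq_0)
  have fx: "rat_map f None = None" "rat_map f (Some 0) = Some 0" "rat_map f (Some 1) = Some 1"
    using a1 by (simp_all add: klein_four_map proj_point_def add.commute)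
  have no0: "\<beta> (Some 0) \<in> {None, Some 0}" if \<beta>: "\<beta> \<in> Aut f" for \<beta>
  proof -
    have "rat_map f (\<beta> (Some 0)) = \<beta> (Some 0)" using Aut_commute[OF \<beta>, of "Some 0"] fx(2) by simp
    then have "\<beta> (Some 0) \<in> {None, Some 0, Some 1, Some (- 1)}" by (rule fixed)
    moreover have "\<beta> (Some 0) \<noteq> Some 1" by (rule klein_four_no_map_0_1[OF \<beta>])
    \<comment> \<open>Following \<open>\<beta>\<close> by negation would move 0 to 1.\<close>
    moreover have "\<beta> (Some 0) \<noteq> Some (- 1)"
      using klein_four_no_map_0_1[OF Aut_comp[OF D(1) \<beta>]] by auto
    ultimately show ?thesis by blast
  qed
  have 0: "\<alpha> (Some 0) \<in> {None, Some 0}" by (rule no0[OF \<alpha>])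
  have N: "\<alpha> None \<in> {None, Some 0}" using no0[OF Aut_comp[OF \<alpha> D(2)]] by simp
  have ne: "\<alpha> (Some 0) \<noteq> \<alpha> None" using b by (metis bij_pointE option.distinct(1))
  have "rat_map f (\<alpha> (Some 1)) = \<alpha> (Some 1)" using Aut_commute[OF \<alpha>, of "Some 1"] fx(3) by simp
  then have 1: "\<alpha> (Some 1) \<in> {None, Some 0, Some 1, Some (- 1)}" by (rule fixed)
  consider "\<alpha> None = None" "\<alpha> (Some 0) = Some 0" | "\<alpha> None = Some 0" "\<alpha> (Some 0) = None"
    using 0 N ne by auto
  then show "\<alpha> \<in> dihedral_PGL 2"
  proof cases
    case 1
    then obtain c where c: "c \<noteq> 0" "\<alpha> = scale c" using PGL_fix_None_0[OF Aut_PGL[OF \<alpha>]] by metis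
    then have "c \<in> {1, - 1}" using \<open>\<alpha> (Some 1) \<in> _\<close> by simp
    then show ?thesis using c by (simp add: dihedral_PGL_def unity_roots_2)
  next
    case 2
    then obtain c where c: "c \<noteq> 0" "\<alpha> = flip c" using PGL_swap_None_0[OF Aut_PGL[OF \<alpha>]] by metis
    then have "c \<in> {1, - 1}" using \<open>\<alpha> (Some 1) \<in> _\<close> by simp
    then show ?thesis using c by (auto simp: dihedral_PGL_def unity_roots_2)
  qed
qed

end

section \<open>Minimal degrees\<close>

lemma poly_eqI_infinite:
  fixes p q :: "'a::idom poly"
  assumes "infinite A" "\<And>t. t \<in> A \<Longrightarrow> poly p t = poly q t"
  shows "p = q"
proof (rule ccontr)
  assume "p \<noteq> q"
  then have "finite {t. poly (p - q) t = 0}" by (intro poly_roots_finite) simp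
  moreover have "A \<subseteq> {t. poly (p - q) t = 0}" using assms(2) by auto
  ultimately show False using assms(1) finite_subset by blast
qed

lemma rat_pair_coprime:
  fixes F G :: "'a::{alg_closed_field,field_gcd} poly"
  assumes "rat_pair d F G"
  shows "coprime F G"
proof (rule coprimeI)
  fix c assume c: "c dvd F" "c dvd G"
  have "poly c t \<noteq> 0" for t
    using c assms unfolding rat_pair_def by (auto elim!: dvdE)
  then have "Polynomial.degree c = 0" "c \<noteq> 0" using alg_closed_imp_poly_has_root by (blast, force)
  then show "is_unit c" by (simp add: is_unit_iff_degree)
qed

text \<open>Commutation says F(az) G(z) = a F(z) G(az). By coprimality \<open>F\<close> divides
  F(az), which has the same degree, so \<open>F\<close> is an eigenvector of the substitution, and
  likewise \<open>G\<close>. The eigenvalues differ by the factor \<open>a\<close>; comparing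
  coefficients restricts the exponents.\<close>

lemma semi_invariant_coeffs:
  fixes F G :: "'a::{alg_closed_field,field_gcd} poly"
  assumes rp: "rat_pair d F G" "F \<noteq> 0" "G \<noteq> 0" and a: "a \<noteq> 0"
    and inv: "\<And>x. pair_map d F G (scale a x) = scale a (pair_map d F G x)"
  obtains c where "\<And>i. Polynomial.coeff F i \<noteq> 0 \<Longrightarrow> a ^ i = a * c" "\<And>i. Polynomial.coeff G i \<noteq> 0 \<Longrightarrow> a ^ i = c"
proof -
  define s where "s p = pcompose p [:0, a:]" for p
  have cs: "Polynomial.coeff (s p) i = a ^ i * Polynomial.coeff p i" for p i
    by (simp add: s_def coeff_pcompose_linear)
  have ps: "poly (s p) t = poly p (a * t)" for p t by (simp add: s_def poly_pcompose mult.commute)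
  have degs: "Polynomial.degree (s p) = Polynomial.degree p" for p
    using a by (simp add: s_def degree_pcompose)
  have "poly (s F * G) t = poly (Polynomial.smult a (F * s G)) t" for t
  proof -
    have "proj_point (poly F (a * t)) (poly G (a * t)) = proj_point (a * poly F t) (poly G t)"
      using inv[of "Some t"] by (simp add: pair_map_def scale_proj_point)
    then show ?thesis using rp(1) a unfolding rat_pair_def
      by (subst (asm) proj_point_eq_iff) (auto simp: ps)
  qed
  then have eq: "s F * G = Polynomial.smult a (F * s G)"
    by (intro poly_eqI_infinite[OF infinite_alg_closed]) blast
  have cop: "coprime F G" by (rule rat_pair_coprime[OF rp(1)])
  have multiple: "\<exists>k. s p = Polynomial.smult k p" if "p dvd s p" "p \<noteq> 0" for p
  proof -
    obtain q where q: "s p = p * q" using \<open>p dvd s p\<close> by (elim dvdE)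
    have "Polynomial.coeff (s p) (Polynomial.degree p) \<noteq> 0"
      unfolding cs using a \<open>p \<noteq> 0\<close> by simp
    then have "q \<noteq> 0" using q by auto
    then have "Polynomial.degree p + Polynomial.degree q = Polynomial.degree p"
      using q degs[of p] \<open>p \<noteq> 0\<close> by (simp add: degree_mult_eq)
    then obtain k where "q = [:k:]" using degree_eq_zeroE by (metis add_cancel_left_right)
    then show ?thesis using q by (intro exI[of _ k]) (simp add: mult.commute)
  qed
  have "F dvd s F * G" using eq by (simp add: dvd_smult)
  then have "F dvd s F" using cop by (simp add: coprime_dvd_mult_left_iff)
  then obtain k where k: "s F = Polynomial.smult k F" using multiple rp(2) by blast
  have "G dvd Polynomial.smult a (F * s G)" using eq by (metis dvd_triv_right)
  then have "G dvd F * s G" using a by (simp add: dvd_smult_iff)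
  then have "G dvd s G" using cop by (simp add: coprime_commute coprime_dvd_mult_right_iff)
  then obtain c where c: "s G = Polynomial.smult c G" using multiple rp(3) by blast
  have "Polynomial.smult k (F * G) = Polynomial.smult (a * c) (F * G)" using eq by (simp add: k c)
  then have "Polynomial.smult (k - a * c) (F * G) = 0" by (simp add: smult_diff_left)
  then have kc: "k = a * c" using rp(2,3) by simp
  show ?thesis
  proof (rule that[of c])
    fix i
    show "a ^ i = a * c" if "Polynomial.coeff F i \<noteq> 0"
      using arg_cong[OF k, of "\<lambda>p. Polynomial.coeff p i"] that by (simp add: cs kc)
    show "a ^ i = c" if "Polynomial.coeff G i \<noteq> 0"
      using arg_cong[OF c, of "\<lambda>p. Polynomial.coeff p i"] that by (simp add: cs)
  qed
qed

lemma nonconstant_coprime_nonzero: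
  fixes F G :: "'a::alg_closed_field poly"
  assumes "rat_pair d F G" "d > 0"
  shows "F \<noteq> 0" "G \<noteq> 0"
proof -
  show "G \<noteq> 0" by (rule rat_pair_G_nonzero[OF assms])
  have "rat_pair d G F" using assms(1) by (auto simp: rat_pair_def)
  then show "F \<noteq> 0" using rat_pair_G_nonzero assms(2) by blast
qed

lemma diagonal_conjugate:
  fixes \<phi> :: "'a::{alg_closed_field,field_gcd} poly fract"
  assumes "\<alpha> \<in> Aut \<phi>" "\<alpha> ^^ n = id" "\<alpha> \<noteq> id" "of_nat n \<noteq> (0::'a)" "rat_degree \<phi> > 0"
  obtains \<sigma> a F G where "\<sigma> \<in> PGL" "a \<noteq> 0" "conj_map \<sigma> \<alpha> = scale a" "rat_pair (rat_degree \<phi>) F G" "F \<noteq> 0" "G \<noteq> 0"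
    "conj_map \<sigma> (rat_map \<phi>) = pair_map (rat_degree \<phi>) F G"
    "\<forall>x. pair_map (rat_degree \<phi>) F G (scale a x) = scale a (pair_map (rat_degree \<phi>) F G x)"
    "\<forall>\<beta>\<in>Aut \<phi>. conj_map \<sigma> \<beta> \<in> PGL \<and>
       (\<forall>x. pair_map (rat_degree \<phi>) F G (conj_map \<sigma> \<beta> x) = conj_map \<sigma> \<beta> (pair_map (rat_degree \<phi>) F G x))"
proof -
  obtain \<sigma> a where \<sigma>: "\<sigma> \<in> PGL" "a \<noteq> 0" "conj_map \<sigma> \<alpha> = scale a"
    using PGL_diagonalizable[OF Aut_PGL[OF assms(1)] assms(2-4)] by metis
  obtain \<psi> :: "'a poly fract" where \<psi>: "rat_map \<psi> = conj_map \<sigma> (rat_map \<phi>)" "rat_degree \<psi> = rat_degree \<phi>"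
    using conj_rat_map[OF \<sigma>(1) assms(5)] by metis
  obtain F G where FG: "rat_pair (rat_degree \<phi>) F G" "rat_map \<psi> = pair_map (rat_degree \<phi>) F G"
    using rat_pairE[of \<psi>] \<psi>(2) by metis
  have A: "Aut \<psi> = conj_map \<sigma> ` Aut \<phi>" by (rule Aut_conj[OF \<sigma>(1) \<psi>(1)])
  have B: "conj_map \<sigma> \<beta> \<in> PGL \<and>
       (\<forall>x. pair_map (rat_degree \<phi>) F G (conj_map \<sigma> \<beta> x) = conj_map \<sigma> \<beta> (pair_map (rat_degree \<phi>) F G x))"
    if "\<beta> \<in> Aut \<phi>" for \<beta>
  proof -
    have "conj_map \<sigma> \<beta> \<in> Aut \<psi>" using A that by blast
    then show ?thesis unfolding Aut_iff FG(2) .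
  qed
  have "pair_map (rat_degree \<phi>) F G (scale a x) = scale a (pair_map (rat_degree \<phi>) F G x)" for x
    using B[OF assms(1)] unfolding \<sigma>(3) by blast
  then show ?thesis
    using that[OF \<sigma> FG(1) nonconstant_coprime_nonzero[OF FG(1) assms(5)]] B \<psi>(1) FG(2) by simp
qed

text \<open>The degree \<open>d\<close> is below the order of \<open>a\<close>, so the powers with
  exponents up to \<open>d\<close> are distinct and both entries are monomials. One of them is
  constant because there is no common zero at 0.\<close>

lemma low_degree_normal_form:
  fixes \<phi> :: "'a::{alg_closed_field,field_gcd} poly fract"
  assumes \<alpha>: "\<alpha> \<in> Aut \<phi>" "\<alpha> ^^ n = id" and ord: "\<And>k. 0 < k \<Longrightarrow> k < n \<Longrightarrow> \<alpha> ^^ k \<noteq> id"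
    and n: "n \<ge> 2" "of_nat n \<noteq> (0::'a)" and deg: "2 \<le> rat_degree \<phi>" "rat_degree \<phi> < n"
  shows "rat_degree \<phi> = n - 1"
    and "\<exists>\<sigma>\<in>PGL. conj_map \<sigma> (rat_map \<phi>) = rat_map (1 / zvar ^ (n - 1))"
proof -
  define d where "d = rat_degree \<phi>"
  have "\<alpha> \<noteq> id" using ord[of 1] n by auto
  moreover have "rat_degree \<phi> > 0" using deg by simp
  ultimately obtain \<sigma> a F G where \<sigma>: "\<sigma> \<in> PGL" "a \<noteq> 0" "conj_map \<sigma> \<alpha> = scale a" "rat_pair d F G" "F \<noteq> 0" "G \<noteq> 0"
    "conj_map \<sigma> (rat_map \<phi>) = pair_map d F G" "\<forall>x. pair_map d F G (scale a x) = scale a (pair_map d F G x)"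
    "\<forall>\<beta>\<in>Aut \<phi>. conj_map \<sigma> \<beta> \<in> PGL \<and> (\<forall>x. pair_map d F G (conj_map \<sigma> \<beta> x) = conj_map \<sigma> \<beta> (pair_map d F G x))"
    unfolding d_def by (rule diagonal_conjugate[OF \<alpha> _ n(2)]) (assumption | rule that)+
  have b: "bij \<sigma>" using PGL_bij[OF \<sigma>(1)] .
  have pw: "\<alpha> ^^ k = id \<longleftrightarrow> a ^ k = 1" for k
  proof -
    have "conj_map \<sigma> (\<alpha> ^^ k) = scale (a ^ k)" by (simp add: conj_map_funpow[OF b] \<sigma>(3) scale_pow)
    then have "\<alpha> ^^ k = id \<longleftrightarrow> scale (a ^ k) = id"
      using conj_map_inject[OF b, of "\<alpha> ^^ k" id] conj_map_id[OF b] by simp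
    then show ?thesis using scale_inject[of "a ^ k" 1] by (simp only: scale_1)
  qed
  have an: "a ^ n = 1" using \<alpha>(2) pw by simp
  have ao: "a ^ k \<noteq> 1" if "0 < k" "k < n" for k using ord[OF that] pw by simp
  have inj: "i = j" if "a ^ i = a ^ j" "i < n" "j < n" for i j
  proof -
    have *: "i = j" if "a ^ i = a ^ j" "i \<le> j" "j < n" for i j
    proof (rule ccontr)
      assume "i \<noteq> j"
      then have "0 < j - i" "j - i < n" using that by auto
      moreover have "a ^ j = a ^ i * a ^ (j - i)" using that(2) by (simp flip: power_add)
      then have "a ^ (j - i) = 1" using that(1) \<sigma>(2) by simp
      ultimately show False using ao by blast
    qed
    show ?thesis using *[of i j] *[of j i] that by (cases "i \<le> j") auto
  qed
  obtain c where c: "\<And>i. Polynomial.coeff F i \<noteq> 0 \<Longrightarrow> a ^ i = a * c" "\<And>i. Polynomial.coeff G i \<noteq> 0 \<Longrightarrow> a ^ i = c"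
    using semi_invariant_coeffs[OF \<sigma>(4-6,2) \<sigma>(8)[rule_format]] by metis
  have dn: "d < n" "d \<ge> 2" using deg by (simp_all add: d_def)
  have dF: "Polynomial.degree F \<le> d" "Polynomial.degree G \<le> d" using \<sigma>(4) by (auto simp: rat_pair_def)
  have mono: "p = monom (lead_coeff p) (Polynomial.degree p)"
    if "\<And>i. Polynomial.coeff p i \<noteq> 0 \<Longrightarrow> a ^ i = e" "p \<noteq> 0" "Polynomial.degree p \<le> d" for p e
  proof (rule poly_eqI)
    fix i
    show "Polynomial.coeff p i = Polynomial.coeff (monom (lead_coeff p) (Polynomial.degree p)) i"
    proof (cases "Polynomial.coeff p i = 0")
      case False
      then have "i \<le> d" using le_degree that(3) order_trans by blast
      moreover have "a ^ i = a ^ Polynomial.degree p" using that(1)[OF False] that(1)[of "Polynomial.degree p"] that(2) by simp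
      ultimately have "i = Polynomial.degree p" using inj dn(1) that(3) by simp
      then show ?thesis by simp
    next
      case True
      then have "i \<noteq> Polynomial.degree p" using that(2) by auto
      then show ?thesis using True by simp
    qed
  qed
  define x where "x = lead_coeff F"
  define y where "y = lead_coeff G"
  define i where "i = Polynomial.degree F"
  define j where "j = Polynomial.degree G"
  have x: "x \<noteq> 0" "y \<noteq> 0" using \<sigma>(5,6) by (simp_all add: x_def y_def)
  have F: "F = monom x i" and G: "G = monom y j"
    unfolding x_def y_def i_def j_def using mono[OF c(1) \<sigma>(5) dF(1)] mono[OF c(2) \<sigma>(6) dF(2)] by blast+
  have aij: "a ^ i = a * a ^ j"
    using c(1)[of i] c(2)[of j] x by (simp add: F G)
  have mx: "max i j = d" using rat_pair_degree[OF \<sigma>(4)] by (simp add: i_def j_def)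
  have "poly F 0 \<noteq> 0 \<or> poly G 0 \<noteq> 0" using \<sigma>(4) unfolding rat_pair_def by blast
  then have ij: "i = 0 \<or> j = 0" by (auto simp: F G poly_monom zero_power split: if_splits)
  \<comment> \<open>A constant denominator would make the numerator exponent 1, hence the degree
    1.\<close>
  have i0: "i = 0"
  proof (rule ccontr)
    assume "i \<noteq> 0"
    then have "j = 0" using ij by simp
    then have "i = d" using mx by simp
    moreover have "a ^ i = a ^ 1" using aij \<open>j = 0\<close> by simp
    then have "i = 1" using inj[of i 1] dn \<open>i = d\<close> by simp
    ultimately show False using dn by simp
  qed
  then have jd: "j = d" using mx by simp
  have "a ^ (j + 1) = 1" using aij i0 by simp
  then have "j + 1 = n" using ao[of "j + 1"] jd dn by (metis Suc_eq_plus1 less_Suc_eq_0_disj Suc_leI le_neq_implies_less zero_less_Suc)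
  then have dn1: "d = n - 1" "j = n - 1" using jd by simp_all
  show "rat_degree \<phi> = n - 1" using dn1 by (simp add: d_def)
  have h: "pair_map d F G None = Some 0"
    "pair_map d F G (Some t) = (if t = 0 then None else Some (x / (y * t ^ (n - 1))))" for t
    using x n dn1 i0 dn by (simp_all add: pair_map_def proj_point_def F G poly_monom zero_power)
  \<comment> \<open>Conjugation by \<open>scale l\<close> divides the constant in
    \<open>c / z ^ (n - 1)\<close> by \<open>l ^ n\<close>.\<close>
  obtain l where l: "l ^ n = x / y" using nth_root_exists[of n "x / y"] n by auto
  then have l0: "l \<noteq> 0" using x n by (auto simp: zero_power)
  have bl: "bij (scale l)" using PGL_bij[OF PGL_scale[OF l0]] .
  define g where "g = rat_map (1 / zvar ^ (n - 1) :: 'a poly fract)"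
  have n1: "n - 1 > 0" using n by simp
  note gv = inverse_power_map(2,3)[OF n1, where ?'a = 'a, folded g_def]
  obtain m where m: "n = Suc m" using n by (cases n) auto
  have "conj_map (scale l) (pair_map d F G) z = g z" for z
  proof (cases z)
    case None
    then show ?thesis by (simp add: conj_map_eq_iff[OF bl] h gv)
  next
    case (Some t)
    show ?thesis
    proof (cases "t = 0")
      case False
      have "l * l ^ m = x / y" using l m by simp
      then have "x = y * (l * l ^ m)" using x by (simp add: field_simps)
      then have "x / (y * (l * t) ^ m) = l * (1 / t ^ m)"
        using False x l0 by (simp add: power_mult_distrib field_simps)
      then show ?thesis using Some False l0 m by (simp add: conj_map_eq_iff[OF bl] h gv)
    qed (use Some in \<open>simp add: conj_map_eq_iff[OF bl] h gv\<close>)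
  qed
  then have "conj_map (\<sigma> \<circ> scale l) (rat_map \<phi>) = g"
    by (simp add: conj_map_comp_conj[OF b bl] \<sigma>(7) fun_eq_iff)
  then show "\<exists>\<sigma>\<in>PGL. conj_map \<sigma> (rat_map \<phi>) = rat_map (1 / zvar ^ (n - 1))"
    unfolding g_def using PGL_comp[OF \<sigma>(1) PGL_scale[OF l0]] by blast
qed

text \<open>With \<open>\<alpha>\<close> diagonalized to negation, the commuting involution
  \<open>\<beta>\<close> becomes a flip. By parity the map takes the same value at 0 and infinity,
  and this value is 0 or infinity. Commuting with a flip requires the two values to be
  swapped.\<close>

lemma no_klein_four_in_degree_2:
  fixes \<phi> :: "'a::{alg_closed_field,field_gcd} poly fract"
  assumes two: "(2::'a) \<noteq> 0" and deg: "rat_degree \<phi> = 2"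
    and \<alpha>: "\<alpha> \<in> Aut \<phi>" "\<alpha> \<circ> \<alpha> = id" "\<alpha> \<noteq> id" and \<beta>: "\<beta> \<in> Aut \<phi>" "\<beta> \<circ> \<beta> = id" "\<beta> \<noteq> id"
    and ne: "\<alpha> \<noteq> \<beta>" and com: "\<alpha> \<circ> \<beta> = \<beta> \<circ> \<alpha>"
  shows False
proof -
  have a2: "\<alpha> ^^ 2 = id" using \<alpha>(2) by (simp add: numeral_2_eq_2)
  have o2: "of_nat 2 \<noteq> (0::'a)" using two by simp
  have d0: "rat_degree \<phi> > 0" using deg by simp
  obtain \<sigma> a F G where \<sigma>: "\<sigma> \<in> PGL" "a \<noteq> 0" "conj_map \<sigma> \<alpha> = scale a" "rat_pair 2 F G" "F \<noteq> 0" "G \<noteq> 0"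
    "conj_map \<sigma> (rat_map \<phi>) = pair_map 2 F G"
    "\<forall>x. pair_map 2 F G (scale a x) = scale a (pair_map 2 F G x)"
    "\<forall>\<beta>\<in>Aut \<phi>. conj_map \<sigma> \<beta> \<in> PGL \<and> (\<forall>x. pair_map 2 F G (conj_map \<sigma> \<beta> x) = conj_map \<sigma> \<beta> (pair_map 2 F G x))"
    by (rule diagonal_conjugate[OF \<alpha>(1) a2 \<alpha>(3) o2 d0, unfolded deg]) (assumption | rule that)+
  have b: "bij \<sigma>" using PGL_bij[OF \<sigma>(1)] .
  have id_iff: "conj_map \<sigma> \<gamma> = id \<longleftrightarrow> \<gamma> = id" for \<gamma>
    using conj_map_inject[OF b, of \<gamma> id] conj_map_id[OF b] by simp
  have "scale a \<circ> scale a = id" using conj_map_comp[OF b, of \<alpha> \<alpha>] \<alpha>(2) conj_map_id[OF b] \<sigma>(3) by simp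
  then have "a * a = 1" using scale_inject[of "a * a" 1] unfolding scale_comp scale_1 by blast
  moreover have "a \<noteq> 1" using \<alpha>(3) id_iff[of \<alpha>] \<sigma>(3) by (auto simp: scale_1)
  ultimately have a: "a = - 1" using square_eq_1_iff by blast
  have m1: "(1::'a) \<noteq> - 1" using two by (metis add.inverse_inverse add_eq_0_iff one_add_one)
  define \<delta> where "\<delta> = conj_map \<sigma> \<beta>"
  have \<delta>: "\<delta> \<in> PGL" "\<And>x. pair_map 2 F G (\<delta> x) = \<delta> (pair_map 2 F G x)" using \<sigma>(9)[rule_format, OF \<beta>(1)] by (simp_all add: \<delta>_def)
  have "\<delta> \<circ> scale a = scale a \<circ> \<delta>" using conj_map_comp[OF b, of \<alpha> \<beta>] conj_map_comp[OF b, of \<beta> \<alpha>] com \<sigma>(3) by (simp add: \<delta>_def)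
  then have \<delta>a: "\<delta> (scale a x) = scale a (\<delta> x)" for x by (simp add: fun_eq_iff)
  have fx: "x \<in> {None, Some 0}" if x: "scale a x = x" for x
  proof (cases x)
    case (Some t)
    then have "t + t = 0" using x a by (simp add: neg_eq_iff_add_eq_0)
    then have "2 * t = 0" using mult_2[of t] by metis
    then show ?thesis using Some two by simp
  qed simp
  have N: "\<delta> None \<in> {None, Some 0}" using \<delta>a[of None] by (intro fx) simp
  have Z: "\<delta> (Some 0) \<in> {None, Some 0}" using \<delta>a[of "Some 0"] by (intro fx) simp
  have "\<delta> (Some 0) \<noteq> \<delta> None" using PGL_bij[OF \<delta>(1)] by (metis bij_pointE option.distinct(1))
  then consider "\<delta> None = None" "\<delta> (Some 0) = Some 0" | "\<delta> None = Some 0" "\<delta> (Some 0) = None" using N Z by auto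
  then show False
  proof cases
    case 1
    then obtain c where c: "\<delta> = scale c" using PGL_fix_None_0[OF \<delta>(1)] by metis
    have "scale c \<circ> scale c = id" using conj_map_comp[OF b, of \<beta> \<beta>] \<beta>(2) conj_map_id[OF b] c by (simp add: \<delta>_def)
    then have "c * c = 1" using scale_inject[of "c * c" 1] unfolding scale_comp scale_1 by blast
    moreover have "c \<noteq> 1" using \<beta>(3) id_iff[of \<beta>] c by (auto simp: scale_1 \<delta>_def)
    ultimately have "c = - 1" using square_eq_1_iff by blast
    then have "conj_map \<sigma> \<beta> = conj_map \<sigma> \<alpha>" using c \<sigma>(3) a by (simp add: \<delta>_def)
    then show False using ne conj_map_inject[OF b] by metis
  next
    case 2
    obtain c where c: "\<And>i. Polynomial.coeff F i \<noteq> 0 \<Longrightarrow> a ^ i = a * c" "\<And>i. Polynomial.coeff G i \<noteq> 0 \<Longrightarrow> a ^ i = c"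
      using semi_invariant_coeffs[OF \<sigma>(4-6,2) \<sigma>(8)[rule_format]] by metis
    have nz: "Polynomial.coeff F 0 \<noteq> 0 \<or> Polynomial.coeff G 0 \<noteq> 0" "Polynomial.coeff F 2 \<noteq> 0 \<or> Polynomial.coeff G 2 \<noteq> 0"
      using \<sigma>(4) unfolding rat_pair_def poly_0_coeff_0[symmetric] by blast+
    have val: "pair_map 2 F G None = proj_point (Polynomial.coeff F 2) (Polynomial.coeff G 2)"
      "pair_map 2 F G (Some 0) = proj_point (Polynomial.coeff F 0) (Polynomial.coeff G 0)"
      by (simp_all add: pair_map_def poly_0_coeff_0)
    \<comment> \<open>Either \<open>F\<close> has only odd exponents, or \<open>G\<close> has none
      of the exponents 0 and 2.\<close>
    have "pair_map 2 F G (Some 0) = pair_map 2 F G None"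
    proof (cases "c = 1")
      case True
      then have "Polynomial.coeff F 0 = 0" "Polynomial.coeff F 2 = 0" using c(1)[of 0] c(1)[of 2] a m1 by (auto simp: power2_eq_square)
      then show ?thesis using nz by (simp add: val proj_point_def)
    next
      case False
      then have "Polynomial.coeff G 0 = 0" "Polynomial.coeff G 2 = 0" using c(2)[of 0] c(2)[of 2] a by (auto simp: power2_eq_square)
      then show ?thesis by (simp add: val proj_point_def)
    qed
    moreover have "pair_map 2 F G None \<in> {None, Some 0}"
      using \<sigma>(8)[rule_format, of None] by (intro fx) simp
    ultimately show False using \<delta>(2)[of None] 2 by auto
  qed
qed

section \<open>The cyclic and dihedral groups as models\<close>

lemma finite_card_unity_roots:
  assumes "of_nat n \<noteq> (0::'a::alg_closed_field)"
  shows "finite (unity_roots n :: 'a set)" "card (unity_roots n :: 'a set) = n" "n > 0"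
proof -
  show n: "n > 0" using assms by (cases n) auto
  show "finite (unity_roots n :: 'a set)" unfolding unity_roots_def by (rule card_roots_of_unity_le(1)[OF n])
  show "card (unity_roots n :: 'a set) = n" unfolding unity_roots_def by (rule card_roots_of_unity[OF assms])
qed

lemma unity_roots_closed:
  assumes "n > 0" "a \<in> unity_roots n" "b \<in> unity_roots n"
  shows "a * b \<in> unity_roots n" "a / b \<in> unity_roots n" "a \<noteq> 0" "1 \<in> unity_roots n"
  using assms by (auto simp: unity_roots_def power_mult_distrib power_divide zero_power)

lemma inv_scale: "a \<noteq> 0 \<Longrightarrow> inv_into UNIV (scale a) = scale (1 / a)"
  by (rule inv_unique_comp) (simp_all add: scale_comp scale_1)

lemma inv_flip: "a \<noteq> 0 \<Longrightarrow> inv_into UNIV (flip a) = flip a"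
  by (rule inv_unique_comp) (simp_all add: flip_flip scale_1)

lemma scale_mem_cyclic [simp]: "scale a \<in> cyclic_PGL n \<longleftrightarrow> a \<in> unity_roots n"
  by (auto simp: cyclic_PGL_def)

lemma scale_mem_dihedral [simp]: "scale a \<in> dihedral_PGL n \<longleftrightarrow> a \<in> unity_roots n"
  by (auto simp: dihedral_PGL_def)

lemma flip_mem_dihedral [simp]: "flip a \<in> dihedral_PGL n \<longleftrightarrow> a \<in> unity_roots n"
  using scale_neq_flip[symmetric] by (auto simp: dihedral_PGL_def)

lemma cyclic_cases:
  assumes "\<gamma> \<in> cyclic_PGL n"
  obtains a where "a \<in> unity_roots n" "\<gamma> = scale a"
  using assms unfolding cyclic_PGL_def by blast

lemma dihedral_cases:
  assumes "\<gamma> \<in> dihedral_PGL n"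
  obtains a where "a \<in> unity_roots n" "\<gamma> = scale a" | a where "a \<in> unity_roots n" "\<gamma> = flip a"
  using assms unfolding dihedral_PGL_def by blast

lemma finite_PGL_group_cyclic:
  assumes "of_nat n \<noteq> (0::'a::{alg_closed_field,field_gcd})"
  shows "finite_PGL_group (cyclic_PGL n :: ('a option \<Rightarrow> 'a option) set)"
proof -
  note fin = finite_card_unity_roots[OF assms] and cl = unity_roots_closed[OF finite_card_unity_roots(3)[OF assms]]
  have one: "(1::'a) \<in> unity_roots n" by (simp add: unity_roots_def)
  have nz: "u \<noteq> 0" if "u \<in> unity_roots n" for u :: 'a by (rule cl(3)[OF that that])
  show ?thesis
  proof
    show "id \<in> (cyclic_PGL n :: ('a option \<Rightarrow> 'a option) set)"
      using one by (simp flip: scale_1)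
    show "inv_into UNIV \<gamma> \<in> cyclic_PGL n" if "\<gamma> \<in> cyclic_PGL n" for \<gamma> :: "'a option \<Rightarrow> 'a option"
      using that by (cases rule: cyclic_cases) (simp add: inv_scale nz cl(2)[OF one])
    show "\<gamma> \<circ> \<delta> \<in> cyclic_PGL n" if "\<gamma> \<in> cyclic_PGL n" "\<delta> \<in> cyclic_PGL n" for \<gamma> \<delta> :: "'a option \<Rightarrow> 'a option"
      using that(1) that(2) by (cases rule: cyclic_cases; cases rule: cyclic_cases[OF that(2)]) (simp add: scale_comp cl)
    show "\<gamma> \<in> PGL" if "\<gamma> \<in> cyclic_PGL n" for \<gamma> :: "'a option \<Rightarrow> 'a option"
      using that by (cases rule: cyclic_cases) (simp add: PGL_scale nz)
  qed (use fin in \<open>simp add: cyclic_PGL_def\<close>)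
qed

lemma finite_PGL_group_dihedral:
  assumes "of_nat n \<noteq> (0::'a::{alg_closed_field,field_gcd})"
  shows "finite_PGL_group (dihedral_PGL n :: ('a option \<Rightarrow> 'a option) set)"
proof -
  note fin = finite_card_unity_roots[OF assms] and cl = unity_roots_closed[OF finite_card_unity_roots(3)[OF assms]]
  have one: "(1::'a) \<in> unity_roots n" by (simp add: unity_roots_def)
  have nz: "u \<noteq> 0" if "u \<in> unity_roots n" for u :: 'a by (rule cl(3)[OF that that])
  show ?thesis
  proof
    show "id \<in> (dihedral_PGL n :: ('a option \<Rightarrow> 'a option) set)"
      using one by (simp flip: scale_1)
    show "inv_into UNIV \<gamma> \<in> dihedral_PGL n" if "\<gamma> \<in> dihedral_PGL n" for \<gamma> :: "'a option \<Rightarrow> 'a option"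
      using that by (cases rule: dihedral_cases) (simp_all add: inv_scale inv_flip nz cl(2)[OF one])
    show "\<gamma> \<circ> \<delta> \<in> dihedral_PGL n" if "\<gamma> \<in> dihedral_PGL n" "\<delta> \<in> dihedral_PGL n" for \<gamma> \<delta> :: "'a option \<Rightarrow> 'a option"
      using that(1)
      by (cases rule: dihedral_cases; cases rule: dihedral_cases[OF that(2)])
        (simp_all add: scale_comp scale_flip flip_scale flip_flip nz cl)
    show "\<gamma> \<in> PGL" if "\<gamma> \<in> dihedral_PGL n" for \<gamma> :: "'a option \<Rightarrow> 'a option"
      using that by (cases rule: dihedral_cases) (simp_all add: PGL_scale PGL_flip nz)
  qed (use fin in \<open>simp add: dihedral_PGL_def\<close>)
qed

lemma card_cyclic_PGL:
  assumes "of_nat n \<noteq> (0::'a::alg_closed_field)"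
  shows "card (cyclic_PGL n :: ('a option \<Rightarrow> 'a option) set) = n"
  unfolding cyclic_PGL_def using finite_card_unity_roots[OF assms] by (simp add: card_image inj_on_def)

lemma card_dihedral_PGL:
  assumes "of_nat n \<noteq> (0::'a::alg_closed_field)"
  shows "card (dihedral_PGL n :: ('a option \<Rightarrow> 'a option) set) = 2 * n"
proof -
  note fin = finite_card_unity_roots[OF assms]
  have "card (scale ` unity_roots n \<union> flip ` unity_roots n :: ('a option \<Rightarrow> 'a option) set) =
      card (scale ` unity_roots n :: ('a option \<Rightarrow> 'a option) set) + card (flip ` unity_roots n :: ('a option \<Rightarrow> 'a option) set)"
    by (rule card_Un_disjoint) (use fin in auto)
  then show ?thesis using fin by (simp add: dihedral_PGL_def card_image inj_on_def)
qed

text \<open>A realization is known only up to isomorphism. The concrete group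
  \<open>\<Delta>\<close> gives access to orders and relations of elements, and \<open>h\<close>
  carries them over to the automorphism group.\<close>

lemma Aut_model:
  fixes \<phi> :: "'a::{alg_closed_field,field_gcd} poly fract"
  assumes "Aut_group \<phi> \<cong> K" "subgrp \<Delta> \<cong> K" "finite_PGL_group (\<Delta> :: ('a option \<Rightarrow> 'a option) set)"
  obtains h where "finite_PGL_group (Aut \<phi>)" "bij_betw h \<Delta> (Aut \<phi>)"
    "\<forall>x\<in>\<Delta>. \<forall>y\<in>\<Delta>. h (x \<circ> y) = h x \<circ> h y" "h id = id" "\<forall>x\<in>\<Delta>. \<forall>k. h (x ^^ k) = h x ^^ k"
proof -
  interpret D: finite_PGL_group \<Delta> by (rule assms(3))
  have 1: "subgrp (Aut \<phi>) \<cong> subgrp \<Delta>"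
    using iso_trans[OF assms(1) group.iso_sym[OF D.group_subgrp assms(2)]] by (simp add: Aut_group_def)
  then obtain g where "bij_betw g (Aut \<phi>) \<Delta>" unfolding is_iso_def iso_def by auto
  then have fin: "finite (Aut \<phi>)" using D.finite_group bij_betw_finite by blast
  have A: "finite_PGL_group (Aut \<phi>)"
    by (rule finite_PGL_group.intro[OF fin Aut_PGL Aut_id Aut_comp Aut_inv])
  interpret A: finite_PGL_group "Aut \<phi>" by (rule A)
  have "subgrp \<Delta> \<cong> subgrp (Aut \<phi>)" by (rule group.iso_sym[OF A.group_subgrp 1])
  then obtain h where h: "h \<in> hom (subgrp \<Delta>) (subgrp (Aut \<phi>))" "bij_betw h \<Delta> (Aut \<phi>)"
    unfolding is_iso_def iso_def by auto
  have hc: "h (x \<circ> y) = h x \<circ> h y" if "x \<in> \<Delta>" "y \<in> \<Delta>" for x y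
    using h(1) that unfolding hom_def by (simp add: PGL2_mult)
  have hA: "h x \<in> Aut \<phi>" if "x \<in> \<Delta>" for x using h(2) that bij_betwE by blast
  have "h id \<circ> h id = h id" using hc[OF D.id_closed D.id_closed] by simp
  then have "inv_into UNIV (h id) \<circ> (h id \<circ> h id) = inv_into UNIV (h id) \<circ> h id" by simp
  then have hid: "h id = id" using A.elem_inv_comp(1)[OF hA[OF D.id_closed]] by (simp add: comp_assoc[symmetric])
  have hp: "x ^^ k \<in> \<Delta> \<and> h (x ^^ k) = h x ^^ k" if x: "x \<in> \<Delta>" for x k
  proof (induction k)
    case 0
    show ?case unfolding funpow.simps(1) using D.id_closed hid by blast
  next
    case (Suc k)
    then have k: "x ^^ k \<in> \<Delta>" "h (x ^^ k) = h x ^^ k" by auto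
    show ?case unfolding funpow.simps(2) hc[OF x k(1)] k(2) using D.comp_closed[OF x k(1)] by blast
  qed
  show ?thesis using that[OF A h(2) _ hid] hc hp by blast
qed

lemma Aut_card:
  fixes \<phi> :: "'a::{alg_closed_field,field_gcd} poly fract"
  assumes "\<sigma> \<in> PGL" "rat_map \<psi> = conj_map \<sigma> (rat_map \<phi>)"
  shows "card (Aut \<psi>) = card (Aut \<phi>)"
  unfolding Aut_conj[OF assms] by (rule card_image) (simp add: inj_on_def conj_map_inject[OF PGL_bij[OF assms(1)]])

lemma scale_order_transfer:
  fixes \<phi> :: "'a::{alg_closed_field,field_gcd} poly fract" and \<Delta> :: "('a option \<Rightarrow> 'a option) set"
  assumes char: "of_nat n \<noteq> (0::'a)" and sub: "scale ` unity_roots n \<subseteq> \<Delta>"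
    and h: "bij_betw h \<Delta> (Aut \<phi>)" "h id = id" "\<forall>x\<in>\<Delta>. \<forall>k. h (x ^^ k) = h x ^^ k" "id \<in> \<Delta>"
  obtains \<alpha> where "\<alpha> \<in> Aut \<phi>" "\<alpha> ^^ n = id" "\<And>k. 0 < k \<Longrightarrow> k < n \<Longrightarrow> \<alpha> ^^ k \<noteq> id"
proof -
  obtain \<zeta> :: 'a where \<zeta>: "\<And>k. \<zeta> ^ k = 1 \<longleftrightarrow> n dvd k" using primitive_root_exists[OF char] by blast
  have n: "n > 0" by (rule finite_card_unity_roots(3)[OF char])
  have "\<zeta> ^ k \<in> unity_roots n" for k using \<zeta>[of "k * n"] by (simp add: unity_roots_def power_mult)
  then have z: "scale (\<zeta> ^ k) \<in> \<Delta>" for k using sub by blast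
  then have zd: "scale \<zeta> \<in> \<Delta>" using z[of 1] by simp
  have iff: "h (scale \<zeta>) ^^ k = id \<longleftrightarrow> n dvd k" for k
  proof -
    have "h (scale \<zeta>) ^^ k = h (scale (\<zeta> ^ k))" using h(3)[rule_format, OF zd, of k] by (simp only: scale_pow)
    then have "h (scale \<zeta>) ^^ k = id \<longleftrightarrow> h (scale (\<zeta> ^ k)) = h id" using h(2) by simp
    also have "\<dots> \<longleftrightarrow> scale (\<zeta> ^ k) = id" using h(1,4) z by (auto simp: bij_betw_def inj_on_def)
    also have "\<dots> \<longleftrightarrow> \<zeta> ^ k = 1" using scale_inject[of "\<zeta> ^ k" 1] unfolding scale_1 .
    finally show ?thesis using \<zeta> by simp
  qed
  show ?thesis
  proof (rule that[of "h (scale \<zeta>)"])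
    show "h (scale \<zeta>) \<in> Aut \<phi>" using h(1) zd bij_betwE by blast
    show "h (scale \<zeta>) ^^ n = id" using iff by simp
    show "h (scale \<zeta>) ^^ k \<noteq> id" if "0 < k" "k < n" for k using iff that by (simp add: nat_dvd_not_less)
  qed
qed

lemma cyclic_minimal:
  fixes \<phi> :: "'a::{alg_closed_field,field_gcd} poly fract"
  assumes n: "n \<ge> 2" and char: "of_nat n \<noteq> (0::'a)" and r: "realizes \<phi> (integer_mod_group n)"
  shows "n \<le> rat_degree \<phi>"
proof (rule ccontr)
  assume "\<not> n \<le> rat_degree \<phi>"
  then have deg: "2 \<le> rat_degree \<phi>" "rat_degree \<phi> < n" using r by (auto simp: realizes_def)
  have r': "Aut_group \<phi> \<cong> integer_mod_group n" using r by (simp add: realizes_def)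
  obtain h :: "('a option \<Rightarrow> 'a option) \<Rightarrow> _" where "finite_PGL_group (Aut \<phi>)" and bij: "bij_betw h (cyclic_PGL n) (Aut \<phi>)"
    and "\<forall>x\<in>cyclic_PGL n. \<forall>y\<in>cyclic_PGL n. h (x \<circ> y) = h x \<circ> h y"
    and h: "h id = id" "\<forall>x\<in>cyclic_PGL n. \<forall>k. h (x ^^ k) = h x ^^ k"
    by (rule Aut_model[OF r' cyclic_PGL_iso[OF char] finite_PGL_group_cyclic[OF char]])
  have idc: "id \<in> (cyclic_PGL n :: ('a option \<Rightarrow> 'a option) set)"
    by (rule finite_PGL_group.id_closed[OF finite_PGL_group_cyclic[OF char]])
  obtain \<alpha> where \<alpha>: "\<alpha> \<in> Aut \<phi>" "\<alpha> ^^ n = id" "\<And>k. 0 < k \<Longrightarrow> k < n \<Longrightarrow> \<alpha> ^^ k \<noteq> id"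
    using scale_order_transfer[OF char equalityD1[OF cyclic_PGL_def[symmetric]] bij h idc] by metis
  obtain \<sigma> where \<sigma>: "\<sigma> \<in> PGL" "rat_map (1 / zvar ^ (n - 1)) = conj_map \<sigma> (rat_map \<phi>)"
    using low_degree_normal_form(2)[OF \<alpha> n char deg] by metis
  have "card (Aut (1 / zvar ^ (n - 1) :: 'a poly fract)) = n"
    using Aut_card[OF \<sigma>] bij_betw_same_card[OF bij] card_cyclic_PGL[OF char] by simp
  moreover from this have "finite (Aut (1 / zvar ^ (n - 1) :: 'a poly fract))" using n by (intro card_ge_0_finite) simp
  ultimately have "card (dihedral_PGL n :: ('a option \<Rightarrow> 'a option) set) \<le> n"
    using card_mono[OF _ dihedral_PGL_subset_Aut[OF n, where ?'a = 'a]] by simp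
  then show False using card_dihedral_PGL[OF char] n by simp
qed

text \<open>A rotation of order \<open>n\<close> suffices: any degree below \<open>n\<close> is
  already \<open>n - 1\<close> by the normal form.\<close>

lemma dihedral_minimal:
  fixes \<phi> :: "'a::{alg_closed_field,field_gcd} poly fract"
  assumes n: "n \<ge> 2" and char: "of_nat n \<noteq> (0::'a)" and r: "realizes \<phi> (dihedral_group n)"
  shows "n - 1 \<le> rat_degree \<phi>"
proof (rule ccontr)
  assume "\<not> n - 1 \<le> rat_degree \<phi>"
  then have deg: "2 \<le> rat_degree \<phi>" "rat_degree \<phi> < n - 1" "rat_degree \<phi> < n" using r by (auto simp: realizes_def)
  have r': "Aut_group \<phi> \<cong> dihedral_group n" using r by (simp add: realizes_def)
  obtain h :: "('a option \<Rightarrow> 'a option) \<Rightarrow> _" where "finite_PGL_group (Aut \<phi>)" and bij: "bij_betw h (dihedral_PGL n) (Aut \<phi>)"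
    and "\<forall>x\<in>dihedral_PGL n. \<forall>y\<in>dihedral_PGL n. h (x \<circ> y) = h x \<circ> h y"
    and h: "h id = id" "\<forall>x\<in>dihedral_PGL n. \<forall>k. h (x ^^ k) = h x ^^ k"
    by (rule Aut_model[OF r' dihedral_PGL_iso[OF char] finite_PGL_group_dihedral[OF char]])
  have idc: "id \<in> (dihedral_PGL n :: ('a option \<Rightarrow> 'a option) set)"
    by (rule finite_PGL_group.id_closed[OF finite_PGL_group_dihedral[OF char]])
  have sub: "scale ` unity_roots n \<subseteq> (dihedral_PGL n :: ('a option \<Rightarrow> 'a option) set)" unfolding dihedral_PGL_def by (rule Un_upper1)
  obtain \<alpha> where \<alpha>: "\<alpha> \<in> Aut \<phi>" "\<alpha> ^^ n = id" "\<And>k. 0 < k \<Longrightarrow> k < n \<Longrightarrow> \<alpha> ^^ k \<noteq> id"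
    using scale_order_transfer[OF char sub bij h idc] by metis
  show False using low_degree_normal_form(1)[OF \<alpha> n char deg(1,3)] deg(2) by simp
qed

text \<open>For \<open>n = 2\<close> the general bound is only 1, so degree 2 is excluded by the two
  commuting involutions.\<close>

lemma klein_four_minimal:
  fixes \<phi> :: "'a::{alg_closed_field,field_gcd} poly fract"
  assumes two: "(2::'a) \<noteq> 0" and r: "realizes \<phi> (dihedral_group 2)"
  shows "3 \<le> rat_degree \<phi>"
proof (rule ccontr)
  assume "\<not> 3 \<le> rat_degree \<phi>"
  then have deg: "rat_degree \<phi> = 2" using r by (auto simp: realizes_def)
  have char: "of_nat 2 \<noteq> (0::'a)" using two by simp
  have r': "Aut_group \<phi> \<cong> dihedral_group 2" using r by (simp add: realizes_def)
  let ?D = "dihedral_PGL 2 :: ('a option \<Rightarrow> 'a option) set"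
  obtain h where h: "bij_betw h ?D (Aut \<phi>)" "\<forall>x\<in>?D. \<forall>y\<in>?D. h (x \<circ> y) = h x \<circ> h y" "h id = id"
    by (rule Aut_model[OF r' dihedral_PGL_iso[OF char] finite_PGL_group_dihedral[OF char]]) (assumption | rule that)+
  have m1: "(- 1::'a) \<noteq> 1" using two by (metis add.inverse_inverse add_eq_0_iff one_add_one)
  have idc: "id \<in> ?D" by (rule finite_PGL_group.id_closed[OF finite_PGL_group_dihedral[OF char]])
  have s: "scale (- 1) \<in> ?D" and f: "flip 1 \<in> ?D" by (auto simp: dihedral_PGL_def unity_roots_2)
  have sc: "scale (- 1) \<circ> scale (- 1) = (id :: 'a option \<Rightarrow> _)" "flip 1 \<circ> flip 1 = (id :: 'a option \<Rightarrow> _)"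
    "scale (- 1) \<circ> flip 1 = flip 1 \<circ> scale (- 1 :: 'a)" by (simp_all add: scale_comp scale_1 flip_flip scale_flip flip_scale)
  have ne: "scale (- 1 :: 'a) \<noteq> id" "flip (1::'a) \<noteq> id" "scale (- 1 :: 'a) \<noteq> flip 1"
    using m1 scale_inject[of "- 1 :: 'a" 1] scale_neq_flip[of 1 "1::'a"] by (auto simp: scale_1)
  have inj: "h x \<noteq> h y" if "x \<in> ?D" "y \<in> ?D" "x \<noteq> y" for x y using h(1) that by (auto simp: bij_betw_def inj_on_def)
  show False
  proof (rule no_klein_four_in_degree_2[OF two deg, of "h (scale (- 1))" "h (flip 1)"])
    show "h (scale (- 1)) \<in> Aut \<phi>" "h (flip 1) \<in> Aut \<phi>" using h(1) s f bij_betwE by blast+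
    show "h (scale (- 1)) \<circ> h (scale (- 1)) = id" "h (flip 1) \<circ> h (flip 1) = id"
      using h(2)[rule_format, OF s s] h(2)[rule_format, OF f f] sc(1,2) h(3) by simp_all
    show "h (scale (- 1)) \<noteq> id" "h (flip 1) \<noteq> id" using inj[OF s idc ne(1)] inj[OF f idc ne(2)] h(3) by simp_all
    show "h (scale (- 1)) \<noteq> h (flip 1)" by (rule inj[OF s f ne(3)])
    show "h (scale (- 1)) \<circ> h (flip 1) = h (flip 1) \<circ> h (scale (- 1))" using h(2)[rule_format, OF s f] h(2)[rule_format, OF f s] sc(3) by simp
  qed
qed

text \<open>An element of order 3 in degree 2 makes the map conjugate to \<open>1 / z^2\<close>. Its
  automorphism group has order 6, not 12.\<close>

lemma tetrahedral_minimal: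
  fixes \<phi> :: "'a::{alg_closed_field,field_gcd} poly fract"
  assumes two: "(2::'a) \<noteq> 0" and three: "(3::'a) \<noteq> 0" and r: "realizes \<phi> (alt_group 4)"
  shows "3 \<le> rat_degree \<phi>"
proof (rule ccontr)
  assume "\<not> 3 \<le> rat_degree \<phi>"
  then have deg: "2 \<le> rat_degree \<phi>" "rat_degree \<phi> < 3" using r by (auto simp: realizes_def)
  have r': "Aut_group \<phi> \<cong> alt_group 4" using r by (simp add: realizes_def)
  obtain \<Gamma> :: "('a option \<Rightarrow> 'a option) set" where \<Gamma>: "regular_group \<Gamma>" "regular_group.exceptional \<Gamma>" "card \<Gamma> = 12"
    using tetrahedral_exists[OF two three] by blast
  have "finite_PGL_group \<Gamma>" using \<Gamma>(1) by (simp add: regular_group_def)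
  then obtain h where h: "finite_PGL_group (Aut \<phi>)" "bij_betw h \<Gamma> (Aut \<phi>)"
    by (rule Aut_model[OF r' regular_group.exceptional_iso(1)[OF \<Gamma>]]) (assumption | rule that)+
  interpret A: finite_PGL_group "Aut \<phi>" by (rule h(1))
  have c12: "card (Aut \<phi>) = 12" using bij_betw_same_card[OF h(2)] \<Gamma>(3) by simp
  have p3: "Factorial_Ring.prime (3::nat)" "3 dvd card (Aut \<phi>)" using c12 by simp_all
  obtain \<alpha> where \<alpha>: "\<alpha> \<in> Aut \<phi>" "\<alpha> \<noteq> id" "\<alpha> ^^ 3 = id"
    by (rule subgroup_PGL_cauchy[OF A.subgroup_PGL A.finite_group p3])
  have ord: "\<alpha> ^^ k \<noteq> id" if "0 < k" "k < 3" for k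
  proof
    assume k: "\<alpha> ^^ k = id"
    have "k = 1 \<or> k = 2" using that by auto
    then show False
    proof
      assume "k = 2"
      then have "\<alpha> \<circ> \<alpha> = id" using k by (simp add: numeral_2_eq_2)
      moreover have "\<alpha> \<circ> (\<alpha> \<circ> \<alpha>) = id" using \<alpha>(3) by (simp add: numeral_3_eq_3)
      ultimately show False using \<alpha>(2) by simp
    qed (use k \<alpha>(2) in simp)
  qed
  have o3: "of_nat 3 \<noteq> (0::'a)" using three by simp
  obtain \<sigma> where \<sigma>: "\<sigma> \<in> PGL" "rat_map (1 / zvar ^ (3 - 1)) = conj_map \<sigma> (rat_map \<phi>)"
    using low_degree_normal_form(2)[OF \<alpha>(1,3) ord _ o3 deg] by fastforce
  have "Aut (1 / zvar ^ (3 - 1) :: 'a poly fract) = dihedral_PGL 3"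
    by (rule Aut_inverse_power) (use two in simp_all)
  then show False using Aut_card[OF \<sigma>] card_dihedral_PGL[OF o3] c12 by simp
qed

section \<open>Realizations\<close>

context
  fixes p :: nat
  assumes prime_p: "Factorial_Ring.prime p"
    and char_p: "\<And>m. of_nat m = (0::'a::{alg_closed_field,field_gcd}) \<longleftrightarrow> p dvd m"
begin

lemma coprime_char: "coprime n p \<longleftrightarrow> of_nat n \<noteq> (0::'a)"
  unfolding char_p using prime_imp_coprime[OF prime_p, of n] prime_p
  by (metis coprime_absorb_right coprime_commute not_prime_unit)

lemma char_numeral: "(numeral k :: 'a) = 0 \<longleftrightarrow> p dvd numeral k"
  using char_p[of "numeral k"] by simp

lemma char_ge_3: "p > 2 \<Longrightarrow> (2::'a) \<noteq> 0"
  unfolding char_numeral using dvd_imp_le[of p 2] by auto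

lemma char_ge_5:
  assumes "p \<ge> 5"
  shows "(2::'a) \<noteq> 0" "(3::'a) \<noteq> 0"
  unfolding char_numeral using assms dvd_imp_le[of p 2] dvd_imp_le[of p 3] by auto

lemma char_ge_7:
  assumes "p \<ge> 7"
  shows "(5::'a) \<noteq> 0"
  unfolding char_numeral using assms dvd_imp_le[of p 5] by auto

lemma cong_minus_one_char: "[int n = - 1] (mod int p) \<longleftrightarrow> of_nat (n + 1) = (0::'a)"
proof -
  have "[int n = - 1] (mod int p) \<longleftrightarrow> int p dvd int (n + 1)" by (simp add: cong_iff_dvd_diff add.commute)
  then show ?thesis unfolding char_p by (simp only: int_dvd_int_iff)
qed

lemma cong_one_char:
  assumes "n \<ge> 1"
  shows "[int n = 1] (mod int p) \<longleftrightarrow> of_nat (n - 1) = (0::'a)"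
proof -
  have "[int n = 1] (mod int p) \<longleftrightarrow> int p dvd int (n - 1)" using assms by (simp add: cong_iff_dvd_diff of_nat_diff)
  then show ?thesis unfolding char_p by (simp only: int_dvd_int_iff)
qed

lemma realizes_cyclic:
  assumes "n \<ge> 2" "coprime n p"
  shows "minimal_degree_for (1 / zvar ^ (n - 1) + zvar :: 'a poly fract) (integer_mod_group n)"
proof -
  have char: "of_nat n \<noteq> (0::'a)" using assms(2) coprime_char by simp
  have "realizes (1 / zvar ^ (n - 1) + zvar :: 'a poly fract) (integer_mod_group n)"
    unfolding realizes_def Aut_group_def Aut_cyclic[OF assms(1)] cyclic_map(1)[OF assms(1)]
    using assms(1) cyclic_PGL_iso[OF char] by simp
  then show ?thesis
    unfolding minimal_degree_for_def cyclic_map(1)[OF assms(1)] using cyclic_minimal[OF assms(1) char] by blast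
qed

lemma realizes_dihedral:
  fixes f :: "'a poly fract"
  assumes "coprime n p" "Aut f = dihedral_PGL n" "rat_degree f \<ge> 2"
  shows "realizes f (dihedral_group n)"
  unfolding realizes_def Aut_group_def assms(2)
  using assms(3) dihedral_PGL_iso[where ?'a = 'a] assms(1) coprime_char by blast

lemma realizes_power:
  assumes "n \<ge> 2" "coprime n p" "\<not> [int n = - 1] (mod int p)"
  shows "Aut (zvar ^ (n + 1) :: 'a poly fract) = dihedral_PGL n" "rat_degree (zvar ^ (n + 1) :: 'a poly fract) \<ge> 2"
proof -
  show "Aut (zvar ^ (n + 1) :: 'a poly fract) = dihedral_PGL n"
    by (rule Aut_power[OF assms(1)]) (use assms(3) cong_minus_one_char in blast)
  have "rat_degree (zvar ^ (n + 1) :: 'a poly fract) = n + 1" by (rule power_map(1)) simp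
  then show "rat_degree (zvar ^ (n + 1) :: 'a poly fract) \<ge> 2" using assms(1) by linarith
qed

lemma realizes_inverse_power:
  assumes "n > 2" "coprime n p" "\<not> [int n = 1] (mod int p)"
  shows "Aut (1 / zvar ^ (n - 1) :: 'a poly fract) = dihedral_PGL n"
    "rat_degree (1 / zvar ^ (n - 1) :: 'a poly fract) = n - 1"
    "minimal_degree_for (1 / zvar ^ (n - 1) :: 'a poly fract) (dihedral_group n)"
proof -
  have n: "n \<ge> 2" using assms(1) by simp
  show A: "Aut (1 / zvar ^ (n - 1) :: 'a poly fract) = dihedral_PGL n"
    by (rule Aut_inverse_power[OF assms(1)]) (use assms cong_one_char[of n] in simp)
  show d: "rat_degree (1 / zvar ^ (n - 1) :: 'a poly fract) = n - 1"
    by (rule inverse_power_map(1)) (use assms(1) in simp)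
  have "rat_degree (1 / zvar ^ (n - 1) :: 'a poly fract) \<ge> 2" unfolding d using assms(1) by linarith
  then have "realizes (1 / zvar ^ (n - 1) :: 'a poly fract) (dihedral_group n)"
    by (rule realizes_dihedral[OF assms(2) A])
  moreover have "of_nat n \<noteq> (0::'a)" using assms(2) coprime_char by simp
  ultimately show "minimal_degree_for (1 / zvar ^ (n - 1) :: 'a poly fract) (dihedral_group n)"
    unfolding minimal_degree_for_def d using dihedral_minimal[OF n] by blast
qed

lemma realizes_klein_four:
  fixes a :: 'a
  defines "f \<equiv> zvar * ((zvar\<^sup>2 + const_fun a) / (const_fun a * zvar\<^sup>2 + 1))"
  assumes "p > 2" "a \<notin> {- 3, - 1, 0, 1}"
  shows "Aut f = dihedral_PGL 2" "rat_degree f = 3" "minimal_degree_for f (dihedral_group 2)"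
proof -
  have two: "(2::'a) \<noteq> 0" by (rule char_ge_3[OF assms(2)])
  show A: "Aut f = dihedral_PGL 2" by (rule Aut_klein_four[OF assms(3) two]) (simp add: f_def)
  show d: "rat_degree f = 3" by (rule klein_four_map(1)[OF assms(3) two]) (simp add: f_def)
  have "realizes f (dihedral_group 2)"
    by (rule realizes_dihedral[OF _ A]) (use coprime_char[of 2] two d in simp_all)
  then show "minimal_degree_for f (dihedral_group 2)"
    unfolding minimal_degree_for_def d using klein_four_minimal[OF two] by blast
qed

lemma dihedral_realization:
  assumes "p > 2" "n \<ge> 2" "coprime n p"
  obtains f :: "'a poly fract" where "Aut f = dihedral_PGL n" "rat_degree f \<ge> 2" "dihedral_construction p n f"
proof (cases "[int n = - 1] (mod int p)")
  case False
  then show ?thesis using that[OF realizes_power[OF assms(2,3) False]] by (simp add: dihedral_construction_def)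
next
  case True
  show ?thesis
  proof (cases "n = 2")
    case n: True
    obtain a :: 'a where a: "a \<notin> {- 3, - 1, 0, 1}"
      using ex_new_if_finite[OF infinite_alg_closed, of "{- 3, - 1, 0, 1 :: 'a}"] by auto
    define f where "f = zvar * ((zvar\<^sup>2 + const_fun a) / (const_fun a * zvar\<^sup>2 + 1))"
    note k = realizes_klein_four[OF assms(1) a, folded f_def]
    show ?thesis
    proof (rule that[of f])
      show "dihedral_construction p n f" unfolding dihedral_construction_def using n a f_def by blast
    qed (use k n in simp_all)
  next
    case False
    then have n: "n > 2" using assms(2) by simp
    have "\<not> [int n = 1] (mod int p)"
    proof
      assume "[int n = 1] (mod int p)"
      then have "[- 1 = (1 :: int)] (mod int p)" using True cong_sym cong_trans by blast
      then have "int p dvd int 2" by (simp add: cong_iff_dvd_diff)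
      then show False using assms(1) dvd_imp_le[of p 2] by (simp only: int_dvd_int_iff) simp
    qed
    note k = realizes_inverse_power[OF n assms(3) this]
    show ?thesis
    proof (rule that[OF k(1)])
      show "rat_degree (1 / zvar ^ (n - 1) :: 'a poly fract) \<ge> 2" unfolding k(2) using n by linarith
      show "dihedral_construction p n (1 / zvar ^ (n - 1) :: 'a poly fract)"
        using n \<open>\<not> [int n = 1] (mod int p)\<close> unfolding dihedral_construction_def by blast
    qed
  qed
qed

lemma regular_realization:
  fixes \<Gamma> :: "('a option \<Rightarrow> 'a option) set"
  assumes "regular_group \<Gamma>"
  shows "\<exists>\<sigma> \<in> PGL. \<exists>f :: 'a poly fract. rat_degree f \<ge> 2 \<and> Aut f = conj_map \<sigma> ` \<Gamma> \<and>
     (f = zvar\<^sup>2 + zvar \<or>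
      (\<exists>n\<ge>2. coprime n p \<and> f = 1 / zvar ^ (n - 1) + zvar) \<or>
      p > 2 \<and> (\<exists>n\<ge>2. coprime n p \<and> realizes f (dihedral_group n) \<and> dihedral_construction p n f) \<or>
      p \<ge> 5 \<and> rat_degree f = 3 \<and> realizes f (alt_group 4) \<or>
      p \<ge> 5 \<and> realizes f (sym_group 4) \<or>
      p \<ge> 7 \<and> realizes f (alt_group 5))"
proof -
  interpret regular_group \<Gamma> by (rule assms)
  have ndvd: "\<not> p dvd card \<Gamma>" using regular char_p by simp
  consider (fixed) P where "\<forall>\<gamma>\<in>\<Gamma>. \<gamma> P = P" | (pair) P where "card (orb P) = 2" "card (stab P) \<ge> 2" | (ex) exceptional
    using classification unfolding exceptional_def by blast
  then show ?thesis
  proof cases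
    case fixed
    define N where "N = card \<Gamma>"
    obtain \<sigma> where "\<sigma> \<in> PGL" "\<sigma> None = P" "conj_map \<sigma> ` \<Gamma> = scale ` {a. a ^ card \<Gamma> = 1}"
      "card {a::'a. a ^ card \<Gamma> = 1} = card \<Gamma>"
      by (rule fixed_point_scale[of P]) (simp add: fixed)
    then have \<sigma>: "\<sigma> \<in> PGL" "conj_map \<sigma> ` \<Gamma> = cyclic_PGL N"
      by (simp_all add: cyclic_PGL_def unity_roots_def N_def)
    have cop: "coprime N p" using coprime_char regular unfolding N_def by blast
    have "N > 0" using card_pos by (simp add: N_def)
    then consider "N = 1" | "N \<ge> 2" by linarith
    then show ?thesis
    proof cases
      case 1
      have "Aut (zvar\<^sup>2 + zvar :: 'a poly fract) = conj_map \<sigma> ` \<Gamma>"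
        unfolding \<sigma>(2) Aut_quadratic 1 by (simp add: cyclic_PGL_def unity_roots_def scale_1)
      then show ?thesis using \<sigma>(1) quadratic_map(1)[where ?'a = 'a] by (intro bexI[of _ \<sigma>] exI[of _ "zvar\<^sup>2 + zvar"]) simp_all
    next
      case 2
      have "Aut (1 / zvar ^ (N - 1) + zvar :: 'a poly fract) = conj_map \<sigma> ` \<Gamma>"
        unfolding \<sigma>(2) by (rule Aut_cyclic[OF 2])
      moreover have "rat_degree (1 / zvar ^ (N - 1) + zvar :: 'a poly fract) \<ge> 2" using cyclic_map(1)[OF 2, where ?'a = 'a] 2 by simp
      ultimately show ?thesis using \<sigma>(1) 2 cop by blast
    qed
  next
    case pair
    define n where "n = card (stab P)"
    have cN: "card \<Gamma> = 2 * n" using orbit_stabilizer[of P] pair(1) unfolding n_def by metis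
    obtain \<sigma> where "\<sigma> \<in> PGL"
      "conj_map \<sigma> ` \<Gamma> = scale ` {a. a ^ card (stab P) = 1} \<union> flip ` {a. a ^ card (stab P) = 1}"
      by (rule dihedral_form[OF pair(1)])
    then have \<sigma>: "\<sigma> \<in> PGL" "conj_map \<sigma> ` \<Gamma> = dihedral_PGL n"
      by (simp_all add: dihedral_PGL_def unity_roots_def n_def)
    have "p \<noteq> 2" "\<not> p dvd n" using ndvd unfolding cN by auto
    then have p: "p > 2" and cop: "coprime n p"
      using prime_ge_2_nat[OF prime_p] prime_imp_coprime[OF prime_p] by (auto simp: coprime_commute)
    have n: "n \<ge> 2" using pair(2) by (simp add: n_def)
    obtain f :: "'a poly fract" where f: "Aut f = dihedral_PGL n" "rat_degree f \<ge> 2" "dihedral_construction p n f"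
      by (rule dihedral_realization[OF p n cop])
    then show ?thesis using \<sigma> realizes_dihedral[OF cop f(1,2)] p n cop by (intro bexI[of _ \<sigma>] exI[of _ f]) auto
  next
    case ex
    obtain f :: "'a poly fract" where f: "Aut f = \<Gamma>" "rat_degree f \<ge> 2" "card \<Gamma> = 12 \<Longrightarrow> rat_degree f = 3"
      using exceptional_realization[OF ex] by metis
    have f': "rat_degree f \<ge> 2 \<and> Aut f = conj_map id ` \<Gamma>" using f by simp
    have r: "realizes f K" if "subgrp \<Gamma> \<cong> K" for K :: "(nat \<Rightarrow> nat) monoid"
      using that f by (simp add: realizes_def Aut_group_def)
    \<comment> \<open>The bounds on the characteristic are consequences of p-regularity: 12 excludes
      2 and 3, and for order 60 also 5.\<close>
    have "12 dvd card \<Gamma>" using exceptional_card[OF ex] by auto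
    then have "\<not> p dvd 12" using ndvd dvd_trans by blast
    then have "p \<noteq> 2" "p \<noteq> 3" "p \<noteq> 4" by auto
    then have p5: "p \<ge> 5" using prime_ge_2_nat[OF prime_p] by linarith
    from exceptional_card[OF ex] show ?thesis
    proof (elim disjE)
      assume c: "card \<Gamma> = 12"
      then show ?thesis using f' r[OF exceptional_iso(1)[OF ex c]] f(3) p5 PGL_id by blast
    next
      assume c: "card \<Gamma> = 24"
      then show ?thesis using f' r[OF exceptional_iso(2)[OF ex c]] p5 PGL_id by blast
    next
      assume c: "card \<Gamma> = 60"
      have "\<not> p dvd 60" using ndvd c by simp
      then have "p \<noteq> 5" "p \<noteq> 6" by auto
      then have "p \<ge> 7" using p5 by linarith
      then show ?thesis using f' r[OF exceptional_iso(3)[OF ex c]] PGL_id by blast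
    qed
  qed
qed

text \<open>Undoing the conjugation on the map realizes the given group itself and not only a
  conjugate.\<close>

lemma regular_Aut:
  fixes \<Gamma> :: "('a option \<Rightarrow> 'a option) set"
  assumes "regular_group \<Gamma>"
  shows "\<exists>f :: 'a poly fract. rat_degree f \<ge> 2 \<and> Aut f = \<Gamma>"
proof -
  obtain \<sigma> and f :: "'a poly fract" where \<sigma>: "\<sigma> \<in> PGL" and f: "rat_degree f \<ge> 2" "Aut f = conj_map \<sigma> ` \<Gamma>"
    using regular_realization[OF assms] by blast
  have "rat_degree f > 0" using f(1) by simp
  then obtain g :: "'a poly fract" where g: "rat_map g = conj_map (inv_into UNIV \<sigma>) (rat_map f)" "rat_degree g = rat_degree f"
    using conj_rat_map[OF PGL_inv[OF \<sigma>]] by metis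
  have "Aut g = \<Gamma>"
    unfolding Aut_conj[OF PGL_inv[OF \<sigma>] g(1)] f(2) image_image conj_map_inv_left[OF PGL_bij[OF \<sigma>]] by simp
  then show ?thesis using f(1) g(2) by metis
qed

lemma exceptional_realizes:
  fixes \<Gamma> :: "('a option \<Rightarrow> 'a option) set"
  assumes "regular_group \<Gamma>" "regular_group.exceptional \<Gamma>" "subgrp \<Gamma> \<cong> K"
  shows "\<exists>f :: 'a poly fract. realizes f K \<and> (card \<Gamma> = 12 \<longrightarrow> rat_degree f = 3)"
proof -
  obtain f :: "'a poly fract" where "Aut f = \<Gamma>" "rat_degree f \<ge> 2" "card \<Gamma> = 12 \<Longrightarrow> rat_degree f = 3"
    using regular_group.exceptional_realization[OF assms(1,2)] by metis
  then show ?thesis using assms(3) by (auto simp: realizes_def Aut_group_def)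
qed

lemma realizes_alt_4:
  assumes "p \<ge> 5"
  shows "\<exists>f :: 'a poly fract. rat_degree f = 3 \<and> realizes f (alt_group 4) \<and> minimal_degree_for f (alt_group 4)"
proof -
  obtain \<Gamma> :: "('a option \<Rightarrow> 'a option) set" where G: "regular_group \<Gamma>" "regular_group.exceptional \<Gamma>" "card \<Gamma> = 12"
    using tetrahedral_exists[OF char_ge_5[OF assms]] by blast
  obtain f :: "'a poly fract" where f: "realizes f (alt_group 4)" "rat_degree f = 3"
    using exceptional_realizes[OF G(1,2) regular_group.exceptional_iso(1)[OF G]] G(3) by blast
  then show ?thesis unfolding minimal_degree_for_def using tetrahedral_minimal[OF char_ge_5[OF assms]] by metis
qed

lemma realizes_sym_4:
  assumes "p \<ge> 5"
  shows "\<exists>f :: 'a poly fract. realizes f (sym_group 4)"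
proof -
  obtain \<Gamma> :: "('a option \<Rightarrow> 'a option) set" where G: "regular_group \<Gamma>" "regular_group.exceptional \<Gamma>" "card \<Gamma> = 24"
    using octahedral_exists[OF char_ge_5[OF assms]] by blast
  then show ?thesis using exceptional_realizes[OF G(1,2) regular_group.exceptional_iso(2)[OF G]] by blast
qed

lemma realizes_alt_5:
  assumes "p \<ge> 7"
  shows "\<exists>f :: 'a poly fract. realizes f (alt_group 5)"
proof -
  have p5: "p \<ge> 5" using assms by simp
  obtain \<Gamma> :: "('a option \<Rightarrow> 'a option) set" where G: "regular_group \<Gamma>" "regular_group.exceptional \<Gamma>" "card \<Gamma> = 60"
    using icosahedral_exists[OF char_ge_5[OF p5] char_ge_7[OF assms]] by blast
  then show ?thesis using exceptional_realizes[OF G(1,2) regular_group.exceptional_iso(3)[OF G]] by blast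
qed

end

lemma minimal_trivial:
  "minimal_degree_for (zvar\<^sup>2 + zvar :: 'a::{alg_closed_field,field_gcd} poly fract) (singleton_group ())"
proof -
  have "(\<lambda>_. ()) \<in> iso (Aut_group (zvar\<^sup>2 + zvar :: 'a poly fract)) (singleton_group ())"
    by (auto simp: iso_def hom_def bij_betw_def Aut_group_def Aut_quadratic singleton_group_def)
  then show ?thesis
    by (auto simp: minimal_degree_for_def realizes_def is_iso_def quadratic_map(1))
qed

text \<open>Transformations with coefficients in \<open>K\<close> are regarded over the whole field,
  where fixed points and roots of unity are available.\<close>

lemma regular_group_subgroup:
  fixes \<Gamma> :: "('a::{alg_closed_field,field_gcd} option \<Rightarrow> 'a option) set"
  assumes K: "1 \<in> K" "\<And>x y. x \<in> K \<Longrightarrow> y \<in> K \<Longrightarrow> x + y \<in> K" "\<And>x. x \<in> K \<Longrightarrow> - x \<in> K"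
      "\<And>x y. x \<in> K \<Longrightarrow> y \<in> K \<Longrightarrow> x * y \<in> K"
    and \<Gamma>: "subgroup \<Gamma> (PGL2 K)" "finite \<Gamma>" "of_nat (card \<Gamma>) \<noteq> (0::'a)"
  shows "regular_group \<Gamma>"
proof -
  have G: "group (PGL2 K)" by (rule group_PGL2) (use K in auto)
  interpret G: group "PGL2 K" by (rule G)
  interpret S: subgroup \<Gamma> "PGL2 K" by (rule \<Gamma>(1))
  have sub: "\<Gamma> \<subseteq> carrier (PGL2 K)" by (rule S.subset)
  have "carrier (PGL2 K) \<subseteq> PGL" unfolding PGL2_def by auto
  then have P: "\<gamma> \<in> PGL" if "\<gamma> \<in> \<Gamma>" for \<gamma> using that sub by blast
  show ?thesis
  proof
    show "\<gamma> \<circ> \<delta> \<in> \<Gamma>" if "\<gamma> \<in> \<Gamma>" "\<delta> \<in> \<Gamma>" for \<gamma> \<delta>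
      using S.m_closed[OF that] by (simp add: PGL2_mult)
    show "id \<in> \<Gamma>" using S.one_closed by (simp add: PGL2_one)
    show "inv_into UNIV \<gamma> \<in> \<Gamma>" if "\<gamma> \<in> \<Gamma>" for \<gamma>
    proof -
      have c: "\<gamma> \<in> carrier (PGL2 K)" using that sub by blast
      have "inv\<^bsub>PGL2 K\<^esub> \<gamma> \<circ> \<gamma> = id" "\<gamma> \<circ> inv\<^bsub>PGL2 K\<^esub> \<gamma> = id"
        using G.l_inv[OF c] G.r_inv[OF c] by (simp_all add: PGL2_mult PGL2_one)
      then have "inv_into UNIV \<gamma> = inv\<^bsub>PGL2 K\<^esub> \<gamma>" by (metis inv_unique_comp)
      then show ?thesis using S.m_inv_closed[OF that] by simp
    qed
  qed (use P \<Gamma> in auto)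
qed

text \<open>The characteristic is a prime that divides the number of elements.\<close>

lemma CHAR_finite_field:
  assumes "Factorial_Ring.prime p" "card (UNIV :: 'k::finite_field set) = p ^ e"
  shows "CHAR('k) = p"
  using CHAR_dvd_CARD[where ?'a = 'k] assms by (metis CHAR_prime prime_dvd_power primes_dvd_imp_eq)

theorem theorem1p7:
  fixes p q e :: nat
    and z :: "'k::finite_field alg_closure poly fract"
  assumes "Factorial_Ring.prime p" and "e > 0" and "q = p ^ e" and "card (UNIV :: 'k set) = q"
    and z: "z = zvar"
  shows
    "\<comment> \<open>every \<open>p\<close>-regular subgroup \<open>\<Gamma>\<close> of \<open>PGL\<^sub>2(\<F>\<^sub>q)\<close> is an automorphism group, and up to
        conjugation it is the automorphism group of one of the maps listed below\<close>
     (\<forall>\<Gamma>. subgroup \<Gamma> (PGL2 (range (to_ac :: 'k \<Rightarrow> 'k alg_closure))) \<and> p_regular p \<Gamma> \<longrightarrow>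
        (\<exists>f :: 'k alg_closure poly fract. rat_degree f \<ge> 2 \<and> Aut f = \<Gamma>) \<and>
        (\<exists>\<sigma> \<in> carrier (PGL2 UNIV). \<exists>f :: 'k alg_closure poly fract.
           Aut f = conj_map \<sigma> ` \<Gamma> \<and>
           (f = z\<^sup>2 + z \<or>
            (\<exists>n\<ge>2. coprime n p \<and> f = 1 / z ^ (n - 1) + z) \<or>
            p > 2 \<and> (\<exists>n\<ge>2. coprime n p \<and> realizes f (dihedral_group n) \<and>
                       dihedral_construction p n f) \<or>
            p \<ge> 5 \<and> rat_degree f = 3 \<and> realizes f (alt_group 4) \<or>
            p \<ge> 5 \<and> realizes f (sym_group 4) \<or>
            p \<ge> 7 \<and> realizes f (alt_group 5))))
     \<and> \<comment> \<open>(1)\<close>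
     Aut (z\<^sup>2 + z) = {id} \<and> minimal_degree_for (z\<^sup>2 + z) (singleton_group ())
     \<and> \<comment> \<open>(2)\<close>
     (\<forall>n\<ge>2. coprime n p \<longrightarrow>
        realizes (1 / z ^ (n - 1) + z) (integer_mod_group n) \<and>
        minimal_degree_for (1 / z ^ (n - 1) + z) (integer_mod_group n))
     \<and> \<comment> \<open>(3)\<close>
     (p > 2 \<longrightarrow> (\<forall>n\<ge>2. coprime n p \<longrightarrow>
        (\<exists>f :: 'k alg_closure poly fract.
           realizes f (dihedral_group n) \<and> dihedral_construction p n f) \<and>
        (\<not> [int n = - 1] (mod int p) \<longrightarrow>
           realizes (z ^ (n + 1)) (dihedral_group n)) \<and>
        (\<not> [int n = 1] (mod int p) \<and> n > 2 \<longrightarrow>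
           realizes (1 / z ^ (n - 1)) (dihedral_group n) \<and>
           minimal_degree_for (1 / z ^ (n - 1)) (dihedral_group n)) \<and>
        (n = 2 \<longrightarrow> (\<forall>a. a \<notin> {- 3, - 1, 0, 1} \<longrightarrow>
           realizes (z * ((z\<^sup>2 + const_fun a) / (const_fun a * z\<^sup>2 + 1))) (dihedral_group n) \<and>
           minimal_degree_for (z * ((z\<^sup>2 + const_fun a) / (const_fun a * z\<^sup>2 + 1)))
             (dihedral_group n)))))
     \<and> \<comment> \<open>(4)\<close>
     (p \<ge> 5 \<longrightarrow> (\<exists>f :: 'k alg_closure poly fract.
        rat_degree f = 3 \<and> realizes f (alt_group 4) \<and> minimal_degree_for f (alt_group 4)))
     \<and> \<comment> \<open>(5)\<close>
     (p \<ge> 5 \<longrightarrow> (\<exists>f :: 'k alg_closure poly fract. realizes f (sym_group 4)))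
     \<and> \<comment> \<open>(6)\<close>
     (p \<ge> 7 \<longrightarrow> (\<exists>f :: 'k alg_closure poly fract. realizes f (alt_group 5)))"
proof -
  have CH: "CHAR('k alg_closure) = p"
    using CHAR_finite_field[of p e, where ?'k = 'k] assms by simp
  have ch: "of_nat m = (0::'k alg_closure) \<longleftrightarrow> p dvd m" for m
    unfolding of_nat_eq_0_iff_char_dvd CH ..
  note pp = assms(1)
  note dih = realizes_dihedral[OF pp ch]
  have reg: "regular_group \<Gamma>"
    if "subgroup \<Gamma> (PGL2 (range (to_ac :: 'k \<Rightarrow> 'k alg_closure)))" "p_regular p \<Gamma>" for \<Gamma>
  proof (rule regular_group_subgroup[OF _ _ _ _ that(1)])
    show "finite \<Gamma>" "of_nat (card \<Gamma>) \<noteq> (0::'k alg_closure)" using that(2) ch by (simp_all add: p_regular_def)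
  qed (auto simp flip: to_ac_1 to_ac_add to_ac_minus to_ac_mult)
  show ?thesis
    unfolding z
  proof (intro conjI allI impI; (elim conjE)?)
    fix \<Gamma> assume "subgroup \<Gamma> (PGL2 (range (to_ac :: 'k \<Rightarrow> 'k alg_closure)))" "p_regular p \<Gamma>"
    note r = reg[OF this]
    show "\<exists>f :: 'k alg_closure poly fract. rat_degree f \<ge> 2 \<and> Aut f = \<Gamma>" by (rule regular_Aut[OF pp ch r])
    show "\<exists>\<sigma> \<in> PGL. \<exists>f :: 'k alg_closure poly fract. Aut f = conj_map \<sigma> ` \<Gamma> \<and>
       (f = zvar\<^sup>2 + zvar \<or>
        (\<exists>n\<ge>2. coprime n p \<and> f = 1 / zvar ^ (n - 1) + zvar) \<or>
        p > 2 \<and> (\<exists>n\<ge>2. coprime n p \<and> realizes f (dihedral_group n) \<and> dihedral_construction p n f) \<or>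
        p \<ge> 5 \<and> rat_degree f = 3 \<and> realizes f (alt_group 4) \<or>
        p \<ge> 5 \<and> realizes f (sym_group 4) \<or>
        p \<ge> 7 \<and> realizes f (alt_group 5))"
      using regular_realization[OF pp ch r] by (elim bexE exE conjE) (intro bexI exI conjI)
  next
    show "Aut (zvar\<^sup>2 + zvar :: 'k alg_closure poly fract) = {id}" by (rule Aut_quadratic)
    show "minimal_degree_for (zvar\<^sup>2 + zvar :: 'k alg_closure poly fract) (singleton_group ())" by (rule minimal_trivial)
  next
    fix n :: nat assume n: "n \<ge> 2" "coprime n p"
    show "minimal_degree_for (1 / zvar ^ (n - 1) + zvar :: 'k alg_closure poly fract) (integer_mod_group n)"
      by (rule realizes_cyclic[OF pp ch n])
    then show "realizes (1 / zvar ^ (n - 1) + zvar :: 'k alg_closure poly fract) (integer_mod_group n)"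
      by (simp add: minimal_degree_for_def)
  next
    fix n :: nat assume p: "p > 2" and n: "n \<ge> 2" "coprime n p"
    show "\<exists>f :: 'k alg_closure poly fract. realizes f (dihedral_group n) \<and> dihedral_construction p n f"
      using dihedral_realization[OF pp ch p n] dih[OF n(2)] by metis
  next
    fix n :: nat assume n: "n \<ge> 2" "coprime n p" and c: "\<not> [int n = - 1] (mod int p)"
    show "realizes (zvar ^ (n + 1) :: 'k alg_closure poly fract) (dihedral_group n)"
      by (rule dih[OF n(2) realizes_power[OF pp ch n c]])
  next
    fix n :: nat assume n: "n > 2" "coprime n p" "\<not> [int n = 1] (mod int p)"
    show "minimal_degree_for (1 / zvar ^ (n - 1) :: 'k alg_closure poly fract) (dihedral_group n)"
      by (rule realizes_inverse_power(3)[OF pp ch n])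
    then show "realizes (1 / zvar ^ (n - 1) :: 'k alg_closure poly fract) (dihedral_group n)"
      by (simp add: minimal_degree_for_def)
  next
    fix n :: nat and a :: "'k alg_closure" assume p: "p > 2" and n: "n = 2" and a: "a \<notin> {- 3, - 1, 0, 1}"
    show "minimal_degree_for (zvar * ((zvar\<^sup>2 + const_fun a) / (const_fun a * zvar\<^sup>2 + 1))) (dihedral_group n)"
      unfolding n by (rule realizes_klein_four(3)[OF pp ch p a])
    then show "realizes (zvar * ((zvar\<^sup>2 + const_fun a) / (const_fun a * zvar\<^sup>2 + 1))) (dihedral_group n)"
      by (simp add: minimal_degree_for_def)
  next
    assume p: "p \<ge> 5"
    show "\<exists>f :: 'k alg_closure poly fract. rat_degree f = 3 \<and> realizes f (alt_group 4) \<and> minimal_degree_for f (alt_group 4)"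
      by (rule realizes_alt_4[OF pp ch p])
    show "\<exists>f :: 'k alg_closure poly fract. realizes f (sym_group 4)" by (rule realizes_sym_4[OF pp ch p])
  next
    assume p: "p \<ge> 7"
    show "\<exists>f :: 'k alg_closure poly fract. realizes f (alt_group 5)" by (rule realizes_alt_5[OF pp ch p])
  qed
qed

end
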